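(* Assume Assumptions 1–4 (stated in the context) hold. Fix $\tilde y\in\mathbb{R}^m$ and an admissible control $\tilde Z$. Let $(\tilde X_t,\tilde Y_t)$ be the solution of the controlled system (E2) and, for a positive integer $N$, let $(\hat X_t,\hat Y_t)$ be the solution of the Euler scheme (E3). Then \[ \sup_{0\le t\le T}\mathbb{E}|\hat Y_t-\tilde Y_t|^2+\sup_{0\le t\le T}\mathbb{E}|\hat X_t-\tilde X_t|^2\le\frac{C}{\ln N}, \] where $C$ is a constant independent of $N$, depending only on $T$, the coefficients $b,\sigma,f$, the control $\tilde Z$ and the initial values $x,\tilde y$.
   Context: Let $(\Omega,\mathcal F,P)$ be a complete probability space, $W$ a standard $d$-dimensional Brownian motion, $T>0$ fixed, and $\mathbf F=\{\mathcal F_t\}_{0\le t\le T}$ the natural filtration of $W$ augmented by the $P$-null sets. The coefficients are deterministic functions $b:[0,T]\times\mathbb{R}^n\times\mathbb{R}^m\to\mathbb{R}^n$, $\sigma:[0,T]\times\mathbb{R}^n\to\mathbb{R}^{n\times d}$, $f:[0,T]\times\mathbb{R}^n\times\mathbb{R}^m\times\mathbb{R}^{m\times d}\to\mathbb{R}^m$, $g:\mathbb{R}^n\to\mathbb{R}^m$, and $x\in\mathbb{R}^n$ is fixed. The FBSDE (E1) is: $X_t=x+\int_0^t b(s,X_s,Y_s)\,ds+\int_0^t\sigma(s,X_s)\,dW_s$, $Y_t=g(X_T)+\int_t^T f(s,X_s,Y_s,Z_s)\,ds-\int_t^T Z_s\,dW_s$. Assumption 1: for each $i=1,\dots,n$ the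 $i$-th row of $\sigma(t,x)$ is $\sigma_i(t,x_i)$, where $\sigma_i:[0,T]\times\mathbb{R}\to\mathbb{R}^{1\times d}$ and $x_i$ is the $i$-th component of $x$. Assumption 2: there are constants $L_b,L_f,L_g,L_\sigma>0$ with $|b(t,x,y)-b(t',x',y')|\le L_b(|t-t'|+|x-x'|+|y-y'|)$, $|f(t,x,y,z)-f(t',x',y',z')|\le L_f(|t-t'|+|x-x'|+|y-y'|+|z-z'|)$, $|g(x)-g(x')|\le L_g|x-x'|$, and $|\sigma_i(t,x_i)-\sigma_i(t',x_i')|^2\le L_\sigma(|t-t'|+|x_i-x_i'|)$ for all $i$. Assumption 3: there exists a classical solution $u:[0,T]\times\mathbb{R}^n\to\mathbb{R}^m$ of the PDE: for each component $j$, $\partial_t u^j+\nabla_x u^j\cdot b(t,x,u)+\tfrac12\operatorname{tr}\big(\sigma\sigma^\top D_x^2u^j\big)+f^j\big(t,x,u,\nabla_x u\,\sigma\big)=0$, $u(T,x)=g(x)$. Assumption 4: there is $L_u>0$ with $|u(t,x)-u(t,x')|\le L_u|x-x'|$. Admissible control: a square-integrable $\mathbf F$-adapted $\mathbb{R}^{m\times d}$-valued process $\tilde Z$ with $\mathbb{E}|\tilde Z_t-\tilde Z_s|^2\le K|t-s|$ for all $s,t\in[0,T]$ and some constant $K$. Controlled system (E2): $\tilde X_t=x+\int_0^t b(s,\tilde X_s,\tilde Y_s)\,ds+\int_0^t\sigma(s,\tilde X_s)\,dW_s$, $\tilde Y_t=\tilde y-\int_0^t f(s,\tilde X_s,\tilde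 Y_s,\tilde Z_s)\,ds+\int_0^t\tilde Z_s\,dW_s$ (it has a unique solution). Euler scheme (E3): with $\alpha(t)=\lfloor Nt/T\rfloor\,T/N$, $\hat X_t=x+\int_0^t b(\alpha(s),\hat X_{\alpha(s)},\hat Y_{\alpha(s)})\,ds+\int_0^t\sigma(\alpha(s),\hat X_{\alpha(s)})\,dW_s$, $\hat Y_t=\tilde y-\int_0^t f(\alpha(s),\hat X_{\alpha(s)},\hat Y_{\alpha(s)},\tilde Z_{\alpha(s)})\,ds+\int_0^t\tilde Z_{\alpha(s)}\,dW_s$. *)

theory Defs
  imports "HOL-Probability.Probability"
begin

definition nat_filt :: "'w measure \<Rightarrow> (real \<Rightarrow> 'w \<Rightarrow> real^'d) \<Rightarrow> real \<Rightarrow> 'w set set" where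
  "nat_filt M W t = sigma_sets (space M)
     (\<Union>r\<in>{0..t}. {W r -` A \<inter> space M | A. A \<in> sets borel})"

definition aug_filt :: "'w measure \<Rightarrow> (real \<Rightarrow> 'w \<Rightarrow> real^'d) \<Rightarrow> real \<Rightarrow> 'w set set" where
  "aug_filt M W t = sigma_sets (space M)
     ((\<Union>r\<in>{0..t}. {W r -` A \<inter> space M | A. A \<in> sets borel}) \<union> null_sets M)"

definition std_BM :: "'w measure \<Rightarrow> (real \<Rightarrow> 'w \<Rightarrow> real^'d::finite) \<Rightarrow> bool" where
  "std_BM M W \<longleftrightarrow>
     (\<forall>t. W t \<in> borel_measurable M) \<and>
     (\<forall>\<omega>\<in>space M. W 0 \<omega> = 0) \<and>
     (\<forall>\<omega>\<in>space M. continuous_on {0..} (\<lambda>t. W t \<omega>)) \<and>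
     (\<forall>s t. 0 \<le> s \<and> s < t \<longrightarrow>
        prob_space.indep_set M (nat_filt M W s)
          {(\<lambda>\<omega>. W t \<omega> - W s \<omega>) -` A \<inter> space M | A. A \<in> sets borel} \<and>
        prob_space.indep_vars M (\<lambda>_. borel) (\<lambda>i \<omega>. (W t \<omega> - W s \<omega>) $ i) UNIV \<and>
        (\<forall>i. distributed M lborel (\<lambda>\<omega>. (W t \<omega> - W s \<omega>) $ i) (normal_density 0 (sqrt (t - s)))))"

definition adapted_proc :: "'w measure \<Rightarrow> (real \<Rightarrow> 'w set set) \<Rightarrow> real \<Rightarrow>
    (real \<Rightarrow> 'w \<Rightarrow> 'a::{second_countable_topology,real_normed_vector}) \<Rightarrow> bool" where
  "adapted_proc M F T X \<longleftrightarrow>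
     (\<forall>t\<in>{0..T}. X t \<in> borel_measurable (sigma (space M) (F t))) \<and>
     (\<lambda>(s, \<omega>). X s \<omega>) \<in> borel_measurable (restrict_space lborel {0..T} \<Otimes>\<^sub>M M)"

definition simple_adapted :: "'w measure \<Rightarrow> (real \<Rightarrow> 'w set set) \<Rightarrow> real \<Rightarrow> nat \<Rightarrow>
    (nat \<Rightarrow> real) \<Rightarrow> (nat \<Rightarrow> 'w \<Rightarrow> real^'d^'k) \<Rightarrow> bool" where
  "simple_adapted M F T k p V \<longleftrightarrow>
     p 0 = 0 \<and> p k = T \<and> (\<forall>i<k. p i < p (Suc i)) \<and>
     (\<forall>i<k. V i \<in> borel_measurable (sigma (space M) (F (p i))) \<and>
            (\<integral>\<^sup>+\<omega>. ennreal ((norm (V i \<omega>))\<^sup>2) \<partial>M) < \<infinity>)"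

definition simple_proc :: "nat \<Rightarrow> (nat \<Rightarrow> real) \<Rightarrow> (nat \<Rightarrow> 'w \<Rightarrow> real^'d^'k) \<Rightarrow> real \<Rightarrow> 'w \<Rightarrow> real^'d^'k" where
  "simple_proc k p V s \<omega> = (\<Sum>i<k. indicator {p i..<p (Suc i)} s *\<^sub>R V i \<omega>)"

definition simple_int :: "(real \<Rightarrow> 'w \<Rightarrow> real^'d) \<Rightarrow> nat \<Rightarrow> (nat \<Rightarrow> real) \<Rightarrow>
    (nat \<Rightarrow> 'w \<Rightarrow> real^'d^'k) \<Rightarrow> real \<Rightarrow> 'w \<Rightarrow> real^'k" where
  "simple_int W k p V t \<omega> =
     (\<Sum>i<k. V i \<omega> *v (W (min t (p (Suc i))) \<omega> - W (min t (p i)) \<omega>))"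

definition is_ito_integral :: "'w measure \<Rightarrow> (real \<Rightarrow> 'w \<Rightarrow> real^'d) \<Rightarrow> (real \<Rightarrow> 'w set set) \<Rightarrow> real \<Rightarrow>
    (real \<Rightarrow> 'w \<Rightarrow> real^'d^'k) \<Rightarrow> (real \<Rightarrow> 'w \<Rightarrow> real^'k) \<Rightarrow> bool" where
  "is_ito_integral M W F T H I \<longleftrightarrow>
     (\<exists>k p V. (\<forall>n. simple_adapted M F T (k n) (p n) (V n)) \<and>
        ((\<lambda>n. \<integral>\<^sup>+\<omega>. (\<integral>\<^sup>+s\<in>{0..T}. ennreal ((norm (simple_proc (k n) (p n) (V n) s \<omega> - H s \<omega>))\<^sup>2) \<partial>lborel) \<partial>M)
           \<longlonglongrightarrow> 0) \<and>
        (\<forall>t\<in>{0..T}. (\<lambda>n. \<integral>\<^sup>+\<omega>. ennreal ((norm (I t \<omega> - simple_int W (k n) (p n) (V n) t \<omega>))\<^sup>2) \<partial>M)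
           \<longlonglongrightarrow> 0))"

definition classical_pde_sol :: "real \<Rightarrow> (real \<Rightarrow> real^'n \<Rightarrow> real^'m \<Rightarrow> real^'n) \<Rightarrow>
    (real \<Rightarrow> real^'n \<Rightarrow> real^'d^'n) \<Rightarrow> (real \<Rightarrow> real^'n \<Rightarrow> real^'m \<Rightarrow> real^'d^'m \<Rightarrow> real^'m) \<Rightarrow>
    (real^'n \<Rightarrow> real^'m) \<Rightarrow> (real \<Rightarrow> real^'n \<Rightarrow> real^'m) \<Rightarrow> bool" where
  "classical_pde_sol T b \<sigma> f g u \<longleftrightarrow>
     (\<exists>ut Du D2u.
        continuous_on ({0..T} \<times> UNIV) (\<lambda>(t, x). u t x) \<and>
        continuous_on ({0..<T} \<times> UNIV) (\<lambda>(t, x). ut t x) \<and>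
        continuous_on ({0..<T} \<times> UNIV) (\<lambda>(t, x). Du t x) \<and>
        continuous_on ({0..<T} \<times> UNIV) (\<lambda>(t, x). D2u t x) \<and>
        (\<forall>t\<in>{0..<T}. \<forall>x.
           ((\<lambda>s. u s x) has_vector_derivative ut t x) (at t within {0..<T}) \<and>
           ((\<lambda>y. u t y) has_derivative (\<lambda>h. Du t x *v h)) (at x) \<and>
           (\<forall>j. ((\<lambda>y. Du t y $ j) has_derivative (\<lambda>h. D2u t x $ j *v h)) (at x)) \<and>
           (\<forall>j. ut t x $ j + (Du t x $ j) \<bullet> b t x (u t x)
                 + 1/2 * trace (\<sigma> t x ** transpose (\<sigma> t x) ** D2u t x $ j)
                 + f t x (u t x) (Du t x ** \<sigma> t x) $ j = 0)) \<and>
        (\<forall>x. u T x = g x))"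

definition admissible :: "'w measure \<Rightarrow> (real \<Rightarrow> 'w set set) \<Rightarrow> real \<Rightarrow> (real \<Rightarrow> 'w \<Rightarrow> real^'d^'m) \<Rightarrow> bool" where
  "admissible M F T Z \<longleftrightarrow> adapted_proc M F T Z \<and>
     (\<forall>t\<in>{0..T}. (\<integral>\<^sup>+\<omega>. ennreal ((norm (Z t \<omega>))\<^sup>2) \<partial>M) < \<infinity>) \<and>
     (\<exists>K. \<forall>s\<in>{0..T}. \<forall>t\<in>{0..T}.
        (\<integral>\<^sup>+\<omega>. ennreal ((norm (Z t \<omega> - Z s \<omega>))\<^sup>2) \<partial>M) \<le> ennreal (K * \<bar>t - s\<bar>))"

definition E2_sol :: "'w measure \<Rightarrow> (real \<Rightarrow> 'w \<Rightarrow> real^'d) \<Rightarrow> (real \<Rightarrow> 'w set set) \<Rightarrow> real \<Rightarrow>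
    (real \<Rightarrow> real^'n \<Rightarrow> real^'m \<Rightarrow> real^'n) \<Rightarrow> (real \<Rightarrow> real^'n \<Rightarrow> real^'d^'n) \<Rightarrow>
    (real \<Rightarrow> real^'n \<Rightarrow> real^'m \<Rightarrow> real^'d^'m \<Rightarrow> real^'m) \<Rightarrow> real^'n \<Rightarrow> real^'m \<Rightarrow>
    (real \<Rightarrow> 'w \<Rightarrow> real^'d^'m) \<Rightarrow> (real \<Rightarrow> 'w \<Rightarrow> real^'n) \<Rightarrow> (real \<Rightarrow> 'w \<Rightarrow> real^'m) \<Rightarrow> bool" where
  "E2_sol M W F T b \<sigma> f x y Z X Y \<longleftrightarrow>
     adapted_proc M F T X \<and> adapted_proc M F T Y \<and>
     (\<exists>IX IY. is_ito_integral M W F T (\<lambda>s \<omega>. \<sigma> s (X s \<omega>)) IX \<and>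
              is_ito_integral M W F T (\<lambda>s \<omega>. Z s \<omega>) IY \<and>
       (\<forall>t\<in>{0..T}. AE \<omega> in M.
          set_integrable lborel {0..t} (\<lambda>s. b s (X s \<omega>) (Y s \<omega>)) \<and>
          set_integrable lborel {0..t} (\<lambda>s. f s (X s \<omega>) (Y s \<omega>) (Z s \<omega>)) \<and>
          X t \<omega> = x + (LINT s:{0..t}|lborel. b s (X s \<omega>) (Y s \<omega>)) + IX t \<omega> \<and>
          Y t \<omega> = y - (LINT s:{0..t}|lborel. f s (X s \<omega>) (Y s \<omega>) (Z s \<omega>)) + IY t \<omega>))"

definition grid :: "nat \<Rightarrow> real \<Rightarrow> real \<Rightarrow> real" where
  "grid N T t = real_of_int \<lfloor>real N * t / T\<rfloor> * T / real N"

definition E3_sol :: "nat \<Rightarrow> 'w measure \<Rightarrow> (real \<Rightarrow> 'w \<Rightarrow> real^'d) \<Rightarrow> (real \<Rightarrow> 'w set set) \<Rightarrow> real \<Rightarrow>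
    (real \<Rightarrow> real^'n \<Rightarrow> real^'m \<Rightarrow> real^'n) \<Rightarrow> (real \<Rightarrow> real^'n \<Rightarrow> real^'d^'n) \<Rightarrow>
    (real \<Rightarrow> real^'n \<Rightarrow> real^'m \<Rightarrow> real^'d^'m \<Rightarrow> real^'m) \<Rightarrow> real^'n \<Rightarrow> real^'m \<Rightarrow>
    (real \<Rightarrow> 'w \<Rightarrow> real^'d^'m) \<Rightarrow> (real \<Rightarrow> 'w \<Rightarrow> real^'n) \<Rightarrow> (real \<Rightarrow> 'w \<Rightarrow> real^'m) \<Rightarrow> bool" where
  "E3_sol N M W F T b \<sigma> f x y Z X Y \<longleftrightarrow>
     adapted_proc M F T X \<and> adapted_proc M F T Y \<and>
     (\<exists>IX IY. is_ito_integral M W F T (\<lambda>s \<omega>. \<sigma> (grid N T s) (X (grid N T s) \<omega>)) IX \<and>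
              is_ito_integral M W F T (\<lambda>s \<omega>. Z (grid N T s) \<omega>) IY \<and>
       (\<forall>t\<in>{0..T}. AE \<omega> in M.
          set_integrable lborel {0..t} (\<lambda>s. b (grid N T s) (X (grid N T s) \<omega>) (Y (grid N T s) \<omega>)) \<and>
          set_integrable lborel {0..t}
            (\<lambda>s. f (grid N T s) (X (grid N T s) \<omega>) (Y (grid N T s) \<omega>) (Z (grid N T s) \<omega>)) \<and>
          X t \<omega> = x + (LINT s:{0..t}|lborel. b (grid N T s) (X (grid N T s) \<omega>) (Y (grid N T s) \<omega>))
                    + IX t \<omega> \<and>
          Y t \<omega> = y - (LINT s:{0..t}|lborel.
                        f (grid N T s) (X (grid N T s) \<omega>) (Y (grid N T s) \<omega>) (Z (grid N T s) \<omega>))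
                    + IY t \<omega>))"

end

theory Submission
  imports Defs
begin

text \<open>
  From stochastic calculus only the isometry and the vanishing mean of stochastic increments are
  needed; there is no Ito formula. Since \<open>\<sigma>\<close> is merely 1/2-Hoelder continuous, the squared \<open>L\<^sup>2\<close> error
  satisfies a Gronwall inequality whose source term is the \<open>L\<^sup>1\<close> error of the forward component at
  the grid points. That error is bounded by the Yamada--Watanabe argument, carried out directly on
  the grid: for a smooth approximation \<open>yw \<epsilon>\<close> of the absolute value with
  \<open>\<bar>z\<bar> * yw2 \<epsilon> z \<le> 1 / ln (1 / \<epsilon>)\<close>, a second-order Taylor expansion over one step of length \<open>h\<close>
  costs \<open>O(h / ln (1 / \<epsilon>))\<close> and a remainder \<open>O(h powr (5 / 4) / (\<epsilon>\<^sup>2 * ln (1 / \<epsilon>)))\<close>; here it matters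
  that row \<open>i\<close> of \<open>\<sigma>\<close> sees only component \<open>i\<close> of the state. Choosing \<open>\<epsilon> = N powr (- 1 / 8)\<close> makes both
  contributions summable to \<open>O(1 / ln N)\<close>.
\<close>

section \<open>The Yamada--Watanabe function\<close>

text \<open>The logarithm in the rate is the price for \<open>\<sigma>\<close> being only
  1/2-Hoelder: \<open>\<epsilon>\<close> may shrink no faster than a power of \<open>N\<close>, and
  the second-order term gains only the factor \<open>1 / ln (1 / \<epsilon>)\<close>. The exponent
  5/4 has this origin. On a step of length \<open>h\<close> the exact stochastic integral is
  replaced by a frozen coefficient times the Brownian increment, a variable \<open>a\<close> of size
  \<open>h powr (1/2)\<close>. Freezing leaves an error \<open>e\<close>, orthogonal to the past,
  with second moment of order \<open>h powr (3/2)\<close>: \<open>X\<close> is 1/2-Hoelder in mean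
  square, and squared increments of \<open>\<sigma>\<close> are only linear in those of
  \<open>X\<close>. The Taylor remainder is then dominated by
  \<open>\<bar>a\<bar> * \<bar>e\<bar>\<close>. Over \<open>N\<close> steps the quotient of
  \<open>h powr (1/4)\<close> and the square of \<open>\<epsilon>\<close> has to stay bounded, which
  dictates the power of \<open>N\<close>. The drift of \<open>X\<close> involves \<open>Y\<close>,
  so the L1 errors of both must be estimated together; the noise of \<open>Y\<close> is the given
  control in both systems, so at grid points its coefficients agree. Moment bounds are not part of
  the data and have to be derived first, uniformly in \<open>N\<close> for the error.\<close>

text \<open>
  On the positive half-line \<open>1 / sqrt (\<epsilon>\<^sup>2 + z\<^sup>2) - 1 / sqrt (1 + z\<^sup>2)\<close> has total mass \<open>ln (1 / \<epsilon>)\<close>.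
  Normalising it gives the second derivative \<open>yw2\<close>, so that \<open>yw1\<close> increases from \<open>-1\<close> to \<open>1\<close>.
\<close>

definition yw :: "real \<Rightarrow> real \<Rightarrow> real" where
  "yw \<epsilon> z = (z * (arsinh (z / \<epsilon>) - arsinh z) - sqrt (\<epsilon>\<^sup>2 + z\<^sup>2) + sqrt (1 + z\<^sup>2) + \<epsilon> - 1) / ln (1 / \<epsilon>)"

definition yw1 :: "real \<Rightarrow> real \<Rightarrow> real" where
  "yw1 \<epsilon> z = (arsinh (z / \<epsilon>) - arsinh z) / ln (1 / \<epsilon>)"

definition yw2 :: "real \<Rightarrow> real \<Rightarrow> real" where
  "yw2 \<epsilon> z = (1 / sqrt (\<epsilon>\<^sup>2 + z\<^sup>2) - 1 / sqrt (1 + z\<^sup>2)) / ln (1 / \<epsilon>)"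

lemma DERIV_arsinh_scale:
  fixes \<epsilon> z :: real assumes "\<epsilon> > 0"
  shows "((\<lambda>z. arsinh (z / \<epsilon>)) has_real_derivative 1 / sqrt (\<epsilon>\<^sup>2 + z\<^sup>2)) (at z)"
proof -
  have "((\<lambda>z. arsinh (z / \<epsilon>)) has_real_derivative (1 / sqrt ((z/\<epsilon>)\<^sup>2 + 1)) * (1 / \<epsilon>)) (at z)"
    by (rule DERIV_chain2[OF arsinh_real_has_field_derivative DERIV_cdivide[OF DERIV_ident]])
  moreover have "sqrt ((z/\<epsilon>)\<^sup>2 + 1) = sqrt (\<epsilon>\<^sup>2 + z\<^sup>2) / \<epsilon>"
  proof -
    have "(z/\<epsilon>)\<^sup>2 + 1 = (\<epsilon>\<^sup>2 + z\<^sup>2) / \<epsilon>\<^sup>2" using assms by (simp add: field_simps)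
    then show ?thesis using assms by (simp add: real_sqrt_divide)
  qed
  ultimately show ?thesis using assms by simp
qed

lemma DERIV_sqrt_sum:
  fixes c z :: real assumes "c > 0"
  shows "((\<lambda>z. sqrt (c + z\<^sup>2)) has_real_derivative z / sqrt (c + z\<^sup>2)) (at z)"
proof -
  have "c + z\<^sup>2 > 0" using assms by (simp add: add_pos_nonneg)
  then show ?thesis by (auto intro!: derivative_eq_intros simp: divide_simps)
qed

context
  fixes \<epsilon> :: real
  assumes eps: "0 < \<epsilon>" "\<epsilon> < 1"
begin

lemma ln_inv_pos: "ln (1 / \<epsilon>) > 0"
  using eps by simp

lemma sqrt_eps_le: "sqrt (\<epsilon>\<^sup>2 + z\<^sup>2) \<le> sqrt (1 + z\<^sup>2)"
  using eps by (simp add: power_le_one)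

lemma sqrt_eps_pos: "sqrt (\<epsilon>\<^sup>2 + z\<^sup>2) > 0" "sqrt (1 + z\<^sup>2) > 0"
  using eps by (simp_all add: add_pos_nonneg)

lemma eps_le_sqrt: "\<epsilon> \<le> sqrt (\<epsilon>\<^sup>2 + z\<^sup>2)" "\<bar>z\<bar> \<le> sqrt (\<epsilon>\<^sup>2 + z\<^sup>2)"
  using eps by (auto intro!: real_le_rsqrt)

lemma yw_0: "yw \<epsilon> 0 = 0"
  using eps by (simp add: yw_def)

lemma DERIV_yw: "(yw \<epsilon> has_real_derivative yw1 \<epsilon> z) (at z)"
proof -
  note [derivative_intros] = DERIV_arsinh_scale[OF eps(1)] DERIV_sqrt_sum
  \<comment> \<open>Writing \<open>z/1\<close> makes \<open>DERIV_arsinh_scale\<close> applicable to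
    both terms, with the scales \<open>\<epsilon>\<close> and 1.\<close>
  have "((\<lambda>z. z * (arsinh (z / \<epsilon>) - arsinh (z/1)) - sqrt (\<epsilon>\<^sup>2 + z\<^sup>2) + sqrt (1 + z\<^sup>2) + \<epsilon> - 1) has_real_derivative
     (1 * (arsinh (z / \<epsilon>) - arsinh (z/1)) + (1 / sqrt (\<epsilon>\<^sup>2 + z\<^sup>2) - 1 / sqrt (1\<^sup>2 + z\<^sup>2)) * z
       - z / sqrt (\<epsilon>\<^sup>2 + z\<^sup>2) + z / sqrt (1 + z\<^sup>2) + 0 - 0)) (at z)"
    using eps by (intro DERIV_add DERIV_diff DERIV_mult DERIV_ident DERIV_const DERIV_sqrt_sum DERIV_arsinh_scale) auto
  from DERIV_cdivide[OF this, of "ln (1 / \<epsilon>)"] show ?thesis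
    unfolding yw_def[abs_def] yw1_def by (simp add: algebra_simps)
qed

lemma DERIV_yw1: "(yw1 \<epsilon> has_real_derivative yw2 \<epsilon> z) (at z)"
proof -
  have "((\<lambda>z. arsinh (z / \<epsilon>) - arsinh (z/1)) has_real_derivative
     (1 / sqrt (\<epsilon>\<^sup>2 + z\<^sup>2) - 1 / sqrt (1\<^sup>2 + z\<^sup>2))) (at z)"
    by (intro DERIV_diff DERIV_arsinh_scale eps) simp
  from DERIV_cdivide[OF this, of "ln (1 / \<epsilon>)"] show ?thesis
    unfolding yw1_def[abs_def] yw2_def by simp
qed

lemma yw2_nonneg: "yw2 \<epsilon> z \<ge> 0"
  unfolding yw2_def using ln_inv_pos sqrt_eps_le[of z] sqrt_eps_pos[of z]
  by (auto intro!: divide_nonneg_nonneg simp: frac_le)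

lemma yw2_le: "yw2 \<epsilon> z \<le> 1 / sqrt (\<epsilon>\<^sup>2 + z\<^sup>2) / ln (1 / \<epsilon>)"
  unfolding yw2_def using ln_inv_pos sqrt_eps_pos[of z] by (intro divide_right_mono) auto

text \<open>The squared difference of two diffusion coefficients is of order
  \<open>\<bar>z\<bar>\<close>, so this product is what remains of the second-order term. Its bound
  is uniform in \<open>z\<close> and tends to 0 with \<open>\<epsilon>\<close>.\<close>

lemma abs_times_yw2_le: "\<bar>z\<bar> * yw2 \<epsilon> z \<le> 1 / ln (1 / \<epsilon>)"
proof -
  have "\<bar>z\<bar> * yw2 \<epsilon> z \<le> \<bar>z\<bar> * (1 / sqrt (\<epsilon>\<^sup>2 + z\<^sup>2) / ln (1 / \<epsilon>))"
    by (intro mult_left_mono yw2_le) auto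
  also have "\<dots> = (\<bar>z\<bar> / sqrt (\<epsilon>\<^sup>2 + z\<^sup>2)) / ln (1 / \<epsilon>)" by simp
  also have "\<dots> \<le> 1 / ln (1 / \<epsilon>)"
    using ln_inv_pos sqrt_eps_pos(1)[of z] eps_le_sqrt(2)[of z]
    by (intro divide_right_mono) (auto simp: divide_simps)
  finally show ?thesis .
qed

text \<open>The natural order is \<open>1 / \<epsilon>\<close>. It is weakened to the order of the
  Lipschitz constant in \<open>yw2_Lipschitz\<close>, so that a single \<open>K\<close> serves both
  purposes in \<open>Taylor_two_step\<close>.\<close>

lemma yw2_bound: "\<bar>yw2 \<epsilon> z\<bar> \<le> 1 / (\<epsilon>\<^sup>2 * ln (1 / \<epsilon>))"
proof -
  have "\<bar>yw2 \<epsilon> z\<bar> = yw2 \<epsilon> z" using yw2_nonneg by simp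
  also have "\<dots> \<le> 1 / sqrt (\<epsilon>\<^sup>2 + z\<^sup>2) / ln (1 / \<epsilon>)" by (rule yw2_le)
  also have "\<dots> \<le> 1 / \<epsilon>\<^sup>2 / ln (1 / \<epsilon>)"
  proof (intro divide_right_mono)
    have "\<epsilon>\<^sup>2 \<le> \<epsilon>" using eps by (simp add: power2_eq_square)
    then show "1 / sqrt (\<epsilon>\<^sup>2 + z\<^sup>2) \<le> 1 / \<epsilon>\<^sup>2" using eps eps_le_sqrt(1)[of z]
      by (intro divide_left_mono order_trans[OF \<open>\<epsilon>\<^sup>2 \<le> \<epsilon>\<close>]) (auto intro!: mult_pos_pos add_pos_nonneg)
  qed (use ln_inv_pos in auto)
  finally show ?thesis by simp
qed

lemma DERIV_inv_sqrt_sum: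
  fixes c z :: real assumes "c > 0"
  shows "((\<lambda>z. 1 / sqrt (c + z\<^sup>2)) has_real_derivative - z / ((c + z\<^sup>2) * sqrt (c + z\<^sup>2))) (at z)"
proof -
  have p: "c + z\<^sup>2 > 0" using assms by (simp add: add_pos_nonneg)
  have "((\<lambda>z. 1 / sqrt (c + z\<^sup>2)) has_real_derivative
     (0 * sqrt (c + z\<^sup>2) - 1 * (z / sqrt (c + z\<^sup>2))) / (sqrt (c + z\<^sup>2) * sqrt (c + z\<^sup>2))) (at z)"
    using p by (intro DERIV_divide DERIV_const DERIV_sqrt_sum assms) auto
  then show ?thesis using p by (simp add: divide_simps mult.commute)
qed

lemma yw2_Lipschitz: "\<bar>yw2 \<epsilon> z - yw2 \<epsilon> w\<bar> \<le> 1 / (\<epsilon>\<^sup>2 * ln (1 / \<epsilon>)) * \<bar>z - w\<bar>"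
proof -
  define d3 where "d3 = (\<lambda>z. (- z / ((\<epsilon>\<^sup>2 + z\<^sup>2) * sqrt (\<epsilon>\<^sup>2 + z\<^sup>2)) - - z / ((1 + z\<^sup>2) * sqrt (1 + z\<^sup>2))) / ln (1 / \<epsilon>))"
  have "(yw2 \<epsilon> has_real_derivative d3 z) (at z)" for z
    unfolding yw2_def[abs_def] d3_def using eps by (intro DERIV_cdivide DERIV_diff DERIV_inv_sqrt_sum) auto
  moreover have "\<bar>d3 z\<bar> \<le> 1 / (\<epsilon>\<^sup>2 * ln (1 / \<epsilon>))" for z
  proof -
    define A where "A = (\<epsilon>\<^sup>2 + z\<^sup>2) * sqrt (\<epsilon>\<^sup>2 + z\<^sup>2)"
    define B where "B = (1 + z\<^sup>2) * sqrt (1 + z\<^sup>2)"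
    have A: "A > 0" unfolding A_def using sqrt_eps_pos(1)[of z] eps by (intro mult_pos_pos) (auto intro!: add_pos_nonneg)
    have AB: "A \<le> B" unfolding A_def B_def using sqrt_eps_le[of z] eps
      by (intro mult_mono) (auto simp: power_le_one)
    have "\<bar>z\<bar> * \<epsilon>\<^sup>2 \<le> sqrt (\<epsilon>\<^sup>2 + z\<^sup>2) * (\<epsilon>\<^sup>2 + z\<^sup>2)"
      by (intro mult_mono eps_le_sqrt) (auto intro: add_nonneg_nonneg)
    then have zA: "\<bar>z\<bar> / A \<le> 1 / \<epsilon>\<^sup>2" using eps A by (simp add: field_simps A_def)
    have "\<bar>- z / A - - z / B\<bar> = \<bar>z\<bar> * (1 / A - 1 / B)"
    proof -
      have "- z / A - - z / B = - (z * (1 / A - 1 / B))" by (simp add: algebra_simps)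
      moreover have "1 / A - 1 / B \<ge> 0" using A AB by (simp add: frac_le)
      ultimately show ?thesis by (metis abs_minus_cancel abs_mult abs_of_nonneg)
    qed
    also have "\<dots> \<le> \<bar>z\<bar> * (1 / A)" using A AB by (intro mult_left_mono) auto
    also have "\<dots> \<le> 1 / \<epsilon>\<^sup>2" using zA by simp
    finally have "\<bar>- z / A - - z / B\<bar> / ln (1 / \<epsilon>) \<le> 1 / \<epsilon>\<^sup>2 / ln (1 / \<epsilon>)"
      using ln_inv_pos by (intro divide_right_mono) auto
    then show ?thesis unfolding d3_def A_def[symmetric] B_def[symmetric]
      using ln_inv_pos by (simp add: abs_divide)
  qed
  ultimately show ?thesis
    using field_differentiable_bound[of UNIV "yw2 \<epsilon>" d3 "1 / (\<epsilon>\<^sup>2 * ln (1 / \<epsilon>))" z w]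
    by simp
qed

lemma yw1_minus: "yw1 \<epsilon> (- z) = - yw1 \<epsilon> z"
  by (simp add: yw1_def diff_divide_distrib)

lemma yw_minus: "yw \<epsilon> (- z) = yw \<epsilon> z"
  by (simp add: yw_def algebra_simps)

lemma yw1_mono: "z \<le> w \<Longrightarrow> yw1 \<epsilon> z \<le> yw1 \<epsilon> w"
  using DERIV_nonneg_imp_nondecreasing[of z w "yw1 \<epsilon>"] DERIV_yw1 yw2_nonneg by blast

text \<open>The numerator of \<open>yw1\<close> tends to \<open>ln (1 / \<epsilon>)\<close> at
  infinity. Writing \<open>arsinh\<close> as a logarithm expresses the defect as the logarithm of a
  quotient close to 1, which decays like \<open>1 / z\<close>; hence the factor \<open>z\<close>
  does no harm. This is what \<open>yw_lower\<close> requires.\<close>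

lemma yw1_defect:
  assumes z: "z > 0"
  shows "0 \<le> 1 - yw1 \<epsilon> z" "z * (1 - yw1 \<epsilon> z) \<le> 1 / (2 * ln (1 / \<epsilon>))"
proof -
  have L: "ln (1 / \<epsilon>) > 0" by (rule ln_inv_pos)
  define s where "s = sqrt (z\<^sup>2 + 1)"
  define se where "se = sqrt ((z/\<epsilon>)\<^sup>2 + 1)"
  have s: "s > z" "s > 0" "s \<le> z + 1"
  proof -
    show "s > z" unfolding s_def by (rule real_less_rsqrt) simp
    then show "s > 0" using z by simp
    show "s \<le> z + 1" unfolding s_def using z by (intro real_le_lsqrt) (auto simp: power2_sum)
  qed
  have se: "se > z / \<epsilon>" unfolding se_def by (rule real_less_rsqrt) simp
  have ze: "z / \<epsilon> > 0" using z eps by simp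
  have e1: "ln (1/\<epsilon>) - (arsinh (z/\<epsilon>) - arsinh z) = ln ((z + s) / (z + \<epsilon> * se))"
  proof -
    have "z/\<epsilon> + se = (z + \<epsilon> * se) / \<epsilon>" using eps by (simp add: field_simps)
    moreover have "z + \<epsilon> * se > 0" using z se ze eps by (intro add_pos_pos mult_pos_pos) linarith+
    ultimately show ?thesis
      unfolding arsinh_real_def s_def[symmetric] se_def[symmetric] using s z eps
      by (simp add: ln_div)
  qed
  have ese: "\<epsilon> * se > z" "\<epsilon> * se \<le> s"
  proof -
    show "\<epsilon> * se > z" using se eps by (simp add: field_simps)
    have "\<epsilon> * se = sqrt (\<epsilon>\<^sup>2 * ((z/\<epsilon>)\<^sup>2 + 1))" unfolding se_def using eps by (simp add: real_sqrt_mult)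
    also have "\<epsilon>\<^sup>2 * ((z/\<epsilon>)\<^sup>2 + 1) = z\<^sup>2 + \<epsilon>\<^sup>2" using eps by (simp add: field_simps)
    finally show "\<epsilon> * se \<le> s" unfolding s_def using eps by (simp add: power_le_one)
  qed
  have e2: "1 - yw1 \<epsilon> z = ln ((z + s) / (z + \<epsilon> * se)) / ln (1/\<epsilon>)"
    unfolding e1[symmetric] yw1_def using L by (simp add: field_simps)
  show "0 \<le> 1 - yw1 \<epsilon> z" unfolding e2 using L ese z by (intro divide_nonneg_pos ln_ge_zero) (auto simp: field_simps)
  have "ln ((z + s) / (z + \<epsilon> * se)) \<le> (z + s) / (z + \<epsilon> * se) - 1"
    using z s ese by (intro ln_le_minus_one divide_pos_pos) auto
  \<comment> \<open>\<open>\<epsilon> * se\<close> is the root of the sum of the squares of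
    \<open>z\<close> and \<open>\<epsilon>\<close>, hence exceeds \<open>z\<close>; this removes
    \<open>\<epsilon>\<close> from the estimate.\<close>
  also have "\<dots> \<le> (z + s) / (2 * z) - 1" using z s ese by (intro diff_right_mono divide_left_mono) auto
  also have "\<dots> = (s - z) / (2 * z)" using z by (simp add: field_simps)
  also have "\<dots> \<le> 1 / (2 * z)" using s z by (intro divide_right_mono) auto
  finally have "z * ln ((z + s) / (z + \<epsilon> * se)) \<le> 1 / 2" using z by (simp add: field_simps)
  then show "z * (1 - yw1 \<epsilon> z) \<le> 1 / (2 * ln (1 / \<epsilon>))"
    unfolding e2 using L by (simp add: field_simps)
qed

lemma yw1_bound: "\<bar>yw1 \<epsilon> z\<bar> \<le> 1"
proof -
  have *: "\<bar>yw1 \<epsilon> z\<bar> \<le> 1" if "z > 0" for z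
    using yw1_defect(1)[OF that] yw1_mono[of 0 z] that by (simp add: yw1_def)
  consider "z > 0" | "z = 0" | "-z > 0" by linarith
  then show ?thesis
    by cases (use *[of z] *[of "-z"] in \<open>auto simp: yw1_minus yw1_def[of _ 0]\<close>)
qed

text \<open>Lets the drift increment be removed from the argument of \<open>yw\<close> at the cost
  of its L1 norm, without expanding in it.\<close>

lemma yw_Lipschitz: "\<bar>yw \<epsilon> z - yw \<epsilon> w\<bar> \<le> \<bar>z - w\<bar>"
  using field_differentiable_bound[of UNIV "yw \<epsilon>" "yw1 \<epsilon>" 1 w z] DERIV_yw yw1_bound by simp

text \<open>Recovers the absolute value from \<open>yw\<close>. Of the constant 3/2, one half is the
  defect of \<open>yw1\<close> and the rest the normalisation \<open>yw \<epsilon> 0 = 0\<close>,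
  which contributes \<open>\<epsilon> - 1 \<ge> -1\<close> to the numerator.\<close>

lemma yw_lower: "\<bar>z\<bar> - 3 / (2 * ln (1 / \<epsilon>)) \<le> yw \<epsilon> z"
proof -
  have L: "ln (1 / \<epsilon>) > 0" by (rule ln_inv_pos)
  have *: "z - 3 / (2 * ln (1 / \<epsilon>)) \<le> yw \<epsilon> z" if z: "z > 0" for z
  proof -
    have "yw \<epsilon> z = z * yw1 \<epsilon> z + (sqrt (1 + z\<^sup>2) - sqrt (\<epsilon>\<^sup>2 + z\<^sup>2) + \<epsilon> - 1) / ln (1/\<epsilon>)"
      unfolding yw_def yw1_def times_divide_eq_right add_divide_distrib[symmetric] by (simp add: algebra_simps)
    moreover have "(sqrt (1 + z\<^sup>2) - sqrt (\<epsilon>\<^sup>2 + z\<^sup>2) + \<epsilon> - 1) / ln (1/\<epsilon>) \<ge> - 1 / ln (1/\<epsilon>)"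
      using L sqrt_eps_le[of z] eps(1) by (intro divide_right_mono) linarith+
    moreover have "z * yw1 \<epsilon> z \<ge> z - 1 / (2 * ln (1 / \<epsilon>))" using yw1_defect(2)[OF z] by (simp add: algebra_simps)
    ultimately show ?thesis using L by (simp add: field_simps)
  qed
  consider "z > 0" | "z = 0" | "-z > 0" by linarith
  then show ?thesis
    by cases (use *[of z] *[of "-z"] L in \<open>auto simp: yw_minus yw_0\<close>)
qed

end

section \<open>Taylor expansion with a split increment, and a discrete Gronwall inequality\<close>

lemma Taylor2_le:
  fixes f f1 f2 :: "real \<Rightarrow> real"
  assumes d1: "\<And>z. (f has_real_derivative f1 z) (at z)"
    and d2: "\<And>z. (f1 has_real_derivative f2 z) (at z)"
  obtains t where "\<bar>t - x\<bar> \<le> \<bar>a\<bar>" "f (x + a) = f x + f1 x * a + f2 t / 2 * a\<^sup>2"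
proof (cases "a = 0")
  case True
  then show ?thesis using that[of x] by simp
next
  case False
  define diff where "diff = (\<lambda>m::nat. if m = 0 then f else if m = 1 then f1 else f2)"
  have "\<exists>t. (if x + a < x then x + a < t \<and> t < x else x < t \<and> t < x + a) \<and>
    f (x + a) = (\<Sum>m<2. diff m x / fact m * (x + a - x) ^ m) + diff 2 t / fact 2 * (x + a - x)\<^sup>2"
  proof (rule Taylor[of 2 diff f "min x (x+a)" "max x (x+a)"])
    show "\<forall>m t. m < 2 \<and> min x (x + a) \<le> t \<and> t \<le> max x (x + a) \<longrightarrow> DERIV (diff m) t :> diff (Suc m) t"
      using d1 d2 by (auto simp: diff_def less_2_cases_iff)
  qed (use False in \<open>auto simp: diff_def\<close>)
  then obtain t where t: "if x + a < x then x + a < t \<and> t < x else x < t \<and> t < x + a"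
    and e: "f (x + a) = f x + f1 x * a + f2 t / 2 * a\<^sup>2"
    by (auto simp: diff_def lessThan_Suc numeral_2_eq_2 algebra_simps)
  show ?thesis by (rule that[of t]) (use t e in \<open>auto split: if_splits\<close>)
qed

lemma Taylor_two_step:
  fixes f f1 f2 :: "real \<Rightarrow> real"
  assumes d1: "\<And>z. (f has_real_derivative f1 z) (at z)"
    and d2: "\<And>z. (f1 has_real_derivative f2 z) (at z)"
    and b2: "\<And>z. \<bar>f2 z\<bar> \<le> K" and l2: "\<And>z w. \<bar>f2 z - f2 w\<bar> \<le> K * \<bar>z - w\<bar>"
  shows "f (x + a + e) \<le> f x + f1 x * (a + e) + f2 x / 2 * a\<^sup>2 + K * (\<bar>a\<bar> ^ 3 + \<bar>a\<bar> * \<bar>e\<bar> + e\<^sup>2)"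
proof -
  have K: "K \<ge> 0" using b2[of 0] by linarith
  obtain t where t: "\<bar>t - x\<bar> \<le> \<bar>a\<bar>" "f (x + a) = f x + f1 x * a + f2 t / 2 * a\<^sup>2"
    using Taylor2_le[OF d1 d2] .
  obtain s where s: "f (x + a + e) = f (x + a) + f1 (x + a) * e + f2 s / 2 * e\<^sup>2"
    using Taylor2_le[OF d1 d2, of "x + a" e] .
  have 1: "f1 (x + a) * e \<le> f1 x * e + K * (\<bar>a\<bar> * \<bar>e\<bar>)"
  proof -
    have "\<bar>f1 (x + a) - f1 x\<bar> \<le> K * \<bar>a\<bar>"
      using field_differentiable_bound[of UNIV f1 f2 K x "x + a"] d2 b2 by simp
    then have "\<bar>(f1 (x + a) - f1 x) * e\<bar> \<le> K * \<bar>a\<bar> * \<bar>e\<bar>" by (simp add: abs_mult mult_right_mono)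
    then show ?thesis by (simp add: algebra_simps abs_le_iff)
  qed
  have "f2 s / 2 \<le> K" using b2[of s] K by linarith
  then have 2: "f2 s / 2 * e\<^sup>2 \<le> K * e\<^sup>2" by (intro mult_right_mono) auto
  have 3: "f2 t / 2 * a\<^sup>2 \<le> f2 x / 2 * a\<^sup>2 + K * \<bar>a\<bar> ^ 3"
  proof -
    have "f2 t - f2 x \<le> K * \<bar>a\<bar>" using l2[of t x] t(1) K mult_left_mono[OF t(1) K] by linarith
    then have "(f2 t - f2 x) * a\<^sup>2 \<le> K * \<bar>a\<bar> * a\<^sup>2" by (intro mult_right_mono) auto
    moreover have "\<bar>a\<bar> * a\<^sup>2 = \<bar>a\<bar> ^ 3" by (simp add: power2_eq_square power3_eq_cube abs_mult)
    moreover have "K * \<bar>a\<bar> * a\<^sup>2 \<ge> 0" using K by simp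
    ultimately show ?thesis by (simp add: algebra_simps)
  qed
  show ?thesis using 1 2 3 s t(2) by (simp add: algebra_simps)
qed

lemma discrete_Gronwall:
  fixes v :: "nat \<Rightarrow> ennreal"
  assumes A: "A \<ge> 0" and c: "c \<ge> 0"
    and v: "\<And>k. k \<le> N \<Longrightarrow> v k \<le> ennreal A + ennreal c * (\<Sum>j<k. v j)" and k: "k \<le> N"
  shows "v k \<le> ennreal (A * exp (real N * c))"
proof -
  \<comment> \<open>The induction also carries the bound on the whole right-hand side: passing from
    \<open>k\<close> to \<open>Suc k\<close> adds \<open>c * v k\<close> to it, which yields the
    factor \<open>1 + c\<close>.\<close>
  have sm: "v k \<le> ennreal (A * (1 + c) ^ k) \<and> ennreal A + ennreal c * (\<Sum>j<k. v j) \<le> ennreal (A * (1 + c) ^ k)" if "k \<le> N" for k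
    using that
  proof (induction k)
    case 0
    then show ?case using v[of 0] by simp
  next
    case (Suc k)
    then have IH: "v k \<le> ennreal (A * (1 + c) ^ k)" "ennreal A + ennreal c * (\<Sum>j<k. v j) \<le> ennreal (A * (1 + c) ^ k)"
      by auto
    have "ennreal A + ennreal c * (\<Sum>j<Suc k. v j) = (ennreal A + ennreal c * (\<Sum>j<k. v j)) + ennreal c * v k"
      by (simp add: distrib_left add.assoc)
    also have "\<dots> \<le> ennreal (A * (1 + c) ^ k) + ennreal c * ennreal (A * (1 + c) ^ k)"
      by (intro add_mono mult_left_mono IH) auto
    also have "\<dots> = ennreal (A * (1 + c) ^ Suc k)"
      using A c by (simp add: ennreal_mult[symmetric] ennreal_plus[symmetric] algebra_simps del: ennreal_plus)
    finally show ?case using v[OF Suc.prems] by auto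
  qed
  have "(1 + c) ^ k \<le> (1 + c) ^ N" using c k by (intro power_increasing) auto
  also have "\<dots> \<le> exp c ^ N" using c by (intro power_mono) (auto simp: exp_ge_add_one_self)
  also have "\<dots> = exp (real N * c)" by (simp add: exp_of_nat_mult)
  finally have "A * (1 + c) ^ k \<le> A * exp (real N * c)" using A by (intro mult_left_mono)
  then show ?thesis using sm[OF k] by (meson ennreal_leI order_trans)
qed

section \<open>Brownian increments and the augmented filtration\<close>

abbreviation (input) nsq :: "'a::real_normed_vector \<Rightarrow> ennreal" where
  "nsq v \<equiv> ennreal ((norm v)\<^sup>2)"

text \<open>Stated with the nonnegative integral, so that any finite bound on a second moment gives
  membership directly; \<open>L2_iff\<close> is the Bochner form.\<close>

definition L2 :: "'w measure \<Rightarrow> ('w \<Rightarrow> 'a::{second_countable_topology,real_normed_vector}) \<Rightarrow> bool" where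
  "L2 M X \<longleftrightarrow> X \<in> borel_measurable M \<and> (\<integral>\<^sup>+\<omega>. nsq (X \<omega>) \<partial>M) < \<infinity>"

lemma L2_measurable: "L2 M X \<Longrightarrow> X \<in> borel_measurable M"
  by (simp add: L2_def)

lemma L2_integrable: "L2 M X \<Longrightarrow> integrable M (\<lambda>\<omega>. (norm (X \<omega>))\<^sup>2)"
  unfolding L2_def by (intro integrableI_nonneg) auto

lemma L2_iff: "L2 M X \<longleftrightarrow> X \<in> borel_measurable M \<and> integrable M (\<lambda>\<omega>. (norm (X \<omega>))\<^sup>2)"
  by (auto simp: L2_integrable L2_measurable) (simp add: L2_def nn_integral_eq_integral)

lemma L2_mono:
  assumes "X \<in> borel_measurable M" "L2 M Y" "\<And>\<omega>. \<omega> \<in> space M \<Longrightarrow> norm (X \<omega>) \<le> norm (Y \<omega>)"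
  shows "L2 M X"
  using assms unfolding L2_def
  by (auto intro!: le_less_trans[OF nn_integral_mono[of M _ "\<lambda>\<omega>. nsq (Y \<omega>)"]] ennreal_leI power_mono)

lemma norm_sum_sq_le: "(norm (x + y))\<^sup>2 \<le> 2 * (norm x)\<^sup>2 + 2 * (norm (y::'a::real_normed_vector))\<^sup>2"
proof -
  have "(norm (x + y))\<^sup>2 \<le> (norm x + norm y)\<^sup>2" by (intro power_mono norm_triangle_ineq) auto
  also have "\<dots> \<le> 2 * (norm x)\<^sup>2 + 2 * (norm y)\<^sup>2" using sum_squares_bound[of "norm x" "norm y"] by (simp add: power2_sum)
  finally show ?thesis .
qed

lemma norm_sq_add4: "(norm (a + b + c + d))\<^sup>2 \<le> 4 * ((norm a)\<^sup>2 + (norm b)\<^sup>2 + (norm c)\<^sup>2 + (norm (d::'z::real_normed_vector))\<^sup>2)"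
  using norm_sum_sq_le[of "a + b" "c + d"] norm_sum_sq_le[of a b] norm_sum_sq_le[of c d] by (simp add: add.assoc)

lemma L2_add:
  assumes X: "L2 M X" and Y: "L2 M Y" shows "L2 M (\<lambda>\<omega>. X \<omega> + Y \<omega>)"
  unfolding L2_iff
proof
  show [measurable]: "(\<lambda>\<omega>. X \<omega> + Y \<omega>) \<in> borel_measurable M"
    using X Y by (auto simp: L2_def)
  show "integrable M (\<lambda>\<omega>. (norm (X \<omega> + Y \<omega>))\<^sup>2)"
    by (rule Bochner_Integration.integrable_bound[of _ "\<lambda>\<omega>. 2 * (norm (X \<omega>))\<^sup>2 + 2 * (norm (Y \<omega>))\<^sup>2"])
      (use X Y norm_sum_sq_le in \<open>auto simp: L2_iff\<close>)
qed

lemma L2_uminus: "L2 M X \<Longrightarrow> L2 M (\<lambda>\<omega>. - X \<omega>)"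
  by (auto simp: L2_def)

lemma L2_diff: "L2 M X \<Longrightarrow> L2 M Y \<Longrightarrow> L2 M (\<lambda>\<omega>. X \<omega> - Y \<omega>)"
  using L2_add[OF _ L2_uminus, of M X Y] by simp

lemma norm_vec_sq: "(norm (v :: ('a::real_normed_vector)^'k))\<^sup>2 = (\<Sum>i\<in>UNIV. (norm (v $ i))\<^sup>2)"
  by (simp add: norm_vec_def L2_set_def sum_nonneg)

lemma measurable_vec_nth [measurable (raw)]:
  fixes f :: "'w \<Rightarrow> ('a::euclidean_space)^'k"
  shows "f \<in> borel_measurable M \<Longrightarrow> (\<lambda>\<omega>. f \<omega> $ i) \<in> borel_measurable M"
  by (rule measurable_compose[OF _ borel_measurable_continuous_onI[OF continuous_on_component[OF continuous_on_id]]])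

lemma L2_nth: "L2 M (X :: _ \<Rightarrow> 'a::euclidean_space^'k) \<Longrightarrow> L2 M (\<lambda>\<omega>. X \<omega> $ i)"
  by (rule L2_mono[of _ M X]) (simp_all add: L2_measurable Finite_Cartesian_Product.norm_nth_le measurable_vec_nth)

lemma L2_mult_integrable:
  fixes X Y :: "'w \<Rightarrow> real"
  assumes X: "L2 M X" and Y: "L2 M Y" shows "integrable M (\<lambda>\<omega>. X \<omega> * Y \<omega>)"
proof (rule Bochner_Integration.integrable_bound[of _ "\<lambda>\<omega>. (norm (X \<omega>))\<^sup>2 + (norm (Y \<omega>))\<^sup>2"])
  show "AE \<omega> in M. norm (X \<omega> * Y \<omega>) \<le> norm ((norm (X \<omega>))\<^sup>2 + (norm (Y \<omega>))\<^sup>2)"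
  proof (intro always_eventually allI)
    fix \<omega>
    show "norm (X \<omega> * Y \<omega>) \<le> norm ((norm (X \<omega>))\<^sup>2 + (norm (Y \<omega>))\<^sup>2)"
    proof -
      have "2 * (\<bar>X \<omega>\<bar> * \<bar>Y \<omega>\<bar>) \<le> (X \<omega>)\<^sup>2 + (Y \<omega>)\<^sup>2"
        using sum_squares_bound[of "\<bar>X \<omega>\<bar>" "\<bar>Y \<omega>\<bar>"] by (simp add: mult.assoc)
      moreover have "0 \<le> \<bar>X \<omega>\<bar> * \<bar>Y \<omega>\<bar>" by simp
      ultimately have "\<bar>X \<omega>\<bar> * \<bar>Y \<omega>\<bar> \<le> (X \<omega>)\<^sup>2 + (Y \<omega>)\<^sup>2" by linarith
      then show ?thesis by (simp add: abs_mult)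
    qed
  qed
qed (use X Y in \<open>auto simp: L2_iff\<close>)

lemma (in prob_space) L2_const: "L2 M (\<lambda>_. c)"
  by (simp add: L2_iff)

lemma (in prob_space) L2_imp_integrable:
  "L2 M (X :: _ \<Rightarrow> real) \<Longrightarrow> integrable M X"
  using L2_mult_integrable[OF _ L2_const[of "1::real"], of X] by simp

locale brownian = prob_space M for M :: "'w measure" +
  fixes W :: "real \<Rightarrow> 'w \<Rightarrow> real^'d::finite" and T :: real
  assumes complete: "complete_measure M" and BM: "std_BM M W" and T: "T > 0"
begin

abbreviation msq :: "('w \<Rightarrow> 'a::real_normed_vector) \<Rightarrow> ennreal" where
  "msq X \<equiv> \<integral>\<^sup>+\<omega>. nsq (X \<omega>) \<partial>M"

abbreviation "F \<equiv> aug_filt M W"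
abbreviation "FA t \<equiv> sigma (space M) (F t)"

lemma W_measurable [measurable]: "W t \<in> borel_measurable M"
  using BM by (simp add: std_BM_def)

lemma F_subset: "F t \<subseteq> sets M"
  unfolding aug_filt_def by (intro sets.sigma_sets_subset) (auto simp: null_sets_def)

lemma space_FA [simp]: "space (FA t) = space M"
  using F_subset sets.space_closed by (auto simp: space_measure_of_conv)

lemma sets_FA: "sets (FA t) = F t"
proof -
  have "sets (FA t) = sigma_sets (space M) (F t)"
    by (rule sets_measure_of) (use F_subset[of t] sets.space_closed[of M] in blast)
  also have "\<dots> = F t"
  proof -
    have "(\<Union>r\<in>{0..t}. {W r -` A \<inter> space M | A. A \<in> sets borel}) \<union> null_sets M \<subseteq> Pow (space M)"
      by (auto simp: null_sets_def dest: sets.sets_into_space)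
    then show ?thesis unfolding aug_filt_def by (simp add: sigma_sets_sigma_sets_eq)
  qed
  finally show ?thesis .
qed

lemma F_mono: "s \<le> t \<Longrightarrow> F s \<subseteq> F t"
  unfolding aug_filt_def by (intro sigma_sets_mono' Un_mono UN_mono) auto

lemma subalg_M: "subalgebra M (FA t)"
  unfolding subalgebra_def sets_FA space_FA using F_subset by blast

lemma FA_meas: "f \<in> measurable (FA t) N \<Longrightarrow> f \<in> measurable M N"
  by (rule measurable_from_subalg[OF subalg_M])

lemma FA_mono: "s \<le> t \<Longrightarrow> f \<in> measurable (FA s) N \<Longrightarrow> f \<in> measurable (FA t) N"
  by (rule measurable_from_subalg[of "FA t" "FA s"]) (unfold subalgebra_def sets_FA space_FA, use F_mono in blast)

lemma W_FA:
  assumes "0 \<le> r" "r \<le> t"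
  shows "W r \<in> borel_measurable (FA t)"
proof (rule measurableI)
  fix A :: "(real^'d) set" assume "A \<in> sets borel"
  then have "W r -` A \<inter> space M \<in> (\<Union>r\<in>{0..t}. {W r -` A \<inter> space M | A. A \<in> sets borel})"
    using assms by (intro UN_I[of r]) auto
  then have "W r -` A \<inter> space M \<in> F t"
    unfolding aug_filt_def by (intro sigma_sets.Basic UnI1)
  then show "W r -` A \<inter> space (FA t) \<in> sets (FA t)"
    by (simp only: sets_FA space_FA)
qed (simp only: space_borel UNIV_I)

text \<open>The preimages under \<open>f\<close> and \<open>g\<close> differ by subsets of a null
  set, which are measurable by completeness. It is applied to stochastic integrals: these are
  specified only through limits, and their measurability has to be read off from the
  equation.\<close>

lemma measurable_AE_eq:
  fixes f g :: "'w \<Rightarrow> 'a::topological_space"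
  assumes f: "f \<in> borel_measurable M" and g: "AE \<omega> in M. f \<omega> = g \<omega>"
  shows "g \<in> borel_measurable M"
proof (rule measurableI)
  obtain N where N: "{\<omega> \<in> space M. f \<omega> \<noteq> g \<omega>} \<subseteq> N" and N0: "emeasure M N = 0" "N \<in> sets M"
    by (rule AE_E[OF g])
  have N2: "N \<in> null_sets M" using N0 by (rule null_setsI)
  fix A :: "'a set" assume A: "A \<in> sets borel"
  have e: "g -` A \<inter> space M = (f -` A \<inter> space M - (f -` A \<inter> space M - g -` A)) \<union> (g -` A \<inter> space M - f -` A)"
    by blast
  have s1: "f -` A \<inter> space M - g -` A \<subseteq> N" using N by (auto simp: subset_iff)
  have s2: "g -` A \<inter> space M - f -` A \<subseteq> N" using N by (auto simp: subset_iff)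
  note c = complete_measure.complete[OF complete _ N2]
  have "(f -` A \<inter> space M - (f -` A \<inter> space M - g -` A)) \<union> (g -` A \<inter> space M - f -` A) \<in> sets M"
    by (rule sets.Un[OF sets.Diff[OF measurable_sets[OF f A] c[OF s1]] c[OF s2]])
  then show "g -` A \<inter> space M \<in> sets M" by (subst e)
qed (simp only: space_borel UNIV_I)

text \<open>Agreeing almost everywhere with an event of the natural filtration is stable under
  complements and countable unions, and null sets agree with the empty set. Thus the independence
  postulated for the natural filtration carries over to the augmented one.\<close>

lemma aug_nat: "A \<in> F s \<Longrightarrow> \<exists>B\<in>nat_filt M W s. AE \<omega> in M. \<omega> \<in> A \<longleftrightarrow> \<omega> \<in> B"
  unfolding aug_filt_def
proof (induction rule: sigma_sets.induct)
  case (Basic a)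
  then show ?case
  proof
    assume "a \<in> null_sets M"
    then have "AE \<omega> in M. \<omega> \<in> a \<longleftrightarrow> \<omega> \<in> {}" using AE_not_in by fastforce
    then show ?thesis unfolding nat_filt_def by (blast intro: sigma_sets.Empty)
  qed (auto simp: nat_filt_def intro!: bexI[of _ a] sigma_sets.Basic)
next
  case Empty
  then show ?case unfolding nat_filt_def by (blast intro: sigma_sets.Empty)
next
  case (Compl a)
  then obtain B where "B \<in> nat_filt M W s" "AE \<omega> in M. \<omega> \<in> a \<longleftrightarrow> \<omega> \<in> B" by blast
  then show ?case
    by (intro bexI[of _ "space M - B"]) (auto simp: nat_filt_def intro: sigma_sets.Compl)
next
  case (Union a)
  have "\<forall>i. \<exists>B. B \<in> nat_filt M W s \<and> (AE \<omega> in M. \<omega> \<in> a i \<longleftrightarrow> \<omega> \<in> B)"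
    using Union.IH by blast
  from choice[OF this] obtain B where B: "\<And>i. B i \<in> nat_filt M W s" "\<And>i::nat. AE \<omega> in M. \<omega> \<in> a i \<longleftrightarrow> \<omega> \<in> B i"
    by blast
  then have "AE \<omega> in M. \<forall>i. \<omega> \<in> a i \<longleftrightarrow> \<omega> \<in> B i" by (simp add: AE_all_countable)
  then show ?case using B(1)
    by (intro bexI[of _ "\<Union>i. B i"]) (auto simp: nat_filt_def intro: sigma_sets.Union elim!: AE_mp)
qed

lemma nat_filt_sets: "nat_filt M W s \<subseteq> sets M"
  unfolding nat_filt_def by (intro sets.sigma_sets_subset) auto

lemma aug_indep:
  assumes "0 \<le> s" "s < t" "A \<in> F s" "B \<in> sets borel"
  shows "prob (A \<inter> ((\<lambda>\<omega>. W t \<omega> - W s \<omega>) -` B \<inter> space M)) =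
    prob A * prob ((\<lambda>\<omega>. W t \<omega> - W s \<omega>) -` B \<inter> space M)"
proof -
  let ?C = "(\<lambda>\<omega>. W t \<omega> - W s \<omega>) -` B \<inter> space M"
  have C: "?C \<in> sets M" using assms(4) by measurable
  obtain A' where A': "A' \<in> nat_filt M W s" "AE \<omega> in M. \<omega> \<in> A \<longleftrightarrow> \<omega> \<in> A'"
    using aug_nat[OF assms(3)] by blast
  have m: "A \<in> sets M" "A' \<in> sets M" using F_subset assms(3) nat_filt_sets A'(1) by auto
  have "indep_set (nat_filt M W s) {(\<lambda>\<omega>. W t \<omega> - W s \<omega>) -` A \<inter> space M | A. A \<in> sets borel}"
    using BM assms(1,2) by (auto simp: std_BM_def)
  then have "prob (A' \<inter> ?C) = prob A' * prob ?C"
    using A'(1) assms(4) by (intro indep_setD) auto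
  moreover have "prob (A \<inter> ?C) = prob (A' \<inter> ?C)" using A'(2) m C by (intro measure_eq_AE) auto
  moreover have "prob A = prob A'" using A'(2) m by (intro measure_eq_AE) auto
  ultimately show ?thesis by simp
qed

lemma indep_incr:
  fixes U :: "'w \<Rightarrow> real"
  assumes st: "0 \<le> s" "s < t" and U: "U \<in> borel_measurable (FA s)" and \<Phi> [measurable]: "\<Phi> \<in> borel_measurable borel"
  shows "indep_var borel U borel (\<lambda>\<omega>. \<Phi> (W t \<omega> - W s \<omega>) :: real)"
proof -
  have Um [measurable]: "U \<in> borel_measurable M" using U by (rule FA_meas)
  \<comment> \<open>Preimages of a sigma-algebra already form a sigma-algebra, so independence may
    be tested on single preimages.\<close>
  have e1: "sigma_sets (space M) {U -` A \<inter> space M | A. A \<in> sets borel} = {U -` A \<inter> space M | A. A \<in> sets borel}"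
    using sets.sigma_sets_eq[of "vimage_algebra (space M) U borel"] by (simp add: sets_vimage_algebra2)
  let ?V = "\<lambda>\<omega>. \<Phi> (W t \<omega> - W s \<omega>)"
  have e2: "sigma_sets (space M) {?V -` A \<inter> space M | A. A \<in> sets borel} = {?V -` A \<inter> space M | A. A \<in> sets borel}"
    using sets.sigma_sets_eq[of "vimage_algebra (space M) ?V borel"] by (simp add: sets_vimage_algebra2)
  show ?thesis unfolding indep_var_eq e1 e2
  proof (intro conjI indep_setI)
    fix a b assume "a \<in> {U -` A \<inter> space M | A. A \<in> sets borel}" "b \<in> {?V -` A \<inter> space M | A. A \<in> sets borel}"
    then obtain A B where A: "A \<in> sets borel" "a = U -` A \<inter> space M" and B: "B \<in> sets borel" "b = ?V -` B \<inter> space M"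
      by auto
    have "a \<in> F s" using measurable_sets[OF U A(1)] A(2) by (simp add: sets_FA)
    moreover have "b = (\<lambda>\<omega>. W t \<omega> - W s \<omega>) -` (\<Phi> -` B) \<inter> space M" using B by auto
    moreover have "\<Phi> -` B \<in> sets borel" using measurable_sets[OF \<Phi> B(1)] by simp
    ultimately show "prob (a \<inter> b) = prob a * prob b" using aug_indep[OF st] by simp
  qed auto
qed

lemma indep_incr_integral:
  fixes U :: "'w \<Rightarrow> real"
  assumes st: "0 \<le> s" "s < t" and U: "U \<in> borel_measurable (FA s)" "integrable M U"
    and \<Phi>: "\<Phi> \<in> borel_measurable borel" "integrable M (\<lambda>\<omega>. \<Phi> (W t \<omega> - W s \<omega>))"
  shows "integrable M (\<lambda>\<omega>. U \<omega> * \<Phi> (W t \<omega> - W s \<omega>))"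
    and "(\<integral>\<omega>. U \<omega> * \<Phi> (W t \<omega> - W s \<omega>) \<partial>M) = (\<integral>\<omega>. U \<omega> \<partial>M) * (\<integral>\<omega>. \<Phi> (W t \<omega> - W s \<omega>) \<partial>M)"
  using indep_var_integrable[OF indep_incr[OF st U(1) \<Phi>(1)] U(2) \<Phi>(2)]
    indep_var_lebesgue_integral[OF indep_incr[OF st U(1) \<Phi>(1)] U(2) \<Phi>(2)] by auto

text \<open>The fourth moment controls the cubic remainder of the Taylor expansion in
  \<open>yw_step\<close>.\<close>

lemma incr_moments:
  assumes st: "0 \<le> s" "s < t"
  shows "integrable M (\<lambda>\<omega>. ((W t \<omega> - W s \<omega>) $ i) ^ k)"
    and "(\<integral>\<omega>. (W t \<omega> - W s \<omega>) $ i \<partial>M) = 0"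
    and "(\<integral>\<omega>. ((W t \<omega> - W s \<omega>) $ i)\<^sup>2 \<partial>M) = t - s"
    and "(\<integral>\<omega>. ((W t \<omega> - W s \<omega>) $ i) ^ 4 \<partial>M) = 3 * (t - s)\<^sup>2"
proof -
  let ?s = "sqrt (t - s)"
  have D: "distributed M lborel (\<lambda>\<omega>. (W t \<omega> - W s \<omega>) $ i) (normal_density 0 ?s)"
    using BM st by (auto simp: std_BM_def)
  have p: "?s > 0" using st by simp
  show "integrable M (\<lambda>\<omega>. ((W t \<omega> - W s \<omega>) $ i) ^ k)"
    using distributed_integrable[OF D, of "\<lambda>x. x ^ k"] integrable_normal_moment[OF p, of 0 k] by simp
  have m: "(\<integral>\<omega>. ((W t \<omega> - W s \<omega>) $ i) ^ (2 * k) \<partial>M) = fact (2 * k) / ((2 / ?s\<^sup>2)^k * fact k)" for k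
    using distributed_integral[OF D, of "\<lambda>x. x ^ (2 * k)"] integral_normal_moment_even[OF p, of 0 k] by simp
  show "(\<integral>\<omega>. (W t \<omega> - W s \<omega>) $ i \<partial>M) = 0"
    using normal_distributed_expectation[OF p D] .
  show "(\<integral>\<omega>. ((W t \<omega> - W s \<omega>) $ i)\<^sup>2 \<partial>M) = t - s" using m[of 1] st by simp
  show "(\<integral>\<omega>. ((W t \<omega> - W s \<omega>) $ i) ^ 4 \<partial>M) = 3 * (t - s)\<^sup>2" using m[of 2] st
    by (simp add: fact_numeral power2_eq_square divide_simps)
qed

lemma incr_cross:
  assumes st: "0 \<le> s" "s < t"
  shows "integrable M (\<lambda>\<omega>. (W t \<omega> - W s \<omega>) $ i * (W t \<omega> - W s \<omega>) $ j)"
    and "(\<integral>\<omega>. (W t \<omega> - W s \<omega>) $ i * (W t \<omega> - W s \<omega>) $ j \<partial>M) = (if i = j then t - s else 0)"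
proof -
  have *: "integrable M (\<lambda>\<omega>. (W t \<omega> - W s \<omega>) $ i * (W t \<omega> - W s \<omega>) $ j) \<and>
    (\<integral>\<omega>. (W t \<omega> - W s \<omega>) $ i * (W t \<omega> - W s \<omega>) $ j \<partial>M) = (if i = j then t - s else 0)"
  proof (cases "i = j")
    case True
    then show ?thesis using incr_moments(1)[OF st, of i 2] incr_moments(3)[OF st, of i] by (simp add: power2_eq_square)
  next
    case False
    have "indep_vars (\<lambda>_. borel) (\<lambda>i \<omega>. (W t \<omega> - W s \<omega>) $ i) UNIV"
      using BM st by (auto simp: std_BM_def)
    then have I: "indep_vars (\<lambda>_. borel) (\<lambda>i \<omega>. (W t \<omega> - W s \<omega>) $ i) {i, j}"
      by (rule indep_vars_subset) auto
    have i1: "integrable M (\<lambda>\<omega>. (W t \<omega> - W s \<omega>) $ i)" for i using incr_moments(1)[OF st, of i 1] by simp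
    show ?thesis using indep_vars_lebesgue_integral[OF _ I i1] indep_vars_integrable[OF _ I i1] False
      using incr_moments(2)[OF st, of i] by simp
  qed
  then show "integrable M (\<lambda>\<omega>. (W t \<omega> - W s \<omega>) $ i * (W t \<omega> - W s \<omega>) $ j)"
    and "(\<integral>\<omega>. (W t \<omega> - W s \<omega>) $ i * (W t \<omega> - W s \<omega>) $ j \<partial>M) = (if i = j then t - s else 0)" by auto
qed

lemma incr_mean_zero:
  fixes U :: "'w \<Rightarrow> real^'d"
  assumes st: "0 \<le> s" "s < t" and U: "\<And>j. (\<lambda>\<omega>. U \<omega> $ j) \<in> borel_measurable (FA s)" "\<And>j. integrable M (\<lambda>\<omega>. U \<omega> $ j)"
  shows "integrable M (\<lambda>\<omega>. U \<omega> \<bullet> (W t \<omega> - W s \<omega>))" "(\<integral>\<omega>. U \<omega> \<bullet> (W t \<omega> - W s \<omega>) \<partial>M) = 0"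
proof -
  have [measurable]: "(\<lambda>x::real^'d. x $ j) \<in> borel_measurable borel" for j
    by (intro borel_measurable_continuous_onI continuous_intros)
  have *: "integrable M (\<lambda>\<omega>. U \<omega> $ j * (W t \<omega> - W s \<omega>) $ j)" "(\<integral>\<omega>. U \<omega> $ j * (W t \<omega> - W s \<omega>) $ j \<partial>M) = 0" for j
    using indep_incr_integral[OF st U(1) U(2), of "\<lambda>x. x $ j"] incr_moments(1)[OF st, of j 1] incr_moments(2)[OF st, of j]
    by auto
  show "integrable M (\<lambda>\<omega>. U \<omega> \<bullet> (W t \<omega> - W s \<omega>))" "(\<integral>\<omega>. U \<omega> \<bullet> (W t \<omega> - W s \<omega>) \<partial>M) = 0"
    unfolding inner_vec_def using * by (auto simp: Bochner_Integration.integral_sum)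
qed

text \<open>With \<open>U = 1\<close> this is the isometry on one step; the weight is there for
  \<open>yw2 \<epsilon>\<close> evaluated at the error at time \<open>s\<close>.\<close>

lemma incr_second_moment:
  fixes U :: "'w \<Rightarrow> real" and V :: "'w \<Rightarrow> real^'d"
  assumes st: "0 \<le> s" "s < t"
    and U: "U \<in> borel_measurable (FA s)" "\<And>j. (\<lambda>\<omega>. V \<omega> $ j) \<in> borel_measurable (FA s)"
    and I: "\<And>j l. integrable M (\<lambda>\<omega>. U \<omega> * (V \<omega> $ j * V \<omega> $ l))"
  shows "integrable M (\<lambda>\<omega>. U \<omega> * (V \<omega> \<bullet> (W t \<omega> - W s \<omega>))\<^sup>2)"
    "(\<integral>\<omega>. U \<omega> * (V \<omega> \<bullet> (W t \<omega> - W s \<omega>))\<^sup>2 \<partial>M) = (t - s) * (\<integral>\<omega>. U \<omega> * (norm (V \<omega>))\<^sup>2 \<partial>M)"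
proof -
  have [measurable]: "(\<lambda>x::real^'d. x $ j) \<in> borel_measurable borel" for j
    by (intro borel_measurable_continuous_onI continuous_intros)
  let ?D = "\<lambda>\<omega>. W t \<omega> - W s \<omega>"
  have m: "(\<lambda>\<omega>. U \<omega> * (V \<omega> $ j * V \<omega> $ l)) \<in> borel_measurable (FA s)" for j l
    by (intro borel_measurable_times U)
  have *: "integrable M (\<lambda>\<omega>. (U \<omega> * (V \<omega> $ j * V \<omega> $ l)) * (?D \<omega> $ j * ?D \<omega> $ l))"
    "(\<integral>\<omega>. (U \<omega> * (V \<omega> $ j * V \<omega> $ l)) * (?D \<omega> $ j * ?D \<omega> $ l) \<partial>M) = (if j = l then (t - s) * (\<integral>\<omega>. U \<omega> * (V \<omega> $ j)\<^sup>2 \<partial>M) else 0)" for j l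
    using indep_incr_integral[OF st m I, of "\<lambda>x. x $ j * x $ l"] incr_cross[OF st, of j l]
    by (auto simp: power2_eq_square)
  \<comment> \<open>In this double sum every term is a factor known at time \<open>s\<close> times a
    function of the increment, so independence applies termwise, and \<open>incr_cross\<close>
    removes the terms off the diagonal.\<close>
  have "u * (v \<bullet> w)\<^sup>2 = (\<Sum>j\<in>UNIV. \<Sum>l\<in>UNIV. (u * (v $ j * v $ l)) * (w $ j * w $ l))" for u and v w :: "real^'d"
    unfolding inner_vec_def power2_eq_square sum_product sum_distrib_left sum_distrib_right by (intro sum.cong refl) (simp add: mult_ac sum_distrib_left)
  note e = this[of "U _" "V _" "?D _"]
  show "integrable M (\<lambda>\<omega>. U \<omega> * (V \<omega> \<bullet> ?D \<omega>)\<^sup>2)" unfolding e using * by auto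
  have "(\<integral>\<omega>. U \<omega> * (V \<omega> \<bullet> ?D \<omega>)\<^sup>2 \<partial>M) = (\<Sum>j\<in>UNIV. \<Sum>l\<in>UNIV. (if j = l then (t - s) * (\<integral>\<omega>. U \<omega> * (V \<omega> $ j)\<^sup>2 \<partial>M) else 0))"
    unfolding e by (simp only: Bochner_Integration.integral_sum Bochner_Integration.integrable_sum *)
  also have "\<dots> = (t - s) * (\<Sum>j\<in>UNIV. \<integral>\<omega>. U \<omega> * (V \<omega> $ j)\<^sup>2 \<partial>M)" by (simp add: sum_distrib_left)
  also have "(\<Sum>j\<in>UNIV. \<integral>\<omega>. U \<omega> * (V \<omega> $ j)\<^sup>2 \<partial>M) = (\<integral>\<omega>. (\<Sum>j\<in>UNIV. U \<omega> * (V \<omega> $ j)\<^sup>2) \<partial>M)"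
    using I by (intro Bochner_Integration.integral_sum[symmetric]) (simp add: power2_eq_square)
  also have "\<dots> = (\<integral>\<omega>. U \<omega> * (norm (V \<omega>))\<^sup>2 \<partial>M)"
    by (simp add: norm_vec_sq sum_distrib_left)
  finally show "(\<integral>\<omega>. U \<omega> * (V \<omega> \<bullet> ?D \<omega>)\<^sup>2 \<partial>M) = (t - s) * (\<integral>\<omega>. U \<omega> * (norm (V \<omega>))\<^sup>2 \<partial>M)" .
qed

end

section \<open>The Ito integral\<close>

lemma L2_sum: "(\<And>i. i \<in> I \<Longrightarrow> L2 M (X i)) \<Longrightarrow> L2 M (\<lambda>\<omega>. \<Sum>i\<in>I. X i \<omega>)"
proof (induction I rule: infinite_finite_induct)
  case (insert i I)
  then show ?case using L2_add[of M "X i" "\<lambda>\<omega>. \<Sum>i\<in>I. X i \<omega>"] by simp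
qed (auto simp: L2_def)

lemma L2_scaleR: "L2 M X \<Longrightarrow> L2 M (\<lambda>\<omega>. c *\<^sub>R X \<omega>)"
  unfolding L2_iff by (auto simp: power_mult_distrib)

lemma L2_cong: "L2 M X \<Longrightarrow> (\<And>\<omega>. \<omega> \<in> space M \<Longrightarrow> X \<omega> = Y \<omega>) \<Longrightarrow> L2 M Y"
  unfolding L2_def using measurable_cong[of M X Y borel] nn_integral_cong[of M "\<lambda>\<omega>. nsq (X \<omega>)" "\<lambda>\<omega>. nsq (Y \<omega>)"]
  by simp

lemma L2_nn_integral:
  "L2 M X \<Longrightarrow> (\<integral>\<^sup>+\<omega>. nsq (X \<omega>) \<partial>M) = ennreal (\<integral>\<omega>. (norm (X \<omega>))\<^sup>2 \<partial>M)"
  by (rule nn_integral_eq_integral) (auto simp: L2_iff)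

lemma borel_measurable_matrix_vector_mult [measurable (raw)]:
  fixes A :: "'w \<Rightarrow> real^'d^'k" and w :: "'w \<Rightarrow> real^'d"
  assumes "A \<in> borel_measurable M" "w \<in> borel_measurable M"
  shows "(\<lambda>\<omega>. A \<omega> *v w \<omega>) \<in> borel_measurable M"
proof (rule borel_measurable_continuous_Pair[OF assms, of "\<lambda>A w. A *v w"])
  have "continuous_on UNIV (\<lambda>x::(real^'d^'k) \<times> (real^'d). \<chi> i. fst x $ i \<bullet> snd x)"
    by (intro continuous_on_vec_lambda continuous_on_inner continuous_on_component continuous_on_fst continuous_on_snd continuous_on_id)
  then show "continuous_on UNIV (\<lambda>x::(real^'d^'k) \<times> (real^'d). fst x *v snd x)"
    by (simp add: matrix_vector_mult_def inner_vec_def)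
qed

lemma matrix_vector_nth: "(A *v w) $ i = (A $ i) \<bullet> (w :: real^'d)"
  by (simp add: matrix_vector_mult_def inner_vec_def)

lemma matrix_vector_mult_sum:
  fixes w :: "real^'d"
  shows "(\<Sum>i\<in>I. A i :: real^'d^'k) *v w = (\<Sum>i\<in>I. A i *v w)"
  by (induction I rule: infinite_finite_induct) (auto simp: matrix_vector_mult_add_rdistrib)

context brownian
begin

section \<open>Jointly measurable processes and expected time integrals\<close>

abbreviation "lT \<equiv> restrict_space lborel {0..T}"

definition joint_meas :: "(real \<Rightarrow> 'w \<Rightarrow> 'b::topological_space) \<Rightarrow> bool" where
  "joint_meas X \<longleftrightarrow> (\<lambda>(s, \<omega>). X s \<omega>) \<in> borel_measurable (lT \<Otimes>\<^sub>M M)"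

text \<open>For \<open>g\<close> the squared norm of a process, this is the squared norm in the
  space of integrands over \<open>{s..t}\<close>, in the order of integration used by
  \<open>is_ito_integral\<close>. Values in \<open>ennreal\<close> avoid integrability obligations;
  \<open>EI_swap\<close> provides the other order, through which moment bounds at fixed times
  enter.\<close>

definition EI :: "real \<Rightarrow> real \<Rightarrow> (real \<Rightarrow> 'w \<Rightarrow> ennreal) \<Rightarrow> ennreal" where
  "EI s t g = (\<integral>\<^sup>+\<omega>. (\<integral>\<^sup>+r\<in>{s..t}. g r \<omega> \<partial>lborel) \<partial>M)"

lemma sigma_finite_lT: "sigma_finite_measure lT"
  by (intro sigma_finite_measure_restrict_space) (auto simp: lborel.sigma_finite_measure_axioms)

lemma inner_lT:
  assumes "0 \<le> s" "t \<le> T"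
  shows "(\<integral>\<^sup>+r\<in>{s..t}. h r \<partial>lborel) = (\<integral>\<^sup>+r. h r * indicator {s..t} r \<partial>lT)"
  unfolding nn_integral_restrict_space[of "{0..T}" lborel, simplified]
  using assms by (intro nn_integral_cong) (auto simp: indicator_def)

lemma joint_meas_section: "joint_meas X \<Longrightarrow> t \<in> {0..T} \<Longrightarrow> X t \<in> borel_measurable M"
  unfolding joint_meas_def using measurable_compose[OF measurable_Pair1'[of t lT M], of "\<lambda>(s, \<omega>). X s \<omega>" borel]
  by (simp add: space_restrict_space)

lemma joint_meas_path: "joint_meas X \<Longrightarrow> \<omega> \<in> space M \<Longrightarrow> (\<lambda>r. X r \<omega>) \<in> borel_measurable lT"
  unfolding joint_meas_def using measurable_compose[OF measurable_Pair2'[of \<omega> M lT], of "\<lambda>(s, \<omega>). X s \<omega>" borel] by simp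

lemma indicator_lT: "(\<lambda>r. indicator {s..t} r :: ennreal) \<in> borel_measurable lT"
  by (rule measurable_restrict_space1) auto

text \<open>Paths are measurable only over \<open>{0..T}\<close>; the indicator extends them by 0 to
  the whole line.\<close>

lemma joint_meas_path_indicator:
  fixes g :: "real \<Rightarrow> 'w \<Rightarrow> ennreal"
  assumes "joint_meas g" "\<omega> \<in> space M" "0 \<le> s" "t \<le> T"
  shows "(\<lambda>r. g r \<omega> * indicator {s..t} r) \<in> borel_measurable lborel"
proof -
  have "(\<lambda>r. g r \<omega> * indicator {s..t} r) \<in> borel_measurable lT"
    using joint_meas_path[OF assms(1,2)] by (intro borel_measurable_times_ennreal indicator_lT)
  then have "(\<lambda>r. g r \<omega> * indicator {s..t} r * indicator {0..T} r) \<in> borel_measurable lborel"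
    using borel_measurable_restrict_space_iff_ennreal[of "{0..T}" lborel] by simp
  also have "(\<lambda>r. g r \<omega> * indicator {s..t} r * indicator {0..T} r) = (\<lambda>r. g r \<omega> * indicator {s..t} r)"
    using assms by (auto simp: indicator_def fun_eq_iff)
  finally show ?thesis .
qed

lemma joint_meas_swap:
  fixes g :: "real \<Rightarrow> 'w \<Rightarrow> ennreal"
  assumes "joint_meas g"
  shows "(\<lambda>(\<omega>, r). g r \<omega> * indicator {s..t} r) \<in> borel_measurable (M \<Otimes>\<^sub>M lT)"
proof -
  have "(\<lambda>(r, \<omega>). g r \<omega> * indicator {s..t} r) \<in> borel_measurable (lT \<Otimes>\<^sub>M M)"
  proof -
    have "(\<lambda>x. indicator {s..t} (fst x) :: ennreal) \<in> borel_measurable (lT \<Otimes>\<^sub>M M)"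
      by (rule measurable_compose[OF measurable_fst indicator_lT])
    then show ?thesis using assms unfolding joint_meas_def by (auto simp: split_beta')
  qed
  from measurable_pair_swap[OF this] show ?thesis by (simp add: split_beta')
qed

lemma EI_inner_measurable:
  assumes "joint_meas g" "0 \<le> s" "t \<le> T"
  shows "(\<lambda>\<omega>. \<integral>\<^sup>+r\<in>{s..t}. g r \<omega> \<partial>lborel) \<in> borel_measurable M"
  unfolding inner_lT[OF assms(2,3)]
  using sigma_finite_measure.borel_measurable_nn_integral[OF sigma_finite_lT joint_meas_swap[OF assms(1)]] .

lemma EI_swap:
  assumes "joint_meas g" "0 \<le> s" "t \<le> T"
  shows "EI s t g = (\<integral>\<^sup>+r\<in>{s..t}. (\<integral>\<^sup>+\<omega>. g r \<omega> \<partial>M) \<partial>lborel)"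
proof -
  interpret P: pair_sigma_finite M lT
    using sigma_finite_lT prob_space_axioms by (auto intro!: pair_sigma_finite.intro prob_space_imp_sigma_finite)
  have "EI s t g = (\<integral>\<^sup>+r. (\<integral>\<^sup>+\<omega>. g r \<omega> * indicator {s..t} r \<partial>M) \<partial>lT)"
    unfolding EI_def inner_lT[OF assms(2,3)] using P.Fubini'[OF joint_meas_swap[OF assms(1)]] by simp
  also have "\<dots> = (\<integral>\<^sup>+r. (\<integral>\<^sup>+\<omega>. g r \<omega> \<partial>M) * indicator {s..t} r \<partial>lT)"
    by (intro nn_integral_cong) (auto simp: indicator_def)
  finally show ?thesis by (simp add: inner_lT[OF assms(2,3)])
qed

lemma EI_mono:
  "(\<And>r \<omega>. s \<le> r \<Longrightarrow> r \<le> t \<Longrightarrow> \<omega> \<in> space M \<Longrightarrow> g r \<omega> \<le> g' r \<omega>) \<Longrightarrow> EI s t g \<le> EI s t g'"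
  unfolding EI_def by (intro nn_integral_mono) (auto simp: indicator_def)

lemma EI_add:
  assumes "joint_meas g" "joint_meas g'" "0 \<le> s" "t \<le> T"
  shows "EI s t (\<lambda>r \<omega>. g r \<omega> + g' r \<omega>) = EI s t g + EI s t g'"
proof -
  have "EI s t (\<lambda>r \<omega>. g r \<omega> + g' r \<omega>) =
    (\<integral>\<^sup>+\<omega>. (\<integral>\<^sup>+r. g r \<omega> * indicator {s..t} r + g' r \<omega> * indicator {s..t} r \<partial>lborel) \<partial>M)"
    unfolding EI_def by (simp add: distrib_right)
  also have "\<dots> = (\<integral>\<^sup>+\<omega>. (\<integral>\<^sup>+r\<in>{s..t}. g r \<omega> \<partial>lborel) + (\<integral>\<^sup>+r\<in>{s..t}. g' r \<omega> \<partial>lborel) \<partial>M)"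
    using joint_meas_path_indicator[OF assms(1) _ assms(3,4)] joint_meas_path_indicator[OF assms(2) _ assms(3,4)]
    by (intro nn_integral_cong nn_integral_add) auto
  also have "\<dots> = EI s t g + EI s t g'"
    unfolding EI_def using EI_inner_measurable assms by (intro nn_integral_add) auto
  finally show ?thesis .
qed

lemma EI_cmult:
  assumes "joint_meas g" "0 \<le> s" "t \<le> T"
  shows "EI s t (\<lambda>r \<omega>. c * g r \<omega>) = c * EI s t g"
proof -
  have "EI s t (\<lambda>r \<omega>. c * g r \<omega>) = (\<integral>\<^sup>+\<omega>. c * (\<integral>\<^sup>+r\<in>{s..t}. g r \<omega> \<partial>lborel) \<partial>M)"
    unfolding EI_def using joint_meas_path_indicator[OF assms(1) _ assms(2,3)]
    by (intro nn_integral_cong) (simp add: mult.assoc nn_integral_cmult)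
  also have "\<dots> = c * EI s t g" unfolding EI_def using EI_inner_measurable assms by (intro nn_integral_cmult) auto
  finally show ?thesis .
qed

lemma EI_subset:
  assumes "s \<le> s'" "t' \<le> t" shows "EI s' t' g \<le> EI s t g"
  unfolding EI_def using assms by (intro nn_integral_mono) (auto simp: indicator_def)

lemma EI_split:
  assumes g: "joint_meas g" and "0 \<le> s" "s \<le> c" "c \<le> t" "t \<le> T"
  shows "EI s t g = EI s c g + EI c t g"
proof -
  have "(\<integral>\<^sup>+r\<in>{s..t}. g r \<omega> \<partial>lborel) = (\<integral>\<^sup>+r\<in>{s..c}. g r \<omega> \<partial>lborel) + (\<integral>\<^sup>+r\<in>{c..t}. g r \<omega> \<partial>lborel)" if "\<omega> \<in> space M" for \<omega>
  proof -
    have "(\<integral>\<^sup>+r\<in>{s..t}. g r \<omega> \<partial>lborel) = (\<integral>\<^sup>+r. g r \<omega> * indicator {s..c} r + g r \<omega> * indicator {c..t} r \<partial>lborel)"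
      using AE_lborel_singleton[of c] assms by (intro nn_integral_cong_AE) (auto elim!: eventually_mono simp: indicator_def)
    also have "\<dots> = (\<integral>\<^sup>+r\<in>{s..c}. g r \<omega> \<partial>lborel) + (\<integral>\<^sup>+r\<in>{c..t}. g r \<omega> \<partial>lborel)"
      using assms that by (intro nn_integral_add joint_meas_path_indicator) auto
    finally show ?thesis .
  qed
  then have "EI s t g = (\<integral>\<^sup>+\<omega>. (\<integral>\<^sup>+r\<in>{s..c}. g r \<omega> \<partial>lborel) + (\<integral>\<^sup>+r\<in>{c..t}. g r \<omega> \<partial>lborel) \<partial>M)"
    unfolding EI_def by (intro nn_integral_cong) auto
  then show ?thesis unfolding EI_def using assms by (simp add: nn_integral_add EI_inner_measurable)
qed

lemma EI_refl: "EI t t g = 0"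
proof -
  have "(\<integral>\<^sup>+r\<in>{t..t}. g r \<omega> \<partial>lborel) = 0" for \<omega>
    using AE_lborel_singleton[of t] by (intro nn_integral_0_iff_AE[THEN iffD2] nn_integral_zero') (auto elim!: eventually_mono simp: indicator_def)
  then show ?thesis unfolding EI_def by simp
qed

section \<open>Elementary integrands and the exact isometry\<close>

text \<open>
  \<open>Q\<close> contains the break points: between two of them the integrand \<open>G\<close> is frozen and \<open>S\<close> is its
  stochastic integral.
\<close>

definition elementary :: "real set \<Rightarrow> (real \<Rightarrow> 'w \<Rightarrow> real^'d^'k) \<Rightarrow> (real \<Rightarrow> 'w \<Rightarrow> real^'k) \<Rightarrow> bool" where
  "elementary Q G S \<longleftrightarrow> finite Q \<and> joint_meas G \<and>
    (\<forall>a\<in>{0..T}. G a \<in> borel_measurable (FA a) \<and> L2 M (G a) \<and> S a \<in> borel_measurable (FA a)) \<and>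
    (\<forall>a b. 0 \<le> a \<longrightarrow> a < b \<longrightarrow> b \<le> T \<longrightarrow> Q \<inter> {a<..<b} = {} \<longrightarrow>
      (\<forall>\<omega>\<in>space M. S b \<omega> - S a \<omega> = G a \<omega> *v (W b \<omega> - W a \<omega>) \<and> (\<forall>r\<in>{a..<b}. G r \<omega> = G a \<omega>)))"

lemma elementaryD:
  assumes "elementary Q G S"
  shows elementary_finite: "finite Q" and elementary_joint_meas: "joint_meas G"
    and elementary_FA: "a \<in> {0..T} \<Longrightarrow> G a \<in> borel_measurable (FA a)"
    and elementary_L2: "a \<in> {0..T} \<Longrightarrow> L2 M (G a)"
    and elementary_S_FA: "a \<in> {0..T} \<Longrightarrow> S a \<in> borel_measurable (FA a)"
  using assms unfolding elementary_def by blast+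

lemma elementary_step:
  assumes "elementary Q G S" "0 \<le> a" "a < b" "b \<le> T" "Q \<inter> {a<..<b} = {}" "\<omega> \<in> space M"
  shows "S b \<omega> - S a \<omega> = G a \<omega> *v (W b \<omega> - W a \<omega>)" "r \<in> {a..<b} \<Longrightarrow> G r \<omega> = G a \<omega>"
  using assms unfolding elementary_def by blast+

text \<open>Two approximations come with unrelated partitions. Joining the break points makes their
  difference elementary again, so that the isometry applies to it.\<close>

lemma elementary_diff:
  assumes "elementary Q G S" "elementary Q' G' S'"
  shows "elementary (Q \<union> Q') (\<lambda>r \<omega>. G r \<omega> - G' r \<omega>) (\<lambda>r \<omega>. S r \<omega> - S' r \<omega>)"
  unfolding elementary_def
proof (intro conjI allI impI ballI)
  show "finite (Q \<union> Q')" using assms by (simp add: elementary_finite)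
  show "joint_meas (\<lambda>r \<omega>. G r \<omega> - G' r \<omega>)"
    using borel_measurable_diff[OF elementary_joint_meas[OF assms(1), unfolded joint_meas_def] elementary_joint_meas[OF assms(2), unfolded joint_meas_def]]
    unfolding joint_meas_def by (simp add: split_beta')
next
  fix a assume a: "a \<in> {0..T}"
  show "(\<lambda>\<omega>. G a \<omega> - G' a \<omega>) \<in> borel_measurable (FA a)"
    by (rule borel_measurable_diff[OF elementary_FA[OF assms(1) a] elementary_FA[OF assms(2) a]])
  show "(\<lambda>\<omega>. S a \<omega> - S' a \<omega>) \<in> borel_measurable (FA a)"
    by (rule borel_measurable_diff[OF elementary_S_FA[OF assms(1) a] elementary_S_FA[OF assms(2) a]])
  show "L2 M (\<lambda>\<omega>. G a \<omega> - G' a \<omega>)"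
    by (rule L2_diff[OF elementary_L2[OF assms(1) a] elementary_L2[OF assms(2) a]])
next
  fix a b \<omega> assume *: "0 \<le> a" "a < b" "b \<le> T" "(Q \<union> Q') \<inter> {a<..<b} = {}" and \<omega>: "\<omega> \<in> space M"
  then have Q: "Q \<inter> {a<..<b} = {}" "Q' \<inter> {a<..<b} = {}" by blast+
  note e = elementary_step[OF assms(1) *(1-3) Q(1) \<omega>] elementary_step[OF assms(2) *(1-3) Q(2) \<omega>]
  show "S b \<omega> - S' b \<omega> - (S a \<omega> - S' a \<omega>) = (G a \<omega> - G' a \<omega>) *v (W b \<omega> - W a \<omega>)"
    unfolding matrix_vector_mult_diff_rdistrib e(1,3)[symmetric] by (simp add: algebra_simps)
  fix r assume "r \<in> {a..<b}"
  then show "G r \<omega> - G' r \<omega> = G a \<omega> - G' a \<omega>" by (simp only: e(2,4))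
qed

lemma simple_adapted_partition:
  assumes "simple_adapted M F T k p V"
  shows "i \<le> j \<Longrightarrow> j \<le> k \<Longrightarrow> p i \<le> p j" "i \<le> k \<Longrightarrow> 0 \<le> p i \<and> p i \<le> T"
proof -
  have *: "p i \<le> p j" if "i \<le> j" "j \<le> k" for i j
    using that
  proof (induction j)
    case (Suc j)
    then show ?case using assms unfolding simple_adapted_def by (cases "i = Suc j") (force simp: less_eq_Suc_le)+
  qed simp
  then show "i \<le> j \<Longrightarrow> j \<le> k \<Longrightarrow> p i \<le> p j" by blast
  show "i \<le> k \<Longrightarrow> 0 \<le> p i \<and> p i \<le> T" using *[of 0 i] *[of i k] assms unfolding simple_adapted_def by auto
qed

lemma elementary_simple:
  assumes A: "simple_adapted M F T k p V"
  shows "elementary (p ` {..k}) (simple_proc k p V) (simple_int W k p V)"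
  unfolding elementary_def
proof (intro conjI allI impI ballI)
  note p = simple_adapted_partition[OF A]
  have V: "V i \<in> borel_measurable (FA (p i))" "L2 M (V i)" if "i < k" for i
  proof -
    show 1: "V i \<in> borel_measurable (FA (p i))" using A that by (auto simp: simple_adapted_def)
    show "L2 M (V i)" unfolding L2_def using FA_meas[OF 1] A that by (auto simp: simple_adapted_def)
  qed
  show "finite (p ` {..k})" by simp
  show "joint_meas (simple_proc k p V)"
  proof -
    have "(\<lambda>x. \<Sum>i<k. indicat_real {p i..<p (Suc i)} (fst x) *\<^sub>R V i (snd x)) \<in> borel_measurable (lT \<Otimes>\<^sub>M M)"
    proof (intro borel_measurable_sum borel_measurable_scaleR)
      fix i assume "i \<in> {..<k}"
      then have "V i \<in> borel_measurable M" using V by (auto simp: L2_def)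
      then show "(\<lambda>x. V i (snd x)) \<in> borel_measurable (lT \<Otimes>\<^sub>M M)" by (rule measurable_compose[OF measurable_snd])
      show "(\<lambda>x. indicat_real {p i..<p (Suc i)} (fst x)) \<in> borel_measurable (lT \<Otimes>\<^sub>M M)"
        by (rule measurable_compose[OF measurable_fst], rule measurable_restrict_space1) auto
    qed
    then show ?thesis unfolding joint_meas_def simple_proc_def by (simp add: split_beta')
  qed
  fix a assume a: "a \<in> {0..T}"
  have e: "simple_proc k p V a = (\<lambda>\<omega>. \<Sum>i<k. indicat_real {p i..<p (Suc i)} a *\<^sub>R V i \<omega>)"
    by (simp add: simple_proc_def fun_eq_iff)
  show "simple_proc k p V a \<in> borel_measurable (FA a)" unfolding e
  proof (intro borel_measurable_sum)
    fix i assume i: "i \<in> {..<k}"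
    show "(\<lambda>\<omega>. indicat_real {p i..<p (Suc i)} a *\<^sub>R V i \<omega>) \<in> borel_measurable (FA a)"
      using FA_mono[OF _ V(1), of i a] i by (cases "p i \<le> a") (auto simp: indicator_def)
  qed
  show "L2 M (simple_proc k p V a)" unfolding e by (intro L2_sum L2_scaleR V) auto
  show "simple_int W k p V a \<in> borel_measurable (FA a)"
    unfolding simple_int_def[abs_def]
  proof (intro borel_measurable_sum)
    fix i assume i: "i \<in> {..<k}"
    show "(\<lambda>\<omega>. V i \<omega> *v (W (min a (p (Suc i))) \<omega> - W (min a (p i)) \<omega>)) \<in> borel_measurable (FA a)"
    proof (cases "p i \<le> a")
      case True
      then show ?thesis using i a p(2)[of i] p(2)[of "Suc i"]
        by (intro borel_measurable_matrix_vector_mult borel_measurable_diff W_FA FA_mono[OF _ V(1)]) auto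
    next
      case False
      \<comment> \<open>Before time \<open>p i\<close> both minima equal \<open>a\<close>, so the
        summand vanishes and \<open>V i\<close>, which need not be known yet, does not
        enter.\<close>
      then show ?thesis using i p(1)[of i "Suc i"] by (simp add: min_def)
    qed
  qed
next
  note p = simple_adapted_partition[OF A]
  fix a b \<omega> assume ab: "0 \<le> a" "a < b" "b \<le> T" and Q: "p ` {..k} \<inter> {a<..<b} = {}"
  \<comment> \<open>Every piece of the partition therefore contains all of \<open>{a..<b}\<close> or
    misses it.\<close>
  have Q': "p i \<le> a \<or> b \<le> p i" if "i \<le> k" for i using Q that by force
  show "simple_int W k p V b \<omega> - simple_int W k p V a \<omega> = simple_proc k p V a \<omega> *v (W b \<omega> - W a \<omega>)"
  proof -
    have "V i \<omega> *v (W (min b (p (Suc i))) \<omega> - W (min b (p i)) \<omega>) - V i \<omega> *v (W (min a (p (Suc i))) \<omega> - W (min a (p i)) \<omega>)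
      = (indicat_real {p i..<p (Suc i)} a *\<^sub>R V i \<omega>) *v (W b \<omega> - W a \<omega>)" if i: "i < k" for i
      using Q'[of i] Q'[of "Suc i"] p(1)[of i "Suc i"] ab i
      by (auto simp: min_def indicator_def matrix_vector_mult_diff_distrib)
    then show ?thesis unfolding simple_int_def simple_proc_def sum_subtractf[symmetric] matrix_vector_mult_sum
      by (intro sum.cong) auto
  qed
  fix r assume r: "r \<in> {a..<b}"
  show "simple_proc k p V r \<omega> = simple_proc k p V a \<omega>"
    unfolding simple_proc_def
  proof (intro sum.cong refl)
    fix i assume "i \<in> {..<k}"
    then show "indicat_real {p i..<p (Suc i)} r *\<^sub>R V i \<omega> = indicat_real {p i..<p (Suc i)} a *\<^sub>R V i \<omega>"
      using Q'[of i] Q'[of "Suc i"] r by (auto simp: indicator_def)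
  qed
qed

lemma elementary_piece_const:
  assumes e: "elementary Q G S" and ab: "0 \<le> a" "a < b" "b \<le> T" and Q: "Q \<inter> {a<..<b} = {}"
  shows "EI a b (\<lambda>r \<omega>. nsq (G r \<omega>)) = ennreal (b - a) * msq (G a)"
proof -
  have "(\<integral>\<^sup>+r\<in>{a..b}. nsq (G r \<omega>) \<partial>lborel) = ennreal (b - a) * nsq (G a \<omega>)"
    if \<omega>: "\<omega> \<in> space M" for \<omega>
  proof -
    have "(\<integral>\<^sup>+r\<in>{a..b}. nsq (G r \<omega>) \<partial>lborel) = (\<integral>\<^sup>+r\<in>{a..b}. nsq (G a \<omega>) \<partial>lborel)"
      \<comment> \<open>The integrand is frozen only on the half-open interval and may jump at
        \<open>b\<close>, a null set.\<close>
      using AE_lborel_singleton[of b]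
    proof (intro nn_integral_cong_AE, eventually_elim)
      fix r assume "r \<noteq> b"
      then show "nsq (G r \<omega>) * indicator {a..b} r = nsq (G a \<omega>) * indicator {a..b} r"
        using elementary_step(2)[OF e ab Q \<omega>, of r] by (cases "r \<in> {a..b}") auto
    qed
    also have "\<dots> = ennreal (b - a) * nsq (G a \<omega>)"
      using ab by (subst nn_integral_cmult_indicator) (auto simp: mult.commute)
    finally show ?thesis .
  qed
  then have "EI a b (\<lambda>r \<omega>. nsq (G r \<omega>)) = (\<integral>\<^sup>+\<omega>. ennreal (b - a) * nsq (G a \<omega>) \<partial>M)"
    unfolding EI_def by (intro nn_integral_cong) auto
  also have "\<dots> = ennreal (b - a) * msq (G a)"
    using L2_measurable[OF elementary_L2[OF e, of a]] ab by (intro nn_integral_cmult) auto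
  finally show ?thesis .
qed

text \<open>Isometry and orthogonality to the past on an interval where the integrand is frozen: the
  base case of \<open>elementary_main\<close>. The rows decouple, each being a case of
  \<open>incr_second_moment\<close>.\<close>

lemma matrix_incr:
  fixes V :: "'w \<Rightarrow> real^'d^'k"
  assumes st: "0 \<le> s" "s < t" and V: "V \<in> borel_measurable (FA s)" "L2 M V"
  shows "L2 M (\<lambda>\<omega>. V \<omega> *v (W t \<omega> - W s \<omega>))"
    and "msq (\<lambda>\<omega>. V \<omega> *v (W t \<omega> - W s \<omega>)) = ennreal (t - s) * msq V"
    and "A \<in> borel_measurable (FA s) \<Longrightarrow> L2 M A \<Longrightarrow> (\<integral>\<omega>. A \<omega> * (V \<omega> *v (W t \<omega> - W s \<omega>)) $ i \<partial>M) = 0"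
proof -
  let ?D = "\<lambda>\<omega>. W t \<omega> - W s \<omega>"
  have Vij: "(\<lambda>\<omega>. V \<omega> $ i $ j) \<in> borel_measurable (FA s)" "L2 M (\<lambda>\<omega>. V \<omega> $ i $ j)" for i j
    by (intro measurable_vec_nth V) (intro L2_nth V)
  have r: "integrable M (\<lambda>\<omega>. (V \<omega> $ i \<bullet> ?D \<omega>)\<^sup>2)"
    "(\<integral>\<omega>. (V \<omega> $ i \<bullet> ?D \<omega>)\<^sup>2 \<partial>M) = (t - s) * (\<integral>\<omega>. (norm (V \<omega> $ i))\<^sup>2 \<partial>M)" for i
    using incr_second_moment[OF st, of "\<lambda>_. 1" "\<lambda>\<omega>. V \<omega> $ i"] L2_mult_integrable[OF Vij(2) Vij(2)] Vij(1) by auto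
  have n: "(norm (V \<omega> *v ?D \<omega>))\<^sup>2 = (\<Sum>i\<in>UNIV. (V \<omega> $ i \<bullet> ?D \<omega>)\<^sup>2)" for \<omega>
    by (simp add: norm_vec_sq matrix_vector_nth)
  have m: "(\<lambda>\<omega>. V \<omega> *v ?D \<omega>) \<in> borel_measurable M"
    using FA_meas[OF V(1)] by measurable
  show L: "L2 M (\<lambda>\<omega>. V \<omega> *v ?D \<omega>)" unfolding L2_iff n using m r(1) by (auto intro!: Bochner_Integration.integrable_sum)
  have "(\<integral>\<omega>. (norm (V \<omega> *v ?D \<omega>))\<^sup>2 \<partial>M) = (t - s) * (\<Sum>i\<in>UNIV. \<integral>\<omega>. (norm (V \<omega> $ i))\<^sup>2 \<partial>M)"
    unfolding n by (simp only: Bochner_Integration.integral_sum r sum_distrib_left)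
  also have "(\<Sum>i\<in>UNIV. \<integral>\<omega>. (norm (V \<omega> $ i))\<^sup>2 \<partial>M) = (\<integral>\<omega>. (norm (V \<omega>))\<^sup>2 \<partial>M)"
    unfolding norm_vec_sq[of "V _"] by (rule Bochner_Integration.integral_sum[symmetric]) (intro L2_integrable L2_nth V)
  finally show "msq (\<lambda>\<omega>. V \<omega> *v ?D \<omega>) = ennreal (t - s) * msq V"
    unfolding L2_nn_integral[OF L] L2_nn_integral[OF V(2)] using st by (simp add: ennreal_mult)
  assume A: "A \<in> borel_measurable (FA s)" "L2 M A"
  have "(\<integral>\<omega>. (A \<omega> *\<^sub>R V \<omega> $ i) \<bullet> ?D \<omega> \<partial>M) = 0"
  proof (rule incr_mean_zero[OF st])
    show "(\<lambda>\<omega>. (A \<omega> *\<^sub>R V \<omega> $ i) $ j) \<in> borel_measurable (FA s)" for j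
      using borel_measurable_times[OF A(1) Vij(1)] by simp
    show "integrable M (\<lambda>\<omega>. (A \<omega> *\<^sub>R V \<omega> $ i) $ j)" for j
      using L2_mult_integrable[OF A(2) Vij(2)] by simp
  qed
  then show "(\<integral>\<omega>. A \<omega> * (V \<omega> *v ?D \<omega>) $ i \<partial>M) = 0" by (simp add: matrix_vector_nth)
qed

text \<open>Pythagoras. Orthogonality is required in each component, which is the form in which it
  is available for stochastic increments.\<close>

lemma L2_sq_add_orth:
  fixes X Y :: "'w \<Rightarrow> real^'k"
  assumes X: "L2 M X" and Y: "L2 M Y" and o: "\<And>i. (\<integral>\<omega>. X \<omega> $ i * Y \<omega> $ i \<partial>M) = 0"
  shows "msq (\<lambda>\<omega>. X \<omega> + Y \<omega>) =
    msq X + msq Y"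
proof -
  have i: "integrable M (\<lambda>\<omega>. X \<omega> $ i * Y \<omega> $ i)" for i by (intro L2_mult_integrable L2_nth X Y)
  have i': "integrable M (\<lambda>\<omega>. X \<omega> \<bullet> Y \<omega>)" "(\<integral>\<omega>. X \<omega> \<bullet> Y \<omega> \<partial>M) = 0"
    unfolding inner_vec_def using i o by (simp_all add: Bochner_Integration.integral_sum)
  have "(\<integral>\<omega>. (norm (X \<omega> + Y \<omega>))\<^sup>2 \<partial>M) = (\<integral>\<omega>. (norm (X \<omega>))\<^sup>2 + (norm (Y \<omega>))\<^sup>2 + 2 * (X \<omega> \<bullet> Y \<omega>) \<partial>M)"
    by (intro Bochner_Integration.integral_cong) (simp_all add: power2_norm_eq_inner algebra_simps inner_commute)
  also have "\<dots> = (\<integral>\<omega>. (norm (X \<omega>))\<^sup>2 \<partial>M) + (\<integral>\<omega>. (norm (Y \<omega>))\<^sup>2 \<partial>M)"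
    using i' L2_integrable[OF X] L2_integrable[OF Y] by simp
  finally show ?thesis
    unfolding L2_nn_integral[OF X] L2_nn_integral[OF Y] L2_nn_integral[OF L2_add[OF X Y]] by simp
qed

text \<open>Induction on the number of break points strictly inside the interval: cutting at one of
  them leaves fewer on either side. Orthogonality to every square-integrable \<open>A\<close> known
  at time \<open>s\<close> is part of the induction, because it removes the cross term when the
  squared norms of the two halves are added.\<close>

lemma elementary_main:
  fixes G :: "real \<Rightarrow> 'w \<Rightarrow> real^'d^'k"
  assumes e: "elementary Q G S"
  shows "0 \<le> s \<Longrightarrow> s \<le> t \<Longrightarrow> t \<le> T \<Longrightarrow> L2 M (\<lambda>\<omega>. S t \<omega> - S s \<omega>) \<and>
    (\<forall>A i. A \<in> borel_measurable (FA s) \<longrightarrow> L2 M A \<longrightarrow> (\<integral>\<omega>. A \<omega> * (S t \<omega> - S s \<omega>) $ i \<partial>M) = 0) \<and>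
    msq (\<lambda>\<omega>. S t \<omega> - S s \<omega>) = EI s t (\<lambda>r \<omega>. nsq (G r \<omega>))"
proof (induction "card (Q \<inter> {s<..<t})" arbitrary: s t rule: less_induct)
  case less
  have fin: "finite Q" by (rule elementary_finite[OF e])
  have jmG: "joint_meas (\<lambda>r \<omega>. nsq (G r \<omega>))"
    using elementary_joint_meas[OF e] unfolding joint_meas_def by (auto simp: split_beta')
  consider "s = t" | "s < t" "Q \<inter> {s<..<t} = {}" | c where "c \<in> Q" "s < c" "c < t"
    using less.prems by force
  then show ?case
  proof cases
    case 1
    then show ?thesis by (simp add: EI_refl L2_const)
  next
    case 2
    note st = less.prems(1) 2(1)
    have s: "s \<in> {0..T}" using less.prems by simp
    note V = elementary_FA[OF e s] elementary_L2[OF e s]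
    note m = matrix_incr[OF st V]
    note E = elementary_step(1)[OF e st less.prems(3) 2(2)]
    have 1: "L2 M (\<lambda>\<omega>. S t \<omega> - S s \<omega>)" by (rule L2_cong[OF m(1)]) (simp add: E)
    have 2: "(\<integral>\<omega>. A \<omega> * (S t \<omega> - S s \<omega>) $ i \<partial>M) = 0" if "A \<in> borel_measurable (FA s)" "L2 M A" for A i
      unfolding m(3)[OF that, of i, symmetric] by (intro Bochner_Integration.integral_cong) (simp_all only: E)
    have 3: "msq (\<lambda>\<omega>. S t \<omega> - S s \<omega>) = msq (\<lambda>\<omega>. G s \<omega> *v (W t \<omega> - W s \<omega>))"
      by (intro nn_integral_cong) (simp only: E)
    show ?thesis using 1 2 unfolding 3 m(2) elementary_piece_const[OF e st less.prems(3) \<open>Q \<inter> {s<..<t} = {}\<close>] by blast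
  next
    case 3
    have c: "c \<in> {0..T}" "s \<in> {0..T}" using 3 less.prems by auto
    have "card (Q \<inter> {s<..<c}) < card (Q \<inter> {s<..<t})" "card (Q \<inter> {c<..<t}) < card (Q \<inter> {s<..<t})"
      using fin 3 by (intro psubset_card_mono; auto)+
    from less.hyps[OF this(1)] less.hyps[OF this(2)]
    have I1: "L2 M (\<lambda>\<omega>. S c \<omega> - S s \<omega>)" "\<And>A i. A \<in> borel_measurable (FA s) \<Longrightarrow> L2 M A \<Longrightarrow> (\<integral>\<omega>. A \<omega> * (S c \<omega> - S s \<omega>) $ i \<partial>M) = 0"
      "msq (\<lambda>\<omega>. S c \<omega> - S s \<omega>) = EI s c (\<lambda>r \<omega>. nsq (G r \<omega>))"
      and I2: "L2 M (\<lambda>\<omega>. S t \<omega> - S c \<omega>)" "\<And>A i. A \<in> borel_measurable (FA c) \<Longrightarrow> L2 M A \<Longrightarrow> (\<integral>\<omega>. A \<omega> * (S t \<omega> - S c \<omega>) $ i \<partial>M) = 0"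
      "msq (\<lambda>\<omega>. S t \<omega> - S c \<omega>) = EI c t (\<lambda>r \<omega>. nsq (G r \<omega>))"
      using less.prems 3 by auto
    have sum: "S t \<omega> - S s \<omega> = (S c \<omega> - S s \<omega>) + (S t \<omega> - S c \<omega>)" for \<omega> by simp
    have 1: "L2 M (\<lambda>\<omega>. S t \<omega> - S s \<omega>)" unfolding sum by (intro L2_add I1 I2)
    have 2: "(\<integral>\<omega>. A \<omega> * (S t \<omega> - S s \<omega>) $ i \<partial>M) = 0" if A: "A \<in> borel_measurable (FA s)" "L2 M A" for A i
    proof -
      have "A \<in> borel_measurable (FA c)" using FA_mono[OF _ A(1)] 3 by simp
      then have z: "(\<integral>\<omega>. A \<omega> * (S c \<omega> - S s \<omega>) $ i \<partial>M) = 0" "(\<integral>\<omega>. A \<omega> * (S t \<omega> - S c \<omega>) $ i \<partial>M) = 0"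
        using I1(2)[OF A] I2(2)[OF _ A(2)] by auto
      have "(\<integral>\<omega>. A \<omega> * (S t \<omega> - S s \<omega>) $ i \<partial>M) = (\<integral>\<omega>. A \<omega> * (S c \<omega> - S s \<omega>) $ i + A \<omega> * (S t \<omega> - S c \<omega>) $ i \<partial>M)"
        by (intro Bochner_Integration.integral_cong) (simp_all add: algebra_simps)
      also have "\<dots> = 0" unfolding Bochner_Integration.integral_add[OF L2_mult_integrable[OF A(2) L2_nth[OF I1(1)]] L2_mult_integrable[OF A(2) L2_nth[OF I2(1)]]]
        using z by simp
      finally show ?thesis .
    qed
    have "msq (\<lambda>\<omega>. S t \<omega> - S s \<omega>) =
      EI s c (\<lambda>r \<omega>. nsq (G r \<omega>)) + EI c t (\<lambda>r \<omega>. nsq (G r \<omega>))"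
      unfolding sum I1(3)[symmetric] I2(3)[symmetric]
    proof (rule L2_sq_add_orth[OF I1(1) I2(1)])
      fix i
      \<comment> \<open>The left increment is itself known at time \<open>c\<close>, so its
        components can play the role of \<open>A\<close> for the right half.\<close>
      have "(\<lambda>\<omega>. S c \<omega> - S s \<omega>) \<in> borel_measurable (FA c)"
        using FA_mono[OF _ elementary_S_FA[OF e c(2)], of c] 3 elementary_S_FA[OF e c(1)] by (intro borel_measurable_diff) auto
      then show "(\<integral>\<omega>. (S c \<omega> - S s \<omega>) $ i * (S t \<omega> - S c \<omega>) $ i \<partial>M) = 0"
        by (intro I2(2) measurable_vec_nth L2_nth[OF I1(1)])
    qed
    also have "\<dots> = EI s t (\<lambda>r \<omega>. nsq (G r \<omega>))"
      using 3 less.prems by (intro EI_split[symmetric] jmG) auto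
    finally show ?thesis using 1 2 by blast
  qed
qed

text \<open>The isometry for limits, weakened to an inequality. Each integral has its own
  approximating sequence, so integrals and integrands are both replaced by elementary ones through a
  squared triangle inequality. Each replacement costs a factor 2, which explains the 4; only the
  order of magnitude matters later.\<close>

lemma ito_diff:
  fixes H H' :: "real \<Rightarrow> 'w \<Rightarrow> real^'d^'k"
  assumes I: "is_ito_integral M W F T H I" "is_ito_integral M W F T H' I'"
    and joint_meas: "joint_meas H" "joint_meas H'"
    and st: "0 \<le> s" "s \<le> t" "t \<le> T"
    and m: "I s \<in> borel_measurable M" "I t \<in> borel_measurable M" "I' s \<in> borel_measurable M" "I' t \<in> borel_measurable M"
  shows "msq (\<lambda>\<omega>. (I t \<omega> - I s \<omega>) - (I' t \<omega> - I' s \<omega>)) \<le>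
    4 * EI s t (\<lambda>r \<omega>. nsq (H r \<omega> - H' r \<omega>))"
proof -
  obtain k p V where V: "\<And>n. simple_adapted M F T (k n) (p n) (V n)"
    "(\<lambda>n. EI 0 T (\<lambda>s \<omega>. nsq (simple_proc (k n) (p n) (V n) s \<omega> - H s \<omega>))) \<longlonglongrightarrow> 0"
    "\<And>t. t \<in> {0..T} \<Longrightarrow> (\<lambda>n. \<integral>\<^sup>+\<omega>. nsq (I t \<omega> - simple_int W (k n) (p n) (V n) t \<omega>) \<partial>M) \<longlonglongrightarrow> 0"
    using I(1) unfolding is_ito_integral_def EI_def by blast
  obtain k' p' V' where V': "\<And>n. simple_adapted M F T (k' n) (p' n) (V' n)"
    "(\<lambda>n. EI 0 T (\<lambda>s \<omega>. nsq (simple_proc (k' n) (p' n) (V' n) s \<omega> - H' s \<omega>))) \<longlonglongrightarrow> 0"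
    "\<And>t. t \<in> {0..T} \<Longrightarrow> (\<lambda>n. \<integral>\<^sup>+\<omega>. nsq (I' t \<omega> - simple_int W (k' n) (p' n) (V' n) t \<omega>) \<partial>M) \<longlonglongrightarrow> 0"
    using I(2) unfolding is_ito_integral_def EI_def by blast
  define G where "G n = simple_proc (k n) (p n) (V n)" for n
  define S where "S n = simple_int W (k n) (p n) (V n)" for n
  define G' where "G' n = simple_proc (k' n) (p' n) (V' n)" for n
  define S' where "S' n = simple_int W (k' n) (p' n) (V' n)" for n
  note e = elementary_simple[OF V(1), folded G_def S_def] and e' = elementary_simple[OF V'(1), folded G'_def S'_def]
  note lim = V(2,3)[folded G_def S_def] and lim' = V'(2,3)[folded G'_def S'_def]
  have s01: "s \<in> {0..T}" "t \<in> {0..T}" using st by auto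
  have Sm: "S n r \<in> borel_measurable M" "S' n r \<in> borel_measurable M" if "r \<in> {0..T}" for n r
    using FA_meas[OF elementary_S_FA[OF e that]] FA_meas[OF elementary_S_FA[OF e' that]] by auto
  define er where "er n r = msq (\<lambda>\<omega>. I r \<omega> - S n r \<omega>)" for n r
  define er' where "er' n r = msq (\<lambda>\<omega>. I' r \<omega> - S' n r \<omega>)" for n r
  define pr where "pr n = EI 0 T (\<lambda>s \<omega>. nsq (G n s \<omega> - H s \<omega>))" for n
  define pr' where "pr' n = EI 0 T (\<lambda>s \<omega>. nsq (G' n s \<omega> - H' s \<omega>))" for n
  let ?L = "\<integral>\<^sup>+\<omega>. nsq ((I t \<omega> - I s \<omega>) - (I' t \<omega> - I' s \<omega>)) \<partial>M"
  let ?R = "EI s t (\<lambda>r \<omega>. nsq (H r \<omega> - H' r \<omega>))"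
  have jmd: "joint_meas (\<lambda>r \<omega>. nsq (X r \<omega> - Y r \<omega>))" if "joint_meas X" "joint_meas Y" for X Y :: "real \<Rightarrow> 'w \<Rightarrow> real^'d^'k"
    using that unfolding joint_meas_def by (auto simp: split_beta')
  \<comment> \<open>All terms but the first are approximation errors, which vanish as
    \<open>n\<close> grows.\<close>
  have bound: "?L \<le> 4 * ?R + (8 * pr n + 8 * pr' n + 8 * (er n t + er n s + er' n t + er' n s))" for n
  proof -
    let ?D = "\<lambda>\<omega>. (S n t \<omega> - S' n t \<omega>) - (S n s \<omega> - S' n s \<omega>)"
    have "msq (\<lambda>\<omega>. ?D \<omega>) = EI s t (\<lambda>r \<omega>. nsq (G n r \<omega> - G' n r \<omega>))"
      using elementary_main[OF elementary_diff[OF e e'] st] by blast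
    also have "\<dots> \<le> EI s t (\<lambda>r \<omega>. 2 * nsq (H r \<omega> - H' r \<omega>) + 4 * (nsq (G n r \<omega> - H r \<omega>) + nsq (G' n r \<omega> - H' r \<omega>)))"
    proof (rule EI_mono)
      fix r \<omega>
      have "(norm (G n r \<omega> - G' n r \<omega>))\<^sup>2 \<le> 2 * (norm (H r \<omega> - H' r \<omega>))\<^sup>2 + 4 * ((norm (G n r \<omega> - H r \<omega>))\<^sup>2 + (norm (G' n r \<omega> - H' r \<omega>))\<^sup>2)"
        using norm_sum_sq_le[of "H r \<omega> - H' r \<omega>" "(G n r \<omega> - H r \<omega>) + (H' r \<omega> - G' n r \<omega>)"]
          norm_sum_sq_le[of "G n r \<omega> - H r \<omega>" "H' r \<omega> - G' n r \<omega>"] norm_minus_commute[of "H' r \<omega>"]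
        by simp
      then have "nsq (G n r \<omega> - G' n r \<omega>) \<le> ennreal (2 * (norm (H r \<omega> - H' r \<omega>))\<^sup>2 + 4 * ((norm (G n r \<omega> - H r \<omega>))\<^sup>2 + (norm (G' n r \<omega> - H' r \<omega>))\<^sup>2))"
        by (rule ennreal_leI)
      then show "nsq (G n r \<omega> - G' n r \<omega>) \<le> 2 * nsq (H r \<omega> - H' r \<omega>) + 4 * (nsq (G n r \<omega> - H r \<omega>) + nsq (G' n r \<omega> - H' r \<omega>))"
        by (simp add: ennreal_mult)
    qed
    also have "\<dots> = 2 * ?R + 4 * (EI s t (\<lambda>r \<omega>. nsq (G n r \<omega> - H r \<omega>)) + EI s t (\<lambda>r \<omega>. nsq (G' n r \<omega> - H' r \<omega>)))"
    proof -
      note j = jmd[OF joint_meas] jmd[OF elementary_joint_meas[OF e] joint_meas(1)] jmd[OF elementary_joint_meas[OF e'] joint_meas(2)]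
      have j2: "joint_meas (\<lambda>r \<omega>. c * h r \<omega>)" if "joint_meas h" for c and h :: "real \<Rightarrow> 'w \<Rightarrow> ennreal"
        using that unfolding joint_meas_def by (auto simp: split_beta')
      have j3: "joint_meas (\<lambda>r \<omega>. h' r \<omega> + h r \<omega>)" if "joint_meas h" "joint_meas h'" for h h' :: "real \<Rightarrow> 'w \<Rightarrow> ennreal"
        using that unfolding joint_meas_def by (auto simp: split_beta')
      show ?thesis
        by (simp only: EI_add[OF j2[OF j(1)] j2[OF j3[OF j(3,2)]] st(1,3)] EI_cmult[OF j(1) st(1,3)]
            EI_cmult[OF j3[OF j(3,2)] st(1,3)] EI_add[OF j(2,3) st(1,3)])
    qed
    also have "\<dots> \<le> 2 * ?R + 4 * (pr n + pr' n)"
      unfolding pr_def pr'_def using st by (intro add_mono mult_left_mono EI_subset) auto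
    finally have core': "msq (\<lambda>\<omega>. ?D \<omega>) \<le> 2 * ?R + 4 * (pr n + pr' n)" .
    have "?L \<le> (\<integral>\<^sup>+\<omega>. 2 * nsq (?D \<omega>) + 8 * (nsq (I t \<omega> - S n t \<omega>) + nsq (I s \<omega> - S n s \<omega>)
        + nsq (I' t \<omega> - S' n t \<omega>) + nsq (I' s \<omega> - S' n s \<omega>)) \<partial>M)"
    proof (rule nn_integral_mono)
      fix \<omega>
      let ?a = "I t \<omega> - S n t \<omega>" and ?b = "I s \<omega> - S n s \<omega>" and ?c = "I' t \<omega> - S' n t \<omega>" and ?d = "I' s \<omega> - S' n s \<omega>"
      have eq: "(I t \<omega> - I s \<omega>) - (I' t \<omega> - I' s \<omega>) = ?D \<omega> + (?a + (- ?b) + (- ?c) + ?d)" by simp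
      have "(norm ((I t \<omega> - I s \<omega>) - (I' t \<omega> - I' s \<omega>)))\<^sup>2 \<le> 2 * (norm (?D \<omega>))\<^sup>2 + 8 * ((norm ?a)\<^sup>2 + (norm ?b)\<^sup>2 + (norm ?c)\<^sup>2 + (norm ?d)\<^sup>2)"
        unfolding eq using norm_sum_sq_le[of "?D \<omega>" "?a + (- ?b) + (- ?c) + ?d"] norm_sq_add4[of ?a "- ?b" "- ?c" ?d]
        unfolding norm_minus_cancel by linarith
      then have "nsq ((I t \<omega> - I s \<omega>) - (I' t \<omega> - I' s \<omega>)) \<le> ennreal (2 * (norm (?D \<omega>))\<^sup>2 + 8 * ((norm ?a)\<^sup>2 + (norm ?b)\<^sup>2 + (norm ?c)\<^sup>2 + (norm ?d)\<^sup>2))"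
        by (rule ennreal_leI)
      then show "nsq ((I t \<omega> - I s \<omega>) - (I' t \<omega> - I' s \<omega>)) \<le> 2 * nsq (?D \<omega>) + 8 * (nsq ?a + nsq ?b
        + nsq ?c + nsq ?d)"
        by (simp add: ennreal_mult)
    qed
    also have "\<dots> = 2 * msq (\<lambda>\<omega>. ?D \<omega>) + 8 * (er n t + er n s + er' n t + er' n s)"
    proof -
      note [measurable] = Sm[OF s01(1)] Sm[OF s01(2)] m
      show ?thesis unfolding er_def er'_def by (simp add: nn_integral_add nn_integral_cmult)
    qed
    also have "\<dots> \<le> 2 * (2 * ?R + 4 * (pr n + pr' n)) + 8 * (er n t + er n s + er' n t + er' n s)"
      by (intro add_mono mult_left_mono core') auto
    also have "\<dots> = 4 * ?R + (8 * pr n + 8 * pr' n + 8 * (er n t + er n s + er' n t + er' n s))"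
      by (simp add: distrib_left mult.assoc[symmetric] add.assoc)
    finally show ?thesis .
  qed
  have "(\<lambda>n. 4 * ?R + (8 * pr n + 8 * pr' n + 8 * (er n t + er n s + er' n t + er' n s))) \<longlonglongrightarrow> 4 * ?R + (8 * 0 + 8 * 0 + 8 * (0 + 0 + 0 + 0))"
    unfolding pr_def pr'_def er_def er'_def
    by (intro tendsto_add tendsto_const ennreal_tendsto_cmult lim lim' s01) auto
  from LIMSEQ_le_const[OF this] bound show ?thesis by simp
qed

lemma simple_is_ito:
  "simple_adapted M F T k p V \<Longrightarrow> is_ito_integral M W F T (simple_proc k p V) (simple_int W k p V)"
  unfolding is_ito_integral_def
  by (rule exI[of _ "\<lambda>_. k"], rule exI[of _ "\<lambda>_. p"], rule exI[of _ "\<lambda>_. V"]) simp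

text \<open>Turns estimates for a difference of integrals into estimates for one integral.\<close>

lemma zero_is_ito: "is_ito_integral M W F T (\<lambda>_ _. 0 :: real^'d^'k) (\<lambda>_ _. 0)"
proof -
  have "simple_adapted M F T 1 (\<lambda>i. real i * T) (\<lambda>_ _. 0 :: real^'d^'k)"
    using T by (simp add: simple_adapted_def)
  from simple_is_ito[OF this] show ?thesis
    by (simp add: simple_proc_def[abs_def] simple_int_def[abs_def])
qed

lemma ito_bound:
  fixes H :: "real \<Rightarrow> 'w \<Rightarrow> real^'d^'k"
  assumes I: "is_ito_integral M W F T H I" and joint_meas: "joint_meas H"
    and st: "0 \<le> s" "s \<le> t" "t \<le> T" and m: "I s \<in> borel_measurable M" "I t \<in> borel_measurable M"
  shows "msq (\<lambda>\<omega>. I t \<omega> - I s \<omega>) \<le> 4 * EI s t (\<lambda>r \<omega>. nsq (H r \<omega>))"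
  using ito_diff[OF I zero_is_ito joint_meas _ st m] by (simp add: joint_meas_def)

text \<open>The approximating sums vanish at time 0, but \<open>I\<close> is tied to them only in
  L2, so its value is known only almost surely.\<close>

lemma ito_at_0:
  assumes I: "is_ito_integral M W F T H I" and m: "I 0 \<in> borel_measurable M"
  shows "AE \<omega> in M. I 0 \<omega> = 0"
proof -
  obtain k p V where V: "\<And>n. simple_adapted M F T (k n) (p n) (V n)"
    "\<And>t. t \<in> {0..T} \<Longrightarrow> (\<lambda>n. \<integral>\<^sup>+\<omega>. nsq (I t \<omega> - simple_int W (k n) (p n) (V n) t \<omega>) \<partial>M) \<longlonglongrightarrow> 0"
    using I unfolding is_ito_integral_def by blast
  have "simple_int W (k n) (p n) (V n) 0 \<omega> = 0" for n \<omega>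
    unfolding simple_int_def using simple_adapted_partition(2)[OF V(1)[of n]]
    by (intro sum.neutral) (auto simp: min_def)
  then have "(\<lambda>n::nat. \<integral>\<^sup>+\<omega>. nsq (I 0 \<omega>) \<partial>M) \<longlonglongrightarrow> 0" using V(2)[of 0] T by simp
  then have "msq (I 0) = 0" using LIMSEQ_unique tendsto_const by blast
  then show ?thesis using m by (subst (asm) nn_integral_0_iff_AE) auto
qed

text \<open>Being an integrand is defined by approximability alone. Some simple process lies within
  distance 1 of \<open>H\<close>, and by the isometry simple processes have finite norm.\<close>

lemma ito_integrand_finite:
  fixes H :: "real \<Rightarrow> 'w \<Rightarrow> real^'d^'k"
  assumes I: "is_ito_integral M W F T H I" and joint_meas: "joint_meas H"
  shows "EI 0 T (\<lambda>r \<omega>. nsq (H r \<omega>)) < \<infinity>"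
proof -
  obtain k p V where V: "\<And>n. simple_adapted M F T (k n) (p n) (V n)"
    "(\<lambda>n. EI 0 T (\<lambda>s \<omega>. nsq (simple_proc (k n) (p n) (V n) s \<omega> - H s \<omega>))) \<longlonglongrightarrow> 0"
    using I(1) unfolding is_ito_integral_def EI_def by blast
  have "eventually (\<lambda>n. EI 0 T (\<lambda>s \<omega>. nsq (simple_proc (k n) (p n) (V n) s \<omega> - H s \<omega>)) < 1) sequentially"
    by (rule order_tendstoD[OF V(2)]) simp
  then obtain n where n: "EI 0 T (\<lambda>s \<omega>. nsq (simple_proc (k n) (p n) (V n) s \<omega> - H s \<omega>)) < 1"
    by (auto simp: eventually_sequentially)
  define G where "G = simple_proc (k n) (p n) (V n)"
  define S where "S = simple_int W (k n) (p n) (V n)"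
  note e = elementary_simple[OF V(1)[of n], folded G_def S_def]
  have T0: "0 \<le> T" using T by simp
  have j: "joint_meas (\<lambda>r \<omega>. nsq (G r \<omega>))" "joint_meas (\<lambda>r \<omega>. nsq (G r \<omega> - H r \<omega>))"
    using elementary_joint_meas[OF e] joint_meas unfolding joint_meas_def by (auto simp: split_beta')
  have "EI 0 T (\<lambda>r \<omega>. nsq (H r \<omega>)) \<le> EI 0 T (\<lambda>r \<omega>. 2 * (nsq (G r \<omega>) + nsq (G r \<omega> - H r \<omega>)))"
  proof (rule EI_mono)
    fix r \<omega>
    have "nsq (H r \<omega>) \<le> ennreal (2 * ((norm (G r \<omega>))\<^sup>2 + (norm (G r \<omega> - H r \<omega>))\<^sup>2))"
      using norm_sum_sq_le[of "G r \<omega>" "H r \<omega> - G r \<omega>"] norm_minus_commute[of "H r \<omega>"] by (intro ennreal_leI) simp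
    then show "nsq (H r \<omega>) \<le> 2 * (nsq (G r \<omega>) + nsq (G r \<omega> - H r \<omega>))"
      by (simp add: ennreal_mult)
  qed
  also have "\<dots> = 2 * (EI 0 T (\<lambda>r \<omega>. nsq (G r \<omega>)) + EI 0 T (\<lambda>r \<omega>. nsq (G r \<omega> - H r \<omega>)))"
  proof -
    have j3: "joint_meas (\<lambda>r \<omega>. nsq (G r \<omega>) + nsq (G r \<omega> - H r \<omega>))"
      using j unfolding joint_meas_def by (auto simp: split_beta')
    show ?thesis by (simp only: EI_cmult[OF j3 order.refl order.refl] EI_add[OF j order.refl order.refl])
  qed
  also have "\<dots> < \<infinity>"
  proof -
    have "EI 0 T (\<lambda>r \<omega>. nsq (G r \<omega>)) = msq (\<lambda>\<omega>. S T \<omega> - S 0 \<omega>)"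
      using elementary_main[OF e order.refl T0 order.refl] by simp
    also have "L2 M (\<lambda>\<omega>. S T \<omega> - S 0 \<omega>)" using elementary_main[OF e order.refl T0 order.refl] by blast
    then have "msq (\<lambda>\<omega>. S T \<omega> - S 0 \<omega>) < \<infinity>" by (simp only: L2_def)
    finally show ?thesis using n less_trans[OF n, of \<infinity>] unfolding G_def[symmetric]
      by (simp add: ennreal_mult_less_top)
  qed
  finally show ?thesis .
qed

text \<open>For approximating sums the pairing with \<open>A\<close> vanishes exactly; by
  Cauchy-Schwarz the remaining pairing is at most the norm of \<open>A\<close> times the
  approximation error.\<close>

lemma ito_mean_zero:
  fixes H :: "real \<Rightarrow> 'w \<Rightarrow> real^'d^'k"
  assumes I: "is_ito_integral M W F T H I" and joint_meas: "joint_meas H"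
    and st: "0 \<le> s" "s \<le> t" "t \<le> T" and m: "I s \<in> borel_measurable M" "I t \<in> borel_measurable M"
    and A: "A \<in> borel_measurable (FA s)" "L2 M A"
  shows "L2 M (\<lambda>\<omega>. I t \<omega> - I s \<omega>)" "(\<integral>\<omega>. A \<omega> * (I t \<omega> - I s \<omega>) $ i \<partial>M) = 0"
proof -
  have "EI s t (\<lambda>r \<omega>. nsq (H r \<omega>)) < \<infinity>"
    using EI_subset[OF st(1,3)] ito_integrand_finite[OF I joint_meas] by (rule le_less_trans)
  then show L: "L2 M (\<lambda>\<omega>. I t \<omega> - I s \<omega>)"
    unfolding L2_def using m le_less_trans[OF ito_bound[OF I joint_meas st m], of \<infinity>] by (simp add: ennreal_mult_less_top)
  obtain k p V where V: "\<And>n. simple_adapted M F T (k n) (p n) (V n)"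
    "\<And>t. t \<in> {0..T} \<Longrightarrow> (\<lambda>n. \<integral>\<^sup>+\<omega>. nsq (I t \<omega> - simple_int W (k n) (p n) (V n) t \<omega>) \<partial>M) \<longlonglongrightarrow> 0"
    using I unfolding is_ito_integral_def by blast
  define S where "S n = simple_int W (k n) (p n) (V n)" for n
  note e = elementary_simple[OF V(1), folded S_def] and lim = V(2)[folded S_def]
  have s01: "s \<in> {0..T}" "t \<in> {0..T}" using st by auto
  have Sm [measurable]: "S n s \<in> borel_measurable M" "S n t \<in> borel_measurable M" for n
    using FA_meas[OF elementary_S_FA[OF e s01(1)]] FA_meas[OF elementary_S_FA[OF e s01(2)]] by auto
  note [measurable] = m L2_measurable[OF A(2)]
  let ?c = "\<integral>\<omega>. A \<omega> * (I t \<omega> - I s \<omega>) $ i \<partial>M"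
  let ?A = "\<integral>\<^sup>+\<omega>. nsq (A \<omega>) \<partial>M"
  define er where "er n r = msq (\<lambda>\<omega>. I r \<omega> - S n r \<omega>)" for n r
  have bound: "(ennreal (norm ?c))\<^sup>2 \<le> ?A * (2 * (er n t + er n s))" for n
  proof -
    define R where "R = (\<lambda>\<omega>. (I t \<omega> - I s \<omega>) - (S n t \<omega> - S n s \<omega>))"
    have SL: "L2 M (\<lambda>\<omega>. S n t \<omega> - S n s \<omega>)" "(\<integral>\<omega>. A \<omega> * (S n t \<omega> - S n s \<omega>) $ i \<partial>M) = 0"
      using elementary_main[OF e st] A by blast+
    have RL: "L2 M R" unfolding R_def by (intro L2_diff L SL)
    note Rm [measurable] = L2_measurable[OF RL]
    have "?c = (\<integral>\<omega>. A \<omega> * R \<omega> $ i + A \<omega> * (S n t \<omega> - S n s \<omega>) $ i \<partial>M)"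
      unfolding R_def by (intro Bochner_Integration.integral_cong) (simp_all add: algebra_simps)
    also have "\<dots> = (\<integral>\<omega>. A \<omega> * R \<omega> $ i \<partial>M)"
      unfolding Bochner_Integration.integral_add[OF L2_mult_integrable[OF A(2) L2_nth[OF RL]] L2_mult_integrable[OF A(2) L2_nth[OF SL(1)]]]
      using SL(2) by simp
    finally have c: "?c = (\<integral>\<omega>. A \<omega> * R \<omega> $ i \<partial>M)" .
    have "ennreal (norm ?c) \<le> (\<integral>\<^sup>+\<omega>. ennreal (norm (A \<omega> * R \<omega> $ i)) \<partial>M)"
      unfolding c by (rule integral_norm_bound_ennreal[OF L2_mult_integrable[OF A(2) L2_nth[OF RL]]])
    also have "\<dots> \<le> (\<integral>\<^sup>+\<omega>. ennreal (norm (A \<omega>)) * ennreal (norm (R \<omega>)) \<partial>M)"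
      using Finite_Cartesian_Product.norm_nth_le[of "R _" i]
      by (intro nn_integral_mono) (auto simp: ennreal_mult[symmetric] abs_mult intro!: ennreal_leI mult_left_mono)
    finally have "(ennreal (norm ?c))\<^sup>2 \<le> (\<integral>\<^sup>+\<omega>. ennreal (norm (A \<omega>)) * ennreal (norm (R \<omega>)) \<partial>M)\<^sup>2"
      by (intro power_mono) auto
    also have "\<dots> \<le> (\<integral>\<^sup>+\<omega>. (ennreal (norm (A \<omega>)))\<^sup>2 \<partial>M) * (\<integral>\<^sup>+\<omega>. (ennreal (norm (R \<omega>)))\<^sup>2 \<partial>M)"
      by (rule Cauchy_Schwarz_nn_integral) auto
    also have "\<dots> = ?A * msq R" by (simp add: ennreal_power)
    also have "msq R \<le> (\<integral>\<^sup>+\<omega>. 2 * (nsq (I t \<omega> - S n t \<omega>) + nsq (I s \<omega> - S n s \<omega>)) \<partial>M)"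
    proof (rule nn_integral_mono)
      fix \<omega>
      have "R \<omega> = (I t \<omega> - S n t \<omega>) + (- (I s \<omega> - S n s \<omega>))" unfolding R_def by simp
      then have "(norm (R \<omega>))\<^sup>2 \<le> 2 * ((norm (I t \<omega> - S n t \<omega>))\<^sup>2 + (norm (I s \<omega> - S n s \<omega>))\<^sup>2)"
        using norm_sum_sq_le[of "I t \<omega> - S n t \<omega>" "- (I s \<omega> - S n s \<omega>)"] unfolding norm_minus_cancel by simp
      then have "nsq (R \<omega>) \<le> ennreal (2 * ((norm (I t \<omega> - S n t \<omega>))\<^sup>2 + (norm (I s \<omega> - S n s \<omega>))\<^sup>2))"
        by (rule ennreal_leI)
      then show "nsq (R \<omega>) \<le> 2 * (nsq (I t \<omega> - S n t \<omega>) + nsq (I s \<omega> - S n s \<omega>))"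
        by (simp add: ennreal_mult)
    qed
    also have "\<dots> = 2 * (er n t + er n s)" unfolding er_def by (simp add: nn_integral_add nn_integral_cmult)
    finally show ?thesis by (simp add: mult_left_mono)
  qed
  have "(\<lambda>n. ?A * (2 * (er n t + er n s))) \<longlonglongrightarrow> ?A * (2 * (0 + 0))"
    unfolding er_def using A(2)
    by (intro tendsto_add ennreal_tendsto_cmult lim s01) (auto simp: L2_def)
  then have "(ennreal (norm ?c))\<^sup>2 \<le> ?A * (2 * (0 + 0))"
    by (rule LIMSEQ_le_const) (use bound in blast)
  then show "?c = 0" by (simp add: ennreal_power)
qed

end

section \<open>Processes with drift\<close>

text \<open>With the weight \<open>exp (- (2 * c * t))\<close> the integral operator becomes a
  contraction with factor 1/2, so the weighted supremum \<open>S\<close> satisfies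
  \<open>S \<le> A + S / 2\<close>. The bound \<open>B\<close> only ensures that \<open>S\<close> is
  finite and leaves no trace in the result; \<open>moment_coupled\<close> depends on this.\<close>

lemma Gronwall_ennreal:
  fixes \<phi> :: "real \<Rightarrow> ennreal"
  assumes c: "c > 0" and A: "A \<ge> 0"
    and bd: "\<And>t. 0 \<le> t \<Longrightarrow> t \<le> T \<Longrightarrow> \<phi> t \<le> ennreal B"
    and gr: "\<And>t. 0 \<le> t \<Longrightarrow> t \<le> T \<Longrightarrow> \<phi> t \<le> ennreal A + ennreal c * (\<integral>\<^sup>+s\<in>{0..t}. \<phi> s \<partial>lborel)"
    and t: "0 \<le> t" "t \<le> T"
  shows "\<phi> t \<le> ennreal (2 * A * exp (2 * c * t))"
proof -
  define S where "S = (SUP t\<in>{0..T}. \<phi> t * ennreal (exp (- (2 * c * t))))"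
  have "S \<le> ennreal B"
    unfolding S_def
  proof (rule SUP_least)
    fix r assume r: "r \<in> {0..T}"
    have "\<phi> r * ennreal (exp (- (2 * c * r))) \<le> ennreal B * 1"
      using r c bd[of r] by (intro mult_mono) auto
    then show "\<phi> r * ennreal (exp (- (2 * c * r))) \<le> ennreal B" by simp
  qed
  then have "S < \<top>" using le_less_trans[of S "ennreal B" \<top>] by simp
  then obtain s where s: "S = ennreal s" "s \<ge> 0" by (cases S) auto
  have phi: "\<phi> r \<le> S * ennreal (exp (2 * c * r))" if r: "r \<in> {0..T}" for r
  proof -
    have "\<phi> r = (\<phi> r * ennreal (exp (- (2 * c * r)))) * ennreal (exp (2 * c * r))"
      by (simp add: mult.assoc ennreal_mult[symmetric] exp_minus)
    also have "\<dots> \<le> S * ennreal (exp (2 * c * r))"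
      unfolding S_def using r by (intro mult_right_mono SUP_upper) auto
    finally show ?thesis .
  qed
  have ex: "(\<integral>\<^sup>+r\<in>{0..t}. ennreal (exp (2 * c * r)) \<partial>lborel) = ennreal ((exp (2 * c * t) - 1) / (2 * c))" if t: "0 \<le> t" for t
  proof -
    have "((\<lambda>r. exp (2 * c * r)) has_integral exp (2 * c * t) / (2 * c) - exp (2 * c * 0) / (2 * c)) {0..t}"
      using t c
      by (intro fundamental_theorem_of_calculus)
        (auto intro!: derivative_eq_intros simp: has_real_derivative_iff_has_vector_derivative[symmetric])
    then have "((\<lambda>r. exp (2 * c * r)) has_integral (exp (2 * c * t) - 1) / (2 * c)) {0..t}"
      by (simp add: diff_divide_distrib)
    from nn_integral_has_integral_lebesgue'[OF _ this] show ?thesis by simp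
  qed
  have step: "\<phi> r * ennreal (exp (- (2 * c * r))) \<le> ennreal (A + s / 2)" if r: "r \<in> {0..T}" for r
  proof -
    have "\<phi> r \<le> ennreal A + ennreal c * (\<integral>\<^sup>+s\<in>{0..r}. \<phi> s \<partial>lborel)" using gr r by auto
    also have "(\<integral>\<^sup>+s\<in>{0..r}. \<phi> s \<partial>lborel) \<le> (\<integral>\<^sup>+u\<in>{0..r}. S * ennreal (exp (2 * c * u)) \<partial>lborel)"
      using phi r by (intro nn_integral_mono) (auto simp: indicator_def)
    also have "\<dots> = S * (\<integral>\<^sup>+u\<in>{0..r}. ennreal (exp (2 * c * u)) \<partial>lborel)"
      by (simp add: mult.assoc nn_integral_cmult)
    also have "\<dots> = ennreal (s * ((exp (2 * c * r) - 1) / (2 * c)))"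
    proof -
      have "0 \<le> (exp (2 * c * r) - 1) / (2 * c)" using c r by simp
      from ennreal_mult[OF s(2) this] show ?thesis unfolding s(1) using ex[of r] r by simp
    qed
    finally have "\<phi> r \<le> ennreal A + ennreal c * ennreal (s * ((exp (2 * c * r) - 1) / (2 * c)))"
      by (simp add: mult_left_mono add_left_mono)
    also have "\<dots> = ennreal (A + c * (s * ((exp (2 * c * r) - 1) / (2 * c))))"
      using A c s(2) r by (simp add: ennreal_mult[symmetric] ennreal_plus[symmetric] del: ennreal_plus)
    also have "c * (s * ((exp (2 * c * r) - 1) / (2 * c))) = s / 2 * (exp (2 * c * r) - 1)" using c by (simp add: field_simps)
    finally have "\<phi> r \<le> ennreal (A + s / 2 * (exp (2 * c * r) - 1))" .
    then have "\<phi> r * ennreal (exp (- (2 * c * r))) \<le> ennreal (A + s / 2 * (exp (2 * c * r) - 1)) * ennreal (exp (- (2 * c * r)))"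
      by (intro mult_right_mono) auto
    also have "\<dots> = ennreal ((A + s / 2 * (exp (2 * c * r) - 1)) * exp (- (2 * c * r)))"
      by (simp add: ennreal_mult'')
    also have "\<dots> \<le> ennreal (A + s / 2)"
    proof (rule ennreal_leI)
      have e1: "exp (- (2 * c * r)) \<le> 1" using c r by simp
      have "(A + s / 2 * (exp (2 * c * r) - 1)) * exp (- (2 * c * r)) = A * exp (- (2 * c * r)) + s / 2 * (1 - exp (- (2 * c * r)))"
        by (simp add: algebra_simps exp_minus)
      also have "\<dots> \<le> A * 1 + s / 2 * 1" using A s(2) e1 by (intro add_mono mult_left_mono) auto
      finally show "(A + s / 2 * (exp (2 * c * r) - 1)) * exp (- (2 * c * r)) \<le> A + s / 2" by simp
    qed
    finally show ?thesis .
  qed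
  \<comment> \<open>Finiteness of \<open>S\<close> allows \<open>s / 2\<close> to be moved to the
    left.\<close>
  have "ennreal s \<le> ennreal (A + s / 2)" unfolding s(1)[symmetric] unfolding S_def by (rule SUP_least) (rule step)
  then have "s \<le> A + s / 2" using A s(2) by (subst (asm) ennreal_le_iff) auto
  then have "s \<le> 2 * A" by simp
  have "\<phi> t \<le> S * ennreal (exp (2 * c * t))" using phi t by auto
  also have "\<dots> = ennreal (s * exp (2 * c * t))" using s by (simp add: ennreal_mult)
  also have "\<dots> \<le> ennreal (2 * A * exp (2 * c * t))" using \<open>s \<le> 2 * A\<close> by (intro ennreal_leI mult_right_mono) auto
  finally show ?thesis .
qed

context brownian
begin

lemma joint_meas_norm: "joint_meas (X :: real \<Rightarrow> 'w \<Rightarrow> 'b::{second_countable_topology,real_normed_vector}) \<Longrightarrow> joint_meas (\<lambda>r \<omega>. ennreal (norm (X r \<omega>)))"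
  unfolding joint_meas_def by (auto simp: split_beta')

lemma joint_meas_norm_sq: "joint_meas (X :: real \<Rightarrow> 'w \<Rightarrow> 'b::{second_countable_topology,real_normed_vector}) \<Longrightarrow> joint_meas (\<lambda>r \<omega>. nsq (X r \<omega>))"
  unfolding joint_meas_def by (auto simp: split_beta')

lemma joint_meas_diff: "joint_meas (X :: real \<Rightarrow> 'w \<Rightarrow> 'b::{second_countable_topology,real_normed_vector}) \<Longrightarrow> joint_meas Y \<Longrightarrow> joint_meas (\<lambda>r \<omega>. X r \<omega> - Y r \<omega>)"
  unfolding joint_meas_def by (auto simp: split_beta')

lemma joint_meas_const: "joint_meas (\<lambda>_ _. c)"
  unfolding joint_meas_def by auto

lemma joint_meas_ennreal_add: "joint_meas h \<Longrightarrow> joint_meas h' \<Longrightarrow> joint_meas (\<lambda>r \<omega>. h r \<omega> + h' r \<omega> :: ennreal)"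
  unfolding joint_meas_def by (auto simp: split_beta')

lemma joint_meas_ennreal_mult: "joint_meas h \<Longrightarrow> joint_meas h' \<Longrightarrow> joint_meas (\<lambda>r \<omega>. h r \<omega> * h' r \<omega> :: ennreal)"
  unfolding joint_meas_def by (auto simp: split_beta')

lemma joint_meas_static: "h \<in> borel_measurable M \<Longrightarrow> joint_meas (\<lambda>_. h)"
  unfolding joint_meas_def split_beta' by (rule measurable_compose[OF measurable_snd])

lemma joint_meas_lint:
  fixes X :: "real \<Rightarrow> 'w \<Rightarrow> 'b::euclidean_space"
  assumes "joint_meas X" "0 \<le> s" "t \<le> T"
  shows "(\<lambda>\<omega>. LINT r:{s..t}|lborel. X r \<omega>) \<in> borel_measurable M"
proof -
  have "(LINT r:{s..t}|lborel. X r \<omega>) = (\<integral>r. indicat_real {s..t} r *\<^sub>R X r \<omega> \<partial>lT)" for \<omega>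
    unfolding set_lebesgue_integral_def integral_restrict_space[of "{0..T}" lborel, simplified]
    using assms by (intro Bochner_Integration.integral_cong) (auto simp: indicator_def)
  moreover have "(\<lambda>\<omega>. \<integral>r. indicat_real {s..t} r *\<^sub>R X r \<omega> \<partial>lT) \<in> borel_measurable M"
  proof (rule sigma_finite_measure.borel_measurable_lebesgue_integral[OF sigma_finite_lT])
    have "(\<lambda>(r, \<omega>). indicat_real {s..t} r *\<^sub>R X r \<omega>) \<in> borel_measurable (lT \<Otimes>\<^sub>M M)"
      unfolding split_beta'
    proof (rule borel_measurable_scaleR)
      show "(\<lambda>x. indicat_real {s..t} (fst x)) \<in> borel_measurable (lT \<Otimes>\<^sub>M M)"
        by (rule measurable_compose[OF measurable_fst], rule measurable_restrict_space1) auto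
      show "(\<lambda>x. X (fst x) (snd x)) \<in> borel_measurable (lT \<Otimes>\<^sub>M M)"
        using assms(1) unfolding joint_meas_def split_beta' .
    qed
    from measurable_pair_swap[OF this] show "(\<lambda>(\<omega>, r). indicat_real {s..t} r *\<^sub>R X r \<omega>) \<in> borel_measurable (M \<Otimes>\<^sub>M lT)"
      by (simp add: split_beta')
  qed
  ultimately show ?thesis by simp
qed

lemma lint_norm_le:
  fixes h :: "real \<Rightarrow> 'b::euclidean_space"
  shows "ennreal (norm (LINT r:{s..t}|lborel. h r)) \<le> (\<integral>\<^sup>+r\<in>{s..t}. ennreal (norm (h r)) \<partial>lborel)"
proof (cases "set_integrable lborel {s..t} h")
  case True
  have "ennreal (norm (LINT r:{s..t}|lborel. h r)) \<le> (\<integral>\<^sup>+r. ennreal (norm (indicator {s..t} r *\<^sub>R h r)) \<partial>lborel)"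
    unfolding set_lebesgue_integral_def by (rule integral_norm_bound_ennreal[OF True[unfolded set_integrable_def]])
  also have "\<dots> = (\<integral>\<^sup>+r\<in>{s..t}. ennreal (norm (h r)) \<partial>lborel)"
    by (intro nn_integral_cong) (auto simp: indicator_def)
  finally show ?thesis .
next
  case False
  \<comment> \<open>Without integrability the Bochner integral is 0 by convention.\<close>
  then show ?thesis unfolding set_lebesgue_integral_def set_integrable_def by (simp add: not_integrable_integral_eq)
qed

lemma lint_sq_le:
  fixes X :: "real \<Rightarrow> 'w \<Rightarrow> 'b::euclidean_space"
  assumes "joint_meas X" "\<omega> \<in> space M" "0 \<le> s" "s \<le> t" "t \<le> T"
  shows "nsq (LINT r:{s..t}|lborel. X r \<omega>) \<le> ennreal (t - s) * (\<integral>\<^sup>+r\<in>{s..t}. nsq (X r \<omega>) \<partial>lborel)"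
proof -
  have "nsq (LINT r:{s..t}|lborel. X r \<omega>) = (ennreal (norm (LINT r:{s..t}|lborel. X r \<omega>)))\<^sup>2" by (simp add: ennreal_power)
  also have "\<dots> \<le> (\<integral>\<^sup>+r\<in>{s..t}. ennreal (norm (X r \<omega>)) \<partial>lborel)\<^sup>2" by (intro power_mono lint_norm_le) auto
  \<comment> \<open>The indicator is doubled: one copy is paired with the integrand, the other gives
    the length \<open>t - s\<close> in the Cauchy-Schwarz inequality.\<close>
  also have "\<dots> = (\<integral>\<^sup>+r. indicator {s..t} r * (ennreal (norm (X r \<omega>)) * indicator {s..t} r) \<partial>lborel)\<^sup>2"
    by (intro arg_cong[where f="\<lambda>x. x\<^sup>2"] nn_integral_cong) (auto simp: indicator_def)
  also have "\<dots> \<le> (\<integral>\<^sup>+r. (indicator {s..t} r)\<^sup>2 \<partial>lborel) * (\<integral>\<^sup>+r. (ennreal (norm (X r \<omega>)) * indicator {s..t} r)\<^sup>2 \<partial>lborel)"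
    using joint_meas_path_indicator[OF joint_meas_norm[OF assms(1)] assms(2,3,5)] by (intro Cauchy_Schwarz_nn_integral) auto
  also have "(\<integral>\<^sup>+r. (indicator {s..t} r)\<^sup>2 \<partial>lborel) = (\<integral>\<^sup>+r. indicator {s..t} r \<partial>lborel :: ennreal)"
    by (intro nn_integral_cong) (auto simp: indicator_def)
  also have "\<dots> = ennreal (t - s)" using assms by simp
  also have "(\<integral>\<^sup>+r. (ennreal (norm (X r \<omega>)) * indicator {s..t} r)\<^sup>2 \<partial>lborel) = (\<integral>\<^sup>+r\<in>{s..t}. nsq (X r \<omega>) \<partial>lborel)"
    by (intro nn_integral_cong) (auto simp: indicator_def ennreal_power)
  finally show ?thesis .
qed

text \<open>The common shape of both components of the controlled system and of the scheme: initial
  value, drift, integrand, process and stochastic integral. The equation is almost sure at each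
  fixed \<open>t\<close>, with a null set depending on \<open>t\<close>.\<close>

definition ito_proc where
  "ito_proc p \<beta> H P I \<longleftrightarrow> joint_meas \<beta> \<and> joint_meas H \<and> is_ito_integral M W F T H I \<and>
     (\<forall>t\<in>{0..T}. P t \<in> borel_measurable M \<and> I t \<in> borel_measurable M \<and>
        (AE \<omega> in M. set_integrable lborel {0..t} (\<lambda>s. \<beta> s \<omega>) \<and>
           P t \<omega> = p + (LINT s:{0..t}|lborel. \<beta> s \<omega>) + I t \<omega>))"

text \<open>Measurability of \<open>I t\<close> is obtained here: up to a null set it is
  \<open>P t\<close> minus the initial value and the drift integral.\<close>

lemma ito_procI:
  fixes P :: "real \<Rightarrow> 'w \<Rightarrow> real^'k"
  assumes "joint_meas \<beta>" "joint_meas H" "is_ito_integral M W F T H I"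
    and P: "\<And>t. t \<in> {0..T} \<Longrightarrow> P t \<in> borel_measurable M"
    and AE: "\<And>t. t \<in> {0..T} \<Longrightarrow> AE \<omega> in M. set_integrable lborel {0..t} (\<lambda>s. \<beta> s \<omega>) \<and>
           P t \<omega> = p + (LINT s:{0..t}|lborel. \<beta> s \<omega>) + I t \<omega>"
  shows "ito_proc p \<beta> H P I"
  unfolding ito_proc_def
proof (intro conjI ballI assms)
  fix t assume t: "t \<in> {0..T}"
  show "I t \<in> borel_measurable M"
  proof (rule measurable_AE_eq)
    show "(\<lambda>\<omega>. P t \<omega> - p - (LINT s:{0..t}|lborel. \<beta> s \<omega>)) \<in> borel_measurable M"
      using P[OF t] joint_meas_lint[OF assms(1), of 0 t] t by (intro borel_measurable_diff) auto
    show "AE \<omega> in M. P t \<omega> - p - (LINT s:{0..t}|lborel. \<beta> s \<omega>) = I t \<omega>"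
      using AE[OF t] by eventually_elim simp
  qed
qed

lemma ito_procD:
  assumes "ito_proc p \<beta> H P I"
  shows "joint_meas \<beta>" "joint_meas H" "is_ito_integral M W F T H I"
    and "t \<in> {0..T} \<Longrightarrow> P t \<in> borel_measurable M" "t \<in> {0..T} \<Longrightarrow> I t \<in> borel_measurable M"
    and "t \<in> {0..T} \<Longrightarrow> AE \<omega> in M. set_integrable lborel {0..t} (\<lambda>s. \<beta> s \<omega>)"
    and "t \<in> {0..T} \<Longrightarrow> AE \<omega> in M. P t \<omega> = p + (LINT s:{0..t}|lborel. \<beta> s \<omega>) + I t \<omega>"
  using assms unfolding ito_proc_def by (auto elim!: AE_mp)

lemma set_lint_split:
  fixes h :: "real \<Rightarrow> 'b::euclidean_space"
  assumes "set_integrable lborel {0..t} h" "0 \<le> s" "s \<le> t"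
  shows "(LINT r:{0..t}|lborel. h r) = (LINT r:{0..s}|lborel. h r) + (LINT r:{s..t}|lborel. h r)"
proof -
  have i: "set_integrable lborel {0..s} h" "set_integrable lborel {s..t} h"
    using assms by (auto intro: set_integrable_subset)
  have "(LINT r:{0..s} \<union> {s..t}|lborel. h r) = (LINT r:{0..s}|lborel. h r) + (LINT r:{s..t}|lborel. h r)"
    using AE_lborel_singleton[of s] by (intro set_integral_Un_AE i) (auto elim!: eventually_mono)
  moreover have "{0..s} \<union> {s..t} = {0..t}" using assms by auto
  ultimately show ?thesis by simp
qed

lemma ito_proc_incr:
  fixes P :: "real \<Rightarrow> 'w \<Rightarrow> real^'k"
  assumes "ito_proc p \<beta> H P I" and st: "0 \<le> s" "s \<le> t" "t \<le> T"
  shows "AE \<omega> in M. set_integrable lborel {s..t} (\<lambda>r. \<beta> r \<omega>) \<and> P t \<omega> - P s \<omega> = (LINT r:{s..t}|lborel. \<beta> r \<omega>) + (I t \<omega> - I s \<omega>)"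
proof -
  have "s \<in> {0..T}" "t \<in> {0..T}" using st by auto
  from ito_procD(6,7)[OF assms(1) this(1)] ito_procD(6,7)[OF assms(1) this(2)] show ?thesis
  proof eventually_elim
    case (elim \<omega>)
    have "set_integrable lborel {s..t} (\<lambda>r. \<beta> r \<omega>)" using elim(3) st by (auto intro: set_integrable_subset)
    then show ?case using elim set_lint_split[OF elim(3) st(1,2)] by simp
  qed
qed

lemma ito_proc_0:
  fixes P :: "real \<Rightarrow> 'w \<Rightarrow> real^'k"
  assumes "ito_proc p \<beta> H P I"
  shows "AE \<omega> in M. P 0 \<omega> = p"
proof -
  have 0: "0 \<in> {0..T}" using T by simp
  have z: "(LINT s:{0..0}|lborel. \<beta> s \<omega>) = 0" for \<omega>
    unfolding set_lebesgue_integral_def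
  proof (rule integral_eq_zero_AE)
    show "AE s in lborel. indicat_real {0..0} s *\<^sub>R \<beta> s \<omega> = 0"
      using AE_lborel_singleton[of "0::real"] by eventually_elim (auto simp: indicator_def)
  qed
  from ito_procD(7)[OF assms 0] ito_at_0[OF ito_procD(3)[OF assms] ito_procD(5)[OF assms 0]] show ?thesis
    unfolding z by eventually_elim simp
qed

lemma nn_sq_sum_le:
  fixes X Y :: "'w \<Rightarrow> 'b::{second_countable_topology,real_normed_vector}"
  assumes [measurable]: "X \<in> borel_measurable M" "Y \<in> borel_measurable M"
  shows "msq (\<lambda>\<omega>. X \<omega> + Y \<omega>) \<le> 2 * msq X + 2 * msq Y"
proof -
  have "msq (\<lambda>\<omega>. X \<omega> + Y \<omega>) \<le> (\<integral>\<^sup>+\<omega>. 2 * nsq (X \<omega>) + 2 * nsq (Y \<omega>) \<partial>M)"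
  proof (rule nn_integral_mono)
    fix \<omega>
    have "nsq (X \<omega> + Y \<omega>) \<le> ennreal (2 * (norm (X \<omega>))\<^sup>2 + 2 * (norm (Y \<omega>))\<^sup>2)"
      by (intro ennreal_leI norm_sum_sq_le)
    then show "nsq (X \<omega> + Y \<omega>) \<le> 2 * nsq (X \<omega>) + 2 * nsq (Y \<omega>)"
      by (simp add: ennreal_mult)
  qed
  also have "\<dots> = 2 * msq X + 2 * msq Y" by (simp add: nn_integral_add nn_integral_cmult)
  finally show ?thesis .
qed

lemma drift_msq:
  fixes X :: "real \<Rightarrow> 'w \<Rightarrow> 'b::euclidean_space"
  assumes "joint_meas X" "0 \<le> s" "s \<le> t" "t \<le> T"
  shows "msq (\<lambda>\<omega>. LINT r:{s..t}|lborel. X r \<omega>) \<le> ennreal (t - s) * EI s t (\<lambda>r \<omega>. nsq (X r \<omega>))"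
proof -
  have "msq (\<lambda>\<omega>. LINT r:{s..t}|lborel. X r \<omega>) \<le> (\<integral>\<^sup>+\<omega>. ennreal (t - s) * (\<integral>\<^sup>+r\<in>{s..t}. nsq (X r \<omega>) \<partial>lborel) \<partial>M)"
    by (intro nn_integral_mono lint_sq_le assms)
  also have "\<dots> = ennreal (t - s) * EI s t (\<lambda>r \<omega>. nsq (X r \<omega>))"
    unfolding EI_def using EI_inner_measurable[OF joint_meas_norm_sq[OF assms(1)] assms(2,4)] by (intro nn_integral_cmult)
  finally show ?thesis .
qed

text \<open>Drift by Cauchy-Schwarz in time, noise by \<open>ito_diff\<close>. Separating the two
  costs another factor 2, hence \<open>2 * (t - s)\<close> and 8.\<close>

lemma ito_proc_diff:
  fixes P P' :: "real \<Rightarrow> 'w \<Rightarrow> real^'k"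
  assumes P: "ito_proc p \<beta> H P I" and P': "ito_proc p' \<beta>' H' P' I'" and st: "0 \<le> s" "s \<le> t" "t \<le> T"
  shows "msq (\<lambda>\<omega>. (P t \<omega> - P s \<omega>) - (P' t \<omega> - P' s \<omega>)) \<le>
    ennreal (2 * (t - s)) * EI s t (\<lambda>r \<omega>. nsq (\<beta> r \<omega> - \<beta>' r \<omega>)) +
    8 * EI s t (\<lambda>r \<omega>. nsq (H r \<omega> - H' r \<omega>))"
proof -
  have s01: "s \<in> {0..T}" "t \<in> {0..T}" using st by auto
  let ?B = "\<lambda>\<omega>. LINT r:{s..t}|lborel. \<beta> r \<omega> - \<beta>' r \<omega>"
  let ?J = "\<lambda>\<omega>. (I t \<omega> - I s \<omega>) - (I' t \<omega> - I' s \<omega>)"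
  have "AE \<omega> in M. (P t \<omega> - P s \<omega>) - (P' t \<omega> - P' s \<omega>) = ?B \<omega> + ?J \<omega>"
    using ito_proc_incr[OF P st] ito_proc_incr[OF P' st] by eventually_elim simp
  then have "msq (\<lambda>\<omega>. (P t \<omega> - P s \<omega>) - (P' t \<omega> - P' s \<omega>)) = msq (\<lambda>\<omega>. ?B \<omega> + ?J \<omega>)"
    by (intro nn_integral_cong_AE) (auto elim!: eventually_mono)
  also have "\<dots> \<le> 2 * msq ?B + 2 * msq ?J"
    by (intro nn_sq_sum_le joint_meas_lint joint_meas_diff ito_procD[OF P] ito_procD[OF P'] borel_measurable_diff s01 st)
  also have "\<dots> \<le> 2 * (ennreal (t - s) * EI s t (\<lambda>r \<omega>. nsq (\<beta> r \<omega> - \<beta>' r \<omega>))) +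
    2 * (4 * EI s t (\<lambda>r \<omega>. nsq (H r \<omega> - H' r \<omega>)))"
    by (intro add_mono mult_left_mono drift_msq ito_diff joint_meas_diff ito_procD[OF P] ito_procD[OF P'] s01 st) auto
  also have "\<dots> = ennreal (2 * (t - s)) * EI s t (\<lambda>r \<omega>. nsq (\<beta> r \<omega> - \<beta>' r \<omega>)) +
    8 * EI s t (\<lambda>r \<omega>. nsq (H r \<omega> - H' r \<omega>))"
  proof -
    have "ennreal (2 * (t - s)) = 2 * ennreal (t - s)" using st ennreal_mult[of 2 "t - s"] by simp
    then show ?thesis by (simp only: mult.assoc[symmetric]) simp
  qed
  finally show ?thesis .
qed

lemma zero_ito_proc: "ito_proc 0 (\<lambda>_ _. 0) (\<lambda>_ _. 0 :: real^'d^'k) (\<lambda>_ _. 0) (\<lambda>_ _. 0)"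
  unfolding ito_proc_def by (auto simp: joint_meas_const zero_is_ito set_integrable_def set_lebesgue_integral_def)

lemma ito_proc_bound:
  fixes P :: "real \<Rightarrow> 'w \<Rightarrow> real^'k"
  assumes P: "ito_proc p \<beta> H P I" and st: "0 \<le> s" "s \<le> t" "t \<le> T"
  shows "msq (\<lambda>\<omega>. P t \<omega> - P s \<omega>) \<le>
    ennreal (2 * (t - s)) * EI s t (\<lambda>r \<omega>. nsq (\<beta> r \<omega>)) + 8 * EI s t (\<lambda>r \<omega>. nsq (H r \<omega>))"
  using ito_proc_diff[OF P zero_ito_proc st] by simp

lemma ito_proc_diff0:
  fixes P P' :: "real \<Rightarrow> 'w \<Rightarrow> real^'k"
  assumes P: "ito_proc p \<beta> H P I" and P': "ito_proc p \<beta>' H' P' I'" and t: "0 \<le> t" "t \<le> T"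
  shows "msq (\<lambda>\<omega>. P t \<omega> - P' t \<omega>) \<le>
    ennreal (2 * t) * EI 0 t (\<lambda>r \<omega>. nsq (\<beta> r \<omega> - \<beta>' r \<omega>)) +
    8 * EI 0 t (\<lambda>r \<omega>. nsq (H r \<omega> - H' r \<omega>))"
proof -
  have "msq (\<lambda>\<omega>. P t \<omega> - P' t \<omega>) = msq (\<lambda>\<omega>. (P t \<omega> - P 0 \<omega>) - (P' t \<omega> - P' 0 \<omega>))"
    using ito_proc_0[OF P] ito_proc_0[OF P'] by (intro nn_integral_cong_AE) (auto elim!: eventually_elim2)
  then show ?thesis using ito_proc_diff[OF P P' order.refl t] by simp
qed

end

lemma norm_sq_add3: "(norm (a + b + c))\<^sup>2 \<le> 3 * ((norm a)\<^sup>2 + (norm b)\<^sup>2 + (norm (c::'z::real_normed_vector))\<^sup>2)"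
proof -
  have "(norm (a + b + c))\<^sup>2 \<le> (norm a + norm b + norm c)\<^sup>2"
    by (intro power_mono norm_triangle_le add_mono norm_triangle_ineq) auto
  also have "\<dots> \<le> 3 * ((norm a)\<^sup>2 + (norm b)\<^sup>2 + (norm c)\<^sup>2)"
    using sum_squares_bound[of "norm a" "norm b"] sum_squares_bound[of "norm a" "norm c"] sum_squares_bound[of "norm b" "norm c"]
    by (simp add: power2_eq_square algebra_simps)
  finally show ?thesis .
qed

section \<open>A priori second moments\<close>

context brownian
begin

lemma ito_msq:
  fixes P :: "real \<Rightarrow> 'w \<Rightarrow> real^'k"
  assumes P: "ito_proc p \<beta> H P I" and t: "t \<in> {0..T}"
  shows "msq (I t) \<le> 4 * EI 0 T (\<lambda>r \<omega>. nsq (H r \<omega>))"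
proof -
  have 0: "0 \<in> {0..T}" using T by simp
  have "msq (I t) = msq (\<lambda>\<omega>. I t \<omega> - I 0 \<omega>)"
    using ito_at_0[OF ito_procD(3)[OF P] ito_procD(5)[OF P 0]] by (intro nn_integral_cong_AE) (auto elim!: eventually_mono)
  also have "\<dots> \<le> 4 * EI 0 t (\<lambda>r \<omega>. nsq (H r \<omega>))"
    using t 0 by (intro ito_bound ito_procD[OF P]) auto
  also have "\<dots> \<le> 4 * EI 0 T (\<lambda>r \<omega>. nsq (H r \<omega>))"
    using t by (intro mult_left_mono EI_subset) auto
  finally show ?thesis .
qed

text \<open>
  Restricting to the event \<open>\<Omega> K\<close>, on which the total variation of the drifts is at most \<open>K\<close>, replaces
  a localisation by stopping times: the restricted moments are finite and their Gronwall bound does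
  not depend on \<open>K\<close>.
\<close>

lemma moment_coupled:
  fixes P :: "real \<Rightarrow> 'w \<Rightarrow> real^'k" and P' :: "real \<Rightarrow> 'w \<Rightarrow> real^'l"
  assumes P: "ito_proc p \<beta> H P I" and P': "ito_proc p' \<beta>' H' P' I'" and jP: "joint_meas P" "joint_meas P'"
    and \<zeta>: "joint_meas \<zeta>" "EI 0 T \<zeta> < \<infinity>" and c: "c \<ge> 0"
    and growth: "\<And>s \<omega>. s \<in> {0..T} \<Longrightarrow> \<omega> \<in> space M \<Longrightarrow> nsq (\<beta> s \<omega>) + nsq (\<beta>' s \<omega>) \<le>
      ennreal c * (1 + (nsq (P s \<omega>) + nsq (P' s \<omega>))) + \<zeta> s \<omega>"
  shows "\<exists>C\<ge>0. \<forall>t\<in>{0..T}. msq (P t) + msq (P' t) \<le> ennreal C"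
proof -
  note D = ito_procD[OF P] and D' = ito_procD[OF P']
  have T0: "T \<in> {0..T}" using T by simp
  define r where "r t \<omega> = nsq (P t \<omega>) + nsq (P' t \<omega>)" for t \<omega>
  have jr: "joint_meas r" unfolding r_def by (intro joint_meas_ennreal_add joint_meas_norm_sq jP)
  define gb where "gb s \<omega> = nsq (\<beta> s \<omega>) + nsq (\<beta>' s \<omega>)" for s \<omega>
  have jg: "joint_meas gb" unfolding gb_def by (intro joint_meas_ennreal_add joint_meas_norm_sq D D')
  define EH where "EH = EI 0 T (\<lambda>r \<omega>. nsq (H r \<omega>)) + EI 0 T (\<lambda>r \<omega>. nsq (H' r \<omega>))"
  have EH: "EH < \<infinity>" unfolding EH_def using ito_integrand_finite[OF D(3,2)] ito_integrand_finite[OF D'(3,2)] by simp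
  have EIm: "msq (I t) + msq (I' t) \<le> 4 * EH" if "t \<in> {0..T}" for t
    unfolding EH_def distrib_left by (intro add_mono ito_msq[OF P that] ito_msq[OF P' that])
  define p2 where "p2 = (norm p)\<^sup>2 + (norm p')\<^sup>2"
  have p2: "p2 \<ge> 0" unfolding p2_def by simp
  \<comment> \<open>The equations only provide pathwise integrability of the drifts, so
    \<open>B\<close> is finite almost surely but need not have a finite mean.\<close>
  define B where "B \<omega> = (\<integral>\<^sup>+s\<in>{0..T}. ennreal (norm (\<beta> s \<omega>)) \<partial>lborel) + (\<integral>\<^sup>+s\<in>{0..T}. ennreal (norm (\<beta>' s \<omega>)) \<partial>lborel)" for \<omega>
  have Bm [measurable]: "B \<in> borel_measurable M"
    unfolding B_def by (intro borel_measurable_add EI_inner_measurable joint_meas_norm D D') auto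
  have fin: "(\<integral>\<^sup>+s\<in>{0..T}. ennreal (norm (h s)) \<partial>lborel) < \<infinity>" if "set_integrable lborel {0..T} h" for h :: "real \<Rightarrow> real^'i"
  proof -
    have "(\<integral>\<^sup>+s\<in>{0..T}. ennreal (norm (h s)) \<partial>lborel) = (\<integral>\<^sup>+s. ennreal (norm (indicator {0..T} s *\<^sub>R h s)) \<partial>lborel)"
      by (intro nn_integral_cong) (auto simp: indicator_def)
    also have "\<dots> < \<infinity>" using that unfolding set_integrable_def integrable_iff_bounded by simp
    finally show ?thesis .
  qed
  have B_fin: "AE \<omega> in M. B \<omega> < \<infinity>"
    using D(6)[OF T0] D'(6)[OF T0] unfolding B_def by eventually_elim (simp add: fin[simplified])
  define \<Omega> where "\<Omega> K = {\<omega> \<in> space M. B \<omega> \<le> ennreal K}" for K :: real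
  have \<Omega>m [measurable]: "\<Omega> K \<in> sets M" for K unfolding \<Omega>_def by measurable
  define \<phi> where "\<phi> K t = (\<integral>\<^sup>+\<omega>. r t \<omega> * indicator (\<Omega> K) \<omega> \<partial>M)" for K t
  have Im [measurable]: "I t \<in> borel_measurable M" "I' t \<in> borel_measurable M" if "t \<in> {0..T}" for t using D(5) D'(5) that by auto
  have rI: "(\<integral>\<^sup>+\<omega>. 3 * (nsq (I t \<omega>) + nsq (I' t \<omega>)) \<partial>M) \<le> 12 * EH" if "t \<in> {0..T}" for t
  proof -
    note [measurable] = Im[OF that]
    have "(\<integral>\<^sup>+\<omega>. 3 * (nsq (I t \<omega>) + nsq (I' t \<omega>)) \<partial>M) = 3 * (msq (I t) + msq (I' t))"
      by (simp add: nn_integral_cmult nn_integral_add)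
    also have "\<dots> \<le> 3 * (4 * EH)" by (intro mult_left_mono EIm that) auto
    finally show ?thesis by (simp add: mult.assoc[symmetric])
  qed
  have decomp: "AE \<omega> in M. r t \<omega> \<le> ennreal (3 * p2) + 3 * (nsq (LINT s:{0..t}|lborel. \<beta> s \<omega>) + nsq (LINT s:{0..t}|lborel. \<beta>' s \<omega>))
      + 3 * (nsq (I t \<omega>) + nsq (I' t \<omega>))" if t: "t \<in> {0..T}" for t
    using D(7)[OF t] D'(7)[OF t]
  proof eventually_elim
    case (elim \<omega>)
    have "r t \<omega> \<le> ennreal (3 * ((norm p)\<^sup>2 + (norm (LINT s:{0..t}|lborel. \<beta> s \<omega>))\<^sup>2 + (norm (I t \<omega>))\<^sup>2)) +
      ennreal (3 * ((norm p')\<^sup>2 + (norm (LINT s:{0..t}|lborel. \<beta>' s \<omega>))\<^sup>2 + (norm (I' t \<omega>))\<^sup>2))"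
      unfolding r_def elim by (intro add_mono ennreal_leI norm_sq_add3)
    also have "\<dots> = ennreal (3 * p2) + 3 * (nsq (LINT s:{0..t}|lborel. \<beta> s \<omega>) + nsq (LINT s:{0..t}|lborel. \<beta>' s \<omega>))
      + 3 * (nsq (I t \<omega>) + nsq (I' t \<omega>))"
      unfolding p2_def by (simp add: ennreal_mult distrib_left algebra_simps)
    finally show ?case .
  qed
  \<comment> \<open>This bound grows with \<open>K\<close>. Its only purpose is to make
    \<open>\<phi> K\<close> bounded, as required by \<open>Gronwall_ennreal\<close>.\<close>
  have bd: "\<phi> K t \<le> ennreal (3 * p2 + 6 * K\<^sup>2 + enn2real (12 * EH))" if t: "t \<in> {0..T}" and K: "K \<ge> 0" for K t
  proof -
    have "\<phi> K t \<le> (\<integral>\<^sup>+\<omega>. ennreal (3 * p2 + 6 * K\<^sup>2) + 3 * (nsq (I t \<omega>) + nsq (I' t \<omega>)) \<partial>M)"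
      unfolding \<phi>_def
    proof (rule nn_integral_mono_AE)
      show "AE \<omega> in M. r t \<omega> * indicator (\<Omega> K) \<omega> \<le> ennreal (3 * p2 + 6 * K\<^sup>2) + 3 * (nsq (I t \<omega>) + nsq (I' t \<omega>))"
        using decomp[OF t]
      proof eventually_elim
        case (elim \<omega>)
        show ?case
        proof (cases "\<omega> \<in> \<Omega> K")
          case True
          have sub: "(\<integral>\<^sup>+s\<in>{0..t}. h s \<partial>lborel) \<le> (\<integral>\<^sup>+s\<in>{0..T}. h s \<partial>lborel)" for h
            using t by (intro nn_integral_mono) (auto simp: indicator_def)
          have "ennreal (norm (LINT s:{0..t}|lborel. \<beta> s \<omega>)) \<le> B \<omega>" "ennreal (norm (LINT s:{0..t}|lborel. \<beta>' s \<omega>)) \<le> B \<omega>"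
            unfolding B_def by (rule order_trans[OF lint_norm_le], rule order_trans[OF sub], simp)+
          moreover have "B \<omega> \<le> ennreal K" using True by (simp add: \<Omega>_def)
          ultimately have "ennreal (norm (LINT s:{0..t}|lborel. \<beta> s \<omega>)) \<le> ennreal K" "ennreal (norm (LINT s:{0..t}|lborel. \<beta>' s \<omega>)) \<le> ennreal K"
            by auto
          then have "norm (LINT s:{0..t}|lborel. \<beta> s \<omega>) \<le> K" "norm (LINT s:{0..t}|lborel. \<beta>' s \<omega>) \<le> K"
            using K by (auto simp: ennreal_le_iff)
          then have "(norm (LINT s:{0..t}|lborel. \<beta> s \<omega>))\<^sup>2 \<le> K\<^sup>2" "(norm (LINT s:{0..t}|lborel. \<beta>' s \<omega>))\<^sup>2 \<le> K\<^sup>2"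
            by (auto intro: power_mono)
          then have "3 * (nsq (LINT s:{0..t}|lborel. \<beta> s \<omega>) + nsq (LINT s:{0..t}|lborel. \<beta>' s \<omega>)) \<le> 3 * (ennreal (K\<^sup>2) + ennreal (K\<^sup>2))"
            by (intro mult_left_mono add_mono ennreal_leI) auto
          also have "\<dots> = ennreal (6 * K\<^sup>2)" by (simp add: ennreal_mult ennreal_plus[symmetric] del: ennreal_plus)
          finally have "r t \<omega> \<le> ennreal (3 * p2) + ennreal (6 * K\<^sup>2) + 3 * (nsq (I t \<omega>) + nsq (I' t \<omega>))"
            by (intro order_trans[OF elim] add_right_mono add_left_mono)
          then show ?thesis using True p2 by simp
        qed simp
      qed
    qed
    also have "\<dots> = ennreal (3 * p2 + 6 * K\<^sup>2) + (\<integral>\<^sup>+\<omega>. 3 * (nsq (I t \<omega>) + nsq (I' t \<omega>)) \<partial>M)"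
      using Im[OF t] by (subst nn_integral_add) (auto simp: emeasure_space_1)
    also have "\<dots> \<le> ennreal (3 * p2 + 6 * K\<^sup>2) + 12 * EH" by (intro add_left_mono rI t)
    also have "\<dots> = ennreal (3 * p2 + 6 * K\<^sup>2 + enn2real (12 * EH))"
      using EH p2 by (simp add: ennreal_enn2real ennreal_mult_less_top)
    finally show ?thesis .
  qed
  define A where "A = 3 * p2 + enn2real (12 * EH) + 3 * T * (c * T + enn2real (EI 0 T \<zeta>))"
  \<comment> \<open>The summand 1 makes the Gronwall constant strictly positive, also when
    \<open>c = 0\<close>.\<close>
  define c1 where "c1 = 3 * T * c + 1"
  have A0: "A \<ge> 0" unfolding A_def using p2 T c by auto
  have c1: "c1 > 0" unfolding c1_def using T c by (simp add: add_nonneg_pos)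
  have gr: "\<phi> K t \<le> ennreal A + ennreal c1 * (\<integral>\<^sup>+s\<in>{0..t}. \<phi> K s \<partial>lborel)" if t: "t \<in> {0..T}" for K t
  proof -
    have t': "0 \<le> t" "t \<le> T" using t by auto
    define Q where "Q \<omega> = (\<integral>\<^sup>+s\<in>{0..t}. gb s \<omega> * indicator (\<Omega> K) \<omega> \<partial>lborel)" for \<omega>
    have ji: "joint_meas (\<lambda>_. indicator (\<Omega> K) :: 'w \<Rightarrow> ennreal)" by (rule joint_meas_static) simp
    have Qm: "Q \<in> borel_measurable M" unfolding Q_def by (intro EI_inner_measurable joint_meas_ennreal_mult jg ji t') simp
    have "\<phi> K t \<le> (\<integral>\<^sup>+\<omega>. ennreal (3 * p2) + (3 * ennreal T) * Q \<omega> + 3 * (nsq (I t \<omega>) + nsq (I' t \<omega>)) \<partial>M)"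
      unfolding \<phi>_def
    proof (rule nn_integral_mono_AE)
      show "AE \<omega> in M. r t \<omega> * indicator (\<Omega> K) \<omega> \<le> ennreal (3 * p2) + (3 * ennreal T) * Q \<omega> + 3 * (nsq (I t \<omega>) + nsq (I' t \<omega>))"
        using decomp[OF t] AE_space
      proof eventually_elim
        case (elim \<omega>)
        show ?case
        proof (cases "\<omega> \<in> \<Omega> K")
          case True
          have "nsq (LINT s:{0..t}|lborel. \<beta> s \<omega>) + nsq (LINT s:{0..t}|lborel. \<beta>' s \<omega>) \<le>
            ennreal (t - 0) * (\<integral>\<^sup>+s\<in>{0..t}. nsq (\<beta> s \<omega>) \<partial>lborel) + ennreal (t - 0) * (\<integral>\<^sup>+s\<in>{0..t}. nsq (\<beta>' s \<omega>) \<partial>lborel)"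
            using elim(2) t' by (intro add_mono lint_sq_le D D') auto
          also have "\<dots> = ennreal t * (\<integral>\<^sup>+s\<in>{0..t}. gb s \<omega> \<partial>lborel)"
            unfolding gb_def distrib_right distrib_left[symmetric] using joint_meas_path_indicator[OF joint_meas_norm_sq[OF D(1)] elim(2) order.refl t'(2)]
              joint_meas_path_indicator[OF joint_meas_norm_sq[OF D'(1)] elim(2) order.refl t'(2)]
            by (simp add: nn_integral_add)
          also have "\<dots> \<le> ennreal T * Q \<omega>" unfolding Q_def using t' True by (intro mult_mono ennreal_leI) auto
          finally have "3 * (nsq (LINT s:{0..t}|lborel. \<beta> s \<omega>) + nsq (LINT s:{0..t}|lborel. \<beta>' s \<omega>)) \<le> 3 * (ennreal T * Q \<omega>)"
            by (rule mult_left_mono) simp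
          then have "r t \<omega> \<le> ennreal (3 * p2) + 3 * (ennreal T * Q \<omega>) + 3 * (nsq (I t \<omega>) + nsq (I' t \<omega>))"
            by (intro order_trans[OF elim(1)] add_right_mono add_left_mono)
          then show ?thesis using True by (simp add: mult.assoc)
        qed simp
      qed
    qed
    also have "\<dots> = ennreal (3 * p2) + (3 * ennreal T) * (\<integral>\<^sup>+\<omega>. Q \<omega> \<partial>M) + (\<integral>\<^sup>+\<omega>. 3 * (nsq (I t \<omega>) + nsq (I' t \<omega>)) \<partial>M)"
      using Im[OF t] Qm by (simp add: nn_integral_add nn_integral_cmult emeasure_space_1)
    also have "\<dots> \<le> ennreal (3 * p2) + (3 * ennreal T) * (ennreal (c * T) + ennreal c * (\<integral>\<^sup>+s\<in>{0..t}. \<phi> K s \<partial>lborel) + EI 0 T \<zeta>) + 12 * EH"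
    proof (intro add_mono mult_left_mono rI t order.refl)
      have ji: "joint_meas (\<lambda>_. indicator (\<Omega> K) :: 'w \<Rightarrow> ennreal)" by (rule joint_meas_static) simp
      have jri: "joint_meas (\<lambda>s \<omega>. r s \<omega> * indicator (\<Omega> K) \<omega>)" by (intro joint_meas_ennreal_mult jr ji)
      have j1: "joint_meas (\<lambda>s \<omega>. 1 + r s \<omega> * indicator (\<Omega> K) \<omega>)" by (intro joint_meas_ennreal_add jri joint_meas_const)
      have "(\<integral>\<^sup>+\<omega>. Q \<omega> \<partial>M) = EI 0 t (\<lambda>s \<omega>. gb s \<omega> * indicator (\<Omega> K) \<omega>)" unfolding EI_def Q_def ..
      also have "\<dots> \<le> EI 0 t (\<lambda>s \<omega>. ennreal c * (1 + r s \<omega> * indicator (\<Omega> K) \<omega>) + \<zeta> s \<omega>)"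
      proof (rule EI_mono)
        fix s \<omega> assume "0 \<le> s" "s \<le> t" "\<omega> \<in> space M"
        then have "gb s \<omega> \<le> ennreal c * (1 + r s \<omega>) + \<zeta> s \<omega>" using growth[of s \<omega>] t' unfolding gb_def r_def by auto
        then show "gb s \<omega> * indicator (\<Omega> K) \<omega> \<le> ennreal c * (1 + r s \<omega> * indicator (\<Omega> K) \<omega>) + \<zeta> s \<omega>"
          by (cases "\<omega> \<in> \<Omega> K") auto
      qed
      also have "\<dots> = ennreal c * (EI 0 t (\<lambda>_ _. 1) + EI 0 t (\<lambda>s \<omega>. r s \<omega> * indicator (\<Omega> K) \<omega>)) + EI 0 t \<zeta>"
        using t' by (simp only: EI_add[OF joint_meas_ennreal_mult[OF joint_meas_const j1] \<zeta>(1) order.refl t'(2)] EI_cmult[OF j1 order.refl t'(2)] EI_add[OF joint_meas_const jri order.refl t'(2)])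
      also have "EI 0 t (\<lambda>_ _. 1) = ennreal t" unfolding EI_def using t' by (simp add: emeasure_space_1)
      also have "EI 0 t (\<lambda>s \<omega>. r s \<omega> * indicator (\<Omega> K) \<omega>) = (\<integral>\<^sup>+s\<in>{0..t}. \<phi> K s \<partial>lborel)"
        unfolding \<phi>_def by (rule EI_swap[OF jri order.refl t'(2)])
      also have "ennreal c * (ennreal t + (\<integral>\<^sup>+s\<in>{0..t}. \<phi> K s \<partial>lborel)) + EI 0 t \<zeta> \<le>
        ennreal c * (ennreal T + (\<integral>\<^sup>+s\<in>{0..t}. \<phi> K s \<partial>lborel)) + EI 0 T \<zeta>"
        using t' by (intro add_mono mult_left_mono EI_subset ennreal_leI) auto
      also have "\<dots> = ennreal (c * T) + ennreal c * (\<integral>\<^sup>+s\<in>{0..t}. \<phi> K s \<partial>lborel) + EI 0 T \<zeta>"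
        using c T by (simp add: distrib_left ennreal_mult)
      finally show "(\<integral>\<^sup>+\<omega>. Q \<omega> \<partial>M) \<le> \<dots>" .
    qed auto
    also have "\<dots> = ennreal (3 * p2) + 12 * EH + (3 * ennreal T) * (ennreal (c * T) + EI 0 T \<zeta>) + (3 * ennreal T * ennreal c) * (\<integral>\<^sup>+s\<in>{0..t}. \<phi> K s \<partial>lborel)"
      by (simp only: distrib_left mult.assoc ac_simps)
    also have "ennreal (3 * p2) + 12 * EH + (3 * ennreal T) * (ennreal (c * T) + EI 0 T \<zeta>) = ennreal A"
    proof -
      have z: "EI 0 T \<zeta> = ennreal (enn2real (EI 0 T \<zeta>))" "12 * EH = ennreal (enn2real (12 * EH))" using \<zeta>(2) EH by (auto simp: ennreal_enn2real ennreal_mult_less_top)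
      have m: "3 * ennreal T = ennreal (3 * T)" using T by (simp add: ennreal_mult)
      have "ennreal (3 * p2) + ennreal (enn2real (12 * EH)) + ennreal (3 * T) * (ennreal (c * T) + ennreal (enn2real (EI 0 T \<zeta>))) = ennreal A"
        unfolding A_def using p2 T c by (simp add: ennreal_plus[symmetric] ennreal_mult[symmetric] del: ennreal_plus)
      then show ?thesis unfolding m by (simp only: z[symmetric])
    qed
    also have "3 * ennreal T * ennreal c = ennreal (3 * T * c)" using T c by (simp add: ennreal_mult)
    also have "ennreal A + ennreal (3 * T * c) * (\<integral>\<^sup>+s\<in>{0..t}. \<phi> K s \<partial>lborel) \<le> ennreal A + ennreal c1 * (\<integral>\<^sup>+s\<in>{0..t}. \<phi> K s \<partial>lborel)"
      unfolding c1_def by (intro add_left_mono mult_right_mono ennreal_leI) auto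
    finally show ?thesis .
  qed
  have \<phi>_le: "\<phi> K t \<le> ennreal (2 * A * exp (2 * c1 * T))" if t: "t \<in> {0..T}" and K: "K \<ge> 0" for K t
  proof -
    have "\<phi> K t \<le> ennreal (2 * A * exp (2 * c1 * t))"
      by (rule Gronwall_ennreal[OF c1 A0, of T "\<phi> K" "3 * p2 + 6 * K\<^sup>2 + enn2real (12 * EH)"]) (use bd[OF _ K] gr t in auto)
    also have "\<dots> \<le> ennreal (2 * A * exp (2 * c1 * T))" using t A0 c1 by (intro ennreal_leI mult_left_mono) auto
    finally show ?thesis .
  qed
  have "msq (P t) + msq (P' t) \<le> ennreal (2 * A * exp (2 * c1 * T))" if t: "t \<in> {0..T}" for t
  proof -
    have rm [measurable]: "r t \<in> borel_measurable M" using joint_meas_section[OF jr t] .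
    have "msq (P t) + msq (P' t) = (\<integral>\<^sup>+\<omega>. r t \<omega> \<partial>M)"
      unfolding r_def using D(4)[OF t] D'(4)[OF t] by (simp add: nn_integral_add)
    \<comment> \<open>The events \<open>\<Omega> K\<close> increase to a set of full measure, so
      monotone convergence removes the restriction while the bound stays the same.\<close>
    also have "\<dots> = (\<integral>\<^sup>+\<omega>. (SUP i. r t \<omega> * indicator (\<Omega> (real i)) \<omega>) \<partial>M)"
    proof (rule nn_integral_cong_AE)
      show "AE \<omega> in M. r t \<omega> = (SUP i. r t \<omega> * indicator (\<Omega> (real i)) \<omega>)"
        using B_fin AE_space
      proof eventually_elim
        case (elim \<omega>)
        then obtain x where x: "B \<omega> = ennreal x" "x \<ge> 0" by (cases "B \<omega>") auto
        obtain i where "x \<le> real i" using real_arch_simple by blast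
        then have "\<omega> \<in> \<Omega> (real i)" using elim x by (auto simp: \<Omega>_def ennreal_leI)
        then have "r t \<omega> \<le> (SUP i. r t \<omega> * indicator (\<Omega> (real i)) \<omega>)" by (intro SUP_upper2[of i]) auto
        moreover have "(SUP i. r t \<omega> * indicator (\<Omega> (real i)) \<omega>) \<le> r t \<omega>" by (intro SUP_least) (auto simp: indicator_def)
        ultimately show ?case by (rule antisym)
      qed
    qed
    also have "\<dots> = (SUP i. \<phi> (real i) t)"
      unfolding \<phi>_def
    proof (rule nn_integral_monotone_convergence_SUP)
      show "incseq (\<lambda>i \<omega>. r t \<omega> * indicator (\<Omega> (real i)) \<omega>)"
        by (auto simp: incseq_def le_fun_def indicator_def \<Omega>_def intro: order_trans ennreal_leI)
    qed simp
    also have "\<dots> \<le> ennreal (2 * A * exp (2 * c1 * T))" by (intro SUP_least \<phi>_le t) simp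
    finally show ?thesis .
  qed
  then show ?thesis using A0 by (intro exI[of _ "2 * A * exp (2 * c1 * T)"]) auto
qed

end

section \<open>One step of the Yamada--Watanabe argument\<close>

text \<open>The regularity of the coefficients is available as bounds on squared differences. The
  continuity derived from them makes the coefficients along measurable processes measurable.\<close>

lemma continuous_of_sq_bound:
  fixes h :: "'a::metric_space \<Rightarrow> 'b::real_normed_vector"
  assumes b: "\<And>p q. (norm (h p - h q))\<^sup>2 \<le> w p q" and c: "\<And>q. isCont (\<lambda>p. w p q) q" and z: "\<And>q. w q q = 0"
  shows "continuous_on UNIV h"
proof -
  have "isCont h q" for q
  proof -
    have "((\<lambda>p. sqrt (w p q)) \<longlongrightarrow> sqrt (w q q)) (at q)"
      using c[of q] by (intro tendsto_real_sqrt) (simp add: isCont_def)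
    then have "((\<lambda>p. norm (h p - h q)) \<longlongrightarrow> 0) (at q)"
      using b[of _ q] by (intro Lim_null_comparison[of "\<lambda>p. norm (h p - h q)" "\<lambda>p. sqrt (w p q)"])
        (auto simp: z intro!: always_eventually real_le_rsqrt)
    then show ?thesis unfolding isCont_def by (simp add: tendsto_norm_zero_iff LIM_zero_iff)
  qed
  then show ?thesis by (simp add: continuous_at_imp_continuous_on)
qed

section \<open>The time grid and the freezing of integrands on it\<close>

lemma grid_props:
  assumes T: "T > 0" and N: "N \<ge> 1" and r: "0 \<le> r" "r \<le> T"
  shows "0 \<le> grid N T r" "grid N T r \<le> r" "r - grid N T r \<le> T / N"
proof -
  have N0: "real N > 0" using N by simp
  have f: "of_int \<lfloor>real N * r / T\<rfloor> \<le> real N * r / T" "real N * r / T < of_int \<lfloor>real N * r / T\<rfloor> + 1" by linarith+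
  have p: "0 \<le> real N * r / T" using T r by simp
  then have "0 \<le> \<lfloor>real N * r / T\<rfloor>" by simp
  then show "0 \<le> grid N T r" unfolding grid_def using T by simp
  have "of_int \<lfloor>real N * r / T\<rfloor> * (T / real N) \<le> (real N * r / T) * (T / real N)"
    using T N0 f by (intro mult_right_mono) auto
  also have "\<dots> = r" using T N0 by simp
  finally show "grid N T r \<le> r" unfolding grid_def by simp
  have "(real N * r / T) * (T / real N) \<le> (of_int \<lfloor>real N * r / T\<rfloor> + 1) * (T / real N)"
    using T N0 f by (intro mult_right_mono) auto
  then have "r \<le> grid N T r + T / real N" unfolding grid_def using T N0 by (simp add: algebra_simps)
  then show "r - grid N T r \<le> T / N" by simp
qed

lemma grid_eq:
  assumes T: "T > 0" and N: "N \<ge> 1" and r: "real j * T / real N \<le> r" "r < real (Suc j) * T / real N"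
  shows "grid N T r = real j * T / real N"
proof -
  have N0: "real N > 0" using N by simp
  have "\<lfloor>real N * r / T\<rfloor> = int j"
    using r T N0 by (intro floor_unique) (auto simp: field_simps)
  then show ?thesis by (simp add: grid_def)
qed

lemma grid_step_mono: "T > 0 \<Longrightarrow> i \<le> j \<Longrightarrow> real i * T / real N \<le> real j * T / real N"
  by (intro divide_right_mono mult_right_mono) auto

text \<open>Up to the last endpoint, where \<open>grid\<close> has already moved on, the integrand
  is a step function. Time integrals of errors frozen on the grid thereby become the sums of a
  discrete Gronwall inequality.\<close>

lemma grid_sum:
  fixes q :: "real \<Rightarrow> ennreal"
  assumes T: "T > 0" and N: "N \<ge> 1"
  shows "(\<integral>\<^sup>+r\<in>{0..real k * T / real N}. q (grid N T r) \<partial>lborel) = ennreal (T / real N) * (\<Sum>j<k. q (real j * T / real N))"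
proof -
  let ?t = "\<lambda>j. real j * T / real N"
  have N0: "real N > 0" using N by simp
  have "(\<integral>\<^sup>+r\<in>{0..?t k}. q (grid N T r) \<partial>lborel) = (\<integral>\<^sup>+r. (\<Sum>j<k. q (?t j) * indicator {?t j..<?t (Suc j)} r) \<partial>lborel)"
    using AE_lborel_singleton[of "?t k"]
  proof (intro nn_integral_cong_AE, eventually_elim)
    fix r assume r: "r \<noteq> ?t k"
    show "q (grid N T r) * indicator {0..?t k} r = (\<Sum>j<k. q (?t j) * indicator {?t j..<?t (Suc j)} r)"
    proof (cases "0 \<le> r \<and> r < ?t k")
      case True
      define i where "i = nat \<lfloor>real N * r / T\<rfloor>"
      have "0 \<le> real N * r / T" using True T by simp
      then have "real i \<le> real N * r / T" "real N * r / T < real i + 1" unfolding i_def by linarith+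
      then have i: "?t i \<le> r" "r < ?t (Suc i)" using T N0 by (auto simp: field_simps)
      have ik: "i < k"
      proof (rule ccontr)
        assume "\<not> i < k" then have "?t k \<le> ?t i" using grid_step_mono[OF T, of k i N] by simp
        then show False using i True by linarith
      qed
      have ind: "indicator {?t j..<?t (Suc j)} r = (if j = i then 1 else 0 :: ennreal)" for j
      proof (cases "j = i")
        case False
        then consider "Suc j \<le> i" | "Suc i \<le> j" by linarith
        then show ?thesis
          by cases (use False i grid_step_mono[OF T, of "Suc j" i N] grid_step_mono[OF T, of "Suc i" j N] in \<open>auto simp: indicator_def\<close>)
      qed (use i in auto)
      have "(\<Sum>j<k. q (?t j) * indicator {?t j..<?t (Suc j)} r) = (\<Sum>j<k. if j = i then q (?t j) else 0)"
        unfolding ind by (intro sum.cong) auto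
      also have "\<dots> = q (?t i)" using ik by (simp add: sum.delta)
      finally show ?thesis using True grid_eq[OF T N i] by simp
    next
      case False
      have "indicator {?t j..<?t (Suc j)} r = (0 :: ennreal)" if "j < k" for j
      proof -
        have "0 \<le> ?t j" "?t (Suc j) \<le> ?t k" using T grid_step_mono[OF T, of "Suc j" k N] that by auto
        then show ?thesis using False by (auto simp: indicator_def)
      qed
      then show ?thesis using False r by (auto simp: indicator_def)
    qed
  qed
  also have "\<dots> = (\<Sum>j<k. \<integral>\<^sup>+r. q (?t j) * indicator {?t j..<?t (Suc j)} r \<partial>lborel)"
    by (intro nn_integral_sum) auto
  also have "\<dots> = (\<Sum>j<k. q (?t j) * ennreal (T / real N))"
  proof (intro sum.cong refl)
    fix j
    have "?t (Suc j) - ?t j = T / real N" by (simp add: diff_divide_distrib[symmetric] algebra_simps)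
    then show "(\<integral>\<^sup>+r. q (?t j) * indicator {?t j..<?t (Suc j)} r \<partial>lborel) = q (?t j) * ennreal (T / real N)"
      using grid_step_mono[OF T, of j "Suc j" N] by (subst nn_integral_cmult_indicator) auto
  qed
  finally show ?thesis by (simp add: sum_distrib_left mult.commute)
qed

context brownian
begin

lemma joint_meas_grid:
  assumes N: "N \<ge> 1" and X: "joint_meas X"
  shows "joint_meas (\<lambda>s \<omega>. X (grid N T s) \<omega>)"
proof -
  have "grid N T \<in> borel_measurable borel"
    unfolding grid_def[abs_def] by measurable
  then have "grid N T \<in> borel_measurable lT" by (intro measurable_restrict_space1) simp
  then have "grid N T \<in> measurable lT lT"
  proof (intro measurable_restrict_space2)
    show "grid N T \<in> space lT \<rightarrow> {0..T}"
    proof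
      fix r assume "r \<in> space lT"
      then show "grid N T r \<in> {0..T}" using grid_props(1,2)[OF T N, of r] by (auto simp: space_restrict_space)
    qed
  qed simp
  then have "(\<lambda>x. (grid N T (fst x), snd x)) \<in> measurable (lT \<Otimes>\<^sub>M M) (lT \<Otimes>\<^sub>M M)"
    by (intro measurable_Pair measurable_compose[OF measurable_fst] measurable_snd)
  from measurable_compose[OF this X[unfolded joint_meas_def]] show ?thesis
    unfolding joint_meas_def by (simp add: split_beta')
qed

lemma EI_le:
  assumes g: "joint_meas g" and st: "0 \<le> s" "s \<le> t" "t \<le> T" and c: "c \<ge> 0"
    and b: "\<And>r. s \<le> r \<Longrightarrow> r < t \<Longrightarrow> (\<integral>\<^sup>+\<omega>. g r \<omega> \<partial>M) \<le> ennreal c"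
  shows "EI s t g \<le> ennreal (c * (t - s))"
proof -
  have "EI s t g = (\<integral>\<^sup>+r\<in>{s..t}. (\<integral>\<^sup>+\<omega>. g r \<omega> \<partial>M) \<partial>lborel)" by (rule EI_swap[OF g st(1,3)])
  also have "\<dots> \<le> (\<integral>\<^sup>+r. ennreal c * indicator {s..t} r \<partial>lborel)"
    \<comment> \<open>The hypothesis excludes \<open>r = t\<close>, because in the applications
      \<open>grid\<close> jumps at the right endpoint.\<close>
    using AE_lborel_singleton[of t]
  proof (intro nn_integral_mono_AE, eventually_elim)
    fix r assume "r \<noteq> t"
    then show "(\<integral>\<^sup>+\<omega>. g r \<omega> \<partial>M) * indicator {s..t} r \<le> ennreal c * indicator {s..t} r"
      using b[of r] by (cases "r \<in> {s..t}") auto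
  qed
  also have "\<dots> = ennreal (c * (t - s))" using st c by (simp add: nn_integral_cmult_indicator ennreal_mult)
  finally show ?thesis .
qed

text \<open>The integrand frozen at the grid points is itself a simple process, with integral
  increment \<open>K s *v (W t - W s)\<close> on this step. The freezing error is thus a difference
  of two stochastic integrals and inherits both the L2 estimate and the orthogonality to the
  past.\<close>

lemma freeze:
  fixes H K :: "real \<Rightarrow> 'w \<Rightarrow> real^'d^'k"
  assumes N: "N \<ge> 1" and k: "k < N" and I: "is_ito_integral M W F T H I" and jH: "joint_meas H"
    and Im: "\<And>t. t \<in> {0..T} \<Longrightarrow> I t \<in> borel_measurable M"
    and K: "\<And>j. j < N \<Longrightarrow> K (real j * T / N) \<in> borel_measurable (FA (real j * T / N))" "\<And>j. j < N \<Longrightarrow> L2 M (K (real j * T / N))"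
    and st: "s = real k * T / N" "t = real (Suc k) * T / N"
  shows "msq (\<lambda>\<omega>. (I t \<omega> - I s \<omega>) - K s \<omega> *v (W t \<omega> - W s \<omega>)) \<le> 4 * EI s t (\<lambda>r \<omega>. nsq (H r \<omega> - K (grid N T r) \<omega>))"
    and "L2 M (\<lambda>\<omega>. (I t \<omega> - I s \<omega>) - K s \<omega> *v (W t \<omega> - W s \<omega>))"
    and "A \<in> borel_measurable (FA s) \<Longrightarrow> L2 M A \<Longrightarrow> (\<integral>\<omega>. A \<omega> * ((I t \<omega> - I s \<omega>) - K s \<omega> *v (W t \<omega> - W s \<omega>)) $ i \<partial>M) = 0"
proof -
  have N0: "real N > 0" using N by simp
  define p where "p j = real j * T / real N" for j
  define V where "V j = K (p j)" for j
  have ad: "simple_adapted M F T N p V"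
    unfolding simple_adapted_def
  proof (intro conjI allI impI)
    show "p 0 = 0" "p N = T" unfolding p_def using N0 by auto
    fix j assume "j < N"
    then show "p j < p (Suc j)" "V j \<in> borel_measurable (FA (p j))" "msq (V j) < \<infinity>"
      unfolding V_def using K[of j] T N0 by (auto simp: p_def L2_def divide_strict_right_mono)
  qed
  define G where "G = simple_proc N p V"
  define S where "S = simple_int W N p V"
  note e = elementary_simple[OF ad, folded G_def S_def]
  have st': "s = p k" "t = p (Suc k)" using st by (auto simp: p_def)
  note pp = simple_adapted_partition[OF ad]
  have s0: "0 \<le> s" "s < t" "t \<le> T"
    using pp(2)[of k] pp(2)[of "Suc k"] k ad unfolding st' simple_adapted_def by auto
  have G: "G r \<omega> = K (p j) \<omega>" if j: "j < N" "p j \<le> r" "r < p (Suc j)" for r \<omega> j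
  proof -
    have "indicat_real {p i..<p (Suc i)} r *\<^sub>R V i \<omega> = (if i = j then K (p j) \<omega> else 0)" if i: "i < N" for i
    proof (cases "i = j")
      case False
      then consider "Suc i \<le> j" | "Suc j \<le> i" by linarith
      then show ?thesis
        by cases (use False i j pp(1)[of "Suc i" j] pp(1)[of "Suc j" i] in \<open>auto simp: indicator_def\<close>)
    qed (use j in \<open>auto simp: V_def\<close>)
    then have "G r \<omega> = (\<Sum>i<N. if i = j then K (p j) \<omega> else 0)" unfolding G_def simple_proc_def by (intro sum.cong) auto
    then show ?thesis using j(1) by (simp add: sum.delta)
  qed
  have Gr: "G r \<omega> = K (grid N T r) \<omega>" if "s \<le> r" "r < t" for r \<omega>
    using G[OF k, of r \<omega>] grid_eq[OF T N, of k r] that st by (simp add: p_def)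
  have Q: "p ` {..N} \<inter> {s<..<t} = {}"
  proof -
    have "p i \<le> s \<or> t \<le> p i" if "i \<le> N" for i
      using pp(1)[of i k] pp(1)[of "Suc k" i] that k unfolding st' by (cases "i \<le> k") auto
    then show ?thesis by fastforce
  qed
  have inc: "S t \<omega> - S s \<omega> = K s \<omega> *v (W t \<omega> - W s \<omega>)" if "\<omega> \<in> space M" for \<omega>
    using elementary_step(1)[OF e s0 Q that] Gr[of s \<omega>] G[OF k, of s \<omega>] s0 unfolding st' by simp
  have s01: "s \<in> {0..T}" "t \<in> {0..T}" and s00: "s \<le> t" using s0 by auto
  have Sm: "S r \<in> borel_measurable M" if "r \<in> {0..T}" for r by (rule FA_meas[OF elementary_S_FA[OF e that]])
  have sI: "is_ito_integral M W F T G S" unfolding G_def S_def by (rule simple_is_ito[OF ad])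
  have "msq (\<lambda>\<omega>. (I t \<omega> - I s \<omega>) - K s \<omega> *v (W t \<omega> - W s \<omega>)) = msq (\<lambda>\<omega>. (I t \<omega> - I s \<omega>) - (S t \<omega> - S s \<omega>))"
    by (intro nn_integral_cong) (simp only: inc)
  also have "\<dots> \<le> 4 * EI s t (\<lambda>r \<omega>. nsq (H r \<omega> - G r \<omega>))"
    by (rule ito_diff[OF I sI jH elementary_joint_meas[OF e] s0(1) s00 s0(3) Im[OF s01(1)] Im[OF s01(2)] Sm[OF s01(1)] Sm[OF s01(2)]])
  also have "EI s t (\<lambda>r \<omega>. nsq (H r \<omega> - G r \<omega>)) = EI s t (\<lambda>r \<omega>. nsq (H r \<omega> - K (grid N T r) \<omega>))"
    unfolding EI_def
  proof (rule nn_integral_cong)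
    fix \<omega>
    show "(\<integral>\<^sup>+r\<in>{s..t}. nsq (H r \<omega> - G r \<omega>) \<partial>lborel) = (\<integral>\<^sup>+r\<in>{s..t}. nsq (H r \<omega> - K (grid N T r) \<omega>) \<partial>lborel)"
      using AE_lborel_singleton[of t]
    proof (intro nn_integral_cong_AE, eventually_elim)
      fix r assume "r \<noteq> t"
      then show "nsq (H r \<omega> - G r \<omega>) * indicator {s..t} r = nsq (H r \<omega> - K (grid N T r) \<omega>) * indicator {s..t} r"
        using Gr[of r \<omega>] by (cases "r \<in> {s..t}") auto
    qed
  qed
  finally show "msq (\<lambda>\<omega>. (I t \<omega> - I s \<omega>) - K s \<omega> *v (W t \<omega> - W s \<omega>)) \<le> 4 * EI s t (\<lambda>r \<omega>. nsq (H r \<omega> - K (grid N T r) \<omega>))" .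
  note imz = ito_mean_zero[OF I jH s0(1) s00 s0(3) Im[OF s01(1)] Im[OF s01(2)]]
  have z: "(\<lambda>_. 0 :: real) \<in> borel_measurable (FA s)" "L2 M (\<lambda>_. 0 :: real)" by (auto simp: L2_const)
  have LI: "L2 M (\<lambda>\<omega>. I t \<omega> - I s \<omega>)" by (rule imz(1)[OF z])
  have em: "L2 M (\<lambda>\<omega>. S t \<omega> - S s \<omega>)" "\<And>A i. A \<in> borel_measurable (FA s) \<Longrightarrow> L2 M A \<Longrightarrow> (\<integral>\<omega>. A \<omega> * (S t \<omega> - S s \<omega>) $ i \<partial>M) = 0"
    using elementary_main[OF e s0(1) s00 s0(3)] by blast+
  show "L2 M (\<lambda>\<omega>. (I t \<omega> - I s \<omega>) - K s \<omega> *v (W t \<omega> - W s \<omega>))"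
    by (rule L2_cong[OF L2_diff[OF LI em(1)]]) (simp only: inc)
  assume A: "A \<in> borel_measurable (FA s)" "L2 M A"
  have "(\<integral>\<omega>. A \<omega> * ((I t \<omega> - I s \<omega>) - K s \<omega> *v (W t \<omega> - W s \<omega>)) $ i \<partial>M) = (\<integral>\<omega>. A \<omega> * (I t \<omega> - I s \<omega>) $ i - A \<omega> * (S t \<omega> - S s \<omega>) $ i \<partial>M)"
    by (intro Bochner_Integration.integral_cong refl) (simp only: inc[symmetric] vector_minus_component right_diff_distrib)
  also have "\<dots> = 0"
    unfolding Bochner_Integration.integral_diff[OF L2_mult_integrable[OF A(2) L2_nth[OF LI]] L2_mult_integrable[OF A(2) L2_nth[OF em(1)]]]
    using imz(2)[OF A] em(2)[OF A] by simp
  finally show "(\<integral>\<omega>. A \<omega> * ((I t \<omega> - I s \<omega>) - K s \<omega> *v (W t \<omega> - W s \<omega>)) $ i \<partial>M) = 0" .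
qed

text \<open>
  The step size is written as \<open>q ^ 4\<close>, so that all its fractional powers are polynomials in \<open>q\<close>.
\<close>

lemma yw_step:
  fixes D0 D1 R e :: "'w \<Rightarrow> real" and \<gamma> :: "'w \<Rightarrow> real^'d"
  assumes st: "0 \<le> s" "s < t" "t - s = q ^ 4" and q: "q > 0"
    and eps: "0 < \<epsilon>" "\<epsilon> < 1"
    and D0: "D0 \<in> borel_measurable (FA s)" "L2 M D0" "(\<integral>\<omega>. (D0 \<omega>)\<^sup>2 \<partial>M) \<le> m2"
    and \<gamma>: "\<gamma> \<in> borel_measurable (FA s)" "\<And>\<omega>. \<omega> \<in> space M \<Longrightarrow> (norm (\<gamma> \<omega>))\<^sup>2 \<le> L * \<bar>D0 \<omega>\<bar>" and L: "L \<ge> 0"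
    and e: "L2 M e" "\<And>A. A \<in> borel_measurable (FA s) \<Longrightarrow> L2 M A \<Longrightarrow> (\<integral>\<omega>. A \<omega> * e \<omega> \<partial>M) = 0"
      "(\<integral>\<omega>. (e \<omega>)\<^sup>2 \<partial>M) \<le> c * q ^ 6"
    and R: "integrable M R" "(\<integral>\<omega>. \<bar>R \<omega>\<bar> \<partial>M) \<le> \<rho>"
    and D1: "AE \<omega> in M. D1 \<omega> = D0 \<omega> + R \<omega> + \<gamma> \<omega> \<bullet> (W t \<omega> - W s \<omega>) + e \<omega>" "D1 \<in> borel_measurable M"
    and qQ: "q \<le> Q"
  shows "(\<integral>\<omega>. yw \<epsilon> (D1 \<omega>) \<partial>M) \<le> (\<integral>\<omega>. yw \<epsilon> (D0 \<omega>) \<partial>M) + \<rho> + (t - s) * L / (2 * ln (1 / \<epsilon>)) +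
    q ^ 5 / (\<epsilon>\<^sup>2 * ln (1 / \<epsilon>)) * ((1 + Q) * (L * (1 + m2) + 3 * (real CARD('d))\<^sup>2 * L\<^sup>2 * m2 + c))"
proof -
  define K where "K = 1 / (\<epsilon>\<^sup>2 * ln (1 / \<epsilon>))"
  have Lam: "ln (1 / \<epsilon>) > 0" using ln_inv_pos[OF eps] .
  have K: "K > 0" unfolding K_def using Lam eps by simp
  define a where "a = (\<lambda>\<omega>. \<gamma> \<omega> \<bullet> (W t \<omega> - W s \<omega>))"
  have D0m [measurable]: "D0 \<in> borel_measurable M" and gm [measurable]: "\<gamma> \<in> borel_measurable M"
    and em [measurable]: "e \<in> borel_measurable M" and Rm [measurable]: "R \<in> borel_measurable M" and D1m [measurable]: "D1 \<in> borel_measurable M"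
    using FA_meas[OF D0(1)] FA_meas[OF \<gamma>(1)] L2_measurable[OF e(1)] R(1) D1(2) by auto
  have am [measurable]: "a \<in> borel_measurable M" unfolding a_def by measurable
  have gF: "(\<lambda>\<omega>. \<gamma> \<omega> $ j) \<in> borel_measurable (FA s)" for j by (rule measurable_vec_nth[OF \<gamma>(1)])
  have m2: "m2 \<ge> 0" using D0(3) by (rule order_trans[rotated]) simp
  have D0sq: "integrable M (\<lambda>\<omega>. (D0 \<omega>)\<^sup>2)" using L2_integrable[OF D0(2)] by simp
  have D0i: "integrable M D0" by (rule L2_imp_integrable[OF D0(2)])
  have absD0: "(\<integral>\<omega>. \<bar>D0 \<omega>\<bar> \<partial>M) \<le> 1 + m2"
  proof -
    have "(\<integral>\<omega>. \<bar>D0 \<omega>\<bar> \<partial>M) \<le> (\<integral>\<omega>. 1 + (D0 \<omega>)\<^sup>2 \<partial>M)"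
    proof (rule integral_mono)
      fix \<omega> show "\<bar>D0 \<omega>\<bar> \<le> 1 + (D0 \<omega>)\<^sup>2"
        using sum_squares_bound[of 1 "\<bar>D0 \<omega>\<bar>"] by simp
    qed (use D0i D0sq in auto)
    also have "\<dots> \<le> 1 + m2" using D0(3) D0sq by (simp add: prob_space)
    finally show ?thesis .
  qed
  have gL2: "L2 M \<gamma>"
    unfolding L2_iff
  proof (intro conjI gm)
    show "integrable M (\<lambda>\<omega>. (norm (\<gamma> \<omega>))\<^sup>2)"
      by (rule Bochner_Integration.integrable_bound[of _ "\<lambda>\<omega>. L * D0 \<omega>"]) (use \<gamma>(2) L D0i in \<open>auto simp: abs_mult\<close>)
  qed
  have gsq: "(\<integral>\<omega>. (norm (\<gamma> \<omega>))\<^sup>2 \<partial>M) \<le> L * (1 + m2)"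
  proof -
    have "(\<integral>\<omega>. (norm (\<gamma> \<omega>))\<^sup>2 \<partial>M) \<le> (\<integral>\<omega>. L * \<bar>D0 \<omega>\<bar> \<partial>M)"
      by (intro integral_mono L2_integrable gL2 \<gamma>(2)) (use D0i in auto)
    also have "\<dots> = L * (\<integral>\<omega>. \<bar>D0 \<omega>\<bar> \<partial>M)" by simp
    also have "\<dots> \<le> L * (1 + m2)" by (intro mult_left_mono absD0 L)
    finally show ?thesis .
  qed
  have gij: "integrable M (\<lambda>\<omega>. \<gamma> \<omega> $ j * \<gamma> \<omega> $ l)" for j l by (intro L2_mult_integrable L2_nth gL2)
  have a2: "integrable M (\<lambda>\<omega>. (a \<omega>)\<^sup>2)" "(\<integral>\<omega>. (a \<omega>)\<^sup>2 \<partial>M) \<le> q ^ 4 * (L * (1 + m2))"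
  proof -
    show "integrable M (\<lambda>\<omega>. (a \<omega>)\<^sup>2)" "(\<integral>\<omega>. (a \<omega>)\<^sup>2 \<partial>M) \<le> q ^ 4 * (L * (1 + m2))"
      using incr_second_moment[OF st(1,2), of "\<lambda>_. 1" \<gamma>, OF _ gF] gij mult_left_mono[OF gsq, of "q ^ 4"] st(3) by (auto simp: a_def)
  qed
  have aL2: "L2 M a" unfolding L2_iff using a2(1) by simp
  \<comment> \<open>By independence the fourth moment is dominated by a product: the coefficient
    contributes at most \<open>L\<^sup>2 * m2\<close>, since its fourth power is quadratic in
    \<open>D0\<close>, and the Brownian increment contributes the order
    \<open>q ^ 8\<close>.\<close>
  have a4: "integrable M (\<lambda>\<omega>. (a \<omega>) ^ 4)" "(\<integral>\<omega>. (a \<omega>) ^ 4 \<partial>M) \<le> q ^ 8 * (3 * (real CARD('d))\<^sup>2 * L\<^sup>2 * m2)"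
  proof -
    define \<Phi> where "\<Phi> w = (norm w) ^ 4" for w :: "real^'d"
    have \<Phi>m: "\<Phi> \<in> borel_measurable borel" unfolding \<Phi>_def by measurable
    have \<Phi>le: "\<Phi> w \<le> real CARD('d) * (\<Sum>j\<in>UNIV. (w $ j) ^ 4)" for w
    proof -
      have "\<Phi> w = ((norm w)\<^sup>2)\<^sup>2" unfolding \<Phi>_def by simp
      also have "\<dots> = (\<Sum>j\<in>UNIV. (w $ j)\<^sup>2)\<^sup>2" by (simp add: norm_vec_sq)
      also have "\<dots> \<le> real CARD('d) * (\<Sum>j\<in>UNIV. ((w $ j)\<^sup>2)\<^sup>2)"
        using sum_squared_le_sum_of_squares[of "\<lambda>j. (w $ j)\<^sup>2" UNIV] by (simp add: mult.commute)
      finally show ?thesis by simp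
    qed
    have s4: "integrable M (\<lambda>\<omega>. real CARD('d) * (\<Sum>j\<in>UNIV. ((W t \<omega> - W s \<omega>) $ j) ^ 4))"
      using incr_moments(1)[OF st(1,2), of _ 4] by (intro integrable_mult_right Bochner_Integration.integrable_sum) auto
    have \<Phi>i: "integrable M (\<lambda>\<omega>. \<Phi> (W t \<omega> - W s \<omega>))"
    proof (rule Bochner_Integration.integrable_bound[OF s4])
      show "(\<lambda>\<omega>. \<Phi> (W t \<omega> - W s \<omega>)) \<in> borel_measurable M" using \<Phi>m by measurable
      show "AE \<omega> in M. norm (\<Phi> (W t \<omega> - W s \<omega>)) \<le> norm (real CARD('d) * (\<Sum>j\<in>UNIV. ((W t \<omega> - W s \<omega>) $ j) ^ 4))"
      proof (intro always_eventually allI)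
        fix \<omega>
        show "norm (\<Phi> (W t \<omega> - W s \<omega>)) \<le> norm (real CARD('d) * (\<Sum>j\<in>UNIV. ((W t \<omega> - W s \<omega>) $ j) ^ 4))"
          using \<Phi>le[of "W t \<omega> - W s \<omega>"] by (auto intro!: order_trans[OF _ abs_ge_self] simp: \<Phi>_def)
      qed
    qed
    have \<Phi>b: "(\<integral>\<omega>. \<Phi> (W t \<omega> - W s \<omega>) \<partial>M) \<le> 3 * (real CARD('d))\<^sup>2 * q ^ 8"
    proof -
      have "(\<integral>\<omega>. \<Phi> (W t \<omega> - W s \<omega>) \<partial>M) \<le> (\<integral>\<omega>. real CARD('d) * (\<Sum>j\<in>UNIV. ((W t \<omega> - W s \<omega>) $ j) ^ 4) \<partial>M)"
        by (intro integral_mono \<Phi>i s4 \<Phi>le)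
      also have "\<dots> = real CARD('d) * (\<Sum>j\<in>UNIV. (\<integral>\<omega>. ((W t \<omega> - W s \<omega>) $ j) ^ 4 \<partial>M))"
        using Bochner_Integration.integral_sum[OF incr_moments(1)[OF st(1,2), of _ 4]] by simp
      also have "\<dots> = 3 * (real CARD('d))\<^sup>2 * q ^ 8"
        unfolding incr_moments(4)[OF st(1,2)] st(3) by (simp add: power2_eq_square power_mult[symmetric])
      finally show ?thesis .
    qed
    have U: "(\<lambda>\<omega>. (norm (\<gamma> \<omega>)) ^ 4) \<in> borel_measurable (FA s)"
      by (intro borel_measurable_power measurable_compose[OF \<gamma>(1) borel_measurable_norm])
    have Ule: "(norm (\<gamma> \<omega>)) ^ 4 \<le> L\<^sup>2 * (D0 \<omega>)\<^sup>2" if "\<omega> \<in> space M" for \<omega>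
    proof -
      have "(norm (\<gamma> \<omega>)) ^ 4 = ((norm (\<gamma> \<omega>))\<^sup>2)\<^sup>2" by simp
      also have "\<dots> \<le> (L * \<bar>D0 \<omega>\<bar>)\<^sup>2" by (intro power_mono \<gamma>(2) that) auto
      finally show ?thesis by (simp add: power_mult_distrib)
    qed
    have Ui: "integrable M (\<lambda>\<omega>. (norm (\<gamma> \<omega>)) ^ 4)"
      by (rule Bochner_Integration.integrable_bound[of _ "\<lambda>\<omega>. L\<^sup>2 * (D0 \<omega>)\<^sup>2"]) (use Ule D0sq in auto)
    have Ub: "(\<integral>\<omega>. (norm (\<gamma> \<omega>)) ^ 4 \<partial>M) \<le> L\<^sup>2 * m2"
    proof -
      have "(\<integral>\<omega>. (norm (\<gamma> \<omega>)) ^ 4 \<partial>M) \<le> (\<integral>\<omega>. L\<^sup>2 * (D0 \<omega>)\<^sup>2 \<partial>M)" by (intro integral_mono Ui Ule) (use D0sq in auto)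
      also have "\<dots> \<le> L\<^sup>2 * m2" using D0(3) by (simp add: mult_left_mono)
      finally show ?thesis .
    qed
    note ind = indep_incr_integral[OF st(1,2) U Ui \<Phi>m \<Phi>i]
    have ale: "(a \<omega>) ^ 4 \<le> (norm (\<gamma> \<omega>)) ^ 4 * \<Phi> (W t \<omega> - W s \<omega>)" for \<omega>
    proof -
      have "\<bar>a \<omega>\<bar> \<le> norm (\<gamma> \<omega>) * norm (W t \<omega> - W s \<omega>)" unfolding a_def by (rule Cauchy_Schwarz_ineq2)
      then have "\<bar>a \<omega>\<bar> ^ 4 \<le> (norm (\<gamma> \<omega>) * norm (W t \<omega> - W s \<omega>)) ^ 4" by (intro power_mono) auto
      then show ?thesis unfolding \<Phi>_def by (simp add: power_mult_distrib)
    qed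
    show i4: "integrable M (\<lambda>\<omega>. (a \<omega>) ^ 4)"
      by (rule Bochner_Integration.integrable_bound[OF ind(1)]) (use ale in \<open>auto simp: \<Phi>_def\<close>)
    have "(\<integral>\<omega>. (a \<omega>) ^ 4 \<partial>M) \<le> (\<integral>\<omega>. (norm (\<gamma> \<omega>)) ^ 4 * \<Phi> (W t \<omega> - W s \<omega>) \<partial>M)" by (intro integral_mono i4 ind(1) ale)
    also have "\<dots> \<le> (L\<^sup>2 * m2) * (3 * (real CARD('d))\<^sup>2 * q ^ 8)"
      unfolding ind(2) using Ub \<Phi>b m2 by (intro mult_mono) (auto simp: \<Phi>_def intro!: Bochner_Integration.integral_nonneg)
    finally show "(\<integral>\<omega>. (a \<omega>) ^ 4 \<partial>M) \<le> q ^ 8 * (3 * (real CARD('d))\<^sup>2 * L\<^sup>2 * m2)" by (simp add: algebra_simps)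
  qed
  have y1F: "(\<lambda>\<omega>. yw1 \<epsilon> (D0 \<omega>)) \<in> borel_measurable (FA s)"
  proof -
    have "continuous_on UNIV (yw1 \<epsilon>)" using DERIV_yw1[OF eps] by (meson DERIV_isCont continuous_at_imp_continuous_on)
    then show ?thesis by (intro measurable_compose[OF D0(1)] borel_measurable_continuous_onI)
  qed
  have y2F: "(\<lambda>\<omega>. yw2 \<epsilon> (D0 \<omega>)) \<in> borel_measurable (FA s)"
    unfolding yw2_def using D0(1) by measurable
  have y1L2: "L2 M (\<lambda>\<omega>. yw1 \<epsilon> (D0 \<omega>))"
    by (rule L2_mono[of _ M "\<lambda>_. 1::real"]) (use FA_meas[OF y1F] yw1_bound[OF eps] in \<open>auto simp: L2_const\<close>)
  \<comment> \<open>The first-order terms have mean zero because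
    \<open>yw1 \<epsilon> (D0 \<omega>)\<close> is bounded and known at time
    \<open>s\<close>.\<close>
  have za: "(\<integral>\<omega>. yw1 \<epsilon> (D0 \<omega>) * a \<omega> \<partial>M) = 0"
  proof -
    have "(\<integral>\<omega>. (yw1 \<epsilon> (D0 \<omega>) *\<^sub>R \<gamma> \<omega>) \<bullet> (W t \<omega> - W s \<omega>) \<partial>M) = 0"
    proof (rule incr_mean_zero(2)[OF st(1,2)])
      show "(\<lambda>\<omega>. (yw1 \<epsilon> (D0 \<omega>) *\<^sub>R \<gamma> \<omega>) $ j) \<in> borel_measurable (FA s)" for j
        using borel_measurable_times[OF y1F gF] by simp
      show "integrable M (\<lambda>\<omega>. (yw1 \<epsilon> (D0 \<omega>) *\<^sub>R \<gamma> \<omega>) $ j)" for j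
        using L2_mult_integrable[OF y1L2 L2_nth[OF gL2]] by simp
    qed
    then show ?thesis by (simp add: a_def)
  qed
  have ze: "(\<integral>\<omega>. yw1 \<epsilon> (D0 \<omega>) * e \<omega> \<partial>M) = 0" by (rule e(2)[OF y1F y1L2])
  have y2: "integrable M (\<lambda>\<omega>. yw2 \<epsilon> (D0 \<omega>) * (a \<omega>)\<^sup>2)" "(\<integral>\<omega>. yw2 \<epsilon> (D0 \<omega>) * (a \<omega>)\<^sup>2 \<partial>M) \<le> q ^ 4 * (L / ln (1 / \<epsilon>))"
  proof -
    have i1: "integrable M (\<lambda>\<omega>. yw2 \<epsilon> (D0 \<omega>) * (\<gamma> \<omega> $ j * \<gamma> \<omega> $ l))" for j l
    proof (rule Bochner_Integration.integrable_bound[OF integrable_mult_right[OF gij, of K]])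
      show "AE \<omega> in M. norm (yw2 \<epsilon> (D0 \<omega>) * (\<gamma> \<omega> $ j * \<gamma> \<omega> $ l)) \<le> norm (K * (\<gamma> \<omega> $ j * \<gamma> \<omega> $ l))"
        using yw2_bound[OF eps] K unfolding K_def[symmetric]
        by (intro always_eventually allI) (auto simp: abs_mult intro!: mult_right_mono)
    qed (use FA_meas[OF y2F] in measurable)
    note sm = incr_second_moment[OF st(1,2) y2F gF i1]
    show "integrable M (\<lambda>\<omega>. yw2 \<epsilon> (D0 \<omega>) * (a \<omega>)\<^sup>2)" using sm(1) by (simp add: a_def)
    have i2: "integrable M (\<lambda>\<omega>. yw2 \<epsilon> (D0 \<omega>) * (norm (\<gamma> \<omega>))\<^sup>2)"
      unfolding norm_vec_sq[of "\<gamma> _"] sum_distrib_left using i1 by (intro Bochner_Integration.integrable_sum) (simp add: power2_eq_square)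
    have "(\<integral>\<omega>. yw2 \<epsilon> (D0 \<omega>) * (norm (\<gamma> \<omega>))\<^sup>2 \<partial>M) \<le> (\<integral>\<omega>. L / ln (1 / \<epsilon>) \<partial>M)"
    proof (intro integral_mono i2)
      fix \<omega> assume "\<omega> \<in> space M"
      \<comment> \<open>The growth of \<open>\<gamma>\<close> meets the decay of \<open>yw2\<close>:
        the resulting bound does not depend on \<open>D0\<close>.\<close>
      then have "yw2 \<epsilon> (D0 \<omega>) * (norm (\<gamma> \<omega>))\<^sup>2 \<le> yw2 \<epsilon> (D0 \<omega>) * (L * \<bar>D0 \<omega>\<bar>)"
        by (intro mult_left_mono \<gamma>(2) yw2_nonneg eps)
      also have "\<dots> = L * (\<bar>D0 \<omega>\<bar> * yw2 \<epsilon> (D0 \<omega>))" by simp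
      also have "\<dots> \<le> L * (1 / ln (1 / \<epsilon>))" by (intro mult_left_mono abs_times_yw2_le eps L)
      finally show "yw2 \<epsilon> (D0 \<omega>) * (norm (\<gamma> \<omega>))\<^sup>2 \<le> L / ln (1 / \<epsilon>)" by simp
    qed auto
    then have "(\<integral>\<omega>. yw2 \<epsilon> (D0 \<omega>) * (norm (\<gamma> \<omega>))\<^sup>2 \<partial>M) \<le> L / ln (1 / \<epsilon>)" by (simp add: prob_space)
    then show "(\<integral>\<omega>. yw2 \<epsilon> (D0 \<omega>) * (a \<omega>)\<^sup>2 \<partial>M) \<le> q ^ 4 * (L / ln (1 / \<epsilon>))"
      unfolding a_def sm(2) st(3) using q by (intro mult_left_mono) auto
  qed
  define r where "r = (\<lambda>\<omega>. \<bar>a \<omega>\<bar> ^ 3 + \<bar>a \<omega>\<bar> * \<bar>e \<omega>\<bar> + (e \<omega>)\<^sup>2)"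
  \<comment> \<open>Young's inequality with powers of \<open>q\<close> as weights. In the mean, the
    halves of the cubic term are both of order \<open>q ^ 6\<close> and those of the mixed term both
    of order \<open>q ^ 5\<close>, which is the decisive order.\<close>
  define r' where "r' = (\<lambda>\<omega>. (q\<^sup>2 + q) * (a \<omega>)\<^sup>2 + (1 / q\<^sup>2) * (a \<omega>) ^ 4 + (1 / q + 1) * (e \<omega>)\<^sup>2)"
  have e2: "integrable M (\<lambda>\<omega>. (e \<omega>)\<^sup>2)" using L2_integrable[OF e(1)] by simp
  have r'i: "integrable M r'" unfolding r'_def using a2(1) a4(1) e2 by auto
  have rr: "r \<omega> \<le> r' \<omega>" "0 \<le> r \<omega>" for \<omega>
  proof -
    define A where "A = \<bar>a \<omega>\<bar>"
    define E where "E = \<bar>e \<omega>\<bar>"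
    have A: "A \<ge> 0" "E \<ge> 0" unfolding A_def E_def by auto
    have 1: "A ^ 3 \<le> q\<^sup>2 * A\<^sup>2 + (1 / q\<^sup>2) * A ^ 4"
    proof -
      have "2 * (q * A) * (A\<^sup>2 / q) \<le> (q * A)\<^sup>2 + (A\<^sup>2 / q)\<^sup>2" by (rule sum_squares_bound)
      moreover have "2 * (q * A) * (A\<^sup>2 / q) = 2 * A ^ 3" using q by (simp add: power2_eq_square power3_eq_cube)
      moreover have "(q * A)\<^sup>2 + (A\<^sup>2 / q)\<^sup>2 = q\<^sup>2 * A\<^sup>2 + (1 / q\<^sup>2) * A ^ 4" by (simp add: power_mult_distrib power_divide)
      moreover have "A ^ 3 \<ge> 0" using A by simp
      ultimately show ?thesis by linarith
    qed
    have 2: "A * E \<le> q * A\<^sup>2 + (1 / q) * E\<^sup>2"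
    proof -
      have sq: "sqrt q > 0" using q by simp
      have "2 * (sqrt q * A) * (E / sqrt q) \<le> (sqrt q * A)\<^sup>2 + (E / sqrt q)\<^sup>2" by (rule sum_squares_bound)
      moreover have "2 * (sqrt q * A) * (E / sqrt q) = 2 * (A * E)" using sq by simp
      moreover have "(sqrt q * A)\<^sup>2 + (E / sqrt q)\<^sup>2 = q * A\<^sup>2 + (1 / q) * E\<^sup>2" using q by (simp add: power_mult_distrib power_divide)
      moreover have "A * E \<ge> 0" using A by simp
      ultimately show ?thesis by linarith
    qed
    have p: "A\<^sup>2 = (a \<omega>)\<^sup>2" "A ^ 4 = (a \<omega>) ^ 4" "E\<^sup>2 = (e \<omega>)\<^sup>2" unfolding A_def E_def by simp_all
    show "r \<omega> \<le> r' \<omega>" unfolding r_def r'_def A_def[symmetric] E_def[symmetric] p[symmetric] using 1 2 by (simp add: algebra_simps)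
    show "0 \<le> r \<omega>" unfolding r_def by simp
  qed
  have rm: "r \<in> borel_measurable M" unfolding r_def by measurable
  have ri: "integrable M r" by (rule Bochner_Integration.integrable_bound[OF r'i rm]) (use rr in \<open>auto intro!: always_eventually order_trans[OF _ abs_ge_self]\<close>)
  define Cst where "Cst = L * (1 + m2) + 3 * (real CARD('d))\<^sup>2 * L\<^sup>2 * m2 + c"
  have c0: "c \<ge> 0"
  proof -
    have "0 \<le> (\<integral>\<omega>. (e \<omega>)\<^sup>2 \<partial>M)" by simp
    then have "0 \<le> c * q ^ 6" using e(3) by linarith
    then show ?thesis using q by (simp add: zero_le_mult_iff)
  qed
  have rint: "(\<integral>\<omega>. r \<omega> \<partial>M) \<le> q ^ 5 * ((1 + Q) * Cst)"
  proof -
    have "(\<integral>\<omega>. r \<omega> \<partial>M) \<le> (\<integral>\<omega>. r' \<omega> \<partial>M)" by (intro integral_mono ri r'i rr)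
    also have "\<dots> = (q\<^sup>2 + q) * (\<integral>\<omega>. (a \<omega>)\<^sup>2 \<partial>M) + (1 / q\<^sup>2) * (\<integral>\<omega>. (a \<omega>) ^ 4 \<partial>M) + (1 / q + 1) * (\<integral>\<omega>. (e \<omega>)\<^sup>2 \<partial>M)"
      unfolding r'_def using a2(1) a4(1) e2 by simp
    also have "\<dots> \<le> (q\<^sup>2 + q) * (q ^ 4 * (L * (1 + m2))) + (1 / q\<^sup>2) * (q ^ 8 * (3 * (real CARD('d))\<^sup>2 * L\<^sup>2 * m2)) + (1 / q + 1) * (c * q ^ 6)"
      using q by (intro add_mono mult_left_mono a2 a4 e(3)) auto
    also have "\<dots> = q ^ 5 * ((1 + q) * (L * (1 + m2)) + q * (3 * (real CARD('d))\<^sup>2 * L\<^sup>2 * m2) + (1 + q) * c)"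
      using q by (simp add: field_simps power_numeral_reduce)
    \<comment> \<open>The surplus powers of \<open>q\<close> are absorbed by the bound
      \<open>Q\<close>, which does not depend on the step size.\<close>
    also have "\<dots> \<le> q ^ 5 * ((1 + Q) * (L * (1 + m2)) + (1 + Q) * (3 * (real CARD('d))\<^sup>2 * L\<^sup>2 * m2) + (1 + Q) * c)"
      using q qQ L m2 c0 by (intro mult_left_mono add_mono mult_right_mono) auto
    also have "\<dots> = q ^ 5 * ((1 + Q) * Cst)" unfolding Cst_def by (simp only: distrib_left)
    finally show ?thesis .
  qed
  have ywm: "yw \<epsilon> \<in> borel_measurable borel"
    using DERIV_yw[OF eps] by (meson DERIV_isCont continuous_at_imp_continuous_on borel_measurable_continuous_onI)
  have ywi: "integrable M (\<lambda>\<omega>. yw \<epsilon> (X \<omega>))" if "integrable M X" for X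
  proof (rule Bochner_Integration.integrable_bound[OF that])
    show "(\<lambda>\<omega>. yw \<epsilon> (X \<omega>)) \<in> borel_measurable M" using ywm that by measurable
    show "AE \<omega> in M. norm (yw \<epsilon> (X \<omega>)) \<le> norm (X \<omega>)"
      using yw_Lipschitz[OF eps, of _ 0] by (intro always_eventually allI) (simp add: yw_0[OF eps])
  qed
  have ai: "integrable M a" "integrable M e" by (intro L2_imp_integrable aL2 e(1))+
  have D1i: "integrable M D1"
  proof -
    have "integrable M (\<lambda>\<omega>. D0 \<omega> + R \<omega> + a \<omega> + e \<omega>)" using D0i R(1) ai by simp
    then show ?thesis using D1 by (subst integrable_cong_AE[of D1 M "\<lambda>\<omega>. D0 \<omega> + R \<omega> + a \<omega> + e \<omega>"]) (auto simp: a_def)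
  qed
  note yi = L2_mult_integrable[OF y1L2 aL2] L2_mult_integrable[OF y1L2 e(1)]
  have "(\<integral>\<omega>. yw \<epsilon> (D1 \<omega>) \<partial>M) \<le> (\<integral>\<omega>. yw \<epsilon> (D0 \<omega>) + (yw1 \<epsilon> (D0 \<omega>) * a \<omega> + yw1 \<epsilon> (D0 \<omega>) * e \<omega>) + (1/2) * (yw2 \<epsilon> (D0 \<omega>) * (a \<omega>)\<^sup>2) + K * r \<omega> + \<bar>R \<omega>\<bar> \<partial>M)"
  proof (rule integral_mono_AE)
    show "integrable M (\<lambda>\<omega>. yw \<epsilon> (D0 \<omega>) + (yw1 \<epsilon> (D0 \<omega>) * a \<omega> + yw1 \<epsilon> (D0 \<omega>) * e \<omega>) + (1/2) * (yw2 \<epsilon> (D0 \<omega>) * (a \<omega>)\<^sup>2) + K * r \<omega> + \<bar>R \<omega>\<bar>)"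
      using ywi[OF D0i] yi y2(1) ri R(1) by (intro Bochner_Integration.integrable_add integrable_mult_right integrable_abs)
    show "AE \<omega> in M. yw \<epsilon> (D1 \<omega>) \<le> yw \<epsilon> (D0 \<omega>) + (yw1 \<epsilon> (D0 \<omega>) * a \<omega> + yw1 \<epsilon> (D0 \<omega>) * e \<omega>) + (1/2) * (yw2 \<epsilon> (D0 \<omega>) * (a \<omega>)\<^sup>2) + K * r \<omega> + \<bar>R \<omega>\<bar>"
      using D1(1)
    proof eventually_elim
      case (elim \<omega>)
      \<comment> \<open>The drift increment is removed first, so that only the noise is
        expanded.\<close>
      have "yw \<epsilon> (D1 \<omega>) \<le> yw \<epsilon> (D0 \<omega> + a \<omega> + e \<omega>) + \<bar>R \<omega>\<bar>"
        using yw_Lipschitz[OF eps, of "D1 \<omega>" "D0 \<omega> + a \<omega> + e \<omega>"] elim by (simp add: a_def abs_le_iff)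
      also have "yw \<epsilon> (D0 \<omega> + a \<omega> + e \<omega>) \<le> yw \<epsilon> (D0 \<omega>) + yw1 \<epsilon> (D0 \<omega>) * (a \<omega> + e \<omega>) + yw2 \<epsilon> (D0 \<omega>) / 2 * (a \<omega>)\<^sup>2 + K * (\<bar>a \<omega>\<bar> ^ 3 + \<bar>a \<omega>\<bar> * \<bar>e \<omega>\<bar> + (e \<omega>)\<^sup>2)"
        unfolding K_def by (rule Taylor_two_step[OF DERIV_yw[OF eps] DERIV_yw1[OF eps] yw2_bound[OF eps] yw2_Lipschitz[OF eps]])
      finally show ?case unfolding r_def by (simp add: algebra_simps)
    qed
  qed (intro ywi D1i)
  also have "\<dots> = (\<integral>\<omega>. yw \<epsilon> (D0 \<omega>) \<partial>M) + (1/2) * (\<integral>\<omega>. yw2 \<epsilon> (D0 \<omega>) * (a \<omega>)\<^sup>2 \<partial>M) + K * (\<integral>\<omega>. r \<omega> \<partial>M) + (\<integral>\<omega>. \<bar>R \<omega>\<bar> \<partial>M)"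
    using ywi[OF D0i] yi y2(1) ri R(1) za ze by simp
  also have "\<dots> \<le> (\<integral>\<omega>. yw \<epsilon> (D0 \<omega>) \<partial>M) + (1/2) * (q ^ 4 * (L / ln (1 / \<epsilon>))) + K * (q ^ 5 * ((1 + Q) * Cst)) + \<rho>"
    using K by (intro add_mono mult_left_mono y2 rint R order.refl) auto
  finally show ?thesis unfolding K_def Cst_def st(3) by (simp add: algebra_simps)
qed

lemma adapted_joint_meas: "adapted_proc M F T X \<Longrightarrow> joint_meas X"
  unfolding adapted_proc_def joint_meas_def by (rule conjunct2)

lemma adapted_FA: "adapted_proc M F T X \<Longrightarrow> t \<in> {0..T} \<Longrightarrow> X t \<in> borel_measurable (FA t)"
  unfolding adapted_proc_def by (rule bspec[OF conjunct1])

lemma adapted_meas: "adapted_proc M F T X \<Longrightarrow> t \<in> {0..T} \<Longrightarrow> X t \<in> borel_measurable M"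
  by (rule FA_meas[OF adapted_FA])

text \<open>Formulated for three arguments so that \<open>b\<close>, \<open>f\<close> and
  \<open>\<sigma>\<close> are all covered; where a coefficient has fewer arguments, its bound is
  enlarged by the additional nonnegative terms.\<close>

lemma msq_growth:
  fixes h :: "'w \<Rightarrow> 'z::real_normed_vector" and p :: "'w \<Rightarrow> real^'i" and q :: "'w \<Rightarrow> real^'j" and r :: "'w \<Rightarrow> real^'d^'k"
  assumes [measurable]: "p \<in> borel_measurable M" "q \<in> borel_measurable M" "r \<in> borel_measurable M"
    and g: "g \<ge> 0" "a \<ge> 0"
    and le: "\<And>\<omega>. \<omega> \<in> space M \<Longrightarrow> (norm (h \<omega>))\<^sup>2 \<le> g * (a + (norm (p \<omega>))\<^sup>2 + (norm (q \<omega>))\<^sup>2 + (norm (r \<omega>))\<^sup>2)"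
    and b: "msq p \<le> P" "msq q \<le> Q" "msq r \<le> R"
  shows "msq h \<le> ennreal g * (ennreal a + P + Q + R)"
proof -
  have "msq h \<le> (\<integral>\<^sup>+\<omega>. ennreal g * (ennreal a + nsq (p \<omega>) + nsq (q \<omega>) + nsq (r \<omega>)) \<partial>M)"
  proof (rule nn_integral_mono)
    fix \<omega> assume "\<omega> \<in> space M"
    from ennreal_leI[OF le[OF this]]
    show "nsq (h \<omega>) \<le> ennreal g * (ennreal a + nsq (p \<omega>) + nsq (q \<omega>) + nsq (r \<omega>))"
      using g by (simp add: ennreal_mult)
  qed
  also have "\<dots> = ennreal g * (ennreal a + msq p + msq q + msq r)"
    by (simp add: nn_integral_cmult nn_integral_add emeasure_space_1)
  also have "\<dots> \<le> ennreal g * (ennreal a + P + Q + R)"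
    by (intro mult_left_mono add_mono b order.refl) auto
  finally show ?thesis .
qed

text \<open>Young's inequality with a free weight. Taking \<open>\<kappa> = sqrt h\<close> turns a
  second moment of order \<open>h\<close> into a first moment of order \<open>sqrt h\<close>; taking
  \<open>\<kappa> = 1\<close> gives finiteness of the first moment.\<close>

lemma l1_le:
  fixes p :: "'w \<Rightarrow> 'z::{second_countable_topology,real_normed_vector}"
  assumes [measurable]: "p \<in> borel_measurable M" and k: "\<kappa> > 0"
  shows "(\<integral>\<^sup>+\<omega>. ennreal (norm (p \<omega>)) \<partial>M) \<le> ennreal \<kappa> + ennreal (1 / \<kappa>) * msq p"
proof -
  have "(\<integral>\<^sup>+\<omega>. ennreal (norm (p \<omega>)) \<partial>M) \<le> (\<integral>\<^sup>+\<omega>. ennreal \<kappa> + ennreal (1 / \<kappa>) * nsq (p \<omega>) \<partial>M)"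
  proof (rule nn_integral_mono)
    fix \<omega>
    have "2 * norm (p \<omega>) * \<kappa> \<le> (norm (p \<omega>))\<^sup>2 + \<kappa>\<^sup>2" by (rule sum_squares_bound)
    then have "2 * (norm (p \<omega>) * \<kappa>) \<le> (norm (p \<omega>))\<^sup>2 + \<kappa> * \<kappa>" by (simp add: power2_eq_square mult.assoc)
    moreover have "0 \<le> norm (p \<omega>) * \<kappa>" using k by simp
    ultimately have "norm (p \<omega>) * \<kappa> \<le> (norm (p \<omega>))\<^sup>2 + \<kappa> * \<kappa>" by linarith
    then have "norm (p \<omega>) \<le> \<kappa> + (1 / \<kappa>) * (norm (p \<omega>))\<^sup>2" using k by (simp add: field_simps)
    then have "ennreal (norm (p \<omega>)) \<le> ennreal (\<kappa> + (1 / \<kappa>) * (norm (p \<omega>))\<^sup>2)" by (rule ennreal_leI)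
    then show "ennreal (norm (p \<omega>)) \<le> ennreal \<kappa> + ennreal (1 / \<kappa>) * nsq (p \<omega>)"
      using k by (simp add: ennreal_mult[symmetric])
  qed
  also have "\<dots> = ennreal \<kappa> + ennreal (1 / \<kappa>) * msq p" by (simp add: nn_integral_add nn_integral_cmult emeasure_space_1)
  finally show ?thesis .
qed

lemma l1_add_le:
  fixes p q :: "'w \<Rightarrow> 'z::{second_countable_topology,real_normed_vector}"
  assumes [measurable]: "p \<in> borel_measurable M" "q \<in> borel_measurable M"
  shows "(\<integral>\<^sup>+\<omega>. ennreal (norm (p \<omega> + q \<omega>)) \<partial>M) \<le> (\<integral>\<^sup>+\<omega>. ennreal (norm (p \<omega>)) \<partial>M) + (\<integral>\<^sup>+\<omega>. ennreal (norm (q \<omega>)) \<partial>M)"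
proof -
  have "(\<integral>\<^sup>+\<omega>. ennreal (norm (p \<omega> + q \<omega>)) \<partial>M) \<le> (\<integral>\<^sup>+\<omega>. ennreal (norm (p \<omega>)) + ennreal (norm (q \<omega>)) \<partial>M)"
    by (intro nn_integral_mono) (simp add: ennreal_plus[symmetric] norm_triangle_ineq del: ennreal_plus)
  then show ?thesis by (simp add: nn_integral_add)
qed

end

section \<open>The controlled system and its Euler scheme\<close>

text \<open>
  \<open>L\<close> merges all constants of the theorem. The time increment enters the squared Lipschitz conditions
  to the first power only, which on a bounded time interval is weaker than the square and is
  the same for all coefficients.
\<close>

locale fbsde = brownian M W T for M :: "'w measure" and W :: "real \<Rightarrow> 'w \<Rightarrow> real^'d::finite" and T :: real +
  fixes b :: "real \<Rightarrow> real^'n::finite \<Rightarrow> real^'m::finite \<Rightarrow> real^'n"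
    and \<sigma> :: "real \<Rightarrow> real^'n \<Rightarrow> real^'d^'n"
    and f :: "real \<Rightarrow> real^'n \<Rightarrow> real^'m \<Rightarrow> real^'d^'m \<Rightarrow> real^'m"
    and x :: "real^'n" and y :: "real^'m" and Z :: "real \<Rightarrow> 'w \<Rightarrow> real^'d^'m"
    and X :: "real \<Rightarrow> 'w \<Rightarrow> real^'n" and Y :: "real \<Rightarrow> 'w \<Rightarrow> real^'m" and L :: real
  assumes L: "L > 0"
    and b_sq: "t \<in> {0..T} \<Longrightarrow> t' \<in> {0..T} \<Longrightarrow>
      (norm (b t z v - b t' z' v'))\<^sup>2 \<le> L * (\<bar>t - t'\<bar> + (norm (z - z'))\<^sup>2 + (norm (v - v'))\<^sup>2)"
    and f_sq: "t \<in> {0..T} \<Longrightarrow> t' \<in> {0..T} \<Longrightarrow>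
      (norm (f t z v r - f t' z' v' r'))\<^sup>2 \<le> L * (\<bar>t - t'\<bar> + (norm (z - z'))\<^sup>2 + (norm (v - v'))\<^sup>2 + (norm (r - r'))\<^sup>2)"
    and \<sigma>_row: "t \<in> {0..T} \<Longrightarrow> t' \<in> {0..T} \<Longrightarrow>
      (norm (\<sigma> t z $ i - \<sigma> t' z' $ i))\<^sup>2 \<le> L * (\<bar>t - t'\<bar> + \<bar>z $ i - z' $ i\<bar>)"
    and Z_ad: "adapted_proc M (aug_filt M W) T Z"
    and Z_L2: "t \<in> {0..T} \<Longrightarrow> msq (Z t) < \<infinity>"
    and Z_reg: "s \<in> {0..T} \<Longrightarrow> t \<in> {0..T} \<Longrightarrow> msq (\<lambda>\<omega>. Z t \<omega> - Z s \<omega>) \<le> ennreal (L * \<bar>t - s\<bar>)"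
    and E2: "E2_sol M W (aug_filt M W) T b \<sigma> f x y Z X Y"
begin

text \<open>Nothing is assumed about the coefficients at times outside \<open>{0..T}\<close>.\<close>

definition clamp :: "real \<Rightarrow> real" where
  "clamp t = max 0 (min t T)"

lemma clamp: "clamp t \<in> {0..T}" "\<bar>clamp t - clamp s\<bar> \<le> \<bar>t - s\<bar>" "t \<in> {0..T} \<Longrightarrow> clamp t = t"
  using T unfolding clamp_def by auto

lemma \<sigma>_sq:
  assumes "t \<in> {0..T}" "t' \<in> {0..T}"
  shows "(norm (\<sigma> t z - \<sigma> t' z'))\<^sup>2 \<le> (\<Sum>i\<in>UNIV. L * (\<bar>t - t'\<bar> + \<bar>z $ i - z' $ i\<bar>))"
  unfolding norm_vec_sq[of "\<sigma> t z - \<sigma> t' z'"] using \<sigma>_row[OF assms] by (intro sum_mono) simp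

lemma \<sigma>_sq_norm:
  assumes "t \<in> {0..T}" "t' \<in> {0..T}"
  shows "(norm (\<sigma> t z - \<sigma> t' z'))\<^sup>2 \<le> L * real CARD('n) * (\<bar>t - t'\<bar> + norm (z - z'))"
proof -
  have "(\<Sum>i\<in>UNIV. L * (\<bar>t - t'\<bar> + \<bar>z $ i - z' $ i\<bar>)) \<le> (\<Sum>i\<in>(UNIV::'n set). L * (\<bar>t - t'\<bar> + norm (z - z')))"
    using L component_le_norm_cart[of "z - z'"] by (intro sum_mono mult_left_mono add_left_mono) auto
  then show ?thesis using \<sigma>_sq[OF assms, of z z'] by (simp add: algebra_simps)
qed

lemma b_cont: "continuous_on UNIV (\<lambda>p. b (clamp (fst p)) (fst (snd p)) (snd (snd p)))"
proof (rule continuous_of_sq_bound)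
  fix p q :: "real \<times> (real^'n) \<times> (real^'m)"
  show "(norm (b (clamp (fst p)) (fst (snd p)) (snd (snd p)) - b (clamp (fst q)) (fst (snd q)) (snd (snd q))))\<^sup>2 \<le>
    L * (\<bar>fst p - fst q\<bar> + (norm (fst (snd p) - fst (snd q)))\<^sup>2 + (norm (snd (snd p) - snd (snd q)))\<^sup>2)"
    using L clamp(2)[of "fst p" "fst q"] by (intro order_trans[OF b_sq] clamp mult_left_mono add_mono) auto
qed (auto intro!: continuous_intros)

lemma f_cont: "continuous_on UNIV (\<lambda>p. f (clamp (fst p)) (fst (snd p)) (fst (snd (snd p))) (snd (snd (snd p))))"
proof (rule continuous_of_sq_bound)
  fix p q :: "real \<times> (real^'n) \<times> (real^'m) \<times> (real^'d^'m)"
  show "(norm (f (clamp (fst p)) (fst (snd p)) (fst (snd (snd p))) (snd (snd (snd p))) - f (clamp (fst q)) (fst (snd q)) (fst (snd (snd q))) (snd (snd (snd q)))))\<^sup>2 \<le>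
    L * (\<bar>fst p - fst q\<bar> + (norm (fst (snd p) - fst (snd q)))\<^sup>2 + (norm (fst (snd (snd p)) - fst (snd (snd q))))\<^sup>2 + (norm (snd (snd (snd p)) - snd (snd (snd q))))\<^sup>2)"
    using L clamp(2)[of "fst p" "fst q"] by (intro order_trans[OF f_sq] clamp mult_left_mono add_mono) auto
qed (auto intro!: continuous_intros)

lemma \<sigma>_cont: "continuous_on UNIV (\<lambda>p. \<sigma> (clamp (fst p)) (snd p))"
proof (rule continuous_of_sq_bound)
  fix p q :: "real \<times> (real^'n)"
  show "(norm (\<sigma> (clamp (fst p)) (snd p) - \<sigma> (clamp (fst q)) (snd q)))\<^sup>2 \<le> L * real CARD('n) * (\<bar>fst p - fst q\<bar> + norm (snd p - snd q))"
    using L clamp(2)[of "fst p" "fst q"] by (intro order_trans[OF \<sigma>_sq_norm] clamp mult_left_mono add_mono) auto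
qed (auto intro!: continuous_intros)

lemma fst_lT: "(\<lambda>p. fst p) \<in> borel_measurable (lT \<Otimes>\<^sub>M M)"
  by (rule measurable_compose[OF measurable_fst], rule measurable_restrict_space1) simp

text \<open>On \<open>{0..T}\<close> clamping is the identity, so the coefficient may be replaced by
  its continuous clamped version.\<close>

lemma joint_meas_b:
  fixes P :: "real \<Rightarrow> 'w \<Rightarrow> real^'n" and Q :: "real \<Rightarrow> 'w \<Rightarrow> real^'m"
  assumes "joint_meas P" "joint_meas Q" shows "joint_meas (\<lambda>s \<omega>. b s (P s \<omega>) (Q s \<omega>))"
proof -
  have "(\<lambda>p. b (clamp (fst p)) (P (fst p) (snd p)) (Q (fst p) (snd p))) \<in> borel_measurable (lT \<Otimes>\<^sub>M M)"
    using measurable_compose[OF borel_measurable_Pair[OF fst_lT borel_measurable_Pair[OF assms[unfolded joint_meas_def split_beta']]] borel_measurable_continuous_onI[OF b_cont]]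
    by simp
  also have "?this \<longleftrightarrow> (\<lambda>p. b (fst p) (P (fst p) (snd p)) (Q (fst p) (snd p))) \<in> borel_measurable (lT \<Otimes>\<^sub>M M)"
    by (intro measurable_cong) (auto simp: space_pair_measure space_restrict_space clamp(3))
  finally show ?thesis unfolding joint_meas_def split_beta' .
qed

lemma joint_meas_f:
  fixes P :: "real \<Rightarrow> 'w \<Rightarrow> real^'n" and Q :: "real \<Rightarrow> 'w \<Rightarrow> real^'m" and R :: "real \<Rightarrow> 'w \<Rightarrow> real^'d^'m"
  assumes "joint_meas P" "joint_meas Q" "joint_meas R" shows "joint_meas (\<lambda>s \<omega>. f s (P s \<omega>) (Q s \<omega>) (R s \<omega>))"
proof -
  have "(\<lambda>p. f (clamp (fst p)) (P (fst p) (snd p)) (Q (fst p) (snd p)) (R (fst p) (snd p))) \<in> borel_measurable (lT \<Otimes>\<^sub>M M)"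
    using measurable_compose[OF borel_measurable_Pair[OF fst_lT borel_measurable_Pair[OF assms(1)[unfolded joint_meas_def split_beta'] borel_measurable_Pair[OF assms(2,3)[unfolded joint_meas_def split_beta']]]] borel_measurable_continuous_onI[OF f_cont]]
    by simp
  also have "?this \<longleftrightarrow> (\<lambda>p. f (fst p) (P (fst p) (snd p)) (Q (fst p) (snd p)) (R (fst p) (snd p))) \<in> borel_measurable (lT \<Otimes>\<^sub>M M)"
    by (intro measurable_cong) (auto simp: space_pair_measure space_restrict_space clamp(3))
  finally show ?thesis unfolding joint_meas_def split_beta' .
qed

lemma joint_meas_\<sigma>:
  fixes P :: "real \<Rightarrow> 'w \<Rightarrow> real^'n"
  assumes "joint_meas P" shows "joint_meas (\<lambda>s \<omega>. \<sigma> s (P s \<omega>))"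
proof -
  have "(\<lambda>p. \<sigma> (clamp (fst p)) (P (fst p) (snd p))) \<in> borel_measurable (lT \<Otimes>\<^sub>M M)"
    using measurable_compose[OF borel_measurable_Pair[OF fst_lT assms[unfolded joint_meas_def split_beta']] borel_measurable_continuous_onI[OF \<sigma>_cont]]
    by simp
  also have "?this \<longleftrightarrow> (\<lambda>p. \<sigma> (fst p) (P (fst p) (snd p))) \<in> borel_measurable (lT \<Otimes>\<^sub>M M)"
    by (intro measurable_cong) (auto simp: space_pair_measure space_restrict_space clamp(3))
  finally show ?thesis unfolding joint_meas_def split_beta' .
qed

lemma \<sigma>_measurable: "t \<in> {0..T} \<Longrightarrow> \<sigma> t \<in> borel_measurable borel"
proof -
  assume t: "t \<in> {0..T}"
  have "continuous_on UNIV (\<lambda>z. \<sigma> (clamp (fst (t, z))) (snd (t, z)))"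
    by (rule continuous_on_compose2[OF \<sigma>_cont]) (auto intro!: continuous_intros)
  then show ?thesis using clamp(3)[OF t] by (intro borel_measurable_continuous_onI) simp
qed

lemma growth:
  obtains G where "G > 0"
    and "\<And>t z v. t \<in> {0..T} \<Longrightarrow> (norm (b t z v))\<^sup>2 \<le> G * (1 + (norm z)\<^sup>2 + (norm v)\<^sup>2)"
    and "\<And>t z v r. t \<in> {0..T} \<Longrightarrow> (norm (f t z v r))\<^sup>2 \<le> G * (1 + (norm z)\<^sup>2 + (norm v)\<^sup>2 + (norm r)\<^sup>2)"
    and "\<And>t z. t \<in> {0..T} \<Longrightarrow> (norm (\<sigma> t z))\<^sup>2 \<le> G * (1 + (norm z)\<^sup>2)"
proof -
  define n where "n = real CARD('n)"
  define a where "a = (norm (b 0 0 0))\<^sup>2 + (norm (f 0 0 0 0))\<^sup>2 + (norm (\<sigma> 0 0))\<^sup>2"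
  \<comment> \<open>\<open>a\<close> collects the values at the origin and the factors 2 come from
    splitting them off. \<open>T\<close> bounds the time increment, the added 1 pays for replacing
    \<open>norm z\<close> by its square in the bound for \<open>\<sigma>\<close>, and
    \<open>1 + n\<close> accounts for the rows of \<open>\<sigma>\<close>.\<close>
  define G where "G = 2 * a + 2 * L * (1 + n) * (T + 1)"
  have n: "n \<ge> 0" unfolding n_def by simp
  have a: "a \<ge> 0" "(norm (b 0 0 0))\<^sup>2 \<le> a" "(norm (f 0 0 0 0))\<^sup>2 \<le> a" "(norm (\<sigma> 0 0))\<^sup>2 \<le> a" unfolding a_def by auto
  have n1: "1 + n > 0" using n by simp
  have "0 < 2 * L * (1 + n) * (T + 1)" using L n1 T by simp
  then have G: "G > 0" unfolding G_def using a(1) by linarith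
  have z0: "0 \<in> {0..T}" using T by simp
  have key: "u \<le> G * (1 + w)" if u: "u \<le> 2 * a + 2 * (L * (1 + n) * (T + 1 + w))" and w: "w \<ge> 0" for u w
  proof -
    have "G * (1 + w) = (2 * a + 2 * (L * (1 + n) * (T + 1 + w))) + (2 * a * w + 2 * L * (1 + n) * T * w)"
      unfolding G_def by (simp add: algebra_simps)
    moreover have "0 \<le> 2 * a * w + 2 * L * (1 + n) * T * w" using a(1) w L n T by (intro add_nonneg_nonneg mult_nonneg_nonneg) auto
    ultimately show ?thesis using u by linarith
  qed
  have weak: "L * (s + w) \<le> L * (1 + n) * (T + 1 + w)" if "0 \<le> s" "s \<le> T" "w \<ge> 0" for s w
  proof -
    have "L * (s + w) \<le> L * (T + 1 + w)" using L that by (intro mult_left_mono) auto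
    also have "\<dots> \<le> (L * (1 + n)) * (T + 1 + w)" using L n that T by (intro mult_right_mono) auto
    finally show ?thesis .
  qed
  show ?thesis
  proof (rule that[OF G])
    fix t z v assume t: "t \<in> {0..T}"
    have "(norm (b t z v))\<^sup>2 \<le> 2 * (norm (b t z v - b 0 0 0))\<^sup>2 + 2 * (norm (b 0 0 0))\<^sup>2"
      using norm_sum_sq_le[of "b t z v - b 0 0 0" "b 0 0 0"] by simp
    also have "\<dots> \<le> 2 * a + 2 * (L * (1 + n) * (T + 1 + ((norm z)\<^sup>2 + (norm v)\<^sup>2)))"
      using b_sq[OF t z0, of z v 0 0] a(2) weak[of t "(norm z)\<^sup>2 + (norm v)\<^sup>2"] t by (simp add: add.assoc)
    finally show "(norm (b t z v))\<^sup>2 \<le> G * (1 + (norm z)\<^sup>2 + (norm v)\<^sup>2)" using key[of _ "(norm z)\<^sup>2 + (norm v)\<^sup>2"] by (simp add: add.assoc)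
  next
    fix t z v r assume t: "t \<in> {0..T}"
    have "(norm (f t z v r))\<^sup>2 \<le> 2 * (norm (f t z v r - f 0 0 0 0))\<^sup>2 + 2 * (norm (f 0 0 0 0))\<^sup>2"
      using norm_sum_sq_le[of "f t z v r - f 0 0 0 0" "f 0 0 0 0"] by simp
    also have "\<dots> \<le> 2 * a + 2 * (L * (1 + n) * (T + 1 + ((norm z)\<^sup>2 + (norm v)\<^sup>2 + (norm r)\<^sup>2)))"
      using f_sq[OF t z0, of z v r 0 0 0] a(3) weak[of t "(norm z)\<^sup>2 + (norm v)\<^sup>2 + (norm r)\<^sup>2"] t by (simp add: add.assoc)
    finally show "(norm (f t z v r))\<^sup>2 \<le> G * (1 + (norm z)\<^sup>2 + (norm v)\<^sup>2 + (norm r)\<^sup>2)" using key[of _ "(norm z)\<^sup>2 + (norm v)\<^sup>2 + (norm r)\<^sup>2"] by (simp add: add.assoc)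
  next
    fix t and z :: "real^'n" assume t: "t \<in> {0..T}"
    have nz: "norm z \<le> 1 + (norm z)\<^sup>2" using sum_squares_bound[of 1 "norm z"] norm_ge_zero[of z] unfolding power_one by linarith
    have "(norm (\<sigma> t z - \<sigma> 0 0))\<^sup>2 \<le> L * n * (t + norm z)" using \<sigma>_sq_norm[OF t z0, of z 0] t unfolding n_def by simp
    also have "\<dots> \<le> L * (1 + n) * (T + 1 + (norm z)\<^sup>2)"     proof (rule mult_mono)
      show "t + norm z \<le> T + 1 + (norm z)\<^sup>2" using t nz by auto
    qed (use L n t in auto)
    finally have s: "(norm (\<sigma> t z - \<sigma> 0 0))\<^sup>2 \<le> L * (1 + n) * (T + 1 + (norm z)\<^sup>2)" .
    have "(norm (\<sigma> t z))\<^sup>2 \<le> 2 * (norm (\<sigma> t z - \<sigma> 0 0))\<^sup>2 + 2 * (norm (\<sigma> 0 0))\<^sup>2"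
      using norm_sum_sq_le[of "\<sigma> t z - \<sigma> 0 0" "\<sigma> 0 0"] by simp
    also have "\<dots> \<le> 2 * a + 2 * (L * (1 + n) * (T + 1 + (norm z)\<^sup>2))" using s a(4) by linarith
    finally show "(norm (\<sigma> t z))\<^sup>2 \<le> G * (1 + (norm z)\<^sup>2)" by (rule key) simp
  qed
qed

lemma X_ad: "adapted_proc M F T X" and Y_ad: "adapted_proc M F T Y"
  using E2 unfolding E2_sol_def by blast+

lemma set_lint_uminus: "(LINT s:A|lborel. - h s) = - (LINT s:A|lborel. h s :: real^'i)"
  by (simp add: set_lebesgue_integral_def)

lemma set_integrable_uminus: "set_integrable lborel A h \<Longrightarrow> set_integrable lborel A (\<lambda>s. - h s :: real^'i)"
  by (simp add: set_integrable_def)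

lemma joint_meas_uminus: "joint_meas h \<Longrightarrow> joint_meas (\<lambda>s \<omega>. - h s \<omega> :: real^'i)"
  unfolding joint_meas_def by (auto simp: split_beta')

text \<open>The controlled \<open>Y\<close> runs forward in time, so its drift is
  \<open>- f\<close>.\<close>

lemma exact_procs:
  obtains IX IY where "ito_proc x (\<lambda>s \<omega>. b s (X s \<omega>) (Y s \<omega>)) (\<lambda>s \<omega>. \<sigma> s (X s \<omega>)) X IX"
    and "ito_proc y (\<lambda>s \<omega>. - f s (X s \<omega>) (Y s \<omega>) (Z s \<omega>)) Z Y IY"
proof -
  note j = adapted_joint_meas[OF X_ad] adapted_joint_meas[OF Y_ad] adapted_joint_meas[OF Z_ad]
  obtain IX IY where I: "is_ito_integral M W F T (\<lambda>s \<omega>. \<sigma> s (X s \<omega>)) IX" "is_ito_integral M W F T (\<lambda>s \<omega>. Z s \<omega>) IY"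
    and AE: "\<And>t. t \<in> {0..T} \<Longrightarrow> AE \<omega> in M.
          set_integrable lborel {0..t} (\<lambda>s. b s (X s \<omega>) (Y s \<omega>)) \<and>
          set_integrable lborel {0..t} (\<lambda>s. f s (X s \<omega>) (Y s \<omega>) (Z s \<omega>)) \<and>
          X t \<omega> = x + (LINT s:{0..t}|lborel. b s (X s \<omega>) (Y s \<omega>)) + IX t \<omega> \<and>
          Y t \<omega> = y - (LINT s:{0..t}|lborel. f s (X s \<omega>) (Y s \<omega>) (Z s \<omega>)) + IY t \<omega>"
    using E2 unfolding E2_sol_def by blast
  show ?thesis
  proof (rule that)
    show "ito_proc x (\<lambda>s \<omega>. b s (X s \<omega>) (Y s \<omega>)) (\<lambda>s \<omega>. \<sigma> s (X s \<omega>)) X IX"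
    proof (rule ito_procI[OF joint_meas_b[OF j(1,2)] joint_meas_\<sigma>[OF j(1)] I(1) adapted_meas[OF X_ad]])
      fix t assume "t \<in> {0..T}"
      from AE[OF this] show "AE \<omega> in M. set_integrable lborel {0..t} (\<lambda>s. b s (X s \<omega>) (Y s \<omega>)) \<and>
         X t \<omega> = x + (LINT s:{0..t}|lborel. b s (X s \<omega>) (Y s \<omega>)) + IX t \<omega>" by eventually_elim blast
    qed
    show "ito_proc y (\<lambda>s \<omega>. - f s (X s \<omega>) (Y s \<omega>) (Z s \<omega>)) Z Y IY"
    proof (rule ito_procI[OF joint_meas_uminus[OF joint_meas_f[OF j]] j(3) I(2) adapted_meas[OF Y_ad]])
      fix t assume "t \<in> {0..T}"
      from AE[OF this] show "AE \<omega> in M. set_integrable lborel {0..t} (\<lambda>s. - f s (X s \<omega>) (Y s \<omega>) (Z s \<omega>)) \<and>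
         Y t \<omega> = y + (LINT s:{0..t}|lborel. - f s (X s \<omega>) (Y s \<omega>) (Z s \<omega>)) + IY t \<omega>"
        unfolding set_lint_uminus by eventually_elim (auto intro: set_integrable_uminus)
    qed
  qed
qed

lemma euler_procs:
  assumes N: "N \<ge> 1" and E3: "E3_sol N M W (aug_filt M W) T b \<sigma> f x y Z Xh Yh"
  obtains IX IY where "ito_proc x (\<lambda>s \<omega>. b (grid N T s) (Xh (grid N T s) \<omega>) (Yh (grid N T s) \<omega>)) (\<lambda>s \<omega>. \<sigma> (grid N T s) (Xh (grid N T s) \<omega>)) Xh IX"
    and "ito_proc y (\<lambda>s \<omega>. - f (grid N T s) (Xh (grid N T s) \<omega>) (Yh (grid N T s) \<omega>) (Z (grid N T s) \<omega>)) (\<lambda>s. Z (grid N T s)) Yh IY"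
    and "adapted_proc M F T Xh" "adapted_proc M F T Yh"
proof -
  let ?g = "grid N T"
  have ad: "adapted_proc M F T Xh" "adapted_proc M F T Yh" using E3 unfolding E3_sol_def by blast+
  note j = adapted_joint_meas[OF ad(1)] adapted_joint_meas[OF ad(2)] adapted_joint_meas[OF Z_ad]
  obtain IX IY where I: "is_ito_integral M W F T (\<lambda>s \<omega>. \<sigma> (?g s) (Xh (?g s) \<omega>)) IX" "is_ito_integral M W F T (\<lambda>s \<omega>. Z (?g s) \<omega>) IY"
    and AE: "\<And>t. t \<in> {0..T} \<Longrightarrow> AE \<omega> in M.
          set_integrable lborel {0..t} (\<lambda>s. b (?g s) (Xh (?g s) \<omega>) (Yh (?g s) \<omega>)) \<and>
          set_integrable lborel {0..t} (\<lambda>s. f (?g s) (Xh (?g s) \<omega>) (Yh (?g s) \<omega>) (Z (?g s) \<omega>)) \<and>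
          Xh t \<omega> = x + (LINT s:{0..t}|lborel. b (?g s) (Xh (?g s) \<omega>) (Yh (?g s) \<omega>)) + IX t \<omega> \<and>
          Yh t \<omega> = y - (LINT s:{0..t}|lborel. f (?g s) (Xh (?g s) \<omega>) (Yh (?g s) \<omega>) (Z (?g s) \<omega>)) + IY t \<omega>"
    using E3 unfolding E3_sol_def by blast
  show ?thesis
  proof (rule that[OF _ _ ad])
    show "ito_proc x (\<lambda>s \<omega>. b (?g s) (Xh (?g s) \<omega>) (Yh (?g s) \<omega>)) (\<lambda>s \<omega>. \<sigma> (?g s) (Xh (?g s) \<omega>)) Xh IX"
    proof (rule ito_procI[OF joint_meas_grid[OF N joint_meas_b[OF j(1,2)]] joint_meas_grid[OF N joint_meas_\<sigma>[OF j(1)]] I(1) adapted_meas[OF ad(1)]])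
      fix t assume "t \<in> {0..T}"
      from AE[OF this] show "AE \<omega> in M. set_integrable lborel {0..t} (\<lambda>s. b (?g s) (Xh (?g s) \<omega>) (Yh (?g s) \<omega>)) \<and>
         Xh t \<omega> = x + (LINT s:{0..t}|lborel. b (?g s) (Xh (?g s) \<omega>) (Yh (?g s) \<omega>)) + IX t \<omega>" by eventually_elim blast
    qed
    show "ito_proc y (\<lambda>s \<omega>. - f (?g s) (Xh (?g s) \<omega>) (Yh (?g s) \<omega>) (Z (?g s) \<omega>)) (\<lambda>s. Z (?g s)) Yh IY"
    proof (rule ito_procI[OF joint_meas_grid[OF N joint_meas_uminus[OF joint_meas_f[OF j]]] joint_meas_grid[OF N j(3)] I(2) adapted_meas[OF ad(2)]])
      fix t assume "t \<in> {0..T}"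
      from AE[OF this] show "AE \<omega> in M. set_integrable lborel {0..t} (\<lambda>s. - f (?g s) (Xh (?g s) \<omega>) (Yh (?g s) \<omega>) (Z (?g s) \<omega>)) \<and>
         Yh t \<omega> = y + (LINT s:{0..t}|lborel. - f (?g s) (Xh (?g s) \<omega>) (Yh (?g s) \<omega>) (Z (?g s) \<omega>)) + IY t \<omega>"
        unfolding set_lint_uminus by eventually_elim (auto intro: set_integrable_uminus)
    qed
  qed
qed

text \<open>\<open>b\<close> involves \<open>Y\<close> and \<open>f\<close> involves
  \<open>X\<close>, so the two moments are bounded jointly. \<open>Z\<close> enters as the source
  \<open>\<zeta>\<close>, integrable because \<open>Z\<close> is a stochastic integrand. A bound on
  its second moments uniform in time follows from the value at 0 and the mean-square
  regularity.\<close>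

lemma moments:
  obtains C where "C > 0" "\<And>t. t \<in> {0..T} \<Longrightarrow> msq (X t) \<le> ennreal C" "\<And>t. t \<in> {0..T} \<Longrightarrow> msq (Y t) \<le> ennreal C"
    "\<And>t. t \<in> {0..T} \<Longrightarrow> msq (Z t) \<le> ennreal C"
proof -
  obtain IX IY where PX: "ito_proc x (\<lambda>s \<omega>. b s (X s \<omega>) (Y s \<omega>)) (\<lambda>s \<omega>. \<sigma> s (X s \<omega>)) X IX"
    and PY: "ito_proc y (\<lambda>s \<omega>. - f s (X s \<omega>) (Y s \<omega>) (Z s \<omega>)) Z Y IY" by (rule exact_procs)
  obtain G where G: "G > 0"
    "\<And>t z v. t \<in> {0..T} \<Longrightarrow> (norm (b t z v))\<^sup>2 \<le> G * (1 + (norm z)\<^sup>2 + (norm v)\<^sup>2)"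
    "\<And>t z v r. t \<in> {0..T} \<Longrightarrow> (norm (f t z v r))\<^sup>2 \<le> G * (1 + (norm z)\<^sup>2 + (norm v)\<^sup>2 + (norm r)\<^sup>2)"
    by (rule growth) blast
  note j = adapted_joint_meas[OF X_ad] adapted_joint_meas[OF Y_ad] adapted_joint_meas[OF Z_ad]
  have T0: "0 \<in> {0..T}" "0 \<le> T" using T by auto
  have jz: "joint_meas (\<lambda>s \<omega>. nsq (Z s \<omega>))" by (rule joint_meas_norm_sq[OF j(3)])
  have "\<exists>C\<ge>0. \<forall>t\<in>{0..T}. msq (X t) + msq (Y t) \<le> ennreal C"
  proof (rule moment_coupled[OF PX PY j(1,2), where c = "2 * G" and \<zeta> = "\<lambda>s \<omega>. ennreal G * nsq (Z s \<omega>)"])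
    show "joint_meas (\<lambda>s \<omega>. ennreal G * nsq (Z s \<omega>))" by (intro joint_meas_ennreal_mult joint_meas_const jz)
    show "EI 0 T (\<lambda>s \<omega>. ennreal G * nsq (Z s \<omega>)) < \<infinity>"
      unfolding EI_cmult[OF jz order.refl order.refl]
      using ito_integrand_finite[OF ito_procD(3,2)[OF PY]] by (simp add: ennreal_mult_less_top)
    fix s \<omega> assume s: "s \<in> {0..T}"
    have "nsq (b s (X s \<omega>) (Y s \<omega>)) + nsq (- f s (X s \<omega>) (Y s \<omega>) (Z s \<omega>)) \<le>
      ennreal (G * (1 + (norm (X s \<omega>))\<^sup>2 + (norm (Y s \<omega>))\<^sup>2)) + ennreal (G * (1 + (norm (X s \<omega>))\<^sup>2 + (norm (Y s \<omega>))\<^sup>2 + (norm (Z s \<omega>))\<^sup>2))"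
      unfolding norm_minus_cancel by (intro add_mono ennreal_leI G s)
    also have "\<dots> = ennreal (2 * G * (1 + ((norm (X s \<omega>))\<^sup>2 + (norm (Y s \<omega>))\<^sup>2)) + G * (norm (Z s \<omega>))\<^sup>2)"
      using G(1) by (simp add: ennreal_plus[symmetric] algebra_simps del: ennreal_plus)
    also have "\<dots> = ennreal (2 * G) * (1 + (nsq (X s \<omega>) + nsq (Y s \<omega>))) + ennreal G * nsq (Z s \<omega>)"
      using G(1) by (simp add: ennreal_mult)
    finally show "nsq (b s (X s \<omega>) (Y s \<omega>)) + nsq (- f s (X s \<omega>) (Y s \<omega>) (Z s \<omega>)) \<le>
      ennreal (2 * G) * (1 + (nsq (X s \<omega>) + nsq (Y s \<omega>))) + ennreal G * nsq (Z s \<omega>)" .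
  qed (use G(1) in auto)
  then obtain C where C: "C \<ge> 0" "\<And>t. t \<in> {0..T} \<Longrightarrow> msq (X t) + msq (Y t) \<le> ennreal C" by blast
  define CZ where "CZ = 2 * (L * T) + 2 * enn2real (msq (Z 0))"
  have CZ: "CZ \<ge> 0" unfolding CZ_def using L T by simp
  have Zb: "msq (Z t) \<le> ennreal CZ" if t: "t \<in> {0..T}" for t
  proof -
    have "msq (Z t) = msq (\<lambda>\<omega>. (Z t \<omega> - Z 0 \<omega>) + Z 0 \<omega>)" by simp
    also have "\<dots> \<le> 2 * msq (\<lambda>\<omega>. Z t \<omega> - Z 0 \<omega>) + 2 * msq (Z 0)"
      using adapted_meas[OF Z_ad t] adapted_meas[OF Z_ad T0(1)] by (intro nn_sq_sum_le borel_measurable_diff)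
    also have "\<dots> \<le> 2 * ennreal (L * T) + 2 * msq (Z 0)"
      using t L by (intro add_mono mult_left_mono order_trans[OF Z_reg[OF T0(1) t]] ennreal_leI) auto
    also have "msq (Z 0) = ennreal (enn2real (msq (Z 0)))" using Z_L2[OF T0(1)] by (simp add: ennreal_enn2real)
    also have "2 * ennreal (L * T) + 2 * ennreal (enn2real (msq (Z 0))) = ennreal CZ"
      unfolding CZ_def using L T by (simp add: ennreal_mult)
    finally show ?thesis .
  qed
  show ?thesis
  proof (rule that[of "C + CZ + 1"])
    fix t assume t: "t \<in> {0..T}"
    have "msq (X t) \<le> msq (X t) + msq (Y t)" "msq (Y t) \<le> msq (X t) + msq (Y t)" by simp_all
    then show "msq (X t) \<le> ennreal (C + CZ + 1)" "msq (Y t) \<le> ennreal (C + CZ + 1)" "msq (Z t) \<le> ennreal (C + CZ + 1)"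
      using C CZ by (auto intro: order_trans[OF Zb[OF t]] order_trans[OF order_trans[OF _ C(2)[OF t]]] ennreal_leI)
  qed (use C CZ in auto)
qed

text \<open>With moments bounded uniformly in time, the drift contributes the square of
  \<open>t - s\<close> and the noise contributes \<open>t - s\<close>; one factor of the former is
  absorbed into \<open>T\<close>.\<close>

lemma regularity:
  obtains C where "C > 0"
    and "\<And>s t. 0 \<le> s \<Longrightarrow> s \<le> t \<Longrightarrow> t \<le> T \<Longrightarrow> msq (\<lambda>\<omega>. X t \<omega> - X s \<omega>) \<le> ennreal (C * (t - s))"
    and "\<And>s t. 0 \<le> s \<Longrightarrow> s \<le> t \<Longrightarrow> t \<le> T \<Longrightarrow> msq (\<lambda>\<omega>. Y t \<omega> - Y s \<omega>) \<le> ennreal (C * (t - s))"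
    and "\<And>s t. 0 \<le> s \<Longrightarrow> s \<le> t \<Longrightarrow> t \<le> T \<Longrightarrow> msq (\<lambda>\<omega>. Z t \<omega> - Z s \<omega>) \<le> ennreal (C * (t - s))"
proof -
  obtain IX IY where PX: "ito_proc x (\<lambda>s \<omega>. b s (X s \<omega>) (Y s \<omega>)) (\<lambda>s \<omega>. \<sigma> s (X s \<omega>)) X IX"
    and PY: "ito_proc y (\<lambda>s \<omega>. - f s (X s \<omega>) (Y s \<omega>) (Z s \<omega>)) Z Y IY" by (rule exact_procs)
  obtain G where G: "G > 0"
    "\<And>t z v. t \<in> {0..T} \<Longrightarrow> (norm (b t z v))\<^sup>2 \<le> G * (1 + (norm z)\<^sup>2 + (norm v)\<^sup>2)"
    "\<And>t z v r. t \<in> {0..T} \<Longrightarrow> (norm (f t z v r))\<^sup>2 \<le> G * (1 + (norm z)\<^sup>2 + (norm v)\<^sup>2 + (norm r)\<^sup>2)"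
    "\<And>t z. t \<in> {0..T} \<Longrightarrow> (norm (\<sigma> t z))\<^sup>2 \<le> G * (1 + (norm z)\<^sup>2)"
    by (rule growth) blast
  obtain C where C: "C > 0" "\<And>t. t \<in> {0..T} \<Longrightarrow> msq (X t) \<le> ennreal C" "\<And>t. t \<in> {0..T} \<Longrightarrow> msq (Y t) \<le> ennreal C"
    "\<And>t. t \<in> {0..T} \<Longrightarrow> msq (Z t) \<le> ennreal C" by (rule moments) blast
  define B where "B = G * (1 + C + C + C) + C"
  have B: "B > 0" unfolding B_def using G(1) C(1) by (intro add_pos_pos mult_pos_pos) auto
  have Beq: "ennreal G * (ennreal 1 + ennreal C + ennreal C + ennreal C) \<le> ennreal B"
  proof -
    have "ennreal 1 + ennreal C + ennreal C + ennreal C = ennreal (1 + C + C + C)"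
      using C(1) by (simp only: ennreal_plus add_nonneg_nonneg less_imp_le zero_le_one)
    then have "ennreal G * (ennreal 1 + ennreal C + ennreal C + ennreal C) = ennreal (G * (1 + C + C + C))"
      using G(1) C(1) by (subst ennreal_mult) (simp_all only: add_nonneg_nonneg less_imp_le zero_le_one)
    also have "\<dots> \<le> ennreal B" unfolding B_def using C(1) by (intro ennreal_leI) simp
    finally show ?thesis .
  qed
  have g: "msq (\<lambda>\<omega>. b r (X r \<omega>) (Y r \<omega>)) \<le> ennreal B" "msq (\<lambda>\<omega>. - f r (X r \<omega>) (Y r \<omega>) (Z r \<omega>)) \<le> ennreal B"
    "msq (\<lambda>\<omega>. \<sigma> r (X r \<omega>)) \<le> ennreal B" "msq (Z r) \<le> ennreal B" if r: "r \<in> {0..T}" for r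
  proof -
    note m = adapted_meas[OF X_ad r] adapted_meas[OF Y_ad r] adapted_meas[OF Z_ad r]
    have G0: "0 \<le> G" using G(1) by simp
    note gr = order_trans[OF msq_growth[OF m G0 zero_le_one _ C(2-4)[OF r]] Beq]
    have add0: "G * u \<le> G * (u + (w::real)\<^sup>2)" for u w using G(1) by simp
    show "msq (\<lambda>\<omega>. b r (X r \<omega>) (Y r \<omega>)) \<le> ennreal B"
      by (rule gr) (rule order_trans[OF G(2)[OF r] add0])
    show "msq (\<lambda>\<omega>. - f r (X r \<omega>) (Y r \<omega>) (Z r \<omega>)) \<le> ennreal B"
      by (rule gr) (simp add: G(3)[OF r])
    show "msq (\<lambda>\<omega>. \<sigma> r (X r \<omega>)) \<le> ennreal B"
      by (rule gr) (rule order_trans[OF G(4)[OF r] order_trans[OF add0 add0]])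
    show "msq (Z r) \<le> ennreal B"
      using G(1) C(1) by (intro order_trans[OF C(4)[OF r]] ennreal_leI) (simp add: B_def)
  qed
  define K where "K = 2 * T * B + 8 * B + L"
  have K: "K > 0" unfolding K_def using T B L by (simp add: add_pos_pos)
  have main: "msq (\<lambda>\<omega>. P t \<omega> - P s \<omega>) \<le> ennreal (K * (t - s))"
    if P: "ito_proc p \<beta> H P I" and st: "0 \<le> s" "s \<le> t" "t \<le> T" and bd: "\<And>r. r \<in> {0..T} \<Longrightarrow> msq (\<beta> r) \<le> ennreal B" "\<And>r. r \<in> {0..T} \<Longrightarrow> msq (H r) \<le> ennreal B"
    for p \<beta> H I s t and P :: "real \<Rightarrow> 'w \<Rightarrow> real^'k"
  proof -
    have "msq (\<lambda>\<omega>. P t \<omega> - P s \<omega>) \<le> ennreal (2 * (t - s)) * EI s t (\<lambda>r \<omega>. nsq (\<beta> r \<omega>)) + 8 * EI s t (\<lambda>r \<omega>. nsq (H r \<omega>))"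
      by (rule ito_proc_bound[OF P st])
    also have "\<dots> \<le> ennreal (2 * T) * ennreal (B * (t - s)) + 8 * ennreal (B * (t - s))"
      using st B bd by (intro add_mono mult_mono mult_left_mono EI_le joint_meas_norm_sq ito_procD(1,2)[OF P] ennreal_leI) auto
    also have "\<dots> = ennreal ((2 * T * B + 8 * B) * (t - s))"
    proof -
      have w: "0 \<le> B * (t - s)" using B st by simp
      have "ennreal (2 * T) * ennreal (B * (t - s)) + 8 * ennreal (B * (t - s)) = (ennreal (2 * T) + ennreal 8) * ennreal (B * (t - s))"
        by (simp add: distrib_right)
      also have "\<dots> = ennreal (2 * T + 8) * ennreal (B * (t - s))" using T by (subst ennreal_plus) auto
      also have "\<dots> = ennreal ((2 * T + 8) * (B * (t - s)))" using T w by (intro ennreal_mult[symmetric]) auto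
      finally show ?thesis by (simp add: algebra_simps)
    qed
    also have "\<dots> \<le> ennreal (K * (t - s))" unfolding K_def using st L by (intro ennreal_leI mult_right_mono) auto
    finally show ?thesis .
  qed
  show ?thesis
  proof (rule that[OF K])
    fix s t assume st: "0 \<le> s" "s \<le> t" "t \<le> T"
    show "msq (\<lambda>\<omega>. X t \<omega> - X s \<omega>) \<le> ennreal (K * (t - s))" by (rule main[OF PX st g(1,3)])
    show "msq (\<lambda>\<omega>. Y t \<omega> - Y s \<omega>) \<le> ennreal (K * (t - s))" by (rule main[OF PY st g(2,4)])
    have "msq (\<lambda>\<omega>. Z t \<omega> - Z s \<omega>) \<le> ennreal (L * \<bar>t - s\<bar>)" using st by (intro Z_reg) auto
    also have "\<dots> \<le> ennreal (K * (t - s))" unfolding K_def using st T B by (intro ennreal_leI) (auto intro!: mult_right_mono)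
    finally show "msq (\<lambda>\<omega>. Z t \<omega> - Z s \<omega>) \<le> ennreal (K * (t - s))" .
  qed
qed

text \<open>The L1 counterpart of \<open>msq_growth\<close>. The constants occur squared so that the
  square root can be taken pointwise from the squared coefficient bounds.\<close>

lemma l1_growth:
  fixes h :: "'w \<Rightarrow> 'z::real_normed_vector" and p :: "'w \<Rightarrow> real^'i" and q :: "'w \<Rightarrow> real^'j" and r :: "'w \<Rightarrow> real^'d^'k"
  assumes [measurable]: "p \<in> borel_measurable M" "q \<in> borel_measurable M" "r \<in> borel_measurable M"
    and g: "g \<ge> 0" "a \<ge> 0"
    and le: "\<And>\<omega>. \<omega> \<in> space M \<Longrightarrow> (norm (h \<omega>))\<^sup>2 \<le> g\<^sup>2 * (a\<^sup>2 + (norm (p \<omega>))\<^sup>2 + (norm (q \<omega>))\<^sup>2 + (norm (r \<omega>))\<^sup>2)"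
    and b: "(\<integral>\<^sup>+\<omega>. ennreal (norm (p \<omega>)) \<partial>M) \<le> P" "(\<integral>\<^sup>+\<omega>. ennreal (norm (q \<omega>)) \<partial>M) \<le> Q" "(\<integral>\<^sup>+\<omega>. ennreal (norm (r \<omega>)) \<partial>M) \<le> R"
  shows "(\<integral>\<^sup>+\<omega>. ennreal (norm (h \<omega>)) \<partial>M) \<le> ennreal g * (ennreal a + P + Q + R)"
proof -
  have "(\<integral>\<^sup>+\<omega>. ennreal (norm (h \<omega>)) \<partial>M) \<le> (\<integral>\<^sup>+\<omega>. ennreal g * (ennreal a + ennreal (norm (p \<omega>)) + ennreal (norm (q \<omega>)) + ennreal (norm (r \<omega>))) \<partial>M)"
  proof (rule nn_integral_mono)
    fix \<omega> assume w: "\<omega> \<in> space M"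
    have "norm (h \<omega>) \<le> g * (a + norm (p \<omega>) + norm (q \<omega>) + norm (r \<omega>))"
    proof (rule power2_le_imp_le)
      have sq: "u\<^sup>2 + v\<^sup>2 \<le> (u + v)\<^sup>2" if "u \<ge> 0" "v \<ge> 0" for u v :: real using that by (simp add: power2_sum)
      have "a\<^sup>2 + (norm (p \<omega>))\<^sup>2 + (norm (q \<omega>))\<^sup>2 + (norm (r \<omega>))\<^sup>2 \<le> (a + norm (p \<omega>) + norm (q \<omega>) + norm (r \<omega>))\<^sup>2"
        using sq[of a "norm (p \<omega>)"] sq[of "a + norm (p \<omega>)" "norm (q \<omega>)"] sq[of "a + norm (p \<omega>) + norm (q \<omega>)" "norm (r \<omega>)"] g by simp
      then have "g\<^sup>2 * (a\<^sup>2 + (norm (p \<omega>))\<^sup>2 + (norm (q \<omega>))\<^sup>2 + (norm (r \<omega>))\<^sup>2) \<le> g\<^sup>2 * (a + norm (p \<omega>) + norm (q \<omega>) + norm (r \<omega>))\<^sup>2"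
        by (rule mult_left_mono) simp
      then show "(norm (h \<omega>))\<^sup>2 \<le> (g * (a + norm (p \<omega>) + norm (q \<omega>) + norm (r \<omega>)))\<^sup>2"
        using le[OF w] by (simp add: power_mult_distrib)
    qed (use g in auto)
    from ennreal_leI[OF this]
    show "ennreal (norm (h \<omega>)) \<le> ennreal g * (ennreal a + ennreal (norm (p \<omega>)) + ennreal (norm (q \<omega>)) + ennreal (norm (r \<omega>)))"
      using g by (simp add: ennreal_mult)
  qed
  also have "\<dots> = ennreal g * (ennreal a + (\<integral>\<^sup>+\<omega>. ennreal (norm (p \<omega>)) \<partial>M) + (\<integral>\<^sup>+\<omega>. ennreal (norm (q \<omega>)) \<partial>M) + (\<integral>\<^sup>+\<omega>. ennreal (norm (r \<omega>)) \<partial>M))"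
    by (simp add: nn_integral_cmult nn_integral_add emeasure_space_1)
  also have "\<dots> \<le> ennreal g * (ennreal a + P + Q + R)"
    by (intro mult_left_mono add_mono b order.refl) auto
  finally show ?thesis .
qed

text \<open>The situation common to \<open>X\<close> and \<open>Y\<close>: one process with a
  general integrand, one with an integrand frozen on the grid, compared in a single component. For
  \<open>X\<close> the coefficients are \<open>\<sigma>\<close> along both processes; for
  \<open>Y\<close> they coincide and the row condition is trivial. The factor in
  \<open>4 * c\<close> stems from \<open>freeze\<close>.\<close>

lemma component_step:
  fixes P P' :: "real \<Rightarrow> 'w \<Rightarrow> real^'k" and K K' :: "real \<Rightarrow> 'w \<Rightarrow> real^'d^'k"
  assumes N: "N \<ge> 1" and k: "k < N"
    and P: "ito_proc p \<beta> H P I" and P': "ito_proc p' \<beta>' (\<lambda>r. K' (grid N T r)) P' I'"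
    and K: "\<And>j. j < N \<Longrightarrow> K (real j * T / N) \<in> borel_measurable (FA (real j * T / N))" "\<And>j. j < N \<Longrightarrow> L2 M (K (real j * T / N))"
    and K': "\<And>j. j < N \<Longrightarrow> K' (real j * T / N) \<in> borel_measurable (FA (real j * T / N))" "\<And>j. j < N \<Longrightarrow> L2 M (K' (real j * T / N))"
    and st: "s = real k * T / N" "t = real (Suc k) * T / N"
    and FA: "P s \<in> borel_measurable (FA s)" "P' s \<in> borel_measurable (FA s)"
    and m2: "msq (\<lambda>\<omega>. P s \<omega> - P' s \<omega>) \<le> ennreal m2" "m2 \<ge> 0"
    and row: "\<And>\<omega>. (norm (K s \<omega> $ i - K' s \<omega> $ i))\<^sup>2 \<le> L * \<bar>P s \<omega> $ i - P' s \<omega> $ i\<bar>" and L: "L \<ge> 0"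
    and drift: "EI s t (\<lambda>r \<omega>. ennreal (norm (\<beta> r \<omega> - \<beta>' r \<omega>))) \<le> ennreal \<rho>" "\<rho> \<ge> 0"
    and mart: "EI s t (\<lambda>r \<omega>. nsq (H r \<omega> - K (grid N T r) \<omega>)) \<le> ennreal (c * q ^ 6)" "c \<ge> 0"
    and q: "q > 0" "T / real N = q ^ 4" "q \<le> Q" and eps: "0 < \<epsilon>" "\<epsilon> < 1"
  shows "(\<integral>\<omega>. yw \<epsilon> ((P t \<omega> - P' t \<omega>) $ i) \<partial>M) \<le> (\<integral>\<omega>. yw \<epsilon> ((P s \<omega> - P' s \<omega>) $ i) \<partial>M) + \<rho> + T / real N * L / (2 * ln (1 / \<epsilon>)) +
    q ^ 5 / (\<epsilon>\<^sup>2 * ln (1 / \<epsilon>)) * ((1 + Q) * (L * (1 + m2) + 3 * (real CARD('d))\<^sup>2 * L\<^sup>2 * m2 + 4 * c))"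
proof -
  have N0: "real N > 0" using N by simp
  have ts: "t - s = q ^ 4" unfolding st q(2)[symmetric] by (simp add: diff_divide_distrib[symmetric] algebra_simps)
  have q4: "q ^ 4 > 0" using q(1) by simp
  have "real (Suc k) * T / real N \<le> real N * T / real N" using k T by (intro grid_step_mono) auto
  then have "t \<le> T" using N0 unfolding st by simp
  moreover have "s < t" using ts q4 by linarith
  moreover have "0 \<le> s" unfolding st using T by simp
  ultimately have s0: "0 \<le> s" "s < t" "t \<le> T" by auto
  then have s01: "s \<in> {0..T}" "t \<in> {0..T}" and s00: "s \<le> t" by auto
  note D = ito_procD[OF P] and D' = ito_procD[OF P']
  define E where "E = (\<lambda>\<omega>. (I t \<omega> - I s \<omega>) - K s \<omega> *v (W t \<omega> - W s \<omega>))"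
  define E' where "E' = (\<lambda>\<omega>. (I' t \<omega> - I' s \<omega>) - K' s \<omega> *v (W t \<omega> - W s \<omega>))"
  have fr: "msq E \<le> 4 * EI s t (\<lambda>r \<omega>. nsq (H r \<omega> - K (grid N T r) \<omega>))" "L2 M E"
    "A \<in> borel_measurable (FA s) \<Longrightarrow> L2 M A \<Longrightarrow> (\<integral>\<omega>. A \<omega> * E \<omega> $ i \<partial>M) = 0" for A
    unfolding E_def by (rule freeze[OF N k D(3,2,5) K st]; assumption)+
  have fr': "msq E' \<le> 4 * EI s t (\<lambda>r \<omega>. nsq (K' (grid N T r) \<omega> - K' (grid N T r) \<omega>))" "L2 M E'"
    unfolding E'_def by (rule freeze[OF N k D'(3,2,5) K' st]; assumption)+
  \<comment> \<open>The integrand of \<open>P'\<close> is already constant on the step, so freezing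
    it leaves no error.\<close>
  have "msq E' \<le> 0" using fr'(1) by (simp add: EI_def)
  then have E'0: "AE \<omega> in M. E' \<omega> = 0" using L2_measurable[OF fr'(2)] by (simp add: nn_integral_0_iff_AE)
  have msqE: "msq E \<le> ennreal (4 * c * q ^ 6)"
  proof -
    have "msq E \<le> 4 * ennreal (c * q ^ 6)" by (rule order_trans[OF fr(1)]) (intro mult_left_mono mart, simp)
    also have "\<dots> = ennreal (4 * c * q ^ 6)" using mart(2) q(1) ennreal_mult[of 4 "c * q ^ 6"] by (simp add: mult.assoc)
    finally show ?thesis .
  qed
  define R where "R = (\<lambda>\<omega>. (LINT r:{s..t}|lborel. \<beta> r \<omega> - \<beta>' r \<omega>) $ i)"
  have Rm: "R \<in> borel_measurable M" unfolding R_def using joint_meas_lint[OF joint_meas_diff[OF D(1) D'(1)] s0(1,3)] by measurable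
  have Rn: "(\<integral>\<^sup>+\<omega>. ennreal \<bar>R \<omega>\<bar> \<partial>M) \<le> ennreal \<rho>"
  proof -
    have "(\<integral>\<^sup>+\<omega>. ennreal \<bar>R \<omega>\<bar> \<partial>M) \<le> EI s t (\<lambda>r \<omega>. ennreal (norm (\<beta> r \<omega> - \<beta>' r \<omega>)))"
      unfolding EI_def
    proof (rule nn_integral_mono)
      fix \<omega>
      have "ennreal \<bar>R \<omega>\<bar> \<le> ennreal (norm (LINT r:{s..t}|lborel. \<beta> r \<omega> - \<beta>' r \<omega>))"
        unfolding R_def by (intro ennreal_leI component_le_norm_cart)
      also have "\<dots> \<le> (\<integral>\<^sup>+r\<in>{s..t}. ennreal (norm (\<beta> r \<omega> - \<beta>' r \<omega>)) \<partial>lborel)" by (rule lint_norm_le)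
      finally show "ennreal \<bar>R \<omega>\<bar> \<le> (\<integral>\<^sup>+r\<in>{s..t}. ennreal (norm (\<beta> r \<omega> - \<beta>' r \<omega>)) \<partial>lborel)" .
    qed
    then show ?thesis using drift(1) by (rule order_trans)
  qed
  have Ri: "integrable M R"
    unfolding integrable_iff_bounded using Rm Rn by (auto intro: le_less_trans)
  have Rb: "(\<integral>\<omega>. \<bar>R \<omega>\<bar> \<partial>M) \<le> \<rho>"
  proof -
    have "ennreal (\<integral>\<omega>. \<bar>R \<omega>\<bar> \<partial>M) = (\<integral>\<^sup>+\<omega>. ennreal \<bar>R \<omega>\<bar> \<partial>M)" using Ri by (intro nn_integral_eq_integral[symmetric]) auto
    then have "ennreal (\<integral>\<omega>. \<bar>R \<omega>\<bar> \<partial>M) \<le> ennreal \<rho>" using Rn by simp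
    then show ?thesis using drift(2) by (simp add: ennreal_le_iff)
  qed
  have msq_comp: "(\<integral>\<omega>. (V \<omega> $ i)\<^sup>2 \<partial>M) \<le> B" if V: "L2 M V" "msq V \<le> ennreal B" "B \<ge> 0" for V :: "'w \<Rightarrow> real^'k" and B
  proof -
    have "(\<integral>\<omega>. (V \<omega> $ i)\<^sup>2 \<partial>M) \<le> (\<integral>\<omega>. (norm (V \<omega>))\<^sup>2 \<partial>M)"
    proof (rule integral_mono)
      show "integrable M (\<lambda>\<omega>. (V \<omega> $ i)\<^sup>2)" using L2_integrable[OF L2_nth[OF V(1)]] by simp
      show "(V \<omega> $ i)\<^sup>2 \<le> (norm (V \<omega>))\<^sup>2" for \<omega> using power_mono[OF component_le_norm_cart[of "V \<omega>" i], of 2] by simp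
    qed (rule L2_integrable[OF V(1)])
    moreover have "(\<integral>\<omega>. (norm (V \<omega>))\<^sup>2 \<partial>M) \<le> B" using V(2,3) unfolding L2_nn_integral[OF V(1)] by (simp add: ennreal_le_iff)
    ultimately show ?thesis by simp
  qed
  have D0F: "(\<lambda>\<omega>. P s \<omega> - P' s \<omega>) \<in> borel_measurable (FA s)" by (intro borel_measurable_diff FA)
  have D0L: "L2 M (\<lambda>\<omega>. P s \<omega> - P' s \<omega>)" unfolding L2_def using FA_meas[OF D0F] m2 by (auto intro: le_less_trans)
  have "(\<integral>\<omega>. yw \<epsilon> ((P t \<omega> - P' t \<omega>) $ i) \<partial>M) \<le> (\<integral>\<omega>. yw \<epsilon> ((P s \<omega> - P' s \<omega>) $ i) \<partial>M) + \<rho> + (t - s) * L / (2 * ln (1 / \<epsilon>)) +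
    q ^ 5 / (\<epsilon>\<^sup>2 * ln (1 / \<epsilon>)) * ((1 + Q) * (L * (1 + m2) + 3 * (real CARD('d))\<^sup>2 * L\<^sup>2 * m2 + 4 * c))"
  proof (rule yw_step[OF s0(1,2) ts q(1) eps])
    show "(\<lambda>\<omega>. (P s \<omega> - P' s \<omega>) $ i) \<in> borel_measurable (FA s)" by (rule measurable_vec_nth[OF D0F])
    show "L2 M (\<lambda>\<omega>. (P s \<omega> - P' s \<omega>) $ i)" by (rule L2_nth[OF D0L])
    show "(\<integral>\<omega>. ((P s \<omega> - P' s \<omega>) $ i)\<^sup>2 \<partial>M) \<le> m2" by (rule msq_comp[OF D0L m2])
    show "(\<lambda>\<omega>. K s \<omega> $ i - K' s \<omega> $ i) \<in> borel_measurable (FA s)"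
      using K(1)[OF k] K'(1)[OF k] unfolding st(1) by (intro borel_measurable_diff measurable_vec_nth)
    show "(norm (K s \<omega> $ i - K' s \<omega> $ i))\<^sup>2 \<le> L * \<bar>(P s \<omega> - P' s \<omega>) $ i\<bar>" for \<omega> using row by simp
    show "L2 M (\<lambda>\<omega>. E \<omega> $ i)" by (rule L2_nth[OF fr(2)])
    show "(\<integral>\<omega>. A \<omega> * E \<omega> $ i \<partial>M) = 0" if "A \<in> borel_measurable (FA s)" "L2 M A" for A
      by (rule fr(3)[OF that])
    show "(\<integral>\<omega>. (E \<omega> $ i)\<^sup>2 \<partial>M) \<le> 4 * c * q ^ 6" using mart(2) q(1) by (intro msq_comp fr msqE) auto
    show "AE \<omega> in M. (P t \<omega> - P' t \<omega>) $ i = (P s \<omega> - P' s \<omega>) $ i + R \<omega> + (K s \<omega> $ i - K' s \<omega> $ i) \<bullet> (W t \<omega> - W s \<omega>) + E \<omega> $ i"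
      using ito_proc_incr[OF P s0(1) s00 s0(3)] ito_proc_incr[OF P' s0(1) s00 s0(3)] E'0
    proof eventually_elim
      case (elim \<omega>)
      have B: "(LINT r:{s..t}|lborel. \<beta> r \<omega> - \<beta>' r \<omega>) = (LINT r:{s..t}|lborel. \<beta> r \<omega>) - (LINT r:{s..t}|lborel. \<beta>' r \<omega>)"
        using elim(1,2) by (intro set_integral_diff) auto
      have "P t \<omega> - P' t \<omega> = (P s \<omega> - P' s \<omega>) + (LINT r:{s..t}|lborel. \<beta> r \<omega> - \<beta>' r \<omega>) + (K s \<omega> - K' s \<omega>) *v (W t \<omega> - W s \<omega>) + E \<omega>"
      proof -
        have 1: "P t \<omega> - P s \<omega> = (LINT r:{s..t}|lborel. \<beta> r \<omega>) + (I t \<omega> - I s \<omega>)"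
          "P' t \<omega> - P' s \<omega> = (LINT r:{s..t}|lborel. \<beta>' r \<omega>) + (I' t \<omega> - I' s \<omega>)" using elim(1,2) by blast+
        have 2: "I' t \<omega> - I' s \<omega> = K' s \<omega> *v (W t \<omega> - W s \<omega>)" using elim(3) unfolding E'_def by (rule right_minus_eq[THEN iffD1])
        have "P t \<omega> - P' t \<omega> = (P s \<omega> - P' s \<omega>) + ((P t \<omega> - P s \<omega>) - (P' t \<omega> - P' s \<omega>))" by (simp add: algebra_simps)
        then show ?thesis unfolding 1 2 B E_def matrix_vector_mult_diff_rdistrib
          by (simp add: algebra_simps del: matrix_vector_mult_diff_distrib)
      qed
      then have "(P t \<omega> - P' t \<omega>) $ i = ((P s \<omega> - P' s \<omega>) + (LINT r:{s..t}|lborel. \<beta> r \<omega> - \<beta>' r \<omega>) + (K s \<omega> - K' s \<omega>) *v (W t \<omega> - W s \<omega>) + E \<omega>) $ i"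
        by simp
      also have "\<dots> = (P s \<omega> - P' s \<omega>) $ i + R \<omega> + ((K s \<omega> - K' s \<omega>) *v (W t \<omega> - W s \<omega>)) $ i + E \<omega> $ i"
        unfolding R_def by (simp only: vector_add_component)
      finally show ?case unfolding matrix_vector_nth vector_minus_component .
    qed
    show "(\<lambda>\<omega>. (P t \<omega> - P' t \<omega>) $ i) \<in> borel_measurable M"
      by (intro measurable_vec_nth borel_measurable_diff D(4) D'(4) s01)
  qed (rule L Ri Rb q(3))+
  then show ?thesis unfolding ts q(2) .
qed

end

section \<open>Coefficient errors in terms of the errors at grid points\<close>

context fbsde
begin

abbreviation euler :: "nat \<Rightarrow> (real \<Rightarrow> 'w \<Rightarrow> real^'n) \<Rightarrow> (real \<Rightarrow> 'w \<Rightarrow> real^'m) \<Rightarrow> bool" where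
  "euler N Xh Yh \<equiv> E3_sol N M W (aug_filt M W) T b \<sigma> f x y Z Xh Yh"

abbreviation dX :: "(real \<Rightarrow> 'w \<Rightarrow> real^'n) \<Rightarrow> real \<Rightarrow> 'w \<Rightarrow> real^'n" where
  "dX Xh r \<equiv> (\<lambda>\<omega>. X r \<omega> - Xh r \<omega>)"

abbreviation dY :: "(real \<Rightarrow> 'w \<Rightarrow> real^'m) \<Rightarrow> real \<Rightarrow> 'w \<Rightarrow> real^'m" where
  "dY Yh r \<equiv> (\<lambda>\<omega>. Y r \<omega> - Yh r \<omega>)"

abbreviation m1 :: "('w \<Rightarrow> 'a::real_normed_vector) \<Rightarrow> ennreal" where
  "m1 V \<equiv> \<integral>\<^sup>+\<omega>. ennreal (norm (V \<omega>)) \<partial>M"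

abbreviation gridpt :: "nat \<Rightarrow> nat \<Rightarrow> real" where
  "gridpt N j \<equiv> real j * T / real N"

abbreviation \<Delta>b where
  "\<Delta>b N Xh Yh r \<equiv> (\<lambda>\<omega>. b r (X r \<omega>) (Y r \<omega>) - b (grid N T r) (Xh (grid N T r) \<omega>) (Yh (grid N T r) \<omega>))"

abbreviation \<Delta>f where
  "\<Delta>f N Xh Yh r \<equiv> (\<lambda>\<omega>. f r (X r \<omega>) (Y r \<omega>) (Z r \<omega>) - f (grid N T r) (Xh (grid N T r) \<omega>) (Yh (grid N T r) \<omega>) (Z (grid N T r) \<omega>))"

abbreviation \<Delta>\<sigma> where
  "\<Delta>\<sigma> N Xh r \<equiv> (\<lambda>\<omega>. \<sigma> r (X r \<omega>) - \<sigma> (grid N T r) (Xh (grid N T r) \<omega>))"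

abbreviation \<Delta>Z where
  "\<Delta>Z N r \<equiv> (\<lambda>\<omega>. Z r \<omega> - Z (grid N T r) \<omega>)"

text \<open>The first moment stands beside the second moments because the squared error of
  \<open>\<sigma>\<close> is only linear in the distance of its arguments. For the same reason the
  step size enters through its square root, the order of an L1 increment of
  \<open>X\<close>.\<close>

abbreviation err2 where
  "err2 N Xh Yh u \<equiv> ennreal (sqrt (T / real N)) + (msq (dX Xh u) + msq (dY Yh u)) + m1 (dX Xh u)"

text \<open>Only drifts are measured in L1; they see both components, hence both errors.\<close>

abbreviation err1 where
  "err1 N Xh Yh u \<equiv> ennreal (sqrt (T / real N)) + (m1 (dX Xh u) + m1 (dY Yh u))"

text \<open>The squared increments over a step are of order \<open>h\<close>, but the diffusion
  error brings in \<open>sqrt h\<close> anyway, so all of them are weakened to that order. The term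
  \<open>m\<close> is slack for the first moment in \<open>err2\<close>.\<close>

lemma absorb_step_size:
  fixes d e m :: ennreal
  assumes h: "0 \<le> h" "h \<le> T" and C: "C \<ge> 0"
  shows "ennreal h + (2 * ennreal (C * h) + 2 * d) + (2 * ennreal (C * h) + 2 * e) + ennreal (C * h) \<le>
    ennreal (sqrt T * (1 + 5 * C) + 2) * (ennreal (sqrt h) + (d + e) + m)"
proof -
  define \<kappa> where "\<kappa> = sqrt T * (1 + 5 * C) + 2"
  have k: "\<kappa> \<ge> 2" "sqrt T * (1 + 5 * C) \<le> \<kappa>" unfolding \<kappa>_def using C T by auto
  have "ennreal h + (2 * ennreal (C * h) + 2 * d) + (2 * ennreal (C * h) + 2 * e) + ennreal (C * h) =
    (ennreal h + 2 * ennreal (C * h) + 2 * ennreal (C * h) + ennreal (C * h)) + 2 * (d + e)"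
    by (simp add: distrib_left add.assoc add.left_commute)
  also have "ennreal h + 2 * ennreal (C * h) + 2 * ennreal (C * h) + ennreal (C * h) = ennreal (h * (1 + 5 * C))"
  proof -
    have "2 * ennreal (C * h) = ennreal (2 * (C * h))" using C h ennreal_mult[of 2 "C * h"] by simp
    then have "ennreal h + 2 * ennreal (C * h) + 2 * ennreal (C * h) + ennreal (C * h) = ennreal (h + 2 * (C * h) + 2 * (C * h) + C * h)"
      using C h by (simp only: ennreal_plus add_nonneg_nonneg mult_nonneg_nonneg zero_le_numeral)
    then show ?thesis by (simp add: algebra_simps)
  qed
  also have "\<dots> \<le> ennreal \<kappa> * ennreal (sqrt h)"
  proof -
    have "h = sqrt h * sqrt h" using h by simp
    also have "\<dots> \<le> sqrt T * sqrt h" using h by (intro mult_right_mono) auto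
    finally have "h * (1 + 5 * C) \<le> (sqrt T * sqrt h) * (1 + 5 * C)" using C by (intro mult_right_mono) auto
    also have "\<dots> = (sqrt T * (1 + 5 * C)) * sqrt h" by simp
    also have "\<dots> \<le> \<kappa> * sqrt h" using k h by (intro mult_right_mono) auto
    finally show ?thesis using k h by (simp add: ennreal_mult[symmetric] ennreal_leI)
  qed
  also have "2 * (d + e) \<le> ennreal \<kappa> * ((d + e) + m)"
  proof (rule mult_mono)
    show "2 \<le> ennreal \<kappa>" using ennreal_leI[OF k(1)] by simp
  qed auto
  finally show ?thesis unfolding \<kappa>_def[symmetric] by (simp add: distrib_left add.assoc add_mono)
qed

text \<open>A difference such as \<open>X r - Xh (grid N T r)\<close> splits into an increment of
  the exact solution within one step, controlled by \<open>regularity\<close>, and the error at the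
  grid point. About \<open>Xh\<close> and \<open>Yh\<close> only adaptedness is used, so the
  estimates may also be applied with the exact solution in place of the scheme; they then bound the
  freezing error.\<close>

lemma euler_pointwise:
  obtains C where "C > 0" and
    "\<And>N r Xh Yh. N \<ge> 1 \<Longrightarrow> r \<in> {0..T} \<Longrightarrow> adapted_proc M F T Xh \<Longrightarrow> adapted_proc M F T Yh \<Longrightarrow>
      msq (\<Delta>b N Xh Yh r) \<le>
        ennreal C * err2 N Xh Yh (grid N T r)"
    "\<And>N r Xh Yh. N \<ge> 1 \<Longrightarrow> r \<in> {0..T} \<Longrightarrow> adapted_proc M F T Xh \<Longrightarrow> adapted_proc M F T Yh \<Longrightarrow>
      msq (\<Delta>f N Xh Yh r) \<le>
        ennreal C * err2 N Xh Yh (grid N T r)"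
    "\<And>N r Xh. N \<ge> 1 \<Longrightarrow> r \<in> {0..T} \<Longrightarrow> adapted_proc M F T Xh \<Longrightarrow>
      msq (\<Delta>\<sigma> N Xh r) \<le>
        ennreal C * (ennreal (sqrt (T / N)) + m1 (dX Xh (grid N T r)))"
    "\<And>N r. N \<ge> 1 \<Longrightarrow> r \<in> {0..T} \<Longrightarrow> msq (\<Delta>Z N r) \<le> ennreal C * ennreal (sqrt (T / N))"
    "\<And>N r Xh Yh. N \<ge> 1 \<Longrightarrow> r \<in> {0..T} \<Longrightarrow> adapted_proc M F T Xh \<Longrightarrow> adapted_proc M F T Yh \<Longrightarrow>
      m1 (\<Delta>b N Xh Yh r) \<le>
        ennreal C * err1 N Xh Yh (grid N T r)"
    "\<And>N r Xh Yh. N \<ge> 1 \<Longrightarrow> r \<in> {0..T} \<Longrightarrow> adapted_proc M F T Xh \<Longrightarrow> adapted_proc M F T Yh \<Longrightarrow>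
      m1 (\<Delta>f N Xh Yh r) \<le>
        ennreal C * err1 N Xh Yh (grid N T r)"
proof -
  obtain C0 where C0: "C0 > 0"
    "\<And>s t. 0 \<le> s \<Longrightarrow> s \<le> t \<Longrightarrow> t \<le> T \<Longrightarrow> msq (\<lambda>\<omega>. X t \<omega> - X s \<omega>) \<le> ennreal (C0 * (t - s))"
    "\<And>s t. 0 \<le> s \<Longrightarrow> s \<le> t \<Longrightarrow> t \<le> T \<Longrightarrow> msq (\<lambda>\<omega>. Y t \<omega> - Y s \<omega>) \<le> ennreal (C0 * (t - s))"
    "\<And>s t. 0 \<le> s \<Longrightarrow> s \<le> t \<Longrightarrow> t \<le> T \<Longrightarrow> msq (\<lambda>\<omega>. Z t \<omega> - Z s \<omega>) \<le> ennreal (C0 * (t - s))"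
    by (rule regularity) blast
  define \<kappa> where "\<kappa> = sqrt T * (1 + 5 * C0) + 2"
  define n where "n = real CARD('n)"
  \<comment> \<open>One summand for each kind of estimate: \<open>b\<close> and \<open>f\<close> in
    L2, \<open>\<sigma>\<close> in L2, \<open>Z\<close> in L2, and \<open>b\<close> and
    \<open>f\<close> in L1.\<close>
  define C where "C = L * \<kappa> + L * n * (sqrt T + 2 + C0) + sqrt T * C0 + sqrt L * (4 + 3 * C0)"
  have n: "n > 0" unfolding n_def by simp
  have kp: "\<kappa> > 0" unfolding \<kappa>_def using T C0(1) by (intro add_nonneg_pos mult_nonneg_nonneg) auto
  have parts: "0 \<le> L * \<kappa>" "0 \<le> L * n * (sqrt T + 2 + C0)" "0 \<le> sqrt T * C0" "0 < sqrt L * (4 + 3 * C0)"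
    using L kp n T C0(1) by auto
  have C: "C > 0" "L * \<kappa> \<le> C" "L * n * (sqrt T + 2 + C0) \<le> C" "sqrt T * C0 \<le> C" "sqrt L * (4 + 3 * C0) \<le> C"
    using parts unfolding C_def by auto
  have main:
      "msq (\<Delta>b N Xh Yh r) \<le>
        ennreal C * err2 N Xh Yh (grid N T r)" (is ?g1)
      "msq (\<Delta>f N Xh Yh r) \<le>
        ennreal C * err2 N Xh Yh (grid N T r)" (is ?g2)
      "msq (\<Delta>\<sigma> N Xh r) \<le>
        ennreal C * (ennreal (sqrt (T / N)) + m1 (dX Xh (grid N T r)))" (is ?g3)
      "msq (\<Delta>Z N r) \<le> ennreal C * ennreal (sqrt (T / N))" (is ?g4)
      "m1 (\<Delta>b N Xh Yh r) \<le>
        ennreal C * err1 N Xh Yh (grid N T r)" (is ?g5)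
      "m1 (\<Delta>f N Xh Yh r) \<le>
        ennreal C * err1 N Xh Yh (grid N T r)" (is ?g6)
    if N: "N \<ge> 1" and r: "r \<in> {0..T}" and ad: "adapted_proc M F T Xh" "adapted_proc M F T Yh" for N r Xh Yh
  proof -
    define g where "g = grid N T r"
    define h where "h = T / real N"
    have h: "h > 0" "h \<le> T" unfolding h_def using T N by (auto simp: divide_le_eq)
    have gp: "0 \<le> g" "g \<le> r" "r - g \<le> h" "g \<in> {0..T}" unfolding g_def h_def using grid_props[OF T N, of r] r by auto
    have rT: "r \<le> T" using r by simp
    have abs_rg: "\<bar>r - g\<bar> \<le> h" using gp by simp
    note m = adapted_meas[OF X_ad r] adapted_meas[OF Y_ad r] adapted_meas[OF Z_ad r]
    note mg = adapted_meas[OF X_ad gp(4)] adapted_meas[OF Y_ad gp(4)] adapted_meas[OF Z_ad gp(4)]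
    note mh = adapted_meas[OF ad(1) gp(4)] adapted_meas[OF ad(2) gp(4)]
    have le_h: "C0 * (r - g) \<le> C0 * h" using gp(3) C0(1) by simp
    have rX: "msq (\<lambda>\<omega>. X r \<omega> - X g \<omega>) \<le> ennreal (C0 * h)" and rY: "msq (\<lambda>\<omega>. Y r \<omega> - Y g \<omega>) \<le> ennreal (C0 * h)"
      and rZ: "msq (\<lambda>\<omega>. Z r \<omega> - Z g \<omega>) \<le> ennreal (C0 * h)"
      using C0(2-4)[OF gp(1,2) rT] ennreal_leI[OF le_h] by (auto intro: order_trans)
    have eX: "X r \<omega> - Xh g \<omega> = (X r \<omega> - X g \<omega>) + (X g \<omega> - Xh g \<omega>)" for \<omega> by simp
    have eY: "Y r \<omega> - Yh g \<omega> = (Y r \<omega> - Y g \<omega>) + (Y g \<omega> - Yh g \<omega>)" for \<omega> by simp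
    note mX = borel_measurable_diff[OF m(1) mg(1)] borel_measurable_diff[OF mg(1) mh(1)]
    note mY = borel_measurable_diff[OF m(2) mg(2)] borel_measurable_diff[OF mg(2) mh(2)]
    have pX: "msq (\<lambda>\<omega>. X r \<omega> - Xh g \<omega>) \<le> 2 * ennreal (C0 * h) + 2 * msq (dX Xh g)"
      unfolding eX by (rule order_trans[OF nn_sq_sum_le[OF mX]]) (intro add_right_mono mult_left_mono rX, simp)
    have pY: "msq (\<lambda>\<omega>. Y r \<omega> - Yh g \<omega>) \<le> 2 * ennreal (C0 * h) + 2 * msq (dY Yh g)"
      unfolding eY by (rule order_trans[OF nn_sq_sum_le[OF mY]]) (intro add_right_mono mult_left_mono rY, simp)
    have sh: "sqrt h > 0" using h by simp
    have l1: "m1 V \<le> ennreal ((1 + C0) * sqrt h)" if V: "V \<in> borel_measurable M" "msq V \<le> ennreal (C0 * h)"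
      for V :: "'w \<Rightarrow> 'v::{second_countable_topology,real_normed_vector}"
    proof -
      have "m1 V \<le> ennreal (sqrt h) + ennreal (1 / sqrt h) * ennreal (C0 * h)"
        by (rule order_trans[OF l1_le[OF V(1) sh]]) (intro add_left_mono mult_left_mono V(2), simp)
      also have "\<dots> = ennreal (sqrt h + 1 / sqrt h * (C0 * h))"
        using sh h C0(1) by (simp add: ennreal_mult[symmetric])
      also have "sqrt h + 1 / sqrt h * (C0 * h) = (1 + C0) * sqrt h"
      proof -
        have "h / sqrt h = sqrt h" using h real_div_sqrt[of h] by simp
        moreover have "1 / sqrt h * (C0 * h) = C0 * (h / sqrt h)" by simp
        ultimately show ?thesis by (simp only: distrib_right mult_1_left)
      qed
      finally show ?thesis .
    qed
    note lX = l1[OF borel_measurable_diff[OF m(1) mg(1)] rX] and lY = l1[OF borel_measurable_diff[OF m(2) mg(2)] rY] and lZ = l1[OF borel_measurable_diff[OF m(3) mg(3)] rZ]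
    have qX: "m1 (\<lambda>\<omega>. X r \<omega> - Xh g \<omega>) \<le> ennreal ((1 + C0) * sqrt h) + m1 (dX Xh g)"
      unfolding eX by (rule order_trans[OF l1_add_le[OF mX]]) (intro add_right_mono lX)
    have qY: "m1 (\<lambda>\<omega>. Y r \<omega> - Yh g \<omega>) \<le> ennreal ((1 + C0) * sqrt h) + m1 (dY Yh g)"
      unfolding eY by (rule order_trans[OF l1_add_le[OF mY]]) (intro add_right_mono lY)
    let ?U = "ennreal (sqrt h) + (msq (dX Xh g) + msq (dY Yh g)) + m1 (dX Xh g)"
    have C00: "0 \<le> C0" "0 \<le> h" "0 \<le> L" using C0(1) h L by auto
    have fin: "ennreal L * (ennreal h + (2 * ennreal (C0 * h) + 2 * msq (dX Xh g)) + (2 * ennreal (C0 * h) + 2 * msq (dY Yh g)) + ennreal (C0 * h)) \<le> ennreal C * ?U"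
    proof -
      have "ennreal L * (ennreal h + (2 * ennreal (C0 * h) + 2 * msq (dX Xh g)) + (2 * ennreal (C0 * h) + 2 * msq (dY Yh g)) + ennreal (C0 * h)) \<le>
        ennreal L * (ennreal \<kappa> * ?U)" unfolding \<kappa>_def by (intro mult_left_mono absorb_step_size C00 h) simp
      also have "\<dots> = ennreal (L * \<kappa>) * ?U" using L kp by (simp add: ennreal_mult mult.assoc)
      also have "\<dots> \<le> ennreal C * ?U" by (intro mult_right_mono ennreal_leI C) simp
      finally show ?thesis .
    qed
    note md = borel_measurable_diff[OF m(1) mh(1)] borel_measurable_diff[OF m(2) mh(2)] borel_measurable_diff[OF m(3) mg(3)]
    have 1: "msq (\<lambda>\<omega>. b r (X r \<omega>) (Y r \<omega>) - b g (Xh g \<omega>) (Yh g \<omega>)) \<le> ennreal C * ?U"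
    proof (rule order_trans[OF msq_growth[OF md C00(3,2) _ pX pY rZ] fin])
      fix \<omega>
      show "(norm (b r (X r \<omega>) (Y r \<omega>) - b g (Xh g \<omega>) (Yh g \<omega>)))\<^sup>2 \<le> L * (h + (norm (X r \<omega> - Xh g \<omega>))\<^sup>2 + (norm (Y r \<omega> - Yh g \<omega>))\<^sup>2 + (norm (Z r \<omega> - Z g \<omega>))\<^sup>2)"
        using L abs_rg by (intro order_trans[OF b_sq[OF r gp(4)]] mult_left_mono) (auto intro!: add_increasing2)
    qed
    then show ?g1 unfolding g_def h_def .
    have 2: "msq (\<lambda>\<omega>. f r (X r \<omega>) (Y r \<omega>) (Z r \<omega>) - f g (Xh g \<omega>) (Yh g \<omega>) (Z g \<omega>)) \<le> ennreal C * ?U"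
    proof (rule order_trans[OF msq_growth[OF md C00(3,2) _ pX pY rZ] fin])
      fix \<omega>
      show "(norm (f r (X r \<omega>) (Y r \<omega>) (Z r \<omega>) - f g (Xh g \<omega>) (Yh g \<omega>) (Z g \<omega>)))\<^sup>2 \<le> L * (h + (norm (X r \<omega> - Xh g \<omega>))\<^sup>2 + (norm (Y r \<omega> - Yh g \<omega>))\<^sup>2 + (norm (Z r \<omega> - Z g \<omega>))\<^sup>2)"
        using L abs_rg by (intro order_trans[OF f_sq[OF r gp(4)]] mult_left_mono) auto
    qed
    then show ?g2 unfolding g_def h_def .
    have hs: "h \<le> sqrt T * sqrt h"
    proof -
      have "h = sqrt h * sqrt h" using h by simp
      also have "\<dots> \<le> sqrt T * sqrt h" using h by (intro mult_right_mono) auto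
      finally show ?thesis .
    qed
    have 3: "msq (\<lambda>\<omega>. \<sigma> r (X r \<omega>) - \<sigma> g (Xh g \<omega>)) \<le> ennreal C * (ennreal (sqrt h) + m1 (dX Xh g))"
    proof -
      have "msq (\<lambda>\<omega>. \<sigma> r (X r \<omega>) - \<sigma> g (Xh g \<omega>)) \<le> (\<integral>\<^sup>+\<omega>. ennreal (L * n) * (ennreal h + ennreal (norm (X r \<omega> - Xh g \<omega>))) \<partial>M)"
      proof (rule nn_integral_mono)
        fix \<omega>
        have "(norm (\<sigma> r (X r \<omega>) - \<sigma> g (Xh g \<omega>)))\<^sup>2 \<le> L * n * (h + norm (X r \<omega> - Xh g \<omega>))"
          using L abs_rg n unfolding n_def by (intro order_trans[OF \<sigma>_sq_norm[OF r gp(4)]] mult_left_mono) auto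
        from ennreal_leI[OF this] show "nsq (\<sigma> r (X r \<omega>) - \<sigma> g (Xh g \<omega>)) \<le> ennreal (L * n) * (ennreal h + ennreal (norm (X r \<omega> - Xh g \<omega>)))"
          using L n C00 by (simp add: ennreal_mult)
      qed
      also have "\<dots> = ennreal (L * n) * (ennreal h + m1 (\<lambda>\<omega>. X r \<omega> - Xh g \<omega>))"
        using md(1) by (simp add: nn_integral_cmult nn_integral_add emeasure_space_1)
      also have "\<dots> \<le> ennreal (L * n) * (ennreal h + (ennreal ((1 + C0) * sqrt h) + m1 (dX Xh g)))"
        by (intro mult_left_mono add_left_mono qX) simp
      also have "\<dots> = ennreal (L * n) * (ennreal (h + (1 + C0) * sqrt h) + m1 (dX Xh g))"
        using C00 sh by (simp add: add.assoc)
      also have "\<dots> \<le> ennreal (L * n) * (ennreal (sqrt T + 2 + C0) * ennreal (sqrt h) + ennreal (sqrt T + 2 + C0) * m1 (dX Xh g))"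
      proof (intro mult_left_mono add_mono)
        have c: "h + (1 + C0) * sqrt h \<le> (sqrt T + 2 + C0) * sqrt h" unfolding distrib_right mult_1_left using hs sh by linarith
        have e: "ennreal (sqrt T + 2 + C0) * ennreal (sqrt h) = ennreal ((sqrt T + 2 + C0) * sqrt h)"
          by (rule ennreal_mult[symmetric]) (use T C00 sh in auto)
        show "ennreal (h + (1 + C0) * sqrt h) \<le> ennreal (sqrt T + 2 + C0) * ennreal (sqrt h)"
          unfolding e by (rule ennreal_leI[OF c])
        have "1 \<le> ennreal (sqrt T + 2 + C0)" using ennreal_leI[of 1 "sqrt T + 2 + C0"] T C00 by simp
        then show "m1 (dX Xh g) \<le> ennreal (sqrt T + 2 + C0) * m1 (dX Xh g)" using mult_right_mono[of 1 _ "m1 (dX Xh g)"] by simp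
      qed simp
      also have "\<dots> = ennreal (L * n * (sqrt T + 2 + C0)) * (ennreal (sqrt h) + m1 (dX Xh g))"
      proof -
        have "ennreal (L * n * (sqrt T + 2 + C0)) = ennreal (L * n) * ennreal (sqrt T + 2 + C0)"
          by (rule ennreal_mult) (use L n T C00 in auto)
        then show ?thesis by (simp only: distrib_left mult.assoc)
      qed
      also have "\<dots> \<le> ennreal C * (ennreal (sqrt h) + m1 (dX Xh g))" by (intro mult_right_mono ennreal_leI C) simp
      finally show ?thesis .
    qed
    then show ?g3 unfolding g_def h_def .
    have 4: "msq (\<lambda>\<omega>. Z r \<omega> - Z g \<omega>) \<le> ennreal C * ennreal (sqrt h)"
    proof -
      have "C0 * h \<le> (sqrt T * C0) * sqrt h" using mult_left_mono[OF hs C00(1)] by (simp add: mult_ac)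
      also have "\<dots> \<le> C * sqrt h" using sh by (intro mult_right_mono C) simp
      finally have "ennreal (C0 * h) \<le> ennreal (C * sqrt h)" by (rule ennreal_leI)
      then show ?thesis using rZ C(1) sh by (simp add: ennreal_mult)
    qed
    then show ?g4 unfolding g_def h_def .
    let ?V = "ennreal (sqrt h) + (m1 (dX Xh g) + m1 (dY Yh g))"
    have fin1: "ennreal (sqrt L) * (ennreal (sqrt h) + (ennreal ((1 + C0) * sqrt h) + m1 (dX Xh g)) + (ennreal ((1 + C0) * sqrt h) + m1 (dY Yh g)) + ennreal ((1 + C0) * sqrt h)) \<le> ennreal C * ?V"
    proof -
      have "ennreal (sqrt h) + (ennreal ((1 + C0) * sqrt h) + m1 (dX Xh g)) + (ennreal ((1 + C0) * sqrt h) + m1 (dY Yh g)) + ennreal ((1 + C0) * sqrt h) =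
        (ennreal (sqrt h) + ennreal ((1 + C0) * sqrt h) + ennreal ((1 + C0) * sqrt h) + ennreal ((1 + C0) * sqrt h)) + (m1 (dX Xh g) + m1 (dY Yh g))"
        by (simp only: ac_simps)
      also have "ennreal (sqrt h) + ennreal ((1 + C0) * sqrt h) + ennreal ((1 + C0) * sqrt h) + ennreal ((1 + C0) * sqrt h) = ennreal ((4 + 3 * C0) * sqrt h)"
      proof -
        have nn: "0 \<le> sqrt h" "0 \<le> (1 + C0) * sqrt h" using sh C00 by auto
        have "ennreal (sqrt h) + ennreal ((1 + C0) * sqrt h) + ennreal ((1 + C0) * sqrt h) + ennreal ((1 + C0) * sqrt h) =
          ennreal (sqrt h + (1 + C0) * sqrt h + (1 + C0) * sqrt h + (1 + C0) * sqrt h)"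
          by (simp only: ennreal_plus add_nonneg_nonneg nn)
        then show ?thesis by (simp add: algebra_simps)
      qed
      also have "\<dots> = ennreal (4 + 3 * C0) * ennreal (sqrt h)" using C00 sh by (simp add: ennreal_mult)
      also have "\<dots> + (m1 (dX Xh g) + m1 (dY Yh g)) \<le> ennreal (4 + 3 * C0) * ennreal (sqrt h) + ennreal (4 + 3 * C0) * (m1 (dX Xh g) + m1 (dY Yh g))"
      proof (rule add_left_mono)
        have "1 \<le> ennreal (4 + 3 * C0)" using ennreal_leI[of 1 "4 + 3 * C0"] C00 by simp
        then show "m1 (dX Xh g) + m1 (dY Yh g) \<le> ennreal (4 + 3 * C0) * (m1 (dX Xh g) + m1 (dY Yh g))"
          using mult_right_mono[of 1 _ "m1 (dX Xh g) + m1 (dY Yh g)"] by simp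
      qed
      also have "\<dots> = ennreal (4 + 3 * C0) * ?V" by (simp only: distrib_left)
      finally have "ennreal (sqrt L) * (ennreal (sqrt h) + (ennreal ((1 + C0) * sqrt h) + m1 (dX Xh g)) + (ennreal ((1 + C0) * sqrt h) + m1 (dY Yh g)) + ennreal ((1 + C0) * sqrt h)) \<le>
        ennreal (sqrt L) * (ennreal (4 + 3 * C0) * ?V)" by (rule mult_left_mono) simp
      also have "\<dots> = ennreal (sqrt L * (4 + 3 * C0)) * ?V" using L C00 by (simp add: ennreal_mult mult.assoc)
      also have "\<dots> \<le> ennreal C * ?V" by (intro mult_right_mono ennreal_leI C) simp
      finally show ?thesis .
    qed
    have sq: "(sqrt L)\<^sup>2 = L" "(sqrt h)\<^sup>2 = h" "0 \<le> sqrt L" "0 \<le> sqrt h" using L h by auto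
    have 5: "m1 (\<lambda>\<omega>. b r (X r \<omega>) (Y r \<omega>) - b g (Xh g \<omega>) (Yh g \<omega>)) \<le> ennreal C * ?V"
    proof (rule order_trans[OF l1_growth[OF md sq(3,4) _ qX qY lZ] fin1])
      fix \<omega>
      show "(norm (b r (X r \<omega>) (Y r \<omega>) - b g (Xh g \<omega>) (Yh g \<omega>)))\<^sup>2 \<le> (sqrt L)\<^sup>2 * ((sqrt h)\<^sup>2 + (norm (X r \<omega> - Xh g \<omega>))\<^sup>2 + (norm (Y r \<omega> - Yh g \<omega>))\<^sup>2 + (norm (Z r \<omega> - Z g \<omega>))\<^sup>2)"
        unfolding sq(1,2) using L abs_rg by (intro order_trans[OF b_sq[OF r gp(4)]] mult_left_mono) (auto intro!: add_increasing2)
    qed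
    then show ?g5 unfolding g_def h_def .
    have 6: "m1 (\<lambda>\<omega>. f r (X r \<omega>) (Y r \<omega>) (Z r \<omega>) - f g (Xh g \<omega>) (Yh g \<omega>) (Z g \<omega>)) \<le> ennreal C * ?V"
    proof (rule order_trans[OF l1_growth[OF md sq(3,4) _ qX qY lZ] fin1])
      fix \<omega>
      show "(norm (f r (X r \<omega>) (Y r \<omega>) (Z r \<omega>) - f g (Xh g \<omega>) (Yh g \<omega>) (Z g \<omega>)))\<^sup>2 \<le> (sqrt L)\<^sup>2 * ((sqrt h)\<^sup>2 + (norm (X r \<omega> - Xh g \<omega>))\<^sup>2 + (norm (Y r \<omega> - Yh g \<omega>))\<^sup>2 + (norm (Z r \<omega> - Z g \<omega>))\<^sup>2)"
        unfolding sq(1,2) using L abs_rg by (intro order_trans[OF f_sq[OF r gp(4)]] mult_left_mono) auto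
    qed
    then show ?g6 unfolding g_def h_def .
  qed
  \<comment> \<open>Estimates that do not mention \<open>Xh\<close> or \<open>Yh\<close> are
    instances of \<open>main\<close> with the exact process in the vacant place.\<close>
  show ?thesis by (rule that[OF C(1)]) (rule main; assumption | rule main[OF _ _ _ Y_ad]; assumption | rule main[OF _ _ X_ad Y_ad]; assumption)+
qed

end

text \<open>The grid values satisfy a closed recursion. The separate quantity \<open>w\<close> is
  bounded by the same sums, so that the result can be transferred to times between grid
  points.\<close>

lemma grid_Gronwall:
  fixes v :: "nat \<Rightarrow> ennreal"
  assumes T: "T > 0" and N: "N \<ge> 1" and c: "c \<ge> 0" and a: "a \<ge> 0"
    and v: "\<And>k. k \<le> N \<Longrightarrow> v k \<le> ennreal (c * (T / real N)) * (\<Sum>j<k. ennreal a + v j)"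
    and w: "w \<le> ennreal (c * (T / real N)) * (\<Sum>j<N. ennreal a + v j)"
  shows "w \<le> ennreal (c * T * a * (1 + c * T * exp (c * T)))"
proof -
  have N0: "real N > 0" using N by simp
  have ch: "c * (T / real N) \<ge> 0" using c T by simp
  have split: "ennreal (c * (T / real N)) * (\<Sum>j<k. ennreal a + v j) \<le> ennreal (c * T * a) + ennreal (c * (T / real N)) * (\<Sum>j<k. v j)"
    if "k \<le> N" for k
  proof -
    have "(\<Sum>j<k. ennreal a + v j) = ennreal (real k * a) + (\<Sum>j<k. v j)"
      using a by (simp add: sum.distrib ennreal_mult ennreal_of_nat_eq_real_of_nat)
    then have "ennreal (c * (T / real N)) * (\<Sum>j<k. ennreal a + v j) = ennreal (c * (T / real N)) * ennreal (real k * a) + ennreal (c * (T / real N)) * (\<Sum>j<k. v j)"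
      by (simp only: distrib_left)
    also have "ennreal (c * (T / real N)) * ennreal (real k * a) = ennreal (c * (T / real N) * (real k * a))"
      using ch a by (intro ennreal_mult[symmetric]) auto
    also have "\<dots> \<le> ennreal (c * T * a)"
    proof (rule ennreal_leI)
      have "c * (T / real N) * (real k * a) \<le> c * (T / real N) * (real N * a)"
        using that ch a by (intro mult_left_mono mult_right_mono) auto
      then show "c * (T / real N) * (real k * a) \<le> c * T * a" using N0 by simp
    qed
    finally show ?thesis by (simp add: add_mono)
  qed
  have vk: "v k \<le> ennreal (c * T * a * exp (real N * (c * (T / real N))))" if "k \<le> N" for k
    using c T a by (intro discrete_Gronwall[OF _ ch _ that] order_trans[OF v split]) auto
  have e: "real N * (c * (T / real N)) = c * T" using N0 by simp
  have "w \<le> ennreal (c * T * a) + ennreal (c * (T / real N)) * (\<Sum>j<N. v j)" by (rule order_trans[OF w split]) simp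
  also have "\<dots> \<le> ennreal (c * T * a) + ennreal (c * (T / real N)) * (\<Sum>j<N. ennreal (c * T * a * exp (c * T)))"
    using vk[unfolded e] by (intro add_left_mono mult_left_mono sum_mono) auto
  also have "(\<Sum>j<N. ennreal (c * T * a * exp (c * T))) = ennreal (real N * (c * T * a * exp (c * T)))"
    using c T a by (simp add: ennreal_mult ennreal_of_nat_eq_real_of_nat)
  also have "ennreal (c * (T / real N)) * \<dots> = ennreal (c * (T / real N) * (real N * (c * T * a * exp (c * T))))"
    using ch c T a by (intro ennreal_mult[symmetric]) auto
  also have "ennreal (c * T * a) + \<dots> = ennreal (c * T * a + c * (T / real N) * (real N * (c * T * a * exp (c * T))))"
    using ch c T a by (intro ennreal_plus[symmetric]) auto
  also have "c * T * a + c * (T / real N) * (real N * (c * T * a * exp (c * T))) = c * T * a * (1 + c * T * exp (c * T))"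
    using N0 by (simp add: algebra_simps)
  finally show ?thesis .
qed

context brownian
begin

text \<open>Each component loses the constant of \<open>yw_lower\<close>, and the Euclidean norm is
  at most the sum of the moduli of the components.\<close>

lemma m1_le_yw:
  fixes V :: "'w \<Rightarrow> real^'k"
  assumes V: "L2 M V" and eps: "0 < \<epsilon>" "\<epsilon> < 1" and B: "\<And>i. (\<integral>\<omega>. yw \<epsilon> (V \<omega> $ i) \<partial>M) \<le> B"
  shows "(\<integral>\<^sup>+\<omega>. ennreal (norm (V \<omega>)) \<partial>M) \<le> ennreal (real CARD('k) * (B + 3 / (2 * ln (1 / \<epsilon>))))"
proof -
  let ?B = "B + 3 / (2 * ln (1 / \<epsilon>))"
  have Vi: "integrable M (\<lambda>\<omega>. V \<omega> $ i)" for i by (intro L2_imp_integrable L2_nth V)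
  have ywi: "integrable M (\<lambda>\<omega>. yw \<epsilon> (V \<omega> $ i))" for i
  proof (rule Bochner_Integration.integrable_bound[OF Vi])
    have "yw \<epsilon> \<in> borel_measurable borel"
      using DERIV_yw[OF eps] by (meson DERIV_isCont continuous_at_imp_continuous_on borel_measurable_continuous_onI)
    then show "(\<lambda>\<omega>. yw \<epsilon> (V \<omega> $ i)) \<in> borel_measurable M" using Vi by measurable
    show "AE \<omega> in M. norm (yw \<epsilon> (V \<omega> $ i)) \<le> norm (V \<omega> $ i)"
      using yw_Lipschitz[OF eps, of _ 0] by (intro always_eventually allI) (simp add: yw_0[OF eps])
  qed
  have c: "(\<integral>\<omega>. \<bar>V \<omega> $ i\<bar> \<partial>M) \<le> ?B" for i
  proof -
    have "(\<integral>\<omega>. \<bar>V \<omega> $ i\<bar> \<partial>M) \<le> (\<integral>\<omega>. yw \<epsilon> (V \<omega> $ i) + 3 / (2 * ln (1 / \<epsilon>)) \<partial>M)"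
    proof (rule integral_mono)
      show "\<bar>V \<omega> $ i\<bar> \<le> yw \<epsilon> (V \<omega> $ i) + 3 / (2 * ln (1 / \<epsilon>))" for \<omega> using yw_lower[OF eps, of "V \<omega> $ i"] by linarith
    qed (use Vi ywi in auto)
    also have "\<dots> = (\<integral>\<omega>. yw \<epsilon> (V \<omega> $ i) \<partial>M) + 3 / (2 * ln (1 / \<epsilon>))" using ywi by (simp add: prob_space)
    also have "\<dots> \<le> ?B" using B by simp
    finally show ?thesis .
  qed
  have "(\<integral>\<^sup>+\<omega>. ennreal (norm (V \<omega>)) \<partial>M) \<le> (\<integral>\<^sup>+\<omega>. ennreal (\<Sum>i\<in>UNIV. \<bar>V \<omega> $ i\<bar>) \<partial>M)"
    by (intro nn_integral_mono ennreal_leI norm_le_l1_cart)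
  also have "\<dots> = ennreal (\<integral>\<omega>. (\<Sum>i\<in>UNIV. \<bar>V \<omega> $ i\<bar>) \<partial>M)"
    using Vi by (intro nn_integral_eq_integral) (auto intro!: sum_nonneg)
  also have "(\<integral>\<omega>. (\<Sum>i\<in>UNIV. \<bar>V \<omega> $ i\<bar>) \<partial>M) = (\<Sum>i\<in>UNIV. \<integral>\<omega>. \<bar>V \<omega> $ i\<bar> \<partial>M)"
    using Vi by (intro Bochner_Integration.integral_sum) auto
  also have "ennreal \<dots> \<le> ennreal (\<Sum>i\<in>(UNIV :: 'k set). ?B)" by (intro ennreal_leI sum_mono c)
  finally show ?thesis by simp
qed

end

lemma telescope_le:
  fixes u \<rho> :: "nat \<Rightarrow> real"
  assumes "u 0 \<le> 0" "\<And>k. k < N \<Longrightarrow> u (Suc k) \<le> u k + \<rho> k + \<delta>" "k \<le> N"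
  shows "u k \<le> (\<Sum>j<k. \<rho> j) + real k * \<delta>"
  using assms(3)
proof (induction k)
  case (Suc k)
  then show ?case using assms(2)[of k] by (simp add: algebra_simps)
qed (use assms(1) in simp)

section \<open>Propagation of the squared error along the grid\<close>

context fbsde
begin

lemma euler_adapted: "euler N Xh Yh \<Longrightarrow> adapted_proc M F T Xh" "euler N Xh Yh \<Longrightarrow> adapted_proc M F T Yh"
  unfolding E3_sol_def by blast+

text \<open>Since the scheme freezes its coefficients, the error at any time is controlled by errors
  at grid points alone. The first moment of the error of \<open>X\<close> is left as a source: it is
  bounded crudely in \<open>euler_moment\<close> and kept as a parameter in
  \<open>euler_L2\<close>.\<close>

lemma euler_L2_raw:
  obtains C where "C > 0" and "\<And>N Xh Yh k t. N \<ge> 1 \<Longrightarrow> euler N Xh Yh \<Longrightarrow> k \<le> N \<Longrightarrow> 0 \<le> t \<Longrightarrow> t \<le> gridpt N k \<Longrightarrow>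
    msq (dX Xh t) + msq (dY Yh t) \<le> ennreal (C * (T / real N)) *
      (\<Sum>j<k. err2 N Xh Yh (gridpt N j))"
proof -
  obtain C1 where C1: "C1 > 0" and pw:
    "\<And>N r Xh Yh. N \<ge> 1 \<Longrightarrow> r \<in> {0..T} \<Longrightarrow> adapted_proc M F T Xh \<Longrightarrow> adapted_proc M F T Yh \<Longrightarrow>
      msq (\<Delta>b N Xh Yh r) \<le>
        ennreal C1 * err2 N Xh Yh (grid N T r)"
    "\<And>N r Xh Yh. N \<ge> 1 \<Longrightarrow> r \<in> {0..T} \<Longrightarrow> adapted_proc M F T Xh \<Longrightarrow> adapted_proc M F T Yh \<Longrightarrow>
      msq (\<Delta>f N Xh Yh r) \<le>
        ennreal C1 * err2 N Xh Yh (grid N T r)"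
    "\<And>N r Xh. N \<ge> 1 \<Longrightarrow> r \<in> {0..T} \<Longrightarrow> adapted_proc M F T Xh \<Longrightarrow>
      msq (\<Delta>\<sigma> N Xh r) \<le>
        ennreal C1 * (ennreal (sqrt (T / N)) + m1 (dX Xh (grid N T r)))"
    "\<And>N r. N \<ge> 1 \<Longrightarrow> r \<in> {0..T} \<Longrightarrow> msq (\<Delta>Z N r) \<le> ennreal C1 * ennreal (sqrt (T / N))"
    by (rule euler_pointwise) blast
  obtain IX IY where PX: "ito_proc x (\<lambda>s \<omega>. b s (X s \<omega>) (Y s \<omega>)) (\<lambda>s \<omega>. \<sigma> s (X s \<omega>)) X IX"
    and PY: "ito_proc y (\<lambda>s \<omega>. - f s (X s \<omega>) (Y s \<omega>) (Z s \<omega>)) Z Y IY" by (rule exact_procs)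
  define C where "C = (4 * T + 16) * C1"
  show ?thesis
  proof (rule that)
    show "C > 0" unfolding C_def using T C1 by simp
    fix N Xh Yh k t assume N: "N \<ge> 1" and E: "euler N Xh Yh" and k: "k \<le> N" and t: "0 \<le> t" "t \<le> gridpt N k"
    note ad = euler_adapted[OF E]
    obtain IXh IYh where PXh: "ito_proc x (\<lambda>s \<omega>. b (grid N T s) (Xh (grid N T s) \<omega>) (Yh (grid N T s) \<omega>)) (\<lambda>s \<omega>. \<sigma> (grid N T s) (Xh (grid N T s) \<omega>)) Xh IXh"
      and PYh: "ito_proc y (\<lambda>s \<omega>. - f (grid N T s) (Xh (grid N T s) \<omega>) (Yh (grid N T s) \<omega>) (Z (grid N T s) \<omega>)) (\<lambda>s. Z (grid N T s)) Yh IYh"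
      by (rule euler_procs[OF N E])
    have N0: "real N > 0" using N by simp
    have "gridpt N k \<le> T" using grid_step_mono[OF T k, of N] N0 by simp
    then have tT: "t \<le> T" using t by simp
    define U where "U u = err2 N Xh Yh u" for u
    define J where "J = (\<integral>\<^sup>+r\<in>{0..gridpt N k}. ennreal C1 * U (grid N T r) \<partial>lborel)"
    have EIJ: "EI 0 t g \<le> J" if g: "joint_meas g" "\<And>r. r \<in> {0..T} \<Longrightarrow> (\<integral>\<^sup>+\<omega>. g r \<omega> \<partial>M) \<le> ennreal C1 * U (grid N T r)" for g
      unfolding EI_swap[OF g(1) order.refl tT] J_def using t tT g(2) by (intro nn_integral_mono) (auto simp: indicator_def)
    \<comment> \<open>\<open>2 * t\<close> and 8 are the constants of \<open>ito_proc_diff0\<close>;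
      \<open>X\<close> and \<open>Y\<close> each contribute \<open>2 * T + 8\<close>.\<close>
    have one: "ennreal (2 * t) * e1 + 8 * e2 \<le> ennreal (2 * T + 8) * J" if "e1 \<le> J" "e2 \<le> J" for e1 e2
    proof -
      have "ennreal (2 * t) * e1 + 8 * e2 \<le> ennreal (2 * T) * J + ennreal 8 * J"
        using that tT t by (intro add_mono mult_mono ennreal_leI) auto
      also have "\<dots> = ennreal (2 * T + 8) * J" using T by (subst ennreal_plus) (auto simp: distrib_right)
      finally show ?thesis .
    qed
    note j = ito_procD(1,2)[OF PX] ito_procD(1,2)[OF PY] ito_procD(1,2)[OF PXh] ito_procD(1,2)[OF PYh]
    have "msq (dX Xh t) \<le> ennreal (2 * T + 8) * J"
    proof (rule order_trans[OF ito_proc_diff0[OF PX PXh t(1) tT] one])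
      show "EI 0 t (\<lambda>r \<omega>. nsq (b r (X r \<omega>) (Y r \<omega>) - b (grid N T r) (Xh (grid N T r) \<omega>) (Yh (grid N T r) \<omega>))) \<le> J"
        unfolding U_def by (rule EIJ[OF joint_meas_norm_sq[OF joint_meas_diff[OF j(1,5)]], unfolded U_def]) (rule pw(1)[OF N _ ad])
      show "EI 0 t (\<lambda>r \<omega>. nsq (\<sigma> r (X r \<omega>) - \<sigma> (grid N T r) (Xh (grid N T r) \<omega>))) \<le> J"
      proof (rule EIJ[OF joint_meas_norm_sq[OF joint_meas_diff[OF j(2,6)]]])
        fix r assume "r \<in> {0..T}"
        from pw(3)[OF N this ad(1)] show "msq (\<Delta>\<sigma> N Xh r) \<le> ennreal C1 * U (grid N T r)"
          unfolding U_def by (rule order_trans) (intro mult_left_mono add_right_mono, simp_all)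
      qed
    qed
    moreover have "msq (dY Yh t) \<le> ennreal (2 * T + 8) * J"
    proof (rule order_trans[OF ito_proc_diff0[OF PY PYh t(1) tT] one])
      show "EI 0 t (\<lambda>r \<omega>. nsq (- f r (X r \<omega>) (Y r \<omega>) (Z r \<omega>) - - f (grid N T r) (Xh (grid N T r) \<omega>) (Yh (grid N T r) \<omega>) (Z (grid N T r) \<omega>))) \<le> J"
      proof (rule EIJ[OF joint_meas_norm_sq[OF joint_meas_diff[OF j(3,7)]]])
        fix r assume "r \<in> {0..T}"
        from pw(2)[OF N this ad] show "msq (\<lambda>\<omega>. - f r (X r \<omega>) (Y r \<omega>) (Z r \<omega>) - - f (grid N T r) (Xh (grid N T r) \<omega>) (Yh (grid N T r) \<omega>) (Z (grid N T r) \<omega>)) \<le> ennreal C1 * U (grid N T r)"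
          unfolding U_def by (simp add: norm_minus_commute)
      qed
      show "EI 0 t (\<lambda>r \<omega>. nsq (Z r \<omega> - Z (grid N T r) \<omega>)) \<le> J"
      proof (rule EIJ[OF joint_meas_norm_sq[OF joint_meas_diff[OF j(4,8)]]])
        fix r assume "r \<in> {0..T}"
        from pw(4)[OF N this] show "msq (\<Delta>Z N r) \<le> ennreal C1 * U (grid N T r)"
          unfolding U_def by (rule order_trans) (intro mult_left_mono, simp_all add: add.assoc)
      qed
    qed
    ultimately have "msq (dX Xh t) + msq (dY Yh t) \<le> ennreal (2 * T + 8) * J + ennreal (2 * T + 8) * J" by (rule add_mono)
    also have "\<dots> = ennreal (4 * T + 16) * J"
    proof -
      have "ennreal (4 * T + 16) = ennreal (2 * T + 8) + ennreal (2 * T + 8)" using T ennreal_plus[of "2 * T + 8" "2 * T + 8"] by simp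
      then show ?thesis by (simp only: distrib_right)
    qed
    also have "J = ennreal (T / real N) * (\<Sum>j<k. ennreal C1 * U (gridpt N j))"
      unfolding J_def by (rule grid_sum[OF T N])
    also have "(\<Sum>j<k. ennreal C1 * U (gridpt N j)) = ennreal C1 * (\<Sum>j<k. U (gridpt N j))" by (simp add: sum_distrib_left)
    also have "ennreal (4 * T + 16) * (ennreal (T / real N) * (ennreal C1 * (\<Sum>j<k. U (gridpt N j)))) =
      ennreal (C * (T / real N)) * (\<Sum>j<k. U (gridpt N j))"
    proof -
      have "ennreal (C * (T / real N)) = ennreal (4 * T + 16) * ennreal C1 * ennreal (T / real N)"
        unfolding C_def using T C1 N0 by (subst ennreal_mult[symmetric], simp, simp)+ simp
      then show ?thesis by (simp only: mult_ac)
    qed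
    finally show "msq (dX Xh t) + msq (dY Yh t) \<le> ennreal (C * (T / real N)) *
      (\<Sum>j<k. err2 N Xh Yh (gridpt N j))"
      unfolding U_def .
  qed
qed

lemma grid_in: "N \<ge> 1 \<Longrightarrow> j \<le> N \<Longrightarrow> gridpt N j \<in> {0..T}"
  using grid_step_mono[OF T, of j N N] T by simp

text \<open>The crude bound of a first moment by 1 plus the second moment closes the recursion. It
  gives no rate, only a bound uniform in \<open>N\<close>, which serves as \<open>m2\<close> in
  \<open>component_step\<close> and shows that the L1 errors are finite.\<close>

lemma euler_moment:
  obtains C where "C > 0" and "\<And>N Xh Yh k. N \<ge> 1 \<Longrightarrow> euler N Xh Yh \<Longrightarrow> k \<le> N \<Longrightarrow>
    msq (dX Xh (gridpt N k)) + msq (dY Yh (gridpt N k)) \<le> ennreal C"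
proof -
  obtain C0 where C0: "C0 > 0" and raw: "\<And>N Xh Yh k t. N \<ge> 1 \<Longrightarrow> euler N Xh Yh \<Longrightarrow> k \<le> N \<Longrightarrow> 0 \<le> t \<Longrightarrow> t \<le> gridpt N k \<Longrightarrow>
    msq (dX Xh t) + msq (dY Yh t) \<le> ennreal (C0 * (T / real N)) *
      (\<Sum>j<k. err2 N Xh Yh (gridpt N j))"
    by (rule euler_L2_raw) blast
  define c where "c = 2 * C0"
  define a where "a = sqrt T + 1"
  define C where "C = c * T * a * (1 + c * T * exp (c * T))"
  have c: "c > 0" unfolding c_def using C0 by simp
  have a: "a > 0" unfolding a_def using T by (simp add: add_nonneg_pos)
  show ?thesis
  proof (rule that)
    show "C > 0" unfolding C_def using c a T by (simp add: add_pos_pos)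
    fix N Xh Yh k assume N: "N \<ge> 1" and E: "euler N Xh Yh" and k: "k \<le> N"
    note ad = euler_adapted[OF E]
    define v where "v j = msq (dX Xh (gridpt N j)) + msq (dY Yh (gridpt N j))" for j
    have m: "m1 (dX Xh (gridpt N j)) \<le> 1 + v j" if "j \<le> N" for j
    proof -
      have "dX Xh (gridpt N j) \<in> borel_measurable M"
        by (intro borel_measurable_diff adapted_meas[OF X_ad] adapted_meas[OF ad(1)] grid_in N that)
      from l1_le[OF this zero_less_one] show ?thesis unfolding v_def by (simp add: add_mono order_trans)
    qed
    have h: "sqrt (T / real N) \<le> sqrt T" using T N by (simp add: divide_le_eq)
    \<comment> \<open>With \<open>k' = k\<close> this is the recursion on the grid; with
      \<open>k' = N\<close> it gives the final bound, taken over all grid points.\<close>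
    have rec: "v k \<le> ennreal (c * (T / real N)) * (\<Sum>j<k'. ennreal a + v j)" if "k \<le> k'" "k' \<le> N" for k k'
    proof -
      have kk: "gridpt N k \<le> gridpt N k'" by (rule grid_step_mono[OF T that(1)])
      have "v k \<le> ennreal (C0 * (T / real N)) * (\<Sum>j<k'. ennreal (sqrt (T / real N)) + v j + m1 (dX Xh (gridpt N j)))"
        unfolding v_def using T by (intro raw[OF N E that(2) _ kk]) simp
      also have "\<dots> \<le> ennreal (C0 * (T / real N)) * (\<Sum>j<k'. 2 * (ennreal a + v j))"
      proof (intro mult_left_mono sum_mono)
        fix j assume "j \<in> {..<k'}"
        then have "ennreal (sqrt (T / real N)) + v j + m1 (dX Xh (gridpt N j)) \<le> ennreal (sqrt T) + v j + (1 + v j)"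
          using that by (intro add_mono ennreal_leI h m order.refl) simp
        also have "\<dots> = ennreal a + (v j + v j)" unfolding a_def using T by (simp add: ac_simps)
        also have "\<dots> \<le> 2 * (ennreal a + v j)"
          by (simp add: distrib_left mult_2 add_mono add_increasing)
        finally show "ennreal (sqrt (T / real N)) + v j + m1 (dX Xh (gridpt N j)) \<le> 2 * (ennreal a + v j)" .
      qed simp
      also have "\<dots> = (ennreal (C0 * (T / real N)) * 2) * (\<Sum>j<k'. ennreal a + v j)"
        by (simp only: sum_distrib_left[symmetric] mult.assoc)
      also have "ennreal (C0 * (T / real N)) * 2 = ennreal (c * (T / real N))"
        unfolding c_def using C0 T ennreal_mult[of "C0 * (T / real N)" 2] by (simp add: mult_ac)
      finally show ?thesis .
    qed
    have "v k \<le> ennreal C" unfolding C_def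
      by (rule grid_Gronwall[OF T N _ _ rec[OF order.refl] rec[OF k order.refl]]) (use a c in auto)
    then show "msq (dX Xh (gridpt N k)) + msq (dY Yh (gridpt N k)) \<le> ennreal C" unfolding v_def .
  qed
qed

text \<open>A uniform L1 bound \<open>\<mu>\<close> at the grid points acts as a constant source, so
  the squared error inherits its order linearly.\<close>

lemma euler_L2:
  obtains C where "C > 0" and "\<And>N Xh Yh \<mu> t. N \<ge> 1 \<Longrightarrow> euler N Xh Yh \<Longrightarrow> \<mu> \<ge> 0 \<Longrightarrow>
    (\<And>j. j < N \<Longrightarrow> m1 (dX Xh (gridpt N j)) \<le> ennreal \<mu>) \<Longrightarrow> t \<in> {0..T} \<Longrightarrow>
    msq (dX Xh t) + msq (dY Yh t) \<le> ennreal (C * (sqrt (T / real N) + \<mu>))"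
proof -
  obtain c where c: "c > 0" and raw: "\<And>N Xh Yh k t. N \<ge> 1 \<Longrightarrow> euler N Xh Yh \<Longrightarrow> k \<le> N \<Longrightarrow> 0 \<le> t \<Longrightarrow> t \<le> gridpt N k \<Longrightarrow>
    msq (dX Xh t) + msq (dY Yh t) \<le> ennreal (c * (T / real N)) *
      (\<Sum>j<k. err2 N Xh Yh (gridpt N j))"
    by (rule euler_L2_raw) blast
  define C where "C = c * T * (1 + c * T * exp (c * T))"
  show ?thesis
  proof (rule that)
    show "C > 0" unfolding C_def using c T by (simp add: add_pos_pos)
    fix N Xh Yh \<mu> t assume N: "N \<ge> 1" and E: "euler N Xh Yh" and \<mu>: "\<mu> \<ge> 0"
      and m: "\<And>j. j < N \<Longrightarrow> m1 (dX Xh (gridpt N j)) \<le> ennreal \<mu>" and t: "t \<in> {0..T}"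
    have N0: "real N > 0" using N by simp
    define v where "v j = msq (dX Xh (gridpt N j)) + msq (dY Yh (gridpt N j))" for j
    have rec: "msq (dX Xh t) + msq (dY Yh t) \<le> ennreal (c * (T / real N)) * (\<Sum>j<k. ennreal (sqrt (T / real N) + \<mu>) + v j)"
      if "k \<le> N" "0 \<le> t" "t \<le> gridpt N k" for k t
    proof -
      have "msq (dX Xh t) + msq (dY Yh t) \<le> ennreal (c * (T / real N)) * (\<Sum>j<k. ennreal (sqrt (T / real N)) + v j + m1 (dX Xh (gridpt N j)))"
        unfolding v_def by (rule raw[OF N E that])
      also have "\<dots> \<le> ennreal (c * (T / real N)) * (\<Sum>j<k. ennreal (sqrt (T / real N) + \<mu>) + v j)"
      proof (intro mult_left_mono sum_mono)
        fix j assume "j \<in> {..<k}"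
        then have "ennreal (sqrt (T / real N)) + v j + m1 (dX Xh (gridpt N j)) \<le> ennreal (sqrt (T / real N)) + v j + ennreal \<mu>"
          using that by (intro add_left_mono m) simp
        also have "\<dots> = ennreal (sqrt (T / real N) + \<mu>) + v j" using T \<mu> by (simp add: ac_simps)
        finally show "ennreal (sqrt (T / real N)) + v j + m1 (dX Xh (gridpt N j)) \<le> ennreal (sqrt (T / real N) + \<mu>) + v j" .
      qed simp
      finally show ?thesis .
    qed
    have "msq (dX Xh t) + msq (dY Yh t) \<le> ennreal (c * T * (sqrt (T / real N) + \<mu>) * (1 + c * T * exp (c * T)))"
    proof (rule grid_Gronwall[OF T N, of c "sqrt (T / real N) + \<mu>" v])
      show "v k \<le> ennreal (c * (T / real N)) * (\<Sum>j<k. ennreal (sqrt (T / real N) + \<mu>) + v j)" if "k \<le> N" for k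
        unfolding v_def[of k] by (rule rec[OF that]) (use T in auto)
      show "msq (dX Xh t) + msq (dY Yh t) \<le> ennreal (c * (T / real N)) * (\<Sum>j<N. ennreal (sqrt (T / real N) + \<mu>) + v j)"
        by (rule rec) (use t N0 in auto)
    qed (use c \<mu> T in auto)
    then show "msq (dX Xh t) + msq (dY Yh t) \<le> ennreal (C * (sqrt (T / real N) + \<mu>))" unfolding C_def by (simp add: mult_ac)
  qed
qed

lemma \<sigma>_L2:
  assumes V: "L2 M V" and t: "t \<in> {0..T}" shows "L2 M (\<lambda>\<omega>. \<sigma> t (V \<omega>))"
proof -
  obtain G where G: "\<And>t z. t \<in> {0..T} \<Longrightarrow> (norm (\<sigma> t z))\<^sup>2 \<le> G * (1 + (norm z)\<^sup>2)" by (rule growth) blast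
  have m: "(\<lambda>\<omega>. \<sigma> t (V \<omega>)) \<in> borel_measurable M" by (rule measurable_compose[OF L2_measurable[OF V] \<sigma>_measurable[OF t]])
  show ?thesis unfolding L2_iff
  proof
    show "integrable M (\<lambda>\<omega>. (norm (\<sigma> t (V \<omega>)))\<^sup>2)"
      by (rule Bochner_Integration.integrable_bound[of _ "\<lambda>\<omega>. G * (1 + (norm (V \<omega>))\<^sup>2)"])
        (use G[OF t] L2_integrable[OF V] m in \<open>auto intro!: order_trans[OF _ abs_ge_self]\<close>)
  qed (rule m)
qed

end

section \<open>The L1 error at the grid points and the rate\<close>

context fbsde
begin

text \<open>Along the grid the means of \<open>yw\<close> over all components grow in each step by
  the drift error \<open>\<rho> j\<close> and by \<open>\<delta>\<close>, which is \<open>h\<close>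
  times a constant over \<open>ln N\<close>. Summation and \<open>yw_lower\<close> turn this into a
  linear recursion for the total L1 error of \<open>X\<close> and \<open>Y\<close>, solved by the
  discrete Gronwall inequality. The drift couples the components, so the recursion closes only for
  the total.\<close>

lemma euler_L1:
  obtains A where "A > 0" and "\<And>N Xh Yh k. N \<ge> 2 \<Longrightarrow> euler N Xh Yh \<Longrightarrow> k \<le> N \<Longrightarrow>
    m1 (dX Xh (gridpt N k)) \<le> ennreal (A / ln (real N))"
proof -
  obtain C1 where C1: "C1 > 0" and pw:
    "\<And>N r Xh. N \<ge> 1 \<Longrightarrow> r \<in> {0..T} \<Longrightarrow> adapted_proc M F T Xh \<Longrightarrow>
      msq (\<Delta>\<sigma> N Xh r) \<le>
        ennreal C1 * (ennreal (sqrt (T / N)) + m1 (dX Xh (grid N T r)))"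
    "\<And>N r. N \<ge> 1 \<Longrightarrow> r \<in> {0..T} \<Longrightarrow> msq (\<Delta>Z N r) \<le> ennreal C1 * ennreal (sqrt (T / N))"
    "\<And>N r Xh Yh. N \<ge> 1 \<Longrightarrow> r \<in> {0..T} \<Longrightarrow> adapted_proc M F T Xh \<Longrightarrow> adapted_proc M F T Yh \<Longrightarrow>
      m1 (\<Delta>b N Xh Yh r) \<le>
        ennreal C1 * err1 N Xh Yh (grid N T r)"
    "\<And>N r Xh Yh. N \<ge> 1 \<Longrightarrow> r \<in> {0..T} \<Longrightarrow> adapted_proc M F T Xh \<Longrightarrow> adapted_proc M F T Yh \<Longrightarrow>
      m1 (\<Delta>f N Xh Yh r) \<le>
        ennreal C1 * err1 N Xh Yh (grid N T r)"
    by (rule euler_pointwise) blast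
  obtain CV where CV: "CV > 0" "\<And>N Xh Yh k. N \<ge> 1 \<Longrightarrow> euler N Xh Yh \<Longrightarrow> k \<le> N \<Longrightarrow>
    msq (dX Xh (gridpt N k)) + msq (dY Yh (gridpt N k)) \<le> ennreal CV"
    by (rule euler_moment) blast
  obtain CM where CM: "CM > 0" "\<And>t. t \<in> {0..T} \<Longrightarrow> msq (X t) \<le> ennreal CM" "\<And>t. t \<in> {0..T} \<Longrightarrow> msq (Z t) \<le> ennreal CM"
    by (rule moments) blast
  obtain IX IY where PX: "ito_proc x (\<lambda>s \<omega>. b s (X s \<omega>) (Y s \<omega>)) (\<lambda>s \<omega>. \<sigma> s (X s \<omega>)) X IX"
    and PY: "ito_proc y (\<lambda>s \<omega>. - f s (X s \<omega>) (Y s \<omega>) (Z s \<omega>)) Z Y IY" by (rule exact_procs)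
  define Q where "Q = T powr (1/4)"
  define Cst where "Cst = (1 + Q) * (L * (1 + CV) + 3 * (real CARD('d))\<^sup>2 * L\<^sup>2 * CV + 4 * C1)"
  define nm where "nm = real CARD('n) + real CARD('m)"
  \<comment> \<open>The factor 8 comes from \<open>ln (1 / \<epsilon>) = ln N / 8\<close>, and 12 is
    8 times the constant 3/2 of \<open>yw_lower\<close>. The first summand is the time-regularity
    part of the drift error, after \<open>sqrt h\<close> has been replaced by a multiple of
    \<open>1 / ln N\<close>.\<close>
  define A0 where "A0 = nm * (2 * C1 * T * sqrt T + 8 * T * (L / 2 + Q * Cst) + 12)"
  define A where "A = A0 * exp (nm * C1 * T)"
  have Q: "Q > 0" unfolding Q_def using T by simp
  have Cst: "Cst \<ge> 0" unfolding Cst_def using Q L CV(1) C1 by (intro mult_nonneg_nonneg add_nonneg_nonneg) auto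
  have nm: "nm > 0" unfolding nm_def by (simp add: add_pos_pos)
  have "0 < 2 * C1 * T * sqrt T + 8 * T * (L / 2 + Q * Cst) + 12"
    using C1 T L Q Cst by (intro add_nonneg_pos add_nonneg_nonneg mult_nonneg_nonneg) auto
  then have A0: "A0 > 0" unfolding A0_def using nm by simp
  show ?thesis
  proof (rule that)
    show "A > 0" unfolding A_def using A0 by simp
    fix N Xh Yh k assume N2: "N \<ge> 2" and E: "euler N Xh Yh" and kN: "k \<le> N"
    have N: "N \<ge> 1" and N0: "real N > 0" and N1: "real N > 1" using N2 by auto
    note ad = euler_adapted[OF E]
    obtain IXh IYh where PXh: "ito_proc x (\<lambda>s \<omega>. b (grid N T s) (Xh (grid N T s) \<omega>) (Yh (grid N T s) \<omega>)) (\<lambda>s \<omega>. \<sigma> (grid N T s) (Xh (grid N T s) \<omega>)) Xh IXh"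
      and PYh: "ito_proc y (\<lambda>s \<omega>. - f (grid N T s) (Xh (grid N T s) \<omega>) (Yh (grid N T s) \<omega>) (Z (grid N T s) \<omega>)) (\<lambda>s. Z (grid N T s)) Yh IYh"
      by (rule euler_procs[OF N E])
    define tj where "tj j = gridpt N j" for j
    define h where "h = T / real N"
    define q where "q = h powr (1/4)"
    define \<epsilon> where "\<epsilon> = real N powr (- 1/8)" \<comment> \<open>makes \<open>q / \<epsilon>\<^sup>2\<close> independent of \<open>N\<close>\<close>
    have h: "h > 0" "h \<le> T" unfolding h_def using T N by (auto simp: divide_le_eq)
    have q: "q > 0" "q ^ 4 = h" "q\<^sup>2 = sqrt h"
    proof -
      show "q > 0" unfolding q_def using h by simp
      show "q ^ 4 = h" unfolding q_def using h by (simp add: powr_power)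
      show "q\<^sup>2 = sqrt h" unfolding q_def using h by (simp add: powr_power powr_half_sqrt)
    qed
    have qQ: "q \<le> Q" unfolding q_def Q_def using h by (intro powr_mono2) auto
    have eps: "0 < \<epsilon>" "\<epsilon> < 1" unfolding \<epsilon>_def using N1 powr_less_one[of "real N" "-1/8"] by auto
    have Lam: "ln (1 / \<epsilon>) = ln (real N) / 8" unfolding \<epsilon>_def using N0 by (simp add: ln_div ln_powr)
    have lnN: "ln (real N) > 0" using N1 by simp
    have qe: "q / \<epsilon>\<^sup>2 = Q"
    proof -
      have e2: "\<epsilon>\<^sup>2 = real N powr (- (1/4))" unfolding \<epsilon>_def using N0 by (simp add: powr_power)
      have "q = T powr (1/4) * real N powr (- (1/4))" unfolding q_def h_def using T N0 by (simp add: powr_divide powr_minus_divide)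
      then show ?thesis unfolding e2 Q_def using N0 by simp
    qed
    have tjT: "tj j \<in> {0..T}" if "j \<le> N" for j unfolding tj_def by (rule grid_in[OF N that])
    have LX: "L2 M (X (tj j))" and LZ: "L2 M (Z (tj j))" and LdX: "L2 M (dX Xh (tj j))" and LdY: "L2 M (dY Yh (tj j))"
      and mdX: "msq (dX Xh (tj j)) \<le> ennreal CV" and mdY: "msq (dY Yh (tj j)) \<le> ennreal CV" if j: "j \<le> N" for j
    proof -
      note t = tjT[OF j]
      have m: "msq (dX Xh (tj j)) + msq (dY Yh (tj j)) \<le> ennreal CV" unfolding tj_def by (rule CV(2)[OF N E j])
      show m1: "msq (dX Xh (tj j)) \<le> ennreal CV" by (rule order_trans[OF _ m]) simp
      show m2: "msq (dY Yh (tj j)) \<le> ennreal CV" by (rule order_trans[OF _ m]) simp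
      show "L2 M (X (tj j))" "L2 M (Z (tj j))" unfolding L2_def
        using adapted_meas[OF X_ad t] adapted_meas[OF Z_ad t] CM(2,3)[OF t] by (auto intro: le_less_trans)
      show "L2 M (dX Xh (tj j))" unfolding L2_def
        using borel_measurable_diff[OF adapted_meas[OF X_ad t] adapted_meas[OF ad(1) t]] m1 by (auto intro: le_less_trans)
      show "L2 M (dY Yh (tj j))" unfolding L2_def
        using borel_measurable_diff[OF adapted_meas[OF Y_ad t] adapted_meas[OF ad(2) t]] m2 by (auto intro: le_less_trans)
    qed
    have LXh: "L2 M (Xh (tj j))" if "j \<le> N" for j
      by (rule L2_cong[OF L2_diff[OF LX[OF that] LdX[OF that]]]) simp
    define w where "w j = m1 (dX Xh (tj j)) + m1 (dY Yh (tj j))" for j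
    have wfin: "w j < \<infinity>" if j: "j \<le> N" for j
    proof -
      have "m1 (dX Xh (tj j)) \<le> ennreal 1 + ennreal (1/1) * ennreal CV"
        by (rule order_trans[OF l1_le[OF L2_measurable[OF LdX[OF j]] zero_less_one]]) (intro add_left_mono mult_left_mono mdX[OF j], simp)
      moreover have "m1 (dY Yh (tj j)) \<le> ennreal 1 + ennreal (1/1) * ennreal CV"
        by (rule order_trans[OF l1_le[OF L2_measurable[OF LdY[OF j]] zero_less_one]]) (intro add_left_mono mult_left_mono mdY[OF j], simp)
      ultimately have "w j \<le> (ennreal 1 + ennreal (1/1) * ennreal CV) + (ennreal 1 + ennreal (1/1) * ennreal CV)"
        unfolding w_def by (rule add_mono)
      also have "\<dots> < \<infinity>" by (simp add: ennreal_mult_less_top)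
      finally show ?thesis .
    qed
    \<comment> \<open>The means of \<open>yw\<close> are real numbers, so the errors in their step
      inequality are converted to reals; they are finite by the second-moment bounds.\<close>
    define r where "r j = enn2real (w j)" for j
    have r: "r j \<ge> 0" for j unfolding r_def by simp
    have wr: "w j = ennreal (r j)" if "j \<le> N" for j unfolding r_def using wfin[OF that] by (simp add: ennreal_enn2real)
    define \<rho> where "\<rho> j = C1 * (sqrt h + r j) * h" for j
    have \<rho>: "\<rho> j \<ge> 0" for j unfolding \<rho>_def using C1 r h by simp
    \<comment> \<open>The cost of one step apart from the drift: the second-order term and the
      Taylor remainder.\<close>
    define \<delta> where "\<delta> = h * L / (2 * ln (1 / \<epsilon>)) + q ^ 5 / (\<epsilon>\<^sup>2 * ln (1 / \<epsilon>)) * Cst"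
    have stepT: "tj (Suc j) - tj j = h" for j unfolding tj_def h_def by (simp add: diff_divide_distrib[symmetric] algebra_simps)
    have seg: "0 \<le> tj j" "tj j \<le> tj (Suc j)" "tj (Suc j) \<le> T" if "j < N" for j
      using tjT[of j] tjT[of "Suc j"] stepT[of j] h that by auto
    have gj: "grid N T s = tj j" if "tj j \<le> s" "s < tj (Suc j)" for s j
      using grid_eq[OF T N, of j s] that unfolding tj_def by simp
    \<comment> \<open>The freezing error: a squared coefficient increment of order
      \<open>sqrt h\<close>, integrated over a step of length \<open>h\<close>.\<close>
    have c6: "C1 * q ^ 6 = C1 * sqrt h * h" using q(2,3) by (simp add: power_numeral_reduce power2_eq_square mult.assoc)
    have driftX: "EI (tj j) (tj (Suc j)) (\<lambda>s \<omega>. ennreal (norm (b s (X s \<omega>) (Y s \<omega>) - b (grid N T s) (Xh (grid N T s) \<omega>) (Yh (grid N T s) \<omega>)))) \<le> ennreal (\<rho> j)"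
      and driftY: "EI (tj j) (tj (Suc j)) (\<lambda>s \<omega>. ennreal (norm (- f s (X s \<omega>) (Y s \<omega>) (Z s \<omega>) - - f (grid N T s) (Xh (grid N T s) \<omega>) (Yh (grid N T s) \<omega>) (Z (grid N T s) \<omega>)))) \<le> ennreal (\<rho> j)"
      if j: "j < N" for j
    proof -
      have V: "ennreal C1 * (ennreal (sqrt (T / N)) + (m1 (dX Xh (tj j)) + m1 (dY Yh (tj j)))) = ennreal (C1 * (sqrt h + r j))"
        using wr[of j] j C1 r[of j] h unfolding w_def h_def[symmetric] by (simp add: ennreal_mult)
      have c0: "0 \<le> C1 * (sqrt h + r j)" using C1 r[of j] h by simp
      show "EI (tj j) (tj (Suc j)) (\<lambda>s \<omega>. ennreal (norm (b s (X s \<omega>) (Y s \<omega>) - b (grid N T s) (Xh (grid N T s) \<omega>) (Yh (grid N T s) \<omega>)))) \<le> ennreal (\<rho> j)"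
        unfolding \<rho>_def stepT[of j, symmetric]
      proof (rule EI_le[OF joint_meas_norm[OF joint_meas_diff[OF ito_procD(1)[OF PX] ito_procD(1)[OF PXh]]] seg[OF j]])
        fix s assume s: "tj j \<le> s" "s < tj (Suc j)"
        then have sT: "s \<in> {0..T}" using seg[OF j] by auto
        show "m1 (\<Delta>b N Xh Yh s) \<le> ennreal (C1 * (sqrt (tj (Suc j) - tj j) + r j))"
          using pw(3)[OF N sT ad] unfolding gj[OF s] V stepT .
      qed (use c0 stepT in simp)
      show "EI (tj j) (tj (Suc j)) (\<lambda>s \<omega>. ennreal (norm (- f s (X s \<omega>) (Y s \<omega>) (Z s \<omega>) - - f (grid N T s) (Xh (grid N T s) \<omega>) (Yh (grid N T s) \<omega>) (Z (grid N T s) \<omega>)))) \<le> ennreal (\<rho> j)"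
        unfolding \<rho>_def stepT[of j, symmetric]
      proof (rule EI_le[OF joint_meas_norm[OF joint_meas_diff[OF ito_procD(1)[OF PY] ito_procD(1)[OF PYh]]] seg[OF j]])
        fix s assume s: "tj j \<le> s" "s < tj (Suc j)"
        then have sT: "s \<in> {0..T}" using seg[OF j] by auto
        have neg: "norm (- u - - v) = norm (u - v)" for u v :: "real^'m" by (simp add: norm_minus_commute)
        show "m1 (\<lambda>\<omega>. - f s (X s \<omega>) (Y s \<omega>) (Z s \<omega>) - - f (grid N T s) (Xh (grid N T s) \<omega>) (Yh (grid N T s) \<omega>) (Z (grid N T s) \<omega>)) \<le> ennreal (C1 * (sqrt (tj (Suc j) - tj j) + r j))"
          using pw(4)[OF N sT ad] unfolding neg gj[OF s] V stepT .
      qed (use c0 stepT in simp)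
    qed
    have martX: "EI (tj j) (tj (Suc j)) (\<lambda>s \<omega>. nsq (\<sigma> s (X s \<omega>) - \<sigma> (grid N T s) (X (grid N T s) \<omega>))) \<le> ennreal (C1 * q ^ 6)"
      and martZ: "EI (tj j) (tj (Suc j)) (\<lambda>s \<omega>. nsq (Z s \<omega> - Z (grid N T s) \<omega>)) \<le> ennreal (C1 * q ^ 6)"
      if j: "j < N" for j
    proof -
      have c0: "0 \<le> C1 * sqrt h" using C1 h by simp
      note jX = ito_procD(2)[OF PX] and jZ = ito_procD(2)[OF PY]
      have "EI (tj j) (tj (Suc j)) (\<lambda>s \<omega>. nsq (\<sigma> s (X s \<omega>) - \<sigma> (grid N T s) (X (grid N T s) \<omega>))) \<le> ennreal (C1 * sqrt h * (tj (Suc j) - tj j))"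
      proof (rule EI_le[OF joint_meas_norm_sq[OF joint_meas_diff[OF jX joint_meas_grid[OF N jX]]] seg[OF j] c0])
        fix s assume s: "tj j \<le> s" "s < tj (Suc j)"
        then have sT: "s \<in> {0..T}" using seg[OF j] by auto
          \<comment> \<open>The estimate for the scheme is used with \<open>X\<close> itself as the
            approximation, so its first-moment term vanishes.\<close>
          show "msq (\<Delta>\<sigma> N X s) \<le> ennreal (C1 * sqrt h)"
            using pw(1)[OF N sT X_ad] C1 h unfolding h_def[symmetric] by (simp add: ennreal_mult)
      qed
      then show "EI (tj j) (tj (Suc j)) (\<lambda>s \<omega>. nsq (\<sigma> s (X s \<omega>) - \<sigma> (grid N T s) (X (grid N T s) \<omega>))) \<le> ennreal (C1 * q ^ 6)"
        unfolding c6 stepT .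
      have "EI (tj j) (tj (Suc j)) (\<lambda>s \<omega>. nsq (Z s \<omega> - Z (grid N T s) \<omega>)) \<le> ennreal (C1 * sqrt h * (tj (Suc j) - tj j))"
      proof (rule EI_le[OF joint_meas_norm_sq[OF joint_meas_diff[OF jZ joint_meas_grid[OF N jZ]]] seg[OF j] c0])
        fix s assume s: "tj j \<le> s" "s < tj (Suc j)"
        then have sT: "s \<in> {0..T}" using seg[OF j] by auto
          show "msq (\<Delta>Z N s) \<le> ennreal (C1 * sqrt h)"
            using pw(2)[OF N sT] C1 h unfolding h_def[symmetric] by (simp add: ennreal_mult)
      qed
      then show "EI (tj j) (tj (Suc j)) (\<lambda>s \<omega>. nsq (Z s \<omega> - Z (grid N T s) \<omega>)) \<le> ennreal (C1 * q ^ 6)"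
        unfolding c6 stepT .
    qed
    have stepX: "(\<integral>\<omega>. yw \<epsilon> (dX Xh (tj (Suc j)) \<omega> $ i) \<partial>M) \<le> (\<integral>\<omega>. yw \<epsilon> (dX Xh (tj j) \<omega> $ i) \<partial>M) + \<rho> j + \<delta>" if j: "j < N" for j i
    proof -
      have jN: "j \<le> N" using j by simp
      have "(\<integral>\<omega>. yw \<epsilon> ((X (tj (Suc j)) \<omega> - Xh (tj (Suc j)) \<omega>) $ i) \<partial>M) \<le> (\<integral>\<omega>. yw \<epsilon> ((X (tj j) \<omega> - Xh (tj j) \<omega>) $ i) \<partial>M) + \<rho> j +
        T / real N * L / (2 * ln (1 / \<epsilon>)) + q ^ 5 / (\<epsilon>\<^sup>2 * ln (1 / \<epsilon>)) * ((1 + Q) * (L * (1 + CV) + 3 * (real CARD('d))\<^sup>2 * L\<^sup>2 * CV + 4 * C1))"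
      proof (rule component_step[OF N j PX, where K = "\<lambda>s \<omega>. \<sigma> s (X s \<omega>)" and K' = "\<lambda>s \<omega>. \<sigma> s (Xh s \<omega>)"])
        show "ito_proc x (\<lambda>s \<omega>. b (grid N T s) (Xh (grid N T s) \<omega>) (Yh (grid N T s) \<omega>)) (\<lambda>r \<omega>. \<sigma> (grid N T r) (Xh (grid N T r) \<omega>)) Xh IXh" by (rule PXh)
        show "tj j = gridpt N j" "tj (Suc j) = real (Suc j) * T / real N" by (simp_all only: tj_def)
        show "X (tj j) \<in> borel_measurable (FA (tj j))" "Xh (tj j) \<in> borel_measurable (FA (tj j))"
          using adapted_FA[OF X_ad tjT[OF jN]] adapted_FA[OF ad(1) tjT[OF jN]] .
        show "(norm (\<sigma> (tj j) (X (tj j) \<omega>) $ i - \<sigma> (tj j) (Xh (tj j) \<omega>) $ i))\<^sup>2 \<le> L * \<bar>X (tj j) \<omega> $ i - Xh (tj j) \<omega> $ i\<bar>" for \<omega>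
          using \<sigma>_row[OF tjT[OF jN] tjT[OF jN]] by simp
        show "T / real N = q ^ 4" using q(2) by (simp add: h_def)
      next
        fix l assume l: "l < N"
        then have t: "gridpt N l \<in> {0..T}" using tjT[of l] unfolding tj_def by simp
        show "(\<lambda>\<omega>. \<sigma> (gridpt N l) (X (gridpt N l) \<omega>)) \<in> borel_measurable (FA (gridpt N l))"
          "(\<lambda>\<omega>. \<sigma> (gridpt N l) (Xh (gridpt N l) \<omega>)) \<in> borel_measurable (FA (gridpt N l))"
          by (rule measurable_compose[OF adapted_FA[OF X_ad t] \<sigma>_measurable[OF t]], rule measurable_compose[OF adapted_FA[OF ad(1) t] \<sigma>_measurable[OF t]])
        show "L2 M (\<lambda>\<omega>. \<sigma> (gridpt N l) (X (gridpt N l) \<omega>))" "L2 M (\<lambda>\<omega>. \<sigma> (gridpt N l) (Xh (gridpt N l) \<omega>))"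
          using \<sigma>_L2[OF LX t, of l] \<sigma>_L2[OF LXh t, of l] l unfolding tj_def by simp_all
      qed (use mdX[OF jN] CV(1) L driftX[OF j] \<rho> martX[OF j] C1 q(1) qQ eps in simp_all)
      then show ?thesis unfolding \<delta>_def Cst_def h_def by (simp only: add.assoc)
    qed
    have stepY: "(\<integral>\<omega>. yw \<epsilon> (dY Yh (tj (Suc j)) \<omega> $ i) \<partial>M) \<le> (\<integral>\<omega>. yw \<epsilon> (dY Yh (tj j) \<omega> $ i) \<partial>M) + \<rho> j + \<delta>" if j: "j < N" for j i
    proof -
      have jN: "j \<le> N" using j by simp
      have "(\<integral>\<omega>. yw \<epsilon> ((Y (tj (Suc j)) \<omega> - Yh (tj (Suc j)) \<omega>) $ i) \<partial>M) \<le> (\<integral>\<omega>. yw \<epsilon> ((Y (tj j) \<omega> - Yh (tj j) \<omega>) $ i) \<partial>M) + \<rho> j +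
        T / real N * L / (2 * ln (1 / \<epsilon>)) + q ^ 5 / (\<epsilon>\<^sup>2 * ln (1 / \<epsilon>)) * ((1 + Q) * (L * (1 + CV) + 3 * (real CARD('d))\<^sup>2 * L\<^sup>2 * CV + 4 * C1))"
      \<comment> \<open>Both frozen coefficients are \<open>Z\<close>, so their difference is 0 and
        the row condition holds whatever the error of \<open>Y\<close> is.\<close>
      proof (rule component_step[OF N j PY PYh, where K = Z])
        show "tj j = gridpt N j" "tj (Suc j) = real (Suc j) * T / real N" by (simp_all only: tj_def)
        show "Y (tj j) \<in> borel_measurable (FA (tj j))" "Yh (tj j) \<in> borel_measurable (FA (tj j))"
          using adapted_FA[OF Y_ad tjT[OF jN]] adapted_FA[OF ad(2) tjT[OF jN]] .
        show "T / real N = q ^ 4" using q(2) by (simp add: h_def)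
      next
        fix l assume l: "l < N"
        then have t: "gridpt N l \<in> {0..T}" using tjT[of l] unfolding tj_def by simp
        show "Z (gridpt N l) \<in> borel_measurable (FA (gridpt N l))"
          "Z (gridpt N l) \<in> borel_measurable (FA (gridpt N l))" by (rule adapted_FA[OF Z_ad t])+
        show "L2 M (Z (gridpt N l))" "L2 M (Z (gridpt N l))" using LZ[of l] l unfolding tj_def by simp_all
      qed (use mdY[OF jN] CV(1) L driftY[OF j] \<rho> martZ[OF j] C1 q(1) qQ eps in simp_all)
      then show ?thesis unfolding \<delta>_def Cst_def h_def by (simp only: add.assoc)
    qed
    have zero: "(\<integral>\<omega>. yw \<epsilon> (dX Xh (tj 0) \<omega> $ i) \<partial>M) = 0" "(\<integral>\<omega>. yw \<epsilon> (dY Yh (tj 0) \<omega> $ i') \<partial>M) = 0" for i i'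
    proof -
      have t0: "tj 0 = 0" by (simp add: tj_def)
      show "(\<integral>\<omega>. yw \<epsilon> (dX Xh (tj 0) \<omega> $ i) \<partial>M) = 0" unfolding t0
        by (rule integral_eq_zero_AE) (use ito_proc_0[OF PX] ito_proc_0[OF PXh] in eventually_elim, simp add: yw_0[OF eps])
      show "(\<integral>\<omega>. yw \<epsilon> (dY Yh (tj 0) \<omega> $ i') \<partial>M) = 0" unfolding t0
        by (rule integral_eq_zero_AE) (use ito_proc_0[OF PY] ito_proc_0[OF PYh] in eventually_elim, simp add: yw_0[OF eps])
    qed
    define B where "B k = (\<Sum>j<k. \<rho> j) + real k * \<delta>" for k
    have BX: "(\<integral>\<omega>. yw \<epsilon> (dX Xh (tj k) \<omega> $ i) \<partial>M) \<le> B k" and BY: "(\<integral>\<omega>. yw \<epsilon> (dY Yh (tj k) \<omega> $ i') \<partial>M) \<le> B k" if "k \<le> N" for k i i'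
      unfolding B_def by (rule telescope_le[OF _ _ that]; use zero stepX stepY in simp)+
    \<comment> \<open>Since \<open>q ^ 5 = h * q\<close>, the remainder is a multiple of
      \<open>h\<close> once \<open>q\<close> over the square of \<open>\<epsilon>\<close> equals the
      constant \<open>Q\<close>; only the logarithm still depends on \<open>N\<close>.\<close>
    have \<delta>_eq: "\<delta> = h * (8 * (L / 2 + Q * Cst) / ln (real N))"
    proof -
      have "q ^ 5 = h * q" unfolding q(2)[symmetric] by (simp add: power_numeral_reduce)
      then have "\<delta> = h * L / (2 * ln (1 / \<epsilon>)) + h * (q / \<epsilon>\<^sup>2) / ln (1 / \<epsilon>) * Cst"
        unfolding \<delta>_def by simp
      then show ?thesis unfolding qe Lam using lnN by (simp add: field_simps)
    qed
    \<comment> \<open>\<open>ln u \<le> u - 1\<close> at \<open>u = sqrt N\<close> shows that the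
      square root of the step size is of smaller order than the target rate.\<close>
    have sh: "sqrt h \<le> 2 * sqrt T / ln (real N)"
    proof -
      have "ln (sqrt (real N)) \<le> sqrt (real N) - 1" using N0 by (intro ln_le_minus_one) simp
      then have l: "ln (real N) \<le> 2 * sqrt (real N)" using N0 by (simp add: ln_sqrt)
      have "sqrt h = sqrt T / sqrt (real N)" unfolding h_def by (rule real_sqrt_divide)
      also have "\<dots> \<le> 2 * sqrt T / ln (real N)"
        using mult_left_mono[OF l, of "sqrt T"] T N0 lnN by (simp add: field_simps)
      finally show ?thesis .
    qed
    define a where "a = (2 * C1 * T * sqrt T + 8 * T * (L / 2 + Q * Cst) + 12) / ln (real N)"
    have a0: "a \<ge> 0" unfolding a_def using C1 T L Q Cst lnN by (intro divide_nonneg_pos add_nonneg_nonneg mult_nonneg_nonneg) auto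
    have Bk: "B k + 3 / (2 * ln (1 / \<epsilon>)) \<le> a + C1 * h * (\<Sum>j<k. r j)" if k: "k \<le> N" for k
    proof -
      have kh: "real k * h \<le> T" using k T N0 unfolding h_def by (simp add: field_simps mult_right_mono)
      have "(\<Sum>j<k. \<rho> j) = C1 * sqrt h * (real k * h) + C1 * h * (\<Sum>j<k. r j)"
        unfolding \<rho>_def by (simp add: algebra_simps sum.distrib sum_distrib_left)
      moreover have "C1 * sqrt h * (real k * h) \<le> C1 * (2 * sqrt T / ln (real N)) * T"
        using C1 h T lnN by (intro mult_mono mult_left_mono sh kh) auto
      moreover have "real k * \<delta> \<le> T * (8 * (L / 2 + Q * Cst) / ln (real N))"
      proof -
        have "real k * \<delta> = (real k * h) * (8 * (L / 2 + Q * Cst) / ln (real N))" unfolding \<delta>_eq by simp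
        also have "\<dots> \<le> T * (8 * (L / 2 + Q * Cst) / ln (real N))"
          using L Q Cst lnN by (intro mult_right_mono kh) auto
        finally show ?thesis .
      qed
      moreover have "3 / (2 * ln (1 / \<epsilon>)) = 12 / ln (real N)" unfolding Lam by simp
      moreover have "C1 * (2 * sqrt T / ln (real N)) * T + T * (8 * (L / 2 + Q * Cst) / ln (real N)) + 12 / ln (real N) = a"
        unfolding a_def using lnN by (simp add: field_simps)
      ultimately show ?thesis unfolding B_def by linarith
    qed
    have rec: "w k \<le> ennreal (nm * a) + ennreal (nm * C1 * h) * (\<Sum>j<k. w j)" if k: "k \<le> N" for k
    proof -
      have rs: "(\<Sum>j<k. w j) = ennreal (\<Sum>j<k. r j)"
      proof -
        have "(\<Sum>j<k. w j) = (\<Sum>j<k. ennreal (r j))"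
        proof (rule sum.cong)
          fix j assume "j \<in> {..<k}"
          then show "w j = ennreal (r j)" using k by (intro wr) simp
        qed simp
        also have "\<dots> = ennreal (\<Sum>j<k. r j)" by (rule sum_ennreal) (rule r)
        finally show ?thesis .
      qed
      have Bn: "0 \<le> a + C1 * h * (\<Sum>j<k. r j)" using a0 C1 h r by (intro add_nonneg_nonneg mult_nonneg_nonneg sum_nonneg) auto
      have "m1 (dX Xh (tj k)) \<le> ennreal (real CARD('n) * (B k + 3 / (2 * ln (1 / \<epsilon>))))"
        by (rule m1_le_yw[OF LdX[OF k] eps BX[OF k]])
      also have "\<dots> \<le> ennreal (real CARD('n) * (a + C1 * h * (\<Sum>j<k. r j)))" by (intro ennreal_leI mult_left_mono Bk k) simp
      finally have 1: "m1 (dX Xh (tj k)) \<le> ennreal (real CARD('n) * (a + C1 * h * (\<Sum>j<k. r j)))" .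
      have "m1 (dY Yh (tj k)) \<le> ennreal (real CARD('m) * (B k + 3 / (2 * ln (1 / \<epsilon>))))"
        by (rule m1_le_yw[OF LdY[OF k] eps BY[OF k]])
      also have "\<dots> \<le> ennreal (real CARD('m) * (a + C1 * h * (\<Sum>j<k. r j)))" by (intro ennreal_leI mult_left_mono Bk k) simp
      finally have 2: "m1 (dY Yh (tj k)) \<le> ennreal (real CARD('m) * (a + C1 * h * (\<Sum>j<k. r j)))" .
      have "w k \<le> ennreal (real CARD('n) * (a + C1 * h * (\<Sum>j<k. r j))) + ennreal (real CARD('m) * (a + C1 * h * (\<Sum>j<k. r j)))"
        unfolding w_def by (rule add_mono[OF 1 2])
      also have "\<dots> = ennreal (real CARD('n) * (a + C1 * h * (\<Sum>j<k. r j)) + real CARD('m) * (a + C1 * h * (\<Sum>j<k. r j)))"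
        using Bn by (intro ennreal_plus[symmetric] mult_nonneg_nonneg) auto
      also have "real CARD('n) * (a + C1 * h * (\<Sum>j<k. r j)) + real CARD('m) * (a + C1 * h * (\<Sum>j<k. r j)) = nm * a + (nm * C1 * h) * (\<Sum>j<k. r j)"
        unfolding nm_def by (simp add: algebra_simps)
      also have "ennreal \<dots> = ennreal (nm * a) + ennreal ((nm * C1 * h) * (\<Sum>j<k. r j))"
        using nm a0 C1 h r by (intro ennreal_plus mult_nonneg_nonneg sum_nonneg) auto
      also have "ennreal ((nm * C1 * h) * (\<Sum>j<k. r j)) = ennreal (nm * C1 * h) * (\<Sum>j<k. w j)"
        unfolding rs using nm C1 h r by (intro ennreal_mult mult_nonneg_nonneg sum_nonneg) auto
      finally show ?thesis .
    qed
    \<comment> \<open>As \<open>real N * h = T\<close>, the exponential factor does not depend on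
      \<open>N\<close>.\<close>
    have "w k \<le> ennreal (nm * a * exp (real N * (nm * C1 * h)))"
      by (rule discrete_Gronwall[OF _ _ rec kN]) (use nm a0 C1 h in auto)
    also have "nm * a * exp (real N * (nm * C1 * h)) = A / ln (real N)"
      unfolding A_def A0_def a_def h_def using N0 by (simp add: mult_ac)
    finally have "w k \<le> ennreal (A / ln (real N))" .
    moreover have "m1 (dX Xh (tj k)) \<le> w k" unfolding w_def by simp
    ultimately show "m1 (dX Xh (gridpt N k)) \<le> ennreal (A / ln (real N))" unfolding tj_def by (rule order_trans[rotated])
  qed
qed

text \<open>Both parts of the source in \<open>euler_L2\<close> are at most of order
  \<open>1 / ln N\<close>; the step-size part is much smaller.\<close>

lemma euler_rate:
  obtains C where "C > 0" and "\<And>N Xh Yh t. N \<ge> 2 \<Longrightarrow> euler N Xh Yh \<Longrightarrow> t \<in> {0..T} \<Longrightarrow>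
    msq (dX Xh t) + msq (dY Yh t) \<le> ennreal (C / ln (real N))"
proof -
  obtain A where A: "A > 0" "\<And>N Xh Yh k. N \<ge> 2 \<Longrightarrow> euler N Xh Yh \<Longrightarrow> k \<le> N \<Longrightarrow>
    m1 (dX Xh (gridpt N k)) \<le> ennreal (A / ln (real N))" by (rule euler_L1) blast
  obtain C where C: "C > 0" "\<And>N Xh Yh \<mu> t. N \<ge> 1 \<Longrightarrow> euler N Xh Yh \<Longrightarrow> \<mu> \<ge> 0 \<Longrightarrow>
    (\<And>j. j < N \<Longrightarrow> m1 (dX Xh (gridpt N j)) \<le> ennreal \<mu>) \<Longrightarrow> t \<in> {0..T} \<Longrightarrow>
    msq (dX Xh t) + msq (dY Yh t) \<le> ennreal (C * (sqrt (T / real N) + \<mu>))" by (rule euler_L2) blast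
  show ?thesis
  proof (rule that)
    show "C * (2 * sqrt T + A) > 0" using C(1) A(1) T by (simp add: add_pos_pos)
    fix N Xh Yh t assume N: "N \<ge> 2" and E: "euler N Xh Yh" and t: "t \<in> {0..T}"
    have N0: "real N > 0" and lnN: "ln (real N) > 0" using N by auto
    have "msq (dX Xh t) + msq (dY Yh t) \<le> ennreal (C * (sqrt (T / real N) + A / ln (real N)))"
      using N lnN A(1) by (intro C(2)[OF _ E _ _ t] A(2)[OF N E]) auto
    also have "\<dots> \<le> ennreal (C * (2 * sqrt T + A) / ln (real N))"
    proof (rule ennreal_leI)
      have "ln (sqrt (real N)) \<le> sqrt (real N) - 1" using N0 by (intro ln_le_minus_one) simp
      then have l: "ln (real N) \<le> 2 * sqrt (real N)" using N0 by (simp add: ln_sqrt)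
      have "sqrt (T / real N) = sqrt T / sqrt (real N)" by (rule real_sqrt_divide)
      also have "\<dots> \<le> 2 * sqrt T / ln (real N)"
        using mult_left_mono[OF l, of "sqrt T"] T N0 lnN by (simp add: field_simps)
      finally have "C * (sqrt (T / real N) + A / ln (real N)) \<le> C * (2 * sqrt T / ln (real N) + A / ln (real N))"
        using C(1) by (intro mult_left_mono add_right_mono) auto
      then show "C * (sqrt (T / real N) + A / ln (real N)) \<le> C * (2 * sqrt T + A) / ln (real N)"
        by (simp only: times_divide_eq_right[symmetric] add_divide_distrib)
    qed
    finally show "msq (dX Xh t) + msq (dY Yh t) \<le> ennreal (C * (2 * sqrt T + A) / ln (real N))" .
  qed
qed

end

section \<open>Reduction of the stated assumptions to a single constant\<close>

lemma sq_sum3: "(a + b + c)\<^sup>2 \<le> 3 * (a\<^sup>2 + b\<^sup>2 + c\<^sup>2)" for a b c :: real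
  using norm_sq_add3[of a b c] by simp

lemma sq_sum4: "(a + b + c + d)\<^sup>2 \<le> 4 * (a\<^sup>2 + b\<^sup>2 + c\<^sup>2 + d\<^sup>2)" for a b c d :: real
  using norm_sq_add4[of a b c d] by simp

text \<open>The sum of the two suprema is expressed by a bound at independent times \<open>s\<close>
  and \<open>t\<close>, and \<open>C\<close> is chosen before \<open>N\<close> and before the
  scheme. The logarithm is positive from \<open>N = 2\<close> on; at \<open>N = 1\<close> the
  quotient by \<open>ln 1 = 0\<close> would evaluate to 0.\<close>

theorem theorem2:
  fixes M :: "'w measure"
    and W :: "real \<Rightarrow> 'w \<Rightarrow> real^'d::finite"
    and T :: real
    and b :: "real \<Rightarrow> real^'n::finite \<Rightarrow> real^'m::finite \<Rightarrow> real^'n"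
    and \<sigma> :: "real \<Rightarrow> real^'n \<Rightarrow> real^'d^'n"
    and \<sigma>i :: "'n \<Rightarrow> real \<Rightarrow> real \<Rightarrow> real^'d"
    and f :: "real \<Rightarrow> real^'n \<Rightarrow> real^'m \<Rightarrow> real^'d^'m \<Rightarrow> real^'m"
    and g :: "real^'n \<Rightarrow> real^'m"
    and x :: "real^'n"
    and y :: "real^'m"
    and Z :: "real \<Rightarrow> 'w \<Rightarrow> real^'d^'m"
    and Xt :: "real \<Rightarrow> 'w \<Rightarrow> real^'n"
    and Yt :: "real \<Rightarrow> 'w \<Rightarrow> real^'m"
    and Lb Lf Lg L\<sigma> Lu :: real
  assumes "prob_space M"
    and "complete_measure M"
    and "std_BM M W"
    and "T > 0"
    \<comment> \<open>Assumption 1\<close>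
    and A1: "\<forall>t z i. \<sigma> t z $ i = \<sigma>i i t (z $ i)"
    \<comment> \<open>Assumption 2\<close>
    and "Lb > 0" "Lf > 0" "Lg > 0" "L\<sigma> > 0"
    and "\<forall>t\<in>{0..T}. \<forall>t'\<in>{0..T}. \<forall>z z' v v'.
           norm (b t z v - b t' z' v') \<le> Lb * (\<bar>t - t'\<bar> + norm (z - z') + norm (v - v'))"
    and "\<forall>t\<in>{0..T}. \<forall>t'\<in>{0..T}. \<forall>z z' v v' q q'.
           norm (f t z v q - f t' z' v' q') \<le>
             Lf * (\<bar>t - t'\<bar> + norm (z - z') + norm (v - v') + norm (q - q'))"
    and "\<forall>z z'. norm (g z - g z') \<le> Lg * norm (z - z')"
    and "\<forall>i. \<forall>t\<in>{0..T}. \<forall>t'\<in>{0..T}. \<forall>a a'.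
           (norm (\<sigma>i i t a - \<sigma>i i t' a'))\<^sup>2 \<le> L\<sigma> * (\<bar>t - t'\<bar> + \<bar>a - a'\<bar>)"
    \<comment> \<open>Assumptions 3 and 4\<close>
    and "\<exists>u. classical_pde_sol T b \<sigma> f g u \<and> Lu > 0 \<and>
           (\<forall>t\<in>{0..T}. \<forall>z z'. norm (u t z - u t z') \<le> Lu * norm (z - z'))"
    \<comment> \<open>admissible control and the solution of (E2)\<close>
    and "admissible M (aug_filt M W) T Z"
    and "E2_sol M W (aug_filt M W) T b \<sigma> f x y Z Xt Yt"
  shows "\<exists>C. \<forall>N::nat. N \<ge> 2 \<longrightarrow>
           (\<forall>Xh Yh. E3_sol N M W (aug_filt M W) T b \<sigma> f x y Z Xh Yh \<longrightarrow>
              (\<forall>s\<in>{0..T}. \<forall>t\<in>{0..T}.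
                 (\<integral>\<^sup>+\<omega>. ennreal ((norm (Yh s \<omega> - Yt s \<omega>))\<^sup>2) \<partial>M)
               + (\<integral>\<^sup>+\<omega>. ennreal ((norm (Xh t \<omega> - Xt t \<omega>))\<^sup>2) \<partial>M)
                 \<le> ennreal (C / ln (real N))))"
proof -
  interpret P: prob_space M by fact
  have Z: "adapted_proc M (aug_filt M W) T Z" "\<And>t. t \<in> {0..T} \<Longrightarrow> (\<integral>\<^sup>+\<omega>. ennreal ((norm (Z t \<omega>))\<^sup>2) \<partial>M) < \<infinity>"
    using \<open>admissible M (aug_filt M W) T Z\<close> unfolding admissible_def by blast+
  obtain K where K: "\<And>s t. s \<in> {0..T} \<Longrightarrow> t \<in> {0..T} \<Longrightarrow>
      (\<integral>\<^sup>+\<omega>. ennreal ((norm (Z t \<omega> - Z s \<omega>))\<^sup>2) \<partial>M) \<le> ennreal (K * \<bar>t - s\<bar>)"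
    using \<open>admissible M (aug_filt M W) T Z\<close> unfolding admissible_def by blast
  \<comment> \<open>The factors 3 and 4 come from squaring sums of three and four terms. The factor
    \<open>T + 1\<close> reduces the square of the time increment to its first power. The modulus is
    taken because \<open>K\<close> may be negative.\<close>
  define L where "L = 3 * Lb\<^sup>2 * (T + 1) + 4 * Lf\<^sup>2 * (T + 1) + L\<sigma> + \<bar>K\<bar>"
  have parts: "0 < 3 * Lb\<^sup>2 * (T + 1)" "0 < 4 * Lf\<^sup>2 * (T + 1)" "0 < L\<sigma>" "0 \<le> \<bar>K\<bar>"
    using \<open>Lb > 0\<close> \<open>Lf > 0\<close> \<open>L\<sigma> > 0\<close> \<open>T > 0\<close> by auto
  have Lge: "3 * Lb\<^sup>2 * (T + 1) \<le> L" "4 * Lf\<^sup>2 * (T + 1) \<le> L" "L\<sigma> \<le> L" "K \<le> L"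
    using parts abs_ge_self[of K] unfolding L_def by linarith+
  have time_sq: "(t - t')\<^sup>2 + u \<le> (T + 1) * (\<bar>t - t'\<bar> + u)" if "t \<in> {0..T}" "t' \<in> {0..T}" "u \<ge> 0" for t t' u :: real
  proof -
    have "(t - t')\<^sup>2 = \<bar>t - t'\<bar> * \<bar>t - t'\<bar>" by (simp add: power2_eq_square)
    also have "\<dots> \<le> (T + 1) * \<bar>t - t'\<bar>" using that by (intro mult_right_mono) auto
    finally have "(t - t')\<^sup>2 \<le> (T + 1) * \<bar>t - t'\<bar>" .
    moreover have "1 * u \<le> (T + 1) * u" using that(3) \<open>T > 0\<close> by (intro mult_right_mono) auto
    ultimately show ?thesis by (simp add: distrib_left)
  qed
  interpret fbsde M W T b \<sigma> f x y Z Xt Yt L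
  proof (intro fbsde.intro brownian.intro brownian_axioms.intro fbsde_axioms.intro)
    show "prob_space M" "complete_measure M" "std_BM M W" "T > 0" by fact+
    show "L > 0" using parts unfolding L_def by linarith
    show "adapted_proc M (aug_filt M W) T Z" by (rule Z)
    show "E2_sol M W (aug_filt M W) T b \<sigma> f x y Z Xt Yt" by fact
  next
    fix t t' :: real and z z' :: "real^'n" and v v' :: "real^'m" assume t: "t \<in> {0..T}" "t' \<in> {0..T}"
    have "norm (b t z v - b t' z' v') \<le> Lb * (\<bar>t - t'\<bar> + norm (z - z') + norm (v - v'))" by (rule assms(10)[rule_format, OF t])
    then have "(norm (b t z v - b t' z' v'))\<^sup>2 \<le> (Lb * (\<bar>t - t'\<bar> + norm (z - z') + norm (v - v')))\<^sup>2" by (rule power_mono) simp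
    also have "\<dots> \<le> Lb\<^sup>2 * (3 * ((t - t')\<^sup>2 + (norm (z - z'))\<^sup>2 + (norm (v - v'))\<^sup>2))"
      unfolding power_mult_distrib using sq_sum3[of "\<bar>t - t'\<bar>" "norm (z - z')" "norm (v - v')"] by (intro mult_left_mono) auto
    also have "\<dots> \<le> Lb\<^sup>2 * (3 * ((T + 1) * (\<bar>t - t'\<bar> + ((norm (z - z'))\<^sup>2 + (norm (v - v'))\<^sup>2))))"
      using time_sq[OF t, of "(norm (z - z'))\<^sup>2 + (norm (v - v'))\<^sup>2"] by (intro mult_left_mono) (auto simp: add.assoc)
    also have "\<dots> = (3 * Lb\<^sup>2 * (T + 1)) * (\<bar>t - t'\<bar> + (norm (z - z'))\<^sup>2 + (norm (v - v'))\<^sup>2)" by (simp only: mult_ac add.assoc)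
    also have "\<dots> \<le> L * (\<bar>t - t'\<bar> + (norm (z - z'))\<^sup>2 + (norm (v - v'))\<^sup>2)" by (intro mult_right_mono Lge) simp
    finally show "(norm (b t z v - b t' z' v'))\<^sup>2 \<le> L * (\<bar>t - t'\<bar> + (norm (z - z'))\<^sup>2 + (norm (v - v'))\<^sup>2)" .
  next
    fix t t' :: real and z z' :: "real^'n" and v v' :: "real^'m" and r r' :: "real^'d^'m" assume t: "t \<in> {0..T}" "t' \<in> {0..T}"
    have "norm (f t z v r - f t' z' v' r') \<le> Lf * (\<bar>t - t'\<bar> + norm (z - z') + norm (v - v') + norm (r - r'))" by (rule assms(11)[rule_format, OF t])
    then have "(norm (f t z v r - f t' z' v' r'))\<^sup>2 \<le> (Lf * (\<bar>t - t'\<bar> + norm (z - z') + norm (v - v') + norm (r - r')))\<^sup>2" by (rule power_mono) simp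
    also have "\<dots> \<le> Lf\<^sup>2 * (4 * ((t - t')\<^sup>2 + (norm (z - z'))\<^sup>2 + (norm (v - v'))\<^sup>2 + (norm (r - r'))\<^sup>2))"
      unfolding power_mult_distrib using sq_sum4[of "\<bar>t - t'\<bar>" "norm (z - z')" "norm (v - v')" "norm (r - r')"] by (intro mult_left_mono) auto
    also have "\<dots> \<le> Lf\<^sup>2 * (4 * ((T + 1) * (\<bar>t - t'\<bar> + ((norm (z - z'))\<^sup>2 + (norm (v - v'))\<^sup>2 + (norm (r - r'))\<^sup>2))))"
      using time_sq[OF t, of "(norm (z - z'))\<^sup>2 + (norm (v - v'))\<^sup>2 + (norm (r - r'))\<^sup>2"] by (intro mult_left_mono) (auto simp: add.assoc)
    also have "\<dots> = (4 * Lf\<^sup>2 * (T + 1)) * (\<bar>t - t'\<bar> + (norm (z - z'))\<^sup>2 + (norm (v - v'))\<^sup>2 + (norm (r - r'))\<^sup>2)" by (simp only: mult_ac add.assoc)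
    also have "\<dots> \<le> L * (\<bar>t - t'\<bar> + (norm (z - z'))\<^sup>2 + (norm (v - v'))\<^sup>2 + (norm (r - r'))\<^sup>2)" by (intro mult_right_mono Lge) simp
    finally show "(norm (f t z v r - f t' z' v' r'))\<^sup>2 \<le> L * (\<bar>t - t'\<bar> + (norm (z - z'))\<^sup>2 + (norm (v - v'))\<^sup>2 + (norm (r - r'))\<^sup>2)" .
  next
    fix t t' :: real and z z' :: "real^'n" and i assume t: "t \<in> {0..T}" "t' \<in> {0..T}"
    have "(norm (\<sigma>i i t (z $ i) - \<sigma>i i t' (z' $ i)))\<^sup>2 \<le> L\<sigma> * (\<bar>t - t'\<bar> + \<bar>z $ i - z' $ i\<bar>)" by (rule assms(13)[rule_format, OF t])
    also have "\<dots> \<le> L * (\<bar>t - t'\<bar> + \<bar>z $ i - z' $ i\<bar>)" by (intro mult_right_mono Lge) simp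
    finally show "(norm (\<sigma> t z $ i - \<sigma> t' z' $ i))\<^sup>2 \<le> L * (\<bar>t - t'\<bar> + \<bar>z $ i - z' $ i\<bar>)" using A1 by simp
  next
    fix t assume "t \<in> {0..T}"
    then show "(\<integral>\<^sup>+\<omega>. ennreal ((norm (Z t \<omega>))\<^sup>2) \<partial>M) < \<infinity>" by (rule Z(2))
  next
    fix s t assume "s \<in> {0..T}" "t \<in> {0..T}"
    from K[OF this] show "(\<integral>\<^sup>+\<omega>. ennreal ((norm (Z t \<omega> - Z s \<omega>))\<^sup>2) \<partial>M) \<le> ennreal (L * \<bar>t - s\<bar>)"
      by (rule order_trans) (intro ennreal_leI mult_right_mono Lge, simp)
  qed
  obtain C where C: "C > 0" "\<And>N Xh Yh t. N \<ge> 2 \<Longrightarrow> euler N Xh Yh \<Longrightarrow> t \<in> {0..T} \<Longrightarrow>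
    msq (dX Xh t) + msq (dY Yh t) \<le> ennreal (C / ln (real N))" by (rule euler_rate) blast
  show ?thesis
  \<comment> \<open>The rate bounds the sum of both errors at a common time; for two different times
    it is applied twice, which doubles the constant.\<close>
  proof (intro exI[of _ "2 * C"] allI impI ballI)
    fix N :: nat and Xh Yh s t assume N: "N \<ge> 2" and E: "euler N Xh Yh" and st: "s \<in> {0..T}" "t \<in> {0..T}"
    have "(\<integral>\<^sup>+\<omega>. ennreal ((norm (Yh s \<omega> - Yt s \<omega>))\<^sup>2) \<partial>M) = msq (dY Yh s)" "(\<integral>\<^sup>+\<omega>. ennreal ((norm (Xh t \<omega> - Xt t \<omega>))\<^sup>2) \<partial>M) = msq (dX Xh t)"
      by (simp_all add: norm_minus_commute)
    moreover have "msq (dY Yh s) \<le> ennreal (C / ln (real N))" by (rule order_trans[OF _ C(2)[OF N E st(1)]]) simp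
    moreover have "msq (dX Xh t) \<le> ennreal (C / ln (real N))" by (rule order_trans[OF _ C(2)[OF N E st(2)]]) simp
    ultimately have "(\<integral>\<^sup>+\<omega>. ennreal ((norm (Yh s \<omega> - Yt s \<omega>))\<^sup>2) \<partial>M) + (\<integral>\<^sup>+\<omega>. ennreal ((norm (Xh t \<omega> - Xt t \<omega>))\<^sup>2) \<partial>M) \<le>
      ennreal (C / ln (real N)) + ennreal (C / ln (real N))" by (simp only: add_mono)
    also have "\<dots> = ennreal (2 * C / ln (real N))"
      using C(1) N by (subst ennreal_plus[symmetric]) auto
    finally show "(\<integral>\<^sup>+\<omega>. ennreal ((norm (Yh s \<omega> - Yt s \<omega>))\<^sup>2) \<partial>M) + (\<integral>\<^sup>+\<omega>. ennreal ((norm (Xh t \<omega> - Xt t \<omega>))\<^sup>2) \<partial>M) \<le> ennreal (2 * C / ln (real N))" .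
  qed
qed

end
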